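(* Let $W$ be an odd symplectic super vector space with decomposition $W=\operatorname{H}(W)\oplus\mathcal L_s\oplus\Pi\operatorname{im}(d)$ given by a cyclic strong deformation retract $(i,p,s)$ of $\Pi W$ onto its homology, and let $f\in\mathfrak h[W]$ be even. Then $$\hbar\log\int_{\mathcal L_s}e^{\frac f\hbar}e^{\frac{-\sigma}{2\hbar}}=\sum_{G\ \mathrm{connected}}\hbar^{g(G)}\frac{F(G)}{|\operatorname{Aut}(G)|},$$ where the sum is over all (isomorphism classes of) connected stable graphs, $g(G)$ is the genus of $G$ and $F(G)$ its Feynman amplitude.
   Context: **Basics.** A super vector space is a $\mathbb Z/2$-graded real vector space with an odd differential $d$; $|v|$ is parity, $\Pi$ is parity reversion, $\operatorname{H}$ is homology. Odd bilinear forms are compatible with $d$: $\langle dx,y\rangle+(-1)^{|x|}\langle x,dy\rangle=0$. An odd symplectic $W$ (odd, non-degenerate, skew-symmetric form; finite-dimensional) corresponds to $V=\Pi W$ with an odd symmetric non-degenerate form via $\tau(\Pi x,\Pi y)=(-1)^{|x|}\langle x,y\rangle$. $\hat SW^*=\prod_nS^nW^*$ is the algebra of formal functions; $\overline W=W\otimes\mathbb R((\hbar))$, and $\hat S\overline W^*$ is taken over $\mathbb R((\hbar))$. Give $f\hbar^g$, $f$ a monomial of degree $n$ in $\hat SW^*$, the weight $2g+n$; $\mathfrak h[W]\subset\hat SW^*[[\hbar]]$ is the subspace of elements of weight $>2$. $\log$ is the usual power series around $1$. **Cyclic SDR.** A cyclic strong deformation retract from $V$ to $\operatorname{H}(V)$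 (with induced form) consists of even morphisms $i\colon \operatorname{H}(V)\hookrightarrow V$, $p\colon V\twoheadrightarrow \operatorname{H}(V)$ (commuting with differentials) and an odd linear map $s\colon V\to V$ with $pi=\mathrm{id}$, $ds+sd=\mathrm{id}-ip$, $si=0$, $ps=0$, $s^2=0$, $\langle ix,iy\rangle=\langle x,y\rangle$, $\ker p\perp\operatorname{im} i$, $\langle sx,y\rangle=(-1)^{|x|}\langle x,sy\rangle$. Then $W=\Pi\operatorname{im}(i)\oplus\Pi\operatorname{im}(s)\oplus\Pi\operatorname{im}(d)$; $\Pi\operatorname{im}(i)$ is identified with $\operatorname{H}(W)$ and $\mathcal L_s:=\Pi\operatorname{im}(s)$. **Integral.** $\sigma$ is the non-degenerate quadratic function $w\mapsto\langle w,dw\rangle$ on $\mathcal L_s$. Choose linear coordinates on $\mathcal L_s$, $x_1,\dots,x_k$ even and $\xi_{k+1},\dots,\xi_n$ odd ($n-k$ even), with $\sigma=\sum_i\epsilon(x_i)x_i^2-(\xi_{k+1}\xi_{k+2}+\dots+\xi_{n-1}\xi_n)$, $\epsilon(x_i)=\pm1$. The integral over $\mathcal L_s$ is the normalized formal Gaussian integral, the $\mathbb R((\hbar))$-linear iterated integral determined by: for each even $x=x_i$, $\int e^{-\epsilon(x)x^2/2\hbar}=1$, $\int x^{2r+2}e^{-\epsilon(x)x^2/2\hbar}=\epsilon(x)(2r+1)\hbar\int x^{2r}e^{-\epsilon(x)x^2/2\hbar}$ and odd powers integrate to $0$; for each pair $\xi,\eta$ of consecutive odd coordinates, the functions $1,\xi,\eta,\xi\eta$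 times $e^{\xi\eta/2\hbar}$ integrate to $1,0,0,2\hbar$. For $f\in S\overline W^*$, $\int_{\mathcal L_s}fe^{-\sigma/2\hbar}\in S\overline{\operatorname{H}(W)}^*$ is obtained by restricting $f$ to $\operatorname{H}(W)\oplus\mathcal L_s$ and applying $\mathrm{id}_{\operatorname{H}(W)}\otimes\int_{\mathcal L_s}$; it is extended termwise to $e^{f/\hbar}$, $f\in\mathfrak h[W]$. $\sigma^{-1}$ denotes the inverse form on $\mathcal L_s^*$, i.e. $\sigma^{-1}(x_i,x_i)=\epsilon(x_i)$, $\sigma^{-1}(\xi,\eta)=2=-\sigma^{-1}(\eta,\xi)$ for each odd pair $\xi,\eta$, and all other values on coordinates are zero (so $\int_{\mathcal L_s}\phi\psi e^{-\sigma/2\hbar}=\hbar\,\sigma^{-1}(\phi,\psi)$ for $\phi,\psi\in\mathcal L_s^*$). **Stable graphs.** A graph $G$ consists of finite sets $\operatorname{Half}(G)$, $\operatorname{Vert}(G)$, a map $\operatorname{Half}(G)\to\operatorname{Vert}(G)$ and an involution of $\operatorname{Half}(G)$; edges are the two-cycles and legs the fixed points of the involution; the valence $n(v)$ of a vertex $v$ is the number of half-edges (including legs) attached to it. A stable graph is a graph whose vertices carry non-negative integers $g(v)$ (genus) with $2g(v)+n(v)\ge3$. $\operatorname{H}_\bullet(G)$ is the homology of the associated one-dimensional CW-complex and $g(G)=\dim \operatorname{H}_1(G)+\sum_vg(v)$. Isomorphisms and automorphisms are bijections on vertices and half-edges preserving all the structure (legs are unlabelled and may be permuted). Connected graphs are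 non-empty. **Feynman amplitude.** Write the restriction of $f$ to $\operatorname{H}(W)\oplus\mathcal L_s$ as $\sum_{i,j,k}\frac1{j!k!}\hbar^if_{i,j,k}$ with $f_{i,j,k}$ of degree $j$ in $\mathcal L_s^*$ and degree $k$ in $\operatorname{H}(W)^*$, regarded as a symmetric tensor in $(\mathcal L_s^* )^{\otimes j}\otimes(\operatorname{H}(W)^* )^{\otimes k}$. For connected $G$, $F(G)\in(\operatorname{H}(W)^* )^{\otimes|\operatorname{Leg}(G)|}$, regarded as an element of the symmetric algebra on $\operatorname{H}(W)^*$, is obtained by placing $f_{i,j,k}$ at every vertex of genus $i$ with $j$ half-edges belonging to edges and $k$ legs, and contracting along each edge with $\sigma^{-1}$. *)

theory Defs
  imports
    "HOL-Analysis.Analysis"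
    "HOL-Analysis.Finite_Function_Topology"
    "HOL-Computational_Algebra.Formal_Laurent_Series"
    "HOL-Combinatorics.Permutations"
    "HOL-Library.Multiset"
begin

section \<open>Super vector spaces and cyclic strong deformation retracts\<close>

text \<open>
  Parities are booleans, \<open>True\<close> being odd. A grading of the real vector space \<open>'w\<close> is the family
  \<open>W\<close> of its even and odd subspaces. The parity reversion \<open>\<Pi>W\<close> has the same underlying vectors, with
  the grading \<open>\<lambda>q. W (\<not> q)\<close>.
\<close>

definition psign :: "bool \<Rightarrow> real" where
  "psign q = (if q then -1 else 1)"

locale super_space =
  fixes W :: "bool \<Rightarrow> 'w::real_vector set" and d :: "'w \<Rightarrow> 'w"
  assumes finite_dim: "\<exists>B::'w set. finite B \<and> span B = UNIV"
    and subspace_grading: "subspace (W q)"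
    and grading_disjoint: "W False \<inter> W True = {0}"
    and grading_sum: "\<exists>x\<in>W False. \<exists>y\<in>W True. w = x + y"
    and linear_d: "linear d"
    and odd_d: "x \<in> W q \<Longrightarrow> d x \<in> W (\<not> q)"
    and d_d: "d (d w) = 0"

locale odd_symplectic = super_space W d
  for W :: "bool \<Rightarrow> 'w::real_vector set" and d +
  fixes \<omega> :: "'w \<Rightarrow> 'w \<Rightarrow> real"
  assumes bilinear_form: "bilinear \<omega>"
    and odd_form: "\<lbrakk>x \<in> W q; y \<in> W q\<rbrakk> \<Longrightarrow> \<omega> x y = 0"
    and nondegenerate: "(\<And>y. \<omega> x y = 0) \<Longrightarrow> x = 0"
    and skew: "\<lbrakk>x \<in> W q; y \<in> W r\<rbrakk> \<Longrightarrow> \<omega> x y = - psign (q \<and> r) * \<omega> y x"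
    and form_d: "x \<in> W q \<Longrightarrow> \<omega> (d x) y + psign q * \<omega> x (d y) = 0"

definition grade_inv :: "(bool \<Rightarrow> 'w::real_vector set) \<Rightarrow> 'w \<Rightarrow> 'w" where
  "grade_inv W w = (THE z. \<exists>x\<in>W False. \<exists>y\<in>W True. w = x + y \<and> z = x - y)"

text \<open>The form \<open>\<tau>(\<Pi>x,\<Pi>y) = (-1)\<^bsup>|x|\<^esup>\<langle>x,y\<rangle>\<close> on \<open>\<Pi>W\<close>.\<close>

definition reversed_form ::
  "(bool \<Rightarrow> 'w::real_vector set) \<Rightarrow> ('w \<Rightarrow> 'w \<Rightarrow> real) \<Rightarrow> 'w \<Rightarrow> 'w \<Rightarrow> real" where
  "reversed_form W \<omega> x y = \<omega> (grade_inv W x) y"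

text \<open>
  The homology is the set of cosets of \<open>im d\<close> in \<open>ker d\<close>. Its linear structure, grading and form are
  those induced from representatives, and its differential is zero.
\<close>

definition hclass :: "('v::real_vector \<Rightarrow> 'v) \<Rightarrow> 'v \<Rightarrow> 'v set" where
  "hclass d x = {x + d y | y. True}"

definition homology :: "('v::real_vector \<Rightarrow> 'v) \<Rightarrow> 'v set set" where
  "homology d = hclass d ` {x. d x = 0}"

locale cyclic_sdr = super_space V d
  for V :: "bool \<Rightarrow> 'v::real_vector set" and d +
  fixes \<beta> :: "'v \<Rightarrow> 'v \<Rightarrow> real"
    and i :: "'v set \<Rightarrow> 'v" and p :: "'v \<Rightarrow> 'v set" and s :: "'v \<Rightarrow> 'v"
  assumes i_add: "\<lbrakk>d x = 0; d y = 0\<rbrakk> \<Longrightarrow> i (hclass d (x + y)) = i (hclass d x) + i (hclass d y)"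
    and i_scale: "d x = 0 \<Longrightarrow> i (hclass d (r *\<^sub>R x)) = r *\<^sub>R i (hclass d x)"
    and i_even: "\<lbrakk>d x = 0; x \<in> V q\<rbrakk> \<Longrightarrow> i (hclass d x) \<in> V q"
    and i_chain: "c \<in> homology d \<Longrightarrow> d (i c) = 0"
    and p_homology: "p x \<in> homology d"
    and p_add: "\<lbrakk>d a = 0; d b = 0; p x = hclass d a; p y = hclass d b\<rbrakk>
                  \<Longrightarrow> p (x + y) = hclass d (a + b)"
    and p_scale: "\<lbrakk>d a = 0; p x = hclass d a\<rbrakk> \<Longrightarrow> p (r *\<^sub>R x) = hclass d (r *\<^sub>R a)"
    and p_even: "x \<in> V q \<Longrightarrow> \<exists>a\<in>V q. d a = 0 \<and> p x = hclass d a"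
    and p_chain: "p (d x) = hclass d 0"
    and s_linear: "linear s"
    and s_odd: "x \<in> V q \<Longrightarrow> s x \<in> V (\<not> q)"
    and p_i: "c \<in> homology d \<Longrightarrow> p (i c) = c"
    and homotopy: "d (s x) + s (d x) = x - i (p x)"
    and s_i: "c \<in> homology d \<Longrightarrow> s (i c) = 0"
    and p_s: "p (s x) = hclass d 0"
    and s_s: "s (s x) = 0"
    and i_isometry: "\<lbrakk>d x = 0; d y = 0\<rbrakk> \<Longrightarrow> \<beta> (i (hclass d x)) (i (hclass d y)) = \<beta> x y"
    and ker_p_orth: "\<lbrakk>p x = hclass d 0; c \<in> homology d\<rbrakk> \<Longrightarrow> \<beta> x (i c) = 0"
    and s_selfadjoint: "x \<in> V q \<Longrightarrow> \<beta> (s x) y = psign q * \<beta> x (s y)"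

section \<open>Formal functions\<close>

text \<open>
  An element of \<open>S\<^sup>nW\<^sup>*\<close> is given by a supersymmetric \<open>n\<close>-linear form \<open>\<phi>\<close>, which stands for the
  polynomial \<open>1/n! \<Sum> \<phi>(b\<^sub>1,\<dots>,b\<^sub>n) y\<^sub>1\<cdots>y\<^sub>n\<close> (the sum being over all words of length \<open>n\<close> in the vectors
  of a homogeneous basis, and \<open>y\<close> denoting the dual coordinates). So \<open>\<phi>\<close> is \<open>n!\<close> times the symmetric
  tensor of the polynomial, tensors being evaluated by \<open>(\<alpha>\<otimes>\<beta>)(x,y) = \<alpha>(x)\<beta>(y)\<close>; in particular
  the restriction of \<open>\<phi>\<close> to \<open>j\<close> arguments from one subspace and \<open>k\<close> from a complement is \<open>j!k!\<close>
  times the tensor of the \<open>(j,k)\<close> component.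
  A formal function with coefficients in \<open>\<real>[[\<hbar>]]\<close> is a function \<open>f\<close>, where \<open>f g\<close> restricted to lists of
  length \<open>n\<close> is the form for the coefficient of \<open>\<hbar>\<^sup>g\<close> in degree \<open>n\<close>.
\<close>

definition formal_functions ::
  "(bool \<Rightarrow> 'w::real_vector set) \<Rightarrow> (nat \<Rightarrow> 'w list \<Rightarrow> real) set" where
  "formal_functions W = {f.
     (\<forall>g us vs. linear (\<lambda>w. f g (us @ w # vs))) \<and>
     (\<forall>g us vs q r. \<forall>x\<in>W q. \<forall>y\<in>W r.
        f g (us @ x # y # vs) = psign (q \<and> r) * f g (us @ y # x # vs))}"

definition even_function :: "(bool \<Rightarrow> 'w::real_vector set) \<Rightarrow> (nat \<Rightarrow> 'w list \<Rightarrow> real) \<Rightarrow> bool" where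
  "even_function W f \<longleftrightarrow>
     (\<forall>g ws qs. list_all2 (\<lambda>w q. w \<in> W q) ws qs \<and> odd (count_list qs True) \<longrightarrow> f g ws = 0)"

definition weight_gt_2 :: "(bool \<Rightarrow> 'w::real_vector set) \<Rightarrow> (nat \<Rightarrow> 'w list \<Rightarrow> real) set" where
  "weight_gt_2 W = {f \<in> formal_functions W. \<forall>g ws. f g ws \<noteq> 0 \<longrightarrow> 2 * g + length ws > 2}"

section \<open>Supercommutative power series over Laurent series in \<open>\<hbar>\<close>\<close>

text \<open>
  Coordinates are indexed by natural numbers, with parities \<open>par\<close>. A multiset \<open>M\<close> of indices stands
  for the monomial \<open>y\<^sup>M\<close> that is the product of its elements \<^emph>\<open>in increasing order of indices\<close>;
  it vanishes if an odd index is repeated. A series is the function giving its coefficients, and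
  \<open>\<hbar>\<close> is \<^const>\<open>fls_X\<close>. Infinite sums of coefficients converge in the \<open>\<hbar>\<close>-adic metric of the
  library.
\<close>

type_synonym series = "nat multiset \<Rightarrow> real fls"

definition admissible :: "(nat \<Rightarrow> bool) \<Rightarrow> nat multiset \<Rightarrow> bool" where
  "admissible par M \<longleftrightarrow> (\<forall>x. par x \<longrightarrow> count M x \<le> 1)"

definition s_mult :: "(nat \<Rightarrow> bool) \<Rightarrow> series \<Rightarrow> series \<Rightarrow> series" where
  "s_mult par F G M =
     (if admissible par M then
        (\<Sum>A\<in>{A. A \<subseteq># M}.
           (-1) ^ card {(x, y). x \<in># A \<and> y \<in># M - A \<and> par x \<and> par y \<and> y < x} * F A * G (M - A))
      else 0)"

definition s_one :: series where
  "s_one M = (if M = {#} then 1 else 0)"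

definition s_var :: "nat \<Rightarrow> series" where
  "s_var x M = (if M = {#x#} then 1 else 0)"

primrec s_power :: "(nat \<Rightarrow> bool) \<Rightarrow> series \<Rightarrow> nat \<Rightarrow> series" where
  "s_power par F 0 = s_one"
| "s_power par F (Suc r) = s_mult par F (s_power par F r)"

definition s_word :: "(nat \<Rightarrow> bool) \<Rightarrow> nat list \<Rightarrow> series" where
  "s_word par xs = foldr (\<lambda>x F. s_mult par (s_var x) F) xs s_one"

definition s_exp :: "(nat \<Rightarrow> bool) \<Rightarrow> series \<Rightarrow> series" where
  "s_exp par F M = infsum (\<lambda>r. fls_const (1 / fact r) * s_power par F r M) UNIV"

definition s_log :: "(nat \<Rightarrow> bool) \<Rightarrow> series \<Rightarrow> series" where
  "s_log par Z M =
     infsum (\<lambda>r. fls_const ((-1) ^ (r + 1) / real r) * s_power par (\<lambda>A. Z A - s_one A) r M) {1..}"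

text \<open>
  The restriction of \<open>f\<close> to the span of \<open>b 0, \<dots>, b (N - 1)\<close>, in the dual coordinates: collecting
  the words that are rearrangements of \<open>M\<close> turns the factor \<open>1/n!\<close> into \<open>1/\<Prod>(count M x)!\<close>.
\<close>

definition restriction :: "(nat \<Rightarrow> 'w) \<Rightarrow> nat \<Rightarrow> (nat \<Rightarrow> 'w list \<Rightarrow> real) \<Rightarrow> series" where
  "restriction b N f M =
     (if set_mset M \<subseteq> {..<N} then
        fps_to_fls (Abs_fps (\<lambda>g.
          f g (map b (sorted_list_of_multiset M)) / (\<Prod>x\<in>set_mset M. fact (count M x))))
      else 0)"

section \<open>Gaussian integration\<close>

text \<open>
  The coordinates on \<open>H \<oplus> L\<close> are numbered as follows: first the \<open>n\<close> coordinates on \<open>H\<close>, then the \<open>k\<close>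
  even and the \<open>2m\<close> odd coordinates on \<open>L\<close>; the odd pairs are \<open>(n+k+2r, n+k+2r+1)\<close> for \<open>r < m\<close>.
  The function \<open>\<sigma>(w) = \<langle>w,dw\<rangle>\<close> is \<open>\<Sum> \<langle>b\<^sub>i,db\<^sub>j\<rangle>y\<^sub>iy\<^sub>j\<close>.
\<close>

definition sigma ::
  "('w \<Rightarrow> 'w) \<Rightarrow> ('w \<Rightarrow> 'w \<Rightarrow> real) \<Rightarrow> (nat \<Rightarrow> 'w) \<Rightarrow> (nat \<Rightarrow> bool) \<Rightarrow> nat set \<Rightarrow> series" where
  "sigma d \<omega> b par I M =
     (\<Sum>x\<in>I. \<Sum>y\<in>I. fls_const (\<omega> (b x) (d (b y))) * s_mult par (s_var x) (s_var y) M)"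

locale gaussian_coordinates =
  fixes W :: "bool \<Rightarrow> 'w::real_vector set" and d :: "'w \<Rightarrow> 'w" and \<omega> :: "'w \<Rightarrow> 'w \<Rightarrow> real"
    and H L :: "'w set"
    and n k m :: nat and b :: "nat \<Rightarrow> 'w" and par :: "nat \<Rightarrow> bool" and \<epsilon> :: "nat \<Rightarrow> real"
  assumes homogeneous: "x < n + k + 2 * m \<Longrightarrow> b x \<in> W (par x)"
    and basis_H: "inj_on b {..<n}" "independent (b ` {..<n})" "span (b ` {..<n}) = H"
    and basis_L: "inj_on b {n..<n + k + 2 * m}" "independent (b ` {n..<n + k + 2 * m})"
                 "span (b ` {n..<n + k + 2 * m}) = L"
    and even_L: "x \<in> {n..<n + k} \<Longrightarrow> \<not> par x"
    and odd_L: "x \<in> {n + k..<n + k + 2 * m} \<Longrightarrow> par x"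
    and signs: "x \<in> {n..<n + k} \<Longrightarrow> \<epsilon> x = 1 \<or> \<epsilon> x = -1"
    and sigma_normal_form:
      "sigma d \<omega> b par {n..<n + k + 2 * m} M =
         (\<Sum>x\<in>{n..<n + k}. fls_const (\<epsilon> x) * s_mult par (s_var x) (s_var x) M)
         - (\<Sum>r<m. s_mult par (s_var (n + k + 2 * r)) (s_var (n + k + 2 * r + 1)) M)"

text \<open>\<open>\<integral> x\<^sup>r exp(-\<epsilon>x\<^sup>2/2\<hbar>)\<close> for an even coordinate \<open>x\<close>.\<close>

fun even_moment :: "real \<Rightarrow> nat \<Rightarrow> real fls" where
  "even_moment e 0 = 1"
| "even_moment e (Suc 0) = 0"
| "even_moment e (Suc (Suc r)) = fls_const (e * real (r + 1)) * fls_X * even_moment e r"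

text \<open>\<open>\<integral> \<xi>\<^sup>q\<eta>\<^sup>r exp(\<xi>\<eta>/2\<hbar>)\<close> for a pair \<open>\<xi>, \<eta>\<close> of odd coordinates.\<close>

definition odd_moment :: "nat \<Rightarrow> nat \<Rightarrow> real fls" where
  "odd_moment q r = (if q = 0 \<and> r = 0 then 1 else if q = 1 \<and> r = 1 then fls_const 2 * fls_X else 0)"

definition gauss_moment :: "nat \<Rightarrow> nat \<Rightarrow> nat \<Rightarrow> (nat \<Rightarrow> real) \<Rightarrow> nat multiset \<Rightarrow> real fls" where
  "gauss_moment n k m \<epsilon> B =
     (\<Prod>x\<in>{n..<n + k}. even_moment (\<epsilon> x) (count B x)) *
     (\<Prod>r<m. odd_moment (count B (n + k + 2 * r)) (count B (n + k + 2 * r + 1)))"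

text \<open>
  \<open>\<integral>\<^sub>L F exp(-\<sigma>/2\<hbar>)\<close>, termwise. As the coordinates on \<open>H\<close> precede those on \<open>L\<close>, one has
  \<open>y\<^bsup>A+B\<^esup> = y\<^sup>Ay\<^sup>B\<close> for a monomial \<open>A\<close> on \<open>H\<close> and a monomial \<open>B\<close> on \<open>L\<close>. No signs occur in the iterated
  integral of \<open>y\<^sup>B\<close> since the two coordinates of an odd pair are adjacent and only even functions of
  such a pair have a non-zero integral.
\<close>

definition gauss_integral :: "nat \<Rightarrow> nat \<Rightarrow> nat \<Rightarrow> (nat \<Rightarrow> real) \<Rightarrow> series \<Rightarrow> series" where
  "gauss_integral n k m \<epsilon> F A =
     infsum (\<lambda>B. F (A + B) * gauss_moment n k m \<epsilon> B) {B. set_mset B \<subseteq> {n..<n + k + 2 * m}}"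

definition sigma_inv :: "nat \<Rightarrow> nat \<Rightarrow> nat \<Rightarrow> (nat \<Rightarrow> real) \<Rightarrow> nat \<Rightarrow> nat \<Rightarrow> real" where
  "sigma_inv n k m \<epsilon> x y =
     (if x = y \<and> x \<in> {n..<n + k} then \<epsilon> x
      else if \<exists>r<m. x = n + k + 2 * r \<and> y = n + k + 2 * r + 1 then 2
      else if \<exists>r<m. y = n + k + 2 * r \<and> x = n + k + 2 * r + 1 then -2
      else 0)"

section \<open>Stable graphs\<close>

text \<open>Every finite graph is isomorphic to one whose half-edges and vertices are natural numbers.\<close>

record graph =
  half_edges :: "nat set"
  verts :: "nat set"
  root :: "nat \<Rightarrow> nat"
  flip :: "nat \<Rightarrow> nat"
  vgenus :: "nat \<Rightarrow> nat"

definition graph :: "graph \<Rightarrow> bool" where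
  "graph G \<longleftrightarrow> finite (half_edges G) \<and> finite (verts G) \<and>
     (\<forall>x\<in>half_edges G. root G x \<in> verts G \<and> flip G x \<in> half_edges G \<and> flip G (flip G x) = x)"

definition legs :: "graph \<Rightarrow> nat set" where
  "legs G = {x \<in> half_edges G. flip G x = x}"

definition valence :: "graph \<Rightarrow> nat \<Rightarrow> nat" where
  "valence G v = card {x \<in> half_edges G. root G x = v}"

definition stable :: "graph \<Rightarrow> bool" where
  "stable G \<longleftrightarrow> graph G \<and> (\<forall>v\<in>verts G. 2 * vgenus G v + valence G v \<ge> 3)"

definition connected_graph :: "graph \<Rightarrow> bool" where
  "connected_graph G \<longleftrightarrow> verts G \<noteq> {} \<and>
     (\<forall>u\<in>verts G. \<forall>v\<in>verts G. (u, v) \<in> {(root G x, root G (flip G x)) | x. x \<in> half_edges G}\<^sup>*)"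

definition stable_connected :: "graph set" where
  "stable_connected = {G. stable G \<and> connected_graph G}"

text \<open>
  The cellular 1-cycles with real coefficients: \<open>c x\<close> is the coefficient of the edge through \<open>x\<close>,
  oriented away from the root of \<open>x\<close>. Legs do not contribute. There being no 2-cells, this is the
  first homology.
\<close>

definition cycles :: "graph \<Rightarrow> (nat \<Rightarrow>\<^sub>0 real) set" where
  "cycles G = {c. Poly_Mapping.keys c \<subseteq> half_edges G \<and>
     (\<forall>x\<in>half_edges G. Poly_Mapping.lookup c (flip G x) = - Poly_Mapping.lookup c x) \<and>
     (\<forall>v\<in>verts G. (\<Sum>x | x \<in> half_edges G \<and> root G x = v. Poly_Mapping.lookup c x) = 0)}"

definition graph_genus :: "graph \<Rightarrow> nat" where
  "graph_genus G = dim (cycles G) + (\<Sum>v\<in>verts G. vgenus G v)"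

definition is_iso :: "graph \<Rightarrow> graph \<Rightarrow> (nat \<Rightarrow> nat) \<Rightarrow> (nat \<Rightarrow> nat) \<Rightarrow> bool" where
  "is_iso G G' \<phi> \<psi> \<longleftrightarrow>
     bij_betw \<phi> (half_edges G) (half_edges G') \<and> bij_betw \<psi> (verts G) (verts G') \<and>
     (\<forall>x\<in>half_edges G. root G' (\<phi> x) = \<psi> (root G x) \<and> flip G' (\<phi> x) = \<phi> (flip G x)) \<and>
     (\<forall>v\<in>verts G. vgenus G' (\<psi> v) = vgenus G v)"

definition iso_rel :: "(graph \<times> graph) set" where
  "iso_rel = {(G, G'). G \<in> stable_connected \<and> G' \<in> stable_connected \<and> (\<exists>\<phi> \<psi>. is_iso G G' \<phi> \<psi>)}"

definition Aut :: "graph \<Rightarrow> ((nat \<Rightarrow> nat) \<times> (nat \<Rightarrow> nat)) set" where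
  "Aut G = {(\<phi>, \<psi>). \<phi> permutes half_edges G \<and> \<psi> permutes verts G \<and> is_iso G G \<phi> \<psi>}"

section \<open>Feynman amplitudes\<close>

text \<open>
  The tensor of a vertex has its edge half-edges first and then its legs. The tensor product over
  all vertices is indexed by the half-edges in the order \<open>vertex_order\<close>; the contraction needs them
  in the order \<open>edge_order\<close>, where the two halves of an edge are adjacent and the legs come last.
  Moving from one order to the other produces the Koszul sign of the odd labels. As \<open>f\<close> and
  \<open>\<sigma>\<^sup>-\<^sup>1\<close> are even and (super)symmetric, the orders of vertices, edges and half-edges chosen here have
  no influence on the amplitude.
\<close>

definition vertex_half_edges :: "graph \<Rightarrow> nat \<Rightarrow> nat list" where
  "vertex_half_edges G v =
     sorted_list_of_set {x \<in> half_edges G - legs G. root G x = v} @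
     sorted_list_of_set {x \<in> legs G. root G x = v}"

definition vertex_order :: "graph \<Rightarrow> nat list" where
  "vertex_order G = concat (map (vertex_half_edges G) (sorted_list_of_set (verts G)))"

definition edge_order :: "graph \<Rightarrow> nat list" where
  "edge_order G =
     concat (map (\<lambda>x. [x, flip G x]) (sorted_list_of_set {x \<in> half_edges G. x < flip G x})) @
     sorted_list_of_set (legs G)"

definition precedes :: "'a list \<Rightarrow> 'a \<Rightarrow> 'a \<Rightarrow> bool" where
  "precedes xs x y \<longleftrightarrow> (\<exists>i j. i < j \<and> j < length xs \<and> xs ! i = x \<and> xs ! j = y)"

definition koszul_sign :: "('a \<Rightarrow> bool) \<Rightarrow> 'a list \<Rightarrow> 'a list \<Rightarrow> real" where
  "koszul_sign P xs ys = (-1) ^ card {(x, y). P x \<and> P y \<and> precedes xs x y \<and> precedes ys y x}"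

text \<open>
  The amplitude is written as a sum over all labellings \<open>l\<close> of the half-edges by coordinates, on
  \<open>L\<close> for edges and on \<open>H\<close> for legs. Leg labels are multiplied in the symmetric algebra of \<open>H\<^sup>*\<close>.
\<close>

definition amplitude ::
  "nat \<Rightarrow> nat \<Rightarrow> nat \<Rightarrow> (nat \<Rightarrow> 'w) \<Rightarrow> (nat \<Rightarrow> bool) \<Rightarrow> (nat \<Rightarrow> real) \<Rightarrow>
     (nat \<Rightarrow> 'w list \<Rightarrow> real) \<Rightarrow> graph \<Rightarrow> series" where
  "amplitude n k m b par \<epsilon> f G A =
     (\<Sum>l\<in>PiE (half_edges G) (\<lambda>x. if x \<in> legs G then {..<n} else {n..<n + k + 2 * m}).
        fls_const
          (koszul_sign (\<lambda>x. par (l x)) (vertex_order G) (edge_order G) *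
           (\<Prod>v\<in>verts G. f (vgenus G v) (map (\<lambda>x. b (l x)) (vertex_half_edges G v))) *
           (\<Prod>x | x \<in> half_edges G \<and> x < flip G x. sigma_inv n k m \<epsilon> (l x) (l (flip G x)))) *
        s_word par (map l (sorted_list_of_set (legs G))) A)"

end

theory Submission
  imports Defs "HOL-Combinatorics.Multiset_Permutations"
begin

text \<open>
  By Wick's theorem, the Gaussian integral of a monomial is a sum over the involutions of its letters:
  two-cycles are contracted with \<open>\<sigma>\<^sup>-\<^sup>1\<close>, and the fixed points are labels on \<open>H\<close>. Expanding \<open>exp (f/\<hbar>)\<close>, one
  obtains the integral \<open>Z\<close> as the sum of \<open>F(G) / (h! r!)\<close>, with suitable powers of \<open>\<hbar>\<close>, over all graphs with
  half-edges \<open>{..<h}\<close> and vertices \<open>{..<r}\<close>; the factor \<open>1/h!\<close> appears since \<open>h! / \<Prod> n(v)!\<close> maps from the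
  half-edges to the vertices have the given valences \<open>n(v)\<close>.

  Let \<open>C\<close> be the same sum over connected graphs, and let \<open>D\<close> be the derivation that multiplies
  \<open>\<hbar>\<^sup>ey\<^sup>M\<close> by its weight \<open>2e + |M|\<close>. It multiplies the term of \<open>G\<close> by the sum of \<open>2g(v) + n(v) - 2\<close> over the
  vertices \<open>v\<close>. Splitting off the connected component of \<open>v\<close> therefore gives \<open>D Z = (D C) Z\<close>, so \<open>C\<close> is
  the logarithm of \<open>Z\<close>, all its terms having positive weight. The orbit of a graph under relabelling has
  \<open>h! r! / |Aut G|\<close> elements, and the exponent of \<open>\<hbar>\<close> is minus an Euler characteristic, which is \<open>g(G) - 1\<close> for
  connected \<open>G\<close>.
\<close>

section \<open>Signs of words\<close>

text \<open>Two obstacles shape the proof. The first is signs: an amplitude is defined with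
  particular orders of vertices, half-edges, edges and legs, which neither isomorphisms nor disjoint
  unions respect. Multiplying a supersymmetric tensor by the sign that sorts its arguments makes it
  independent of their order, and a Koszul sign is the product of two such sorting signs; even
  blocks commute. Half-edges, unlike their labels, never repeat, so their signs have no exceptional
  cases. The second is infinity. Identities are proved modulo weights above \<open>K\<close>, where
  finitely many graphs matter. Integration over \<open>L\<close> trades two coordinates for one
  \<open>hbar\<close> and so preserves the weight \<open>2e + |M|\<close>; this weight cannot bound
  the number of integrated coordinates. The variant \<open>3e + |M|\<close> is still nonnegative on
  \<open>f / hbar\<close>, and integration raises it by half that number, which therefore is
  bounded.\<close>

definition inversion_sign :: "('a::linorder \<Rightarrow> bool) \<Rightarrow> 'a \<Rightarrow> 'a \<Rightarrow> real" where
  "inversion_sign P x y = (if P x \<and> P y \<and> y < x then -1 else 1)"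

definition swap_sign :: "('a \<Rightarrow> bool) \<Rightarrow> 'a \<Rightarrow> 'a \<Rightarrow> real" where
  "swap_sign P x y = (if P x \<and> P y then -1 else 1)"

text \<open>If the union is admissible, this is the sign in \<open>y^A y^B = +-y^(A+B)\<close> for
  monomials in increasing order. Written as a product over multisets instead of with a cardinality
  of pairs, it is multiplicative in each argument without any admissibility condition.\<close>

definition cross_sign :: "('a::linorder \<Rightarrow> bool) \<Rightarrow> 'a multiset \<Rightarrow> 'a multiset \<Rightarrow> real" where
  "cross_sign P A B = (\<Prod>x\<in>#A. \<Prod>y\<in>#B. inversion_sign P x y)"

text \<open>The sign between a product of coordinates in the order of the word and the ordered
  monomial in the same letters; the exponent of -1 is the number of inversions between odd
  letters.\<close>

primrec sorting_sign :: "('a::linorder \<Rightarrow> bool) \<Rightarrow> 'a list \<Rightarrow> real" where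
  "sorting_sign P [] = 1"
| "sorting_sign P (x # xs) = cross_sign P {#x#} (mset xs) * sorting_sign P xs"

lemma cross_sign_empty [simp]: "cross_sign P {#} B = 1" "cross_sign P A {#} = 1"
  by (simp_all add: cross_sign_def)

lemma cross_sign_union: "cross_sign P (A + A') B = cross_sign P A B * cross_sign P A' B"
  "cross_sign P A (B + B') = cross_sign P A B * cross_sign P A B'"
  by (simp_all add: cross_sign_def prod_mset.distrib)

lemma cross_sign_add_mset: "cross_sign P (add_mset x A) B = cross_sign P {#x#} B * cross_sign P A B"
  "cross_sign P A (add_mset y B) = cross_sign P A {#y#} * cross_sign P A B"
  by (simp_all add: cross_sign_def prod_mset.distrib)

lemma cross_sign_single: "cross_sign P {#x#} {#y#} = inversion_sign P x y"
  by (simp add: cross_sign_def)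

lemma cross_sign_square: "cross_sign P A B * cross_sign P A B = 1"
proof (induction A)
  case (add x A)
  have "cross_sign P {#x#} B * cross_sign P {#x#} B = 1"
    by (induction B) (auto simp: cross_sign_def inversion_sign_def)
  then have "(cross_sign P {#x#} B * cross_sign P A B) * (cross_sign P {#x#} B * cross_sign P A B) = 1"
    by (metis add.IH mult.assoc mult.left_commute mult.right_neutral)
  then show ?case by (simp add: cross_sign_add_mset(1)[of P x A])
qed simp

lemma sorting_sign_append: "sorting_sign P (xs @ ys) = sorting_sign P xs * sorting_sign P ys * cross_sign P (mset xs) (mset ys)"
  by (induction xs) (auto simp: cross_sign_union cross_sign_add_mset(1)[of _ _ "mset _"])

lemma sorting_sign_square: "sorting_sign P xs * sorting_sign P xs = 1"
proof (induction xs)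
  case (Cons x xs)
  have "sorting_sign P (x # xs) * sorting_sign P (x # xs) =
     (cross_sign P {#x#} (mset xs) * cross_sign P {#x#} (mset xs)) * (sorting_sign P xs * sorting_sign P xs)" by simp
  then show ?case by (simp only: Cons cross_sign_square)
qed simp

lemma sorting_sign_sorted: "sorted xs \<Longrightarrow> sorting_sign P xs = 1"
proof (induction xs)
  case (Cons x xs)
  have "cross_sign P {#x#} (mset xs) = 1"
  proof -
    have "\<not> y < x" if "y \<in> set xs" for y using Cons.prems that by (auto simp: not_less)
    then show ?thesis unfolding cross_sign_def by (auto intro!: prod_mset.neutral simp: inversion_sign_def)
  qed
  with Cons show ?case by simp
qed simp

lemma inversion_sign_swap: "x \<noteq> y \<Longrightarrow> inversion_sign P x y = swap_sign P x y * inversion_sign P y x"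
  by (auto simp: inversion_sign_def swap_sign_def)

text \<open>Equal letters are excluded: exchanging two equal odd letters does not change the word,
  although \<open>swap_sign\<close> is -1.\<close>

lemma sorting_sign_swap:
  assumes "x \<noteq> y"
  shows "sorting_sign P (us @ x # y # vs) = swap_sign P x y * sorting_sign P (us @ y # x # vs)"
proof -
  have "cross_sign P (mset us) (add_mset x (add_mset y (mset vs))) = cross_sign P (mset us) (add_mset y (add_mset x (mset vs)))"
    by (simp only: add_mset_commute)
  then show ?thesis
    using inversion_sign_swap[OF assms, of P]
    by (simp add: sorting_sign_append cross_sign_add_mset(2)[of P "{#x#}" y "mset vs"]
        cross_sign_add_mset(2)[of P "{#y#}" x "mset vs"] cross_sign_single)
qed

section \<open>Parity of words and the exchange of blocks\<close>

definition odd_count :: "('a \<Rightarrow> bool) \<Rightarrow> 'a multiset \<Rightarrow> nat" where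
  "odd_count P A = size (filter_mset P A)"

lemma odd_count_simps [simp]: "odd_count P {#} = 0"
  "odd_count P (add_mset x A) = (if P x then 1 else 0) + odd_count P A"
  "odd_count P (A + B) = odd_count P A + odd_count P B"
  by (simp_all add: odd_count_def)

lemma cross_sign_single_left_even: "\<not> P x \<Longrightarrow> cross_sign P {#x#} B = 1"
  by (auto simp: cross_sign_def inversion_sign_def intro!: prod_mset.neutral)

text \<open>Two distinct odd letters are inverted in exactly one of their two orders. A common odd
  letter would be inverted in neither, which the hypothesis excludes.\<close>

lemma cross_sign_swap:
  assumes "\<And>x. x \<in># A \<Longrightarrow> x \<in># B \<Longrightarrow> \<not> P x"
  shows "cross_sign P A B = (-1) ^ (odd_count P A * odd_count P B) * cross_sign P B A"
  using assms
proof (induction A)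
  case (add x A)
  have 1: "cross_sign P {#x#} B = (if P x then (-1) ^ odd_count P B else 1) * cross_sign P B {#x#}"
    if "P x \<Longrightarrow> x \<notin># B"
    using that
  proof (induction B)
    case (add y B)
    have "inversion_sign P x y = (if P x \<and> P y then -1 else 1) * inversion_sign P y x"
      using add.prems by (cases "x = y") (auto simp: inversion_sign_def)
    moreover have "cross_sign P {#x#} B = (if P x then (-1) ^ odd_count P B else 1) * cross_sign P B {#x#}"
      by (rule add.IH) (use add.prems in auto)
    ultimately show ?case
      by (subst cross_sign_add_mset(2), subst cross_sign_add_mset(1)) (simp add: cross_sign_single)
  qed simp
  have IH: "cross_sign P A B = (-1) ^ (odd_count P A * odd_count P B) * cross_sign P B A"
    by (rule add.IH) (use add.prems in auto)
  show ?case
    by (subst cross_sign_add_mset(1), subst cross_sign_add_mset(2), subst 1)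
       (use add.prems in \<open>auto simp: IH power_add\<close>)
qed simp

lemma cross_sign_swap_even:
  assumes "\<And>x. x \<in># A \<Longrightarrow> x \<in># B \<Longrightarrow> \<not> P x" and "even (odd_count P A) \<or> even (odd_count P B)"
  shows "cross_sign P A B = cross_sign P B A"
  using cross_sign_swap[of A B P] assms by auto

lemma cross_sign_cong: "(\<And>x. x \<in># A \<or> x \<in># B \<Longrightarrow> P x = Q x) \<Longrightarrow> cross_sign P A B = cross_sign Q A B"
  unfolding cross_sign_def by (intro arg_cong[where f = prod_mset] image_mset_cong) (auto simp: inversion_sign_def)

lemma sorting_sign_cong: "(\<And>x. x \<in> set xs \<Longrightarrow> P x = Q x) \<Longrightarrow> sorting_sign P xs = sorting_sign Q xs"
proof (induction xs)
  case (Cons x xs)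
  have "cross_sign P {#x#} (mset xs) = cross_sign Q {#x#} (mset xs)" by (rule cross_sign_cong) (use Cons.prems in auto)
  with Cons show ?case by simp
qed simp

text \<open>Adjacent transpositions generate all rearrangements: the first letter of
  \<open>xs\<close> is bubbled to the front of \<open>ys\<close>, and the rest follows by induction.
  Since the hypothesis is stated only for rearrangements of \<open>A\<close>, it may use properties
  of the letters in \<open>A\<close>.\<close>

lemma adjacent_swap_invariant:
  assumes swap: "\<And>us x y vs. mset (us @ x # y # vs) = A \<Longrightarrow> \<Psi> (us @ x # y # vs) = \<Psi> (us @ y # x # vs)"
    and "mset xs = A" "mset ys = A"
  shows "\<Psi> xs = \<Psi> ys"
proof -
  have bubble: "\<Psi> (us @ vs @ x # ws) = \<Psi> (us @ x # vs @ ws)"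
    if "mset (us @ vs @ x # ws) = A" for us vs ws x
    using that
  proof (induction vs arbitrary: us)
    case (Cons v vs)
    have "\<Psi> ((us @ [v]) @ vs @ x # ws) = \<Psi> ((us @ [v]) @ x # vs @ ws)"
      by (rule Cons.IH) (use Cons.prems in auto)
    also have "\<dots> = \<Psi> (us @ x # v # vs @ ws)"
      using swap[of us v x "vs @ ws"] Cons.prems by simp
    finally show ?case by simp
  qed simp
  \<comment> \<open>The common prefix \<open>us\<close> is needed because the swap hypothesis speaks
    of whole words.\<close>
  have "\<Psi> (us @ xs) = \<Psi> (us @ ys)" if "mset xs = mset ys" "mset (us @ xs) = A" for us xs ys
    using that
  proof (induction xs arbitrary: us ys)
    case (Cons x xs)
    have "x \<in> set ys" using mset_eq_setD[OF Cons.prems(1)] by auto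
    then obtain vs ws where ys: "ys = vs @ x # ws" by (meson split_list)
    have "\<Psi> ((us @ [x]) @ xs) = \<Psi> ((us @ [x]) @ vs @ ws)"
      by (rule Cons.IH) (use Cons.prems ys in auto)
    also have "\<dots> = \<Psi> (us @ ys)"
      using bubble[of us vs x ws] Cons.prems ys by auto
    finally show ?case by simp
  qed simp
  from this[of xs ys "[]"] assms(2,3) show ?thesis by simp
qed

text \<open>An adjacent swap of distinct letters multiplies both the sorting sign and the function
  by \<open>swap_sign\<close>, whose square is 1, and a swap of equal letters does nothing. So the
  product depends only on the multiset of letters.\<close>

lemma supersymmetric_invariant:
  fixes \<Phi> :: "'a::linorder list \<Rightarrow> 'b::real_algebra_1"
  assumes "\<And>us x y vs. mset (us @ x # y # vs) = mset xs \<Longrightarrow>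
             \<Phi> (us @ x # y # vs) = of_real (swap_sign P x y) * \<Phi> (us @ y # x # vs)"
    and "\<And>x. P x \<Longrightarrow> count (mset xs) x \<le> 1" "mset xs = mset ys"
  shows "of_real (sorting_sign P xs) * \<Phi> xs = of_real (sorting_sign P ys) * \<Phi> ys"
proof (rule adjacent_swap_invariant[where A = "mset xs"])
  fix us x y vs
  assume *: "mset (us @ x # y # vs) = mset xs"
  have "of_real a * (of_real b * z) = of_real (a * b) * z" for a b and z :: 'b
    by (simp add: mult.assoc)
  moreover have "swap_sign P x y * s * swap_sign P x y = s" for s by (simp add: swap_sign_def)
  ultimately have "of_real (swap_sign P x y * sorting_sign P (us @ y # x # vs)) * (of_real (swap_sign P x y) * \<Phi> (us @ y # x # vs))
     = of_real (sorting_sign P (us @ y # x # vs)) * \<Phi> (us @ y # x # vs)"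
    by metis
  then show "of_real (sorting_sign P (us @ x # y # vs)) * \<Phi> (us @ x # y # vs) =
             of_real (sorting_sign P (us @ y # x # vs)) * \<Phi> (us @ y # x # vs)"
    by (cases "x = y") (simp_all only: assms(1)[OF *] sorting_sign_swap[of x y] not_False_eq_True)
qed (use assms in auto)

section \<open>The Koszul sign as a product of sorting signs\<close>

lemma precedes_Cons:
  "distinct (x # xs) \<Longrightarrow> precedes (x # xs) a b \<longleftrightarrow> (a = x \<and> b \<in> set xs) \<or> precedes xs a b"
proof -
  assume d: "distinct (x # xs)"
  have "precedes (x # xs) a b" if "a = x" "b \<in> set xs"
  proof -
    from that obtain j where "j < length xs" "xs ! j = b" by (auto simp: in_set_conv_nth)
    then show ?thesis unfolding precedes_def using that by (intro exI[of _ 0] exI[of _ "Suc j"]) auto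
  qed
  moreover have "precedes (x # xs) a b" if "precedes xs a b"
  proof -
    from that obtain i j where "i < j" "j < length xs" "xs ! i = a" "xs ! j = b"
      unfolding precedes_def by blast
    then show ?thesis unfolding precedes_def by (intro exI[of _ "Suc i"] exI[of _ "Suc j"]) auto
  qed
  moreover have "(a = x \<and> b \<in> set xs) \<or> precedes xs a b" if p: "precedes (x # xs) a b"
  proof -
    from p obtain i j where ij: "i < j" "j < Suc (length xs)" "(x # xs) ! i = a" "(x # xs) ! j = b"
      unfolding precedes_def by auto
    then obtain j' where j: "j = Suc j'" by (cases j) auto
    show ?thesis
    proof (cases i)
      case 0
      then show ?thesis using ij j by auto
    next
      case (Suc i')
      then show ?thesis using ij j unfolding precedes_def by auto
    qed
  qed
  ultimately show ?thesis by blast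
qed

lemma precedes_set: "precedes xs x y \<Longrightarrow> x \<in> set xs \<and> y \<in> set xs"
  unfolding precedes_def by force

lemma precedes_linear:
  assumes "distinct xs" "x \<in> set xs" "y \<in> set xs" "x \<noteq> y"
  shows "precedes xs x y \<longleftrightarrow> \<not> precedes xs y x"
  using assms
proof (induction xs)
  case (Cons a xs)
  then show ?case using precedes_Cons[OF Cons.prems(1)] precedes_set by (metis distinct.simps(2) set_ConsD)
qed simp

lemma precedes_irrefl: "distinct xs \<Longrightarrow> \<not> precedes xs x x"
  unfolding precedes_def by (auto simp: nth_eq_iff_index_eq)

lemma finite_precedes: "finite {(x, y). precedes xs x y \<and> R x y}"
  by (rule finite_subset[of _ "set xs \<times> set xs"]) (auto dest: precedes_set)

lemma sorting_sign_eq_card: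
  assumes "distinct xs"
  shows "sorting_sign P xs = (-1) ^ card {(x, y). precedes xs x y \<and> P x \<and> P y \<and> y < x}"
  using assms
proof (induction xs)
  case Nil
  have "\<not> precedes [] x y" for x y :: 'a by (simp add: precedes_def)
  then show ?case by simp
next
  case (Cons a xs)
  let ?A = "{y \<in> set xs. P a \<and> P y \<and> y < a}"
  have eq: "{(x, y). precedes (a # xs) x y \<and> P x \<and> P y \<and> y < x} =
     Pair a ` ?A \<union> {(x, y). precedes xs x y \<and> P x \<and> P y \<and> y < x}"
    using precedes_Cons[OF Cons.prems] by auto
  have "card \<dots> = card ?A + card {(x, y). precedes xs x y \<and> P x \<and> P y \<and> y < x}"
    using Cons.prems finite_precedes
    by (subst card_Un_disjoint) (auto simp: card_image inj_on_def dest: precedes_set)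
  moreover have "cross_sign P {#a#} (mset xs) = (-1) ^ card ?A"
  proof -
    have "cross_sign P {#a#} (mset xs) = (\<Prod>y\<in>set xs. inversion_sign P a y)"
      using Cons.prems by (simp add: cross_sign_def prod_unfold_prod_mset mset_set_set)
    also have "\<dots> = (\<Prod>y\<in>?A. - 1)"
      by (rule prod.mono_neutral_cong_right) (auto simp: inversion_sign_def)
    finally show ?thesis by simp
  qed
  ultimately show ?case using Cons eq by (simp add: power_add)
qed

text \<open>The odd pairs that stand in different orders in the two words form the symmetric
  difference of the inversions of \<open>xs\<close> and those of \<open>ys\<close>.\<close>

lemma koszul_sign_eq:
  fixes P :: "'a::linorder \<Rightarrow> bool"
  assumes "distinct xs" "distinct ys" "set xs = set ys"
  shows "koszul_sign P xs ys = sorting_sign P xs * sorting_sign P ys"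
proof -
  \<comment> \<open>\<open>K1\<close> holds the pairs inverted in \<open>xs\<close> only,
    \<open>K2\<close>, with its components exchanged, those inverted in \<open>ys\<close> only, and
    \<open>B\<close> those inverted in both.\<close>
  define K1 where "K1 = {(x, y). precedes xs x y \<and> P x \<and> P y \<and> precedes ys y x \<and> y < x}"
  define K2 where "K2 = {(x, y). precedes xs x y \<and> P x \<and> P y \<and> precedes ys y x \<and> x < y}"
  define B where "B = {(x, y). precedes xs x y \<and> P x \<and> P y \<and> precedes ys x y \<and> y < x}"
  note fin = finite_precedes[of xs]
  have f: "finite K1" "finite K2" "finite B" unfolding K1_def K2_def B_def by (rule fin)+
  have anti: "precedes xs x y \<Longrightarrow> \<not> precedes xs y x" "precedes ys x y \<Longrightarrow> \<not> precedes ys y x" for x y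
    using precedes_linear[OF assms(1), of x y] precedes_set[of xs x y] precedes_irrefl[OF assms(1), of x]
      precedes_linear[OF assms(2), of x y] precedes_set[of ys x y] precedes_irrefl[OF assms(2), of x]
    by (cases "x = y"; blast)+
  have tot: "precedes xs x y \<Longrightarrow> precedes ys x y \<or> precedes ys y x"
    "precedes ys x y \<Longrightarrow> precedes xs x y \<or> precedes xs y x" for x y
    using precedes_linear[OF assms(1), of x y] precedes_set[of xs x y] precedes_irrefl[OF assms(1), of x]
      precedes_linear[OF assms(2), of x y] precedes_set[of ys x y] precedes_irrefl[OF assms(2), of x] assms(3)
    by (cases "x = y"; blast)+
  have irr: "\<not> precedes xs x x" for x by (rule precedes_irrefl[OF assms(1)])
  have disj: "K1 \<inter> K2 = {}" "K1 \<inter> B = {}" "prod.swap ` K2 \<inter> B = {}"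
    by (auto simp: K1_def K2_def B_def) (blast dest: anti)+
  have "{(x, y). P x \<and> P y \<and> precedes xs x y \<and> precedes ys y x} = K1 \<union> K2"
    unfolding K1_def K2_def using irr less_linear by blast
  hence K: "koszul_sign P xs ys = (-1) ^ (card K1 + card K2)"
    unfolding koszul_sign_def using card_Un_disjoint[OF f(1,2) disj(1)] by simp
  have "{(x, y). precedes xs x y \<and> P x \<and> P y \<and> y < x} = K1 \<union> B"
    unfolding K1_def B_def using tot by blast
  hence X: "sorting_sign P xs = (-1) ^ (card K1 + card B)"
    unfolding sorting_sign_eq_card[OF assms(1)] using card_Un_disjoint[OF f(1,3) disj(2)] by simp
  have "(x, y) \<in> prod.swap ` K2 \<longleftrightarrow> precedes xs y x \<and> P x \<and> P y \<and> precedes ys x y \<and> y < x" for x y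
    unfolding K2_def by (auto simp: image_iff)
  hence "{(x, y). precedes ys x y \<and> P x \<and> P y \<and> y < x} = prod.swap ` K2 \<union> B"
    unfolding B_def using tot by blast
  moreover have "card (prod.swap ` K2) = card K2" by (simp add: card_image)
  ultimately have Y: "sorting_sign P ys = (-1) ^ (card K2 + card B)"
    unfolding sorting_sign_eq_card[OF assms(2)] using card_Un_disjoint[OF finite_imageI[OF f(2)] f(3) disj(3)] by simp
  show ?thesis unfolding K X Y by (simp add: power_add)
qed

section \<open>The algebra of series\<close>

lemma finite_submultisets: "finite {A. A \<subseteq># M}"
proof (rule finite_subset)
  show "{A. A \<subseteq># M} \<subseteq> mset ` {xs. set xs \<subseteq> set_mset M \<and> length xs \<le> size M}"
  proof safe
    fix A assume "A \<subseteq># M"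
    moreover obtain xs where "A = mset xs" by (metis ex_mset)
    ultimately show "A \<in> mset ` {xs. set xs \<subseteq> set_mset M \<and> length xs \<le> size M}"
      using set_mset_mono size_mset_mono by (intro image_eqI[of _ _ xs]) fastforce+
  qed
qed (auto intro: finite_lists_length_le)

lemma admissible_mono: "admissible P M \<Longrightarrow> A \<subseteq># M \<Longrightarrow> admissible P A"
  unfolding admissible_def by (meson le_trans mset_subset_eq_count)

lemma admissible_union: "admissible P (A + B) \<Longrightarrow> admissible P A \<and> admissible P B"
  by (auto intro: admissible_mono)

lemma admissible_disjoint:
  assumes "admissible P (A + B)" "x \<in># A" "x \<in># B"
  shows "\<not> P x"
proof
  assume "P x"
  with assms(1) have "count A x + count B x \<le> 1" unfolding admissible_def by auto
  moreover have "count A x > 0" "count B x > 0" using assms by auto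
  ultimately show False by linarith
qed

lemma cross_sign_eq_card:
  fixes P :: "nat \<Rightarrow> bool"
  assumes "admissible P (A + B)"
  shows "cross_sign P A B = (-1) ^ card {(x, y). x \<in># A \<and> y \<in># B \<and> P x \<and> P y \<and> y < x}"
proof -
  have cnt: "P x \<Longrightarrow> x \<in># A \<Longrightarrow> count A x = 1" "P x \<Longrightarrow> x \<in># B \<Longrightarrow> count B x = 1" for x
    using admissible_union[OF assms] unfolding admissible_def
    by (metis count_greater_eq_one_iff le_antisym)+
  have "cross_sign P A B = (\<Prod>x\<in>set_mset A. (\<Prod>y\<in>set_mset B. inversion_sign P x y ^ count B y) ^ count A x)"
    by (simp add: cross_sign_def image_prod_mset_multiplicity)
  \<comment> \<open>Multiplicities drop out: an odd letter occurs at most once by admissibility, and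
    a factor with an even letter is 1.\<close>
  also have "\<dots> = (\<Prod>x\<in>set_mset A. \<Prod>y\<in>set_mset B. inversion_sign P x y)"
  proof (rule prod.cong[OF refl])
    fix x assume x: "x \<in># A"
    have "(\<Prod>y\<in>set_mset B. inversion_sign P x y ^ count B y) = (\<Prod>y\<in>set_mset B. inversion_sign P x y)"
      using cnt(2) by (intro prod.cong) (auto simp: inversion_sign_def)
    moreover have "(\<Prod>y\<in>set_mset B. inversion_sign P x y) = 1" if "\<not> P x" using that by (simp add: inversion_sign_def)
    ultimately show "(\<Prod>y\<in>set_mset B. inversion_sign P x y ^ count B y) ^ count A x = (\<Prod>y\<in>set_mset B. inversion_sign P x y)"
      using cnt(1)[of x] x by (cases "P x") auto
  qed
  also have "\<dots> = (\<Prod>(x, y)\<in>set_mset A \<times> set_mset B. inversion_sign P x y)"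
    by (simp add: prod.cartesian_product)
  also have "\<dots> = (\<Prod>z\<in>{(x, y). x \<in># A \<and> y \<in># B \<and> P x \<and> P y \<and> y < x}. -1)"
    by (rule prod.mono_neutral_cong_right) (auto simp: inversion_sign_def split: if_splits)
  finally show ?thesis by simp
qed

lemma s_mult_eq:
  "s_mult P F G M = (if admissible P M then
     (\<Sum>A\<in>{A. A \<subseteq># M}. fls_const (cross_sign P A (M - A)) * F A * G (M - A)) else 0)"
proof -
  have "fls_const (cross_sign P A (M - A)) =
     (-1) ^ card {(x, y). x \<in># A \<and> y \<in># M - A \<and> P x \<and> P y \<and> y < x}"
    if "admissible P M" "A \<subseteq># M" for A
    using cross_sign_eq_card[of P A "M - A"] that by (simp add: fls_const_power)
  then show ?thesis unfolding s_mult_def by (auto intro!: sum.cong)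
qed

lemma submultisetE:
  assumes "A \<subseteq># M"
  obtains B where "M = A + B"
  using assms subset_mset.add_diff_inverse[OF assms] by metis


lemma s_mult_cong:
  "(\<And>A. A \<subseteq># M \<Longrightarrow> admissible P A \<Longrightarrow> F A = F' A \<and> G A = G' A) \<Longrightarrow>
   s_mult P F G M = s_mult P F' G' M"
  unfolding s_mult_eq using admissible_mono[of P M] by (auto intro!: sum.cong)

lemma s_mult_inadmissible: "\<not> admissible P M \<Longrightarrow> s_mult P F G M = 0"
  by (simp add: s_mult_def)

text \<open>Both sides run over the decompositions of \<open>M\<close> into three parts
  \<open>C\<close>, \<open>D\<close>, \<open>E\<close>. As \<open>cross_sign\<close> is
  multiplicative, both carry the sign
  \<open>cross_sign P C D * cross_sign P C E * cross_sign P D E\<close>.\<close>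

lemma s_mult_assoc: "s_mult P (s_mult P F G) H M = s_mult P F (s_mult P G H) M"
proof (cases "admissible P M")
  case True
  let ?S = "SIGMA A:{A. A \<subseteq># M}. {C. C \<subseteq># A}"
  let ?T = "SIGMA C:{C. C \<subseteq># M}. {D. D \<subseteq># M - C}"
  have "s_mult P (s_mult P F G) H M =
     (\<Sum>A\<in>{A. A \<subseteq># M}. \<Sum>C\<in>{C. C \<subseteq># A}.
        fls_const (cross_sign P A (M - A) * cross_sign P C (A - C)) * F C * G (A - C) * H (M - A))"
    using True admissible_mono[OF True]
    by (simp add: s_mult_eq[of _ _ H] s_mult_eq[of _ F G] sum_distrib_left sum_distrib_right mult_ac flip: fls_const_mult_const)
  also have "\<dots> = (\<Sum>(A, C)\<in>?S.
        fls_const (cross_sign P A (M - A) * cross_sign P C (A - C)) * F C * G (A - C) * H (M - A))"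
    by (rule sum.Sigma) (auto simp: finite_submultisets)
  also have "\<dots> = (\<Sum>(C, D)\<in>?T.
        fls_const (cross_sign P C (M - C) * cross_sign P D (M - C - D)) * F C * G D * H (M - C - D))"
  proof (rule sum.reindex_bij_witness[where i = "\<lambda>(C, D). (C + D, C)" and j = "\<lambda>(A, C). (C, A - C)"])
    fix z assume "z \<in> ?S"
    then obtain A C where z: "z = (A, C)" "A \<subseteq># M" "C \<subseteq># A" by auto
    obtain D where A: "A = C + D" using submultisetE[OF z(3)] .
    obtain E where M: "M = C + D + E" using submultisetE[OF z(2)] A by auto
    have 1: "cross_sign P C (D + E) * cross_sign P D E = cross_sign P A E * cross_sign P C D"
      by (simp add: A cross_sign_union)
    show "(case z of (A, C) \<Rightarrow> (C, A - C)) \<in> ?T" using z A M by auto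
    show "(case case z of (A, C) \<Rightarrow> (C, A - C) of (C, D) \<Rightarrow>
        fls_const (cross_sign P C (M - C) * cross_sign P D (M - C - D)) * F C * G D * H (M - C - D)) =
      (case z of (A, C) \<Rightarrow> fls_const (cross_sign P A (M - A) * cross_sign P C (A - C)) * F C * G (A - C) * H (M - A))"
      using z A M 1 by (simp add: add.assoc)
  next
    fix z assume "z \<in> ?T"
    then obtain C D where z: "z = (C, D)" "C \<subseteq># M" "D \<subseteq># M - C" by auto
    obtain M' where M: "M = C + M'" using submultisetE[OF z(2)] .
    show "(case z of (C, D) \<Rightarrow> (C + D, C)) \<in> ?S" using z M by auto
    show "(case case z of (C, D) \<Rightarrow> (C + D, C) of (A, C) \<Rightarrow> (C, A - C)) = z" using z by auto
  qed auto
  also have "\<dots> = (\<Sum>C\<in>{C. C \<subseteq># M}. \<Sum>D\<in>{D. D \<subseteq># M - C}.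
        fls_const (cross_sign P C (M - C) * cross_sign P D (M - C - D)) * F C * G D * H (M - C - D))"
    by (rule sum.Sigma[symmetric]) (auto simp: finite_submultisets)
  also have "\<dots> = s_mult P F (s_mult P G H) M"
    using True admissible_mono[OF True] diff_subset_eq_self[of M]
    by (simp add: s_mult_eq[of _ F] s_mult_eq[of _ G H] sum_distrib_left sum_distrib_right mult_ac flip: fls_const_mult_const)
  finally show ?thesis .
qed (simp add: s_mult_inadmissible)

definition even_series :: "(nat \<Rightarrow> bool) \<Rightarrow> series \<Rightarrow> bool" where
  "even_series P F \<longleftrightarrow> (\<forall>M. admissible P M \<longrightarrow> F M \<noteq> 0 \<longrightarrow> even (odd_count P M))"

text \<open>Even elements are central, so evenness of one factor suffices.\<close>

lemma s_mult_comm: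
  assumes "even_series P F"
  shows "s_mult P F G M = s_mult P G F M"
proof (cases "admissible P M")
  case True
  have "(\<Sum>A\<in>{A. A \<subseteq># M}. fls_const (cross_sign P A (M - A)) * F A * G (M - A)) =
        (\<Sum>A\<in>{A. A \<subseteq># M}. fls_const (cross_sign P A (M - A)) * G A * F (M - A))"
  proof (rule sum.reindex_bij_witness[where i = "\<lambda>A. M - A" and j = "\<lambda>A. M - A"])
    fix A assume "A \<in> {A. A \<subseteq># M}"
    then obtain B where M: "M = A + B" by (auto elim: submultisetE)
    have "cross_sign P A B = cross_sign P B A" if "F A \<noteq> 0"
      using assms that True M admissible_union[of P A B] admissible_disjoint[of P A B]
      by (intro cross_sign_swap_even) (auto simp: even_series_def)
    then show "fls_const (cross_sign P (M - A) (M - (M - A))) * G (M - A) * F (M - (M - A)) =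
               fls_const (cross_sign P A (M - A)) * F A * G (M - A)"
      by (cases "F A = 0") (auto simp: M)
  next
    fix A assume "A \<in> {A. A \<subseteq># M}"
    then obtain B where M: "M = A + B" by (auto elim: submultisetE)
    show "M - (M - A) = A" "M - (M - A) = A" by (simp_all add: M)
  qed (auto simp: diff_subset_eq_self)
  then show ?thesis using True by (simp add: s_mult_eq)
qed (simp add: s_mult_inadmissible)

lemma s_mult_one_left: "admissible P M \<Longrightarrow> s_mult P s_one F M = F M"
proof -
  assume "admissible P M"
  hence "s_mult P s_one F M = (\<Sum>A\<in>{A. A \<subseteq># M}. if A = {#} then F M else 0)"
    unfolding s_mult_eq by (auto intro!: sum.cong simp: s_one_def)
  then show ?thesis by (simp add: finite_submultisets)
qed

lemma s_mult_one_right: "admissible P M \<Longrightarrow> s_mult P F s_one M = F M"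
proof -
  have "even_series P s_one" by (auto simp: even_series_def s_one_def)
  then show "admissible P M \<Longrightarrow> ?thesis"
    using s_mult_comm s_mult_one_left by metis
qed

lemma s_mult_sum_left:
  "s_mult P (\<lambda>M. \<Sum>i\<in>I. c i * F i M) G M = (\<Sum>i\<in>I. c i * s_mult P (F i) G M)"
  by (simp add: s_mult_eq sum_distrib_left sum_distrib_right mult_ac, intro impI, rule sum.swap)

lemma s_mult_sum_right:
  "s_mult P F (\<lambda>M. \<Sum>i\<in>I. c i * G i M) M = (\<Sum>i\<in>I. c i * s_mult P F (G i) M)"
  by (simp add: s_mult_eq sum_distrib_left sum_distrib_right mult_ac, intro impI, rule sum.swap)

lemma s_mult_scale_left: "s_mult P (\<lambda>M. c * F M) G M = c * s_mult P F G M"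
  by (simp add: s_mult_eq sum_distrib_left mult_ac)

lemma s_mult_scale_right: "s_mult P F (\<lambda>M. c * G M) M = c * s_mult P F G M"
  by (simp add: s_mult_eq sum_distrib_left mult_ac)

lemma s_mult_diff_left: "s_mult P (\<lambda>M. F M - F' M) G M = s_mult P F G M - s_mult P F' G M"
  by (simp add: s_mult_eq sum_subtractf algebra_simps)

lemma s_mult_diff_right: "s_mult P F (\<lambda>M. G M - G' M) M = s_mult P F G M - s_mult P F G' M"
  by (simp add: s_mult_eq sum_subtractf algebra_simps)

lemma s_mult_add_left: "s_mult P (\<lambda>M. F M + F' M) G M = s_mult P F G M + s_mult P F' G M"
  by (simp add: s_mult_eq sum.distrib algebra_simps)

lemma s_mult_add_right: "s_mult P F (\<lambda>M. G M + G' M) M = s_mult P F G M + s_mult P F G' M"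
  by (simp add: s_mult_eq sum.distrib algebra_simps)

lemma s_power_inadmissible: "\<not> admissible P M \<Longrightarrow> s_power P F r M = 0"
  by (cases r) (auto simp: s_mult_inadmissible s_one_def admissible_def)

lemma s_power_Suc_right: "s_power P F (Suc r) M = s_mult P (s_power P F r) F M"
proof (induction r arbitrary: M)
  case 0
  have "even_series P s_one" by (auto simp: even_series_def s_one_def)
  then show ?case using s_mult_comm[of P s_one F] by simp
next
  case (Suc r)
  have "s_power P F (Suc r) = s_mult P (s_power P F r) F" using Suc by blast
  hence "s_power P F (Suc (Suc r)) M = s_mult P F (s_mult P (s_power P F r) F) M"
    by (simp only: s_power.simps(2)[of _ _ "Suc r"])
  then show ?case by (simp add: s_mult_assoc)
qed

lemma s_word_eq:
  "s_word P xs M = (if M = mset xs \<and> admissible P M then fls_const (sorting_sign P xs) else 0)"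
proof (induction xs arbitrary: M)
  case Nil
  then show ?case by (simp add: s_word_def s_one_def admissible_def)
next
  case (Cons x xs)
  have "s_word P (x # xs) M = s_mult P (s_var x) (s_word P xs) M"
    by (simp add: s_word_def)
  also have "\<dots> = (if M = mset (x # xs) \<and> admissible P M then fls_const (sorting_sign P (x # xs)) else 0)"
  proof (cases "admissible P M")
    case True
    have "s_mult P (s_var x) (s_word P xs) M =
      (\<Sum>A\<in>{A. A \<subseteq># M}. if A = {#x#} then fls_const (cross_sign P {#x#} (M - {#x#})) * s_word P xs (M - {#x#}) else 0)"
      unfolding s_mult_eq using True by (auto intro!: sum.cong simp: s_var_def)
    also have "\<dots> = (if x \<in># M then fls_const (cross_sign P {#x#} (M - {#x#})) * s_word P xs (M - {#x#}) else 0)"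
      by (simp add: finite_submultisets)
    also have "\<dots> = (if M = mset (x # xs) then fls_const (sorting_sign P (x # xs)) else 0)"
      using True admissible_mono[OF True, of "M - {#x#}"] by (auto simp: Cons diff_subset_eq_self) (metis insert_DiffM)
    finally show ?thesis using True by simp
  qed (simp add: s_mult_inadmissible)
  finally show ?case .
qed

lemma s_mult_word: "s_mult P (s_word P xs) (s_word P ys) M = s_word P (xs @ ys) M"
proof (cases "admissible P M")
  case True
  have "s_mult P (s_word P xs) (s_word P ys) M =
     (\<Sum>A\<in>{A. A \<subseteq># M}. if A = mset xs then fls_const (cross_sign P A (M - A)) * s_word P xs A * s_word P ys (M - A) else 0)"
    unfolding s_mult_eq using True by (auto intro!: sum.cong simp: s_word_eq)
  also have "\<dots> = (if mset xs \<subseteq># M then fls_const (cross_sign P (mset xs) (M - mset xs)) * s_word P xs (mset xs) * s_word P ys (M - mset xs) else 0)"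
    by (simp add: finite_submultisets)
  also have "\<dots> = s_word P (xs @ ys) M"
  proof (cases "M = mset (xs @ ys)")
    case eq: True
    have "admissible P (mset xs)" "admissible P (mset ys)" using admissible_union[of P "mset xs" "mset ys"] True eq by simp_all
    moreover have "fls_const a * fls_const b * fls_const c = fls_const (b * c * a)" for a b c :: real
      by (simp add: mult_ac)
    ultimately show ?thesis using True unfolding eq by (simp add: s_word_eq sorting_sign_append)
  next
    case False
    have "s_word P ys (M - mset xs) = 0" if le: "mset xs \<subseteq># M"
    proof -
      obtain B where M: "M = mset xs + B" using submultisetE[OF le] .
      have "B \<noteq> mset ys" using False M by auto
      then show ?thesis by (simp add: s_word_eq M)
    qed
    then show ?thesis using False by (simp add: s_word_eq)
  qed
  finally show ?thesis .
qed (simp add: s_mult_inadmissible s_word_eq)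

lemma s_word_swap:
  "s_word P (us @ x # y # vs) M = fls_const (swap_sign P x y) * s_word P (us @ y # x # vs) M"
proof (cases "x = y")
  case True
  \<comment> \<open>A word with a repeated odd letter is zero, in accordance with the swap sign
    -1.\<close>
  have "\<not> admissible P (mset (us @ x # y # vs))" if "P x"
    using that True by (auto simp: admissible_def intro!: exI[of _ x])
  then show ?thesis using True by (auto simp: s_word_eq swap_sign_def)
next
  case False
  then show ?thesis using sorting_sign_swap[OF False, of P us vs] by (auto simp: s_word_eq add_mset_commute)
qed

section \<open>The weight filtration\<close>

text \<open>For \<open>\<alpha> = 2\<close> the left-hand side of the inequality below is bounded by the weight of \<open>\<hbar>\<^sup>ey\<^sup>M\<close>;
  the case \<open>\<alpha> = 3\<close> bounds the number of half-edges in terms of the weight.\<close>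

definition weight_ge :: "(nat \<Rightarrow> bool) \<Rightarrow> int \<Rightarrow> int \<Rightarrow> series \<Rightarrow> bool" where
  "weight_ge P \<alpha> w F \<longleftrightarrow>
     (\<forall>M e. admissible P M \<longrightarrow> fls_nth (F M) e \<noteq> 0 \<longrightarrow> w \<le> \<alpha> * e + int (size M))"

lemma fls_nth_mult_nonzero:
  fixes x y :: "real fls"
  assumes "fls_nth (x * y) e \<noteq> 0"
  obtains i where "fls_nth x i \<noteq> 0" "fls_nth y (e - i) \<noteq> 0"
  using assms unfolding fls_times_nth(2) by (metis (no_types, lifting) mult_eq_0_iff sum.neutral)

lemma weight_ge_mult:
  assumes "weight_ge P \<alpha> v F" "weight_ge P \<alpha> w G"
  shows "weight_ge P \<alpha> (v + w) (s_mult P F G)"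
  unfolding weight_ge_def
proof (intro allI impI)
  fix M e assume M: "admissible P M" "fls_nth (s_mult P F G M) e \<noteq> 0"
  have "fls_nth (s_mult P F G M) e =
     (\<Sum>A\<in>{A. A \<subseteq># M}. cross_sign P A (M - A) * fls_nth (F A * G (M - A)) e)"
    using M by (simp add: s_mult_eq fls_nth_sum mult.assoc)
  then obtain A where A: "A \<subseteq># M" "fls_nth (F A * G (M - A)) e \<noteq> 0"
    using M(2) by (metis (no_types, lifting) mem_Collect_eq mult_eq_0_iff sum.neutral)
  obtain i where i: "fls_nth (F A) i \<noteq> 0" "fls_nth (G (M - A)) (e - i) \<noteq> 0"
    using A(2) by (rule fls_nth_mult_nonzero)
  have "admissible P A" "admissible P (M - A)" using M(1) A(1) admissible_mono diff_subset_eq_self by blast+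
  hence "v \<le> \<alpha> * i + int (size A)" "w \<le> \<alpha> * (e - i) + int (size (M - A))"
    using assms i unfolding weight_ge_def by blast+
  moreover have "size M = size A + size (M - A)"
    using A(1) by (metis size_union subset_mset.add_diff_inverse)
  ultimately show "v + w \<le> \<alpha> * e + int (size M)" by (simp add: algebra_simps)
qed

lemma weight_ge_mono: "weight_ge P \<alpha> v F \<Longrightarrow> w \<le> v \<Longrightarrow> weight_ge P \<alpha> w F"
  unfolding weight_ge_def by force

lemma weight_ge_one: "weight_ge P \<alpha> 0 s_one"
  unfolding weight_ge_def s_one_def by (auto simp: if_distribR)

lemma weight_ge_add: "weight_ge P \<alpha> w F \<Longrightarrow> weight_ge P \<alpha> w G \<Longrightarrow> weight_ge P \<alpha> w (\<lambda>M. F M + G M)"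
  unfolding weight_ge_def by (metis add.right_neutral fls_plus_nth add_0)

lemma weight_ge_const: "weight_ge P \<alpha> w F \<Longrightarrow> weight_ge P \<alpha> w (\<lambda>M. fls_const c * F M)"
  unfolding weight_ge_def by auto

lemma weight_ge_sum: "(\<And>i. i \<in> I \<Longrightarrow> weight_ge P \<alpha> w (F i)) \<Longrightarrow> weight_ge P \<alpha> w (\<lambda>M. \<Sum>i\<in>I. F i M)"
  unfolding weight_ge_def fls_nth_sum by (metis (no_types, lifting) sum.neutral)

lemma weight_ge_power:
  assumes "weight_ge P \<alpha> w F"
  shows "weight_ge P \<alpha> (int r * w) (s_power P F r)"
proof (induction r)
  case (Suc r)
  then show ?case using weight_ge_mult[OF assms Suc] by (simp add: algebra_simps)
qed (simp add: weight_ge_one)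

text \<open>Congruence modulo terms of weight above \<open>K\<close>. It takes the place of
  convergence: up to the weight in question, an infinite sum is represented by a finite
  truncation.\<close>

definition weight_eq :: "(nat \<Rightarrow> bool) \<Rightarrow> int \<Rightarrow> series \<Rightarrow> series \<Rightarrow> bool" where
  "weight_eq P K F G \<longleftrightarrow> weight_ge P 2 (K + 1) (\<lambda>M. F M - G M)"

lemma weight_eq_iff: "weight_eq P K F G \<longleftrightarrow>
  (\<forall>M e. admissible P M \<longrightarrow> 2 * e + int (size M) \<le> K \<longrightarrow> fls_nth (F M) e = fls_nth (G M) e)"
proof -
  have "(K + 1 \<le> t) = (\<not> t \<le> K)" for t by auto
  then show ?thesis unfolding weight_eq_def weight_ge_def by (simp only: fls_minus_nth) auto
qed

lemma weight_eq_mult: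
  assumes "weight_eq P K F F'" "weight_eq P K G G'" "weight_ge P 2 0 F'" "weight_ge P 2 0 G"
  shows "weight_eq P K (s_mult P F G) (s_mult P F' G')"
proof -
  \<comment> \<open>This uses \<open>FG - F'G' = (F - F')G + F'(G - G')\<close>, whence the bounds
    on \<open>F'\<close> and \<open>G\<close>.\<close>
  have "weight_ge P 2 (K + 1 + 0) (s_mult P (\<lambda>M. F M - F' M) G)"
    by (rule weight_ge_mult) (use assms in \<open>auto simp: weight_eq_def\<close>)
  moreover have "weight_ge P 2 (0 + (K + 1)) (s_mult P F' (\<lambda>M. G M - G' M))"
    by (rule weight_ge_mult) (use assms in \<open>auto simp: weight_eq_def\<close>)
  ultimately have "weight_ge P 2 (K + 1) (\<lambda>M. s_mult P (\<lambda>M. F M - F' M) G M + s_mult P F' (\<lambda>M. G M - G' M) M)"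
    using weight_ge_add by simp
  then show ?thesis unfolding weight_eq_def by (simp add: s_mult_diff_left s_mult_diff_right)
qed

lemma weight_eq_power:
  assumes "weight_eq P K F F'" "weight_ge P 2 0 F" "weight_ge P 2 0 F'"
  shows "weight_eq P K (s_power P F r) (s_power P F' r)"
proof (induction r)
  case (Suc r)
  have "weight_ge P 2 (int r * 0) (s_power P F r)" using weight_ge_power assms(2) by blast
  then show ?case using weight_eq_mult[OF assms(1) Suc assms(3)] by simp
qed (simp add: weight_eq_iff)

section \<open>The weight derivation\<close>

text \<open>Twice the Euler operator of \<open>hbar\<close> plus the Euler operator of the
  coordinates: a derivation that is diagonal on monomials.\<close>

definition s_deriv :: "series \<Rightarrow> series" where
  "s_deriv F M = fls_X * (fls_const 2 * fls_deriv (F M)) + of_nat (size M) * F M"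

lemma s_deriv_nth: "fls_nth (s_deriv F M) e = real_of_int (2 * e + int (size M)) * fls_nth (F M) e"
  by (simp add: s_deriv_def fls_X_times_conv_shift algebra_simps)

lemma s_deriv_mult:
  "s_deriv (s_mult P F G) M = s_mult P (s_deriv F) G M + s_mult P F (s_deriv G) M"
proof (cases "admissible P M")
  case True
  have "size A + size (M - A) = size M" if "A \<subseteq># M" for A
    using that by (metis size_union subset_mset.add_diff_inverse)
  hence sz: "of_nat (size M) = (of_nat (size A) + of_nat (size (M - A)) :: real fls)" if "A \<subseteq># M" for A
    using that by (metis of_nat_add)
  have "s_deriv (s_mult P F G) M = (\<Sum>A\<in>{A. A \<subseteq># M}.
     fls_X * (fls_const 2 * fls_deriv (fls_const (cross_sign P A (M - A)) * F A * G (M - A))) +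
     of_nat (size M) * (fls_const (cross_sign P A (M - A)) * F A * G (M - A)))"
    using True by (simp only: s_deriv_def s_mult_eq if_True fls_deriv_sum sum_distrib_left sum.distrib)
  also have "\<dots> = (\<Sum>A\<in>{A. A \<subseteq># M}.
     fls_const (cross_sign P A (M - A)) * s_deriv F A * G (M - A) +
     fls_const (cross_sign P A (M - A)) * F A * s_deriv G (M - A))"
  proof (rule sum.cong[OF refl])
    fix A assume "A \<in> {A. A \<subseteq># M}"
    hence "A \<subseteq># M" by simp
    then show "fls_X * (fls_const 2 * fls_deriv (fls_const (cross_sign P A (M - A)) * F A * G (M - A))) +
      of_nat (size M) * (fls_const (cross_sign P A (M - A)) * F A * G (M - A)) =
      fls_const (cross_sign P A (M - A)) * s_deriv F A * G (M - A) +
      fls_const (cross_sign P A (M - A)) * F A * s_deriv G (M - A)"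
      by (simp add: s_deriv_def sz algebra_simps)
  qed
  finally show ?thesis using True by (simp add: s_mult_eq sum.distrib)
qed (simp add: s_deriv_def s_mult_inadmissible)

section \<open>Convergence of sums of Laurent series\<close>

text \<open>In the \<open>hbar\<close>-adic metric, being close means agreeing up to a high power of
  \<open>hbar\<close>. It is therefore enough that, for every \<open>K\<close>, finitely many
  summands determine all coefficients up to \<open>hbar^K\<close>.\<close>

lemma has_sum_flsI:
  fixes h :: "'a \<Rightarrow> real fls"
  assumes "\<And>K::nat. \<exists>T. finite T \<and> T \<subseteq> S \<and> (\<forall>x\<in>S - T. \<forall>e\<le>int K. fls_nth (h x) e = 0) \<and>
             (\<forall>e\<le>int K. (\<Sum>x\<in>T. fls_nth (h x) e) = fls_nth X e)"
  shows "(h has_sum X) S"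
  unfolding has_sum_def
proof (rule tendstoI)
  fix \<epsilon> :: real assume "\<epsilon> > 0"
  obtain K where K: "inverse (2 ^ K) < \<epsilon>"
    using real_arch_pow_inv[of \<epsilon> "inverse 2"] \<open>\<epsilon> > 0\<close> by (auto simp: power_one_over inverse_eq_divide)
  obtain T where T: "finite T" "T \<subseteq> S" "\<And>x e. x \<in> S - T \<Longrightarrow> e \<le> int K \<Longrightarrow> fls_nth (h x) e = 0"
      "\<And>e. e \<le> int K \<Longrightarrow> (\<Sum>x\<in>T. fls_nth (h x) e) = fls_nth X e"
    using assms[of K] by blast
  have "dist (sum h Y) X < \<epsilon>" if Y: "finite Y" "T \<subseteq> Y" "Y \<subseteq> S" for Y
  proof (cases "sum h Y = X")
    case False
    have "fls_nth (sum h Y - X) e = 0" if "e \<le> int K" for e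
    proof -
      have "(\<Sum>x\<in>Y. fls_nth (h x) e) = (\<Sum>x\<in>T. fls_nth (h x) e)"
        by (rule sum.mono_neutral_right) (use Y T(3) that in auto)
      then show ?thesis using T(4)[OF that] by (simp add: fls_nth_sum)
    qed
    moreover have "fls_nth (sum h Y - X) (fls_subdegree (sum h Y - X)) \<noteq> 0"
      using False by (intro nth_fls_subdegree_nonzero) simp
    ultimately have "fls_subdegree (sum h Y - X) > int K" using linorder_not_le by blast
    hence "dist (sum h Y) X = inverse (2 ^ nat (fls_subdegree (sum h Y - X)))"
      "K \<le> nat (fls_subdegree (sum h Y - X))"
      using False by (auto simp: dist_fls_def)
    then show ?thesis using K by (auto intro!: le_less_trans[OF _ K] simp: le_imp_inverse_le)
  qed (use \<open>\<epsilon> > 0\<close> in simp)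
  then show "eventually (\<lambda>Y. dist (sum h Y) X < \<epsilon>) (finite_subsets_at_top S)"
    unfolding eventually_finite_subsets_at_top using T(1,2) by blast
qed

text \<open>The common lower bound \<open>L\<close> makes the coefficientwise sums a Laurent series,
  and it leaves only the exponents from \<open>L\<close> to \<open>K\<close> to be controlled at
  each stage of the convergence.\<close>

lemma infsum_fls_nth:
  fixes h :: "'a \<Rightarrow> real fls"
  assumes "\<And>x e. x \<in> S \<Longrightarrow> e < L \<Longrightarrow> fls_nth (h x) e = 0"
    and fin: "\<And>e. finite {x \<in> S. fls_nth (h x) e \<noteq> 0}"
  shows "fls_nth (infsum h S) e = (\<Sum>x\<in>{x \<in> S. fls_nth (h x) e \<noteq> 0}. fls_nth (h x) e)"
proof -
  define X where "X = Abs_fls (\<lambda>e. \<Sum>x\<in>{x \<in> S. fls_nth (h x) e \<noteq> 0}. fls_nth (h x) e)"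
  have X: "fls_nth X e = (\<Sum>x\<in>{x \<in> S. fls_nth (h x) e \<noteq> 0}. fls_nth (h x) e)" for e
    unfolding X_def by (rule nth_Abs_fls_lower_bound[of L]) (use assms(1) in \<open>auto intro!: sum.neutral\<close>)
  have "(h has_sum X) S"
  proof (rule has_sum_flsI)
    fix K :: nat
    define T where "T = (\<Union>e\<in>{L..int K}. {x \<in> S. fls_nth (h x) e \<noteq> 0})"
    have "finite T" "T \<subseteq> S" unfolding T_def using fin by auto
    moreover have z: "fls_nth (h x) e = 0" if "x \<in> S - T" "e \<le> int K" for x e
      using that assms(1)[of x e] unfolding T_def by (cases "e < L") auto
    moreover have "(\<Sum>x\<in>T. fls_nth (h x) e) = fls_nth X e" if "e \<le> int K" for e
      unfolding X by (rule sum.mono_neutral_cong)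
        (use fin z[OF _ that] \<open>finite T\<close> \<open>T \<subseteq> S\<close> in auto)
    ultimately show "\<exists>T. finite T \<and> T \<subseteq> S \<and> (\<forall>x\<in>S - T. \<forall>e\<le>int K. fls_nth (h x) e = 0) \<and>
             (\<forall>e\<le>int K. (\<Sum>x\<in>T. fls_nth (h x) e) = fls_nth X e)" by blast
  qed
  from infsumI[OF this] X show ?thesis by simp
qed

lemma infsum_fls_nth_superset:
  fixes h :: "'a \<Rightarrow> real fls"
  assumes "\<And>x e. x \<in> S \<Longrightarrow> e < L \<Longrightarrow> fls_nth (h x) e = 0"
    and fin: "\<And>e. finite {x \<in> S. fls_nth (h x) e \<noteq> 0}"
    and "finite T" "T \<subseteq> S" "\<And>x. x \<in> S - T \<Longrightarrow> fls_nth (h x) e = 0"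
  shows "fls_nth (infsum h S) e = (\<Sum>x\<in>T. fls_nth (h x) e)"
proof -
  have "(\<Sum>x\<in>{x \<in> S. fls_nth (h x) e \<noteq> 0}. fls_nth (h x) e) = (\<Sum>x\<in>T. fls_nth (h x) e)"
    by (rule sum.mono_neutral_cong) (use assms in auto)
  then show ?thesis using infsum_fls_nth[of S L h e] assms(1) fin by simp
qed

text \<open>If all terms of \<open>F\<close> have positive weight, then those of its
  \<open>r\<close>-th power have weight at least \<open>r\<close>; up to weight \<open>K\<close>
  only the powers with \<open>r <= K\<close> are visible.\<close>

lemma power_series_weight_eq:
  assumes "weight_ge P 2 1 F"
  shows "weight_eq P (int K) (\<lambda>M. infsum (\<lambda>r. fls_const (c r) * s_power P F r M) S)
           (\<lambda>M. \<Sum>r\<in>S \<inter> {..K}. fls_const (c r) * s_power P F r M)"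
  unfolding weight_eq_iff
proof (intro allI impI)
  fix M e assume M: "admissible P M" "2 * e + int (size M) \<le> int K"
  have nz: "int r \<le> 2 * e + int (size M)" if "fls_nth (s_power P F r M) e \<noteq> 0" for r e
    using weight_ge_power[OF assms, of r] that M(1) unfolding weight_ge_def by force
  have "fls_nth (infsum (\<lambda>r. fls_const (c r) * s_power P F r M) S) e =
    (\<Sum>r\<in>S \<inter> {..K}. fls_nth (fls_const (c r) * s_power P F r M) e)"
  \<comment> \<open>Nonnegative weight, \<open>2 * e + size M >= 0\<close>, forces
    \<open>e >= - size M\<close>.\<close>
  proof (rule infsum_fls_nth_superset[where L = "- int (size M)"])
    fix e
    have "{r \<in> S. fls_nth (fls_const (c r) * s_power P F r M) e \<noteq> 0} \<subseteq> {..nat (2 * e + int (size M))}"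
      using nz[of _ e] by (force simp: le_nat_iff)
    then show "finite {r \<in> S. fls_nth (fls_const (c r) * s_power P F r M) e \<noteq> 0}"
      using finite_subset by blast
  next
    fix r e assume "e < - int (size M)"
    then show "fls_nth (fls_const (c r) * s_power P F r M) e = 0"
      using nz[of r e] by auto
  next
    fix r assume "r \<in> S - S \<inter> {..K}"
    then show "fls_nth (fls_const (c r) * s_power P F r M) e = 0"
      using nz[of r e] M(2) by auto
  qed auto
  then show "fls_nth (infsum (\<lambda>r. fls_const (c r) * s_power P F r M) S) e =
     fls_nth (\<Sum>r\<in>S \<inter> {..K}. fls_const (c r) * s_power P F r M) e"
    by (simp add: fls_nth_sum)
qed

lemma s_exp_weight_eq:
  "weight_ge P 2 1 F \<Longrightarrow>
   weight_eq P (int K) (s_exp P F) (\<lambda>M. \<Sum>r\<le>K. fls_const (1 / fact r) * s_power P F r M)"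
  using power_series_weight_eq[of P F K "\<lambda>r. 1 / fact r" UNIV] by (simp add: s_exp_def[abs_def])

lemma s_log_weight_eq:
  "weight_ge P 2 1 (\<lambda>M. Z M - s_one M) \<Longrightarrow>
   weight_eq P (int K) (s_log P Z)
     (\<lambda>M. \<Sum>r\<in>{1..K}. fls_const ((-1) ^ (r + 1) / real r) * s_power P (\<lambda>M. Z M - s_one M) r M)"
proof -
  have "{1..} \<inter> {..K} = {1..K}" by auto
  then show "weight_ge P 2 1 (\<lambda>M. Z M - s_one M) \<Longrightarrow> ?thesis"
    using power_series_weight_eq[of P "\<lambda>M. Z M - s_one M" K "\<lambda>r. (-1) ^ (r + 1) / real r" "{1..}"]
    by (simp add: s_log_def[abs_def])
qed

lemma s_exp_inadmissible: "\<not> admissible P M \<Longrightarrow> s_exp P F M = 0"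
  unfolding s_exp_def by (simp add: s_power_inadmissible)

lemma weight_eq_trans [trans]: "weight_eq P K F G \<Longrightarrow> weight_eq P K G H \<Longrightarrow> weight_eq P K F H"
  unfolding weight_eq_iff by metis

lemma weight_eq_sym: "weight_eq P K F G \<Longrightarrow> weight_eq P K G F"
  unfolding weight_eq_iff by metis

lemma weight_eq_refl: "(\<And>M. admissible P M \<Longrightarrow> F M = G M) \<Longrightarrow> weight_eq P K F G"
  unfolding weight_eq_iff by simp

lemma weight_eq_scale_sum:
  "(\<And>i. i \<in> I \<Longrightarrow> weight_eq P K (F i) (G i)) \<Longrightarrow>
   weight_eq P K (\<lambda>M. \<Sum>i\<in>I. fls_const (c i) * F i M) (\<lambda>M. \<Sum>i\<in>I. fls_const (c i) * G i M)"
  unfolding weight_eq_iff by (simp add: fls_nth_sum)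

section \<open>The logarithm\<close>

lemma even_series_mult:
  assumes "even_series P F" "even_series P G"
  shows "even_series P (s_mult P F G)"
  unfolding even_series_def
proof (intro allI impI)
  fix M assume M: "admissible P M" "s_mult P F G M \<noteq> 0"
  then obtain A where A: "A \<subseteq># M" "F A \<noteq> 0" "G (M - A) \<noteq> 0"
    unfolding s_mult_eq by (auto elim!: sum.not_neutral_contains_not_neutral)
  obtain B where B: "M = A + B" using submultisetE[OF A(1)] .
  have "even (odd_count P A)" "even (odd_count P B)"
    using A B M admissible_union[of P A B] assms unfolding even_series_def by auto
  then show "even (odd_count P M)" by (simp add: B)
qed

lemma even_series_one: "even_series P s_one"
  by (auto simp: even_series_def s_one_def)

lemma even_series_power: "even_series P F \<Longrightarrow> even_series P (s_power P F r)"
  by (induction r) (auto simp: even_series_mult even_series_one)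

lemma s_deriv_one: "s_deriv s_one M = 0"
  by (simp add: s_deriv_def s_one_def)

lemma s_deriv_sum:
  "s_deriv (\<lambda>M. \<Sum>i\<in>I. fls_const (c i) * F i M) M = (\<Sum>i\<in>I. fls_const (c i) * s_deriv (F i) M)"
  by (rule fls_eqI) (simp add: s_deriv_nth fls_nth_sum sum_distrib_left mult_ac)

lemma weight_ge_deriv: "weight_ge P 2 w F \<Longrightarrow> weight_ge P 2 w (s_deriv F)"
  unfolding weight_ge_def s_deriv_nth by auto

text \<open>The chain rule requires \<open>F\<close> to commute with its derivative; this is where
  evenness enters.\<close>

lemma s_deriv_power:
  assumes "even_series P F" "admissible P M"
  shows "s_deriv (s_power P F (Suc r)) M = of_nat (Suc r) * s_mult P (s_power P F r) (s_deriv F) M"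
  using assms(2)
proof (induction r arbitrary: M)
  case 0
  have "s_mult P F (s_deriv s_one) M = 0" by (simp add: s_mult_eq s_deriv_one)
  then show ?case
    using s_mult_comm[OF even_series_one, of P "s_deriv F" M] by (simp add: s_deriv_mult)
next
  case (Suc r)
  have "s_mult P F (s_deriv (s_power P F (Suc r))) M =
     s_mult P F (\<lambda>M. of_nat (Suc r) * s_mult P (s_power P F r) (s_deriv F) M) M"
    by (rule s_mult_cong) (use Suc.IH in auto)
  also have "\<dots> = of_nat (Suc r) * s_mult P (s_power P F (Suc r)) (s_deriv F) M"
    by (simp only: s_mult_scale_right s_mult_assoc s_power.simps)
  finally have 1: "s_mult P F (s_deriv (s_power P F (Suc r))) M =
    of_nat (Suc r) * s_mult P (s_power P F (Suc r)) (s_deriv F) M" .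
  have 2: "s_mult P (s_deriv F) (s_power P F (Suc r)) M = s_mult P (s_power P F (Suc r)) (s_deriv F) M"
    using s_mult_comm[OF even_series_power[OF assms(1)]] by metis
  show ?case
    unfolding s_power.simps(2)[of P F "Suc r"] s_deriv_mult 1 2 by (simp add: algebra_simps)
qed

text \<open>For \<open>Z = 1 + Y\<close>, the derivative of the logarithm is the geometric series
  for the inverse of \<open>Z\<close> times the derivative of \<open>Z\<close>, hence congruent to
  the derivative of \<open>C\<close>. The derivation is injective on positive weights.\<close>

lemma s_log_unique:
  fixes K :: nat
  assumes Z_even: "even_series P Z"
    and Z: "weight_ge P 2 1 (\<lambda>M. Z M - s_one M)" and C: "weight_ge P 2 1 C"
    and deriv: "weight_eq P (int K) (s_deriv Z) (s_mult P (s_deriv C) Z)"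
  shows "weight_eq P (int K) (s_log P Z) C"
  unfolding weight_eq_iff
proof (intro allI impI)
  fix M e assume M: "admissible P M" and le: "2 * e + int (size M) \<le> int K"
  define Y where "Y = (\<lambda>M. Z M - s_one M)"
  have Zeq: "Z = (\<lambda>M. s_one M + Y M)" by (simp add: Y_def)
  have Y_even: "even_series P Y"
    using Z_even even_series_one unfolding even_series_def Y_def by (metis diff_zero diff_self)
  have Yw: "weight_ge P 2 1 Y" using Z by (simp add: Y_def)
  have Zw: "weight_ge P 2 0 Z" unfolding Zeq by (rule weight_ge_add[OF weight_ge_one weight_ge_mono[OF Yw]]) simp
  \<comment> \<open>\<open>L\<close> truncates the logarithm, and \<open>S\<close> truncates the
    geometric series for the inverse of \<open>Z\<close>.\<close>
  define L where "L = (\<lambda>K M. \<Sum>r\<in>{1..K}. fls_const ((-1) ^ (r + 1) / real r) * s_power P Y r M)"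
  define S where "S = (\<lambda>K M. \<Sum>r<K. fls_const ((-1) ^ r) * s_power P Y r M)"
  have Pw: "weight_ge P 2 (int r) (s_power P Y r)" for r using weight_ge_power[OF Yw, of r] by simp
  have Sw: "weight_ge P 2 0 (S K)" for K
    unfolding S_def by (intro weight_ge_sum weight_ge_const weight_ge_mono[OF Pw]) simp
  \<comment> \<open>The geometric sum telescopes.\<close>
  have SZ: "s_mult P (S K) Z M = s_one M - fls_const ((-1) ^ K) * s_power P Y K M" if "admissible P M" for K M
  proof (induction K)
    case 0
    then show ?case by (simp add: S_def s_mult_eq)
  next
    case (Suc K)
    have "s_mult P (S (Suc K)) Z M = s_mult P (S K) Z M + fls_const ((-1) ^ K) * s_mult P (s_power P Y K) Z M"
      unfolding S_def by (simp add: s_mult_add_left s_mult_scale_left)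
    moreover have "s_mult P (s_power P Y K) Z M = s_power P Y K M + s_power P Y (Suc K) M"
      unfolding Zeq s_mult_add_right s_power_Suc_right using that by (simp add: s_mult_one_right)
    ultimately show ?case using Suc by (simp add: algebra_simps)
  qed
  have DL: "s_deriv (L K) M = s_mult P (S K) (s_deriv Z) M" if "admissible P M" for K M
  proof -
    have "s_deriv (L K) M = (\<Sum>r\<in>{1..K}. fls_const ((-1) ^ (r + 1) / real r) * s_deriv (s_power P Y r) M)"
      unfolding L_def by (rule s_deriv_sum)
    also have "\<dots> = (\<Sum>r<K. fls_const ((-1) ^ r / real (Suc r)) * s_deriv (s_power P Y (Suc r)) M)"
      by (simp add: sum.atLeast1_atMost_eq)
    also have "\<dots> = (\<Sum>r<K. fls_const ((-1) ^ r) * s_mult P (s_power P Y r) (s_deriv Y) M)"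
    proof (rule sum.cong[OF refl])
      fix r
      have "fls_const ((-1) ^ r / real (Suc r)) * (of_nat (Suc r) :: real fls) = fls_const ((-1) ^ r)"
        unfolding fls_of_nat fls_const_mult_const by simp
      then show "fls_const ((-1) ^ r / real (Suc r)) * s_deriv (s_power P Y (Suc r)) M =
        fls_const ((-1) ^ r) * s_mult P (s_power P Y r) (s_deriv Y) M"
        unfolding s_deriv_power[OF Y_even that] by (metis mult.assoc)
    qed
    also have "\<dots> = s_mult P (S K) (s_deriv Y) M"
      unfolding S_def by (rule s_mult_sum_left[symmetric])
    also have "s_deriv Y = s_deriv Z"
      by (rule ext) (simp add: s_deriv_def Y_def s_one_def algebra_simps)
    finally show ?thesis .
  qed
  have key: "weight_eq P (int K) (s_deriv (L K)) (s_deriv C)"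
  proof -
    have "weight_eq P (int K) (s_deriv (L K)) (s_mult P (S K) (s_deriv Z))"
      by (rule weight_eq_refl) (rule DL)
    also have "weight_eq P (int K) (s_mult P (S K) (s_deriv Z)) (s_mult P (S K) (s_mult P (s_deriv C) Z))"
      by (intro weight_eq_mult weight_eq_refl deriv Sw weight_ge_deriv Zw) simp
    also have "weight_eq P (int K) (s_mult P (S K) (s_mult P (s_deriv C) Z)) (s_mult P (\<lambda>M. s_one M - fls_const ((-1) ^ K) * s_power P Y K M) (s_deriv C))"
    proof (rule weight_eq_refl)
      fix M assume M: "admissible P M"
      have "s_mult P (S K) (s_mult P (s_deriv C) Z) M = s_mult P (S K) (s_mult P Z (s_deriv C)) M"
        by (rule s_mult_cong) (use s_mult_comm[OF Z_even] in auto)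
      also have "\<dots> = s_mult P (s_mult P (S K) Z) (s_deriv C) M" by (rule s_mult_assoc[symmetric])
      also have "\<dots> = s_mult P (\<lambda>M. s_one M - fls_const ((-1) ^ K) * s_power P Y K M) (s_deriv C) M"
        by (rule s_mult_cong) (use SZ in auto)
      finally show "s_mult P (S K) (s_mult P (s_deriv C) Z) M =
         s_mult P (\<lambda>M. s_one M - fls_const ((-1) ^ K) * s_power P Y K M) (s_deriv C) M" .
    qed
    also have "weight_eq P (int K) (s_mult P (\<lambda>M. s_one M - fls_const ((-1) ^ K) * s_power P Y K M) (s_deriv C)) (s_deriv C)"
    proof -
      \<comment> \<open>The remainder is invisible: \<open>Y^K\<close> contributes weight at least
        \<open>K\<close>, and the derivative of \<open>C\<close> at least 1.\<close>
      have w: "weight_ge P 2 (int K + 1) (s_mult P (s_power P Y K) (s_deriv C))"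
        by (rule weight_ge_mult[OF Pw weight_ge_deriv[OF C]])
      show ?thesis
        using w unfolding weight_eq_iff s_mult_diff_left s_mult_scale_left weight_ge_def
        by (simp add: s_mult_one_left) (metis add_le_same_cancel1 not_one_le_zero order_trans zle_add1_eq_le linorder_not_le)
    qed
    finally show ?thesis .
  qed
  have "fls_nth (s_log P Z M) e = fls_nth (L K M) e"
    using s_log_weight_eq[OF Z, of K] M le unfolding weight_eq_iff L_def Y_def by blast
  also have "\<dots> = fls_nth (C M) e"
  \<comment> \<open>In weight 0 the derivation carries no information, but neither side has terms of
    weight below 1. In positive weight the eigenvalue can be divided out.\<close>
  proof (cases "2 * e + int (size M) = 0 \<or> 2 * e + int (size M) < 0")
    case True
    have "weight_ge P 2 1 (L K)"
      unfolding L_def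
    proof (intro weight_ge_sum weight_ge_const)
      fix r assume "r \<in> {1..K}"
      then show "weight_ge P 2 1 (s_power P Y r)" by (intro weight_ge_mono[OF Pw]) auto
    qed
    moreover have "\<not> 1 \<le> 2 * e + int (size M)" using True by auto
    ultimately have "fls_nth (L K M) e = 0" "fls_nth (C M) e = 0"
      using M C unfolding weight_ge_def by blast+
    then show ?thesis by simp
  next
    case False
    have "fls_nth (s_deriv (L K) M) e = fls_nth (s_deriv C M) e"
      using key M le unfolding weight_eq_iff by blast
    then show ?thesis using False by (simp add: s_deriv_nth)
  qed
  finally show "fls_nth (s_log P Z M) e = fls_nth (C M) e" .
qed

text \<open>The coefficient of a power at \<open>M\<close> involves only submultisets of
  \<open>M\<close>. So a series may be altered outside the coordinates on \<open>H\<close> without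
  any effect on coefficients on \<open>H\<close>.\<close>

lemma s_power_cong:
  assumes "\<And>A. A \<subseteq># M \<Longrightarrow> F A = G A"
  shows "s_power P F r M = s_power P G r M"
  using assms
proof (induction r arbitrary: M)
  case (Suc r)
  show ?case unfolding s_power.simps
    by (rule s_mult_cong) (use Suc.IH Suc.prems subset_mset.order_trans in blast)
qed simp

section \<open>Gaussian integration of words\<close>

definition admissible_supported :: "(nat \<Rightarrow> bool) \<Rightarrow> series \<Rightarrow> bool" where
  "admissible_supported P F \<longleftrightarrow> (\<forall>M. \<not> admissible P M \<longrightarrow> F M = 0)"

text \<open>The tensor \<open>t g [x\<^sub>1, \<dots>, x\<^sub>j]\<close> stands for the value of \<open>f g\<close> on the basis vectors with
  these indices.\<close>

locale feynman =
  fixes n k m :: nat and par :: "nat \<Rightarrow> bool" and \<epsilon> :: "nat \<Rightarrow> real"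
    and t :: "nat \<Rightarrow> nat list \<Rightarrow> real"
  assumes even_L: "x \<in> {n..<n + k} \<Longrightarrow> \<not> par x"
    and odd_L: "x \<in> {n + k..<n + k + 2 * m} \<Longrightarrow> par x"
    and t_swap: "set (us @ x # y # vs) \<subseteq> {..<n + k + 2 * m} \<Longrightarrow>
      t g (us @ x # y # vs) = swap_sign par x y * t g (us @ y # x # vs)"
    and t_even: "set xs \<subseteq> {..<n + k + 2 * m} \<Longrightarrow> t g xs \<noteq> 0 \<Longrightarrow> even (odd_count par (mset xs))"
    and t_stable: "t g xs \<noteq> 0 \<Longrightarrow> 2 * g + length xs > 2"
begin

abbreviation N :: nat where "N \<equiv> n + k + 2 * m"

abbreviation moment :: "nat multiset \<Rightarrow> real fls" where "moment \<equiv> gauss_moment n k m \<epsilon>"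

abbreviation integral_L :: "series \<Rightarrow> series" where "integral_L \<equiv> gauss_integral n k m \<epsilon>"

end

lemma even_moment_nth: "fls_nth (even_moment e c) i \<noteq> 0 \<Longrightarrow> 2 * i = int c"
proof (induction e c arbitrary: i rule: even_moment.induct)
  case (3 e r)
  have "fls_nth (even_moment e r) (i - 1) \<noteq> 0"
  proof -
    have "fls_const c * fls_X * E = fls_X * (fls_const c * E)" for c :: real and E by (simp only: mult_ac)
    then show ?thesis using 3(2) by (simp add: fls_X_times_conv_shift)
  qed
  from 3(1)[OF this] show ?case by simp
qed (auto split: if_splits)

lemma odd_moment_nth: "fls_nth (odd_moment q r) i \<noteq> 0 \<Longrightarrow> 2 * i = int (q + r)"
  by (auto simp: odd_moment_def split: if_splits)

lemma prod_fls_nth: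
  assumes "finite I" "\<And>x i. x \<in> I \<Longrightarrow> fls_nth (h x :: real fls) i \<noteq> 0 \<Longrightarrow> 2 * i = int (a x)"
    and "fls_nth (\<Prod>x\<in>I. h x) j \<noteq> 0"
  shows "2 * j = int (\<Sum>x\<in>I. a x)"
  using assms
proof (induction I arbitrary: j)
  case empty
  then show ?case by (auto split: if_splits)
next
  case (insert x I)
  hence "fls_nth (h x * (\<Prod>x\<in>I. h x)) j \<noteq> 0" by simp
  then obtain i where "fls_nth (h x) i \<noteq> 0" "fls_nth (\<Prod>x\<in>I. h x) (j - i) \<noteq> 0"
    by (rule fls_nth_mult_nonzero)
  note i = this
  have "2 * (j - i) = int (\<Sum>x\<in>I. a x)" by (rule insert.IH) (use insert.prems i in auto)
  moreover have "2 * i = int (a x)" using insert.prems i by auto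
  ultimately show ?case using insert.hyps by simp
qed

lemma sum_pairs:
  fixes a m :: nat
  shows "(\<Sum>r<m. c (a + 2 * r) + c (a + 2 * r + 1)) = (\<Sum>x\<in>{a..<a + 2 * m}. c x :: nat)"
proof (induction m)
  case (Suc m)
  have "{a..<a + 2 * Suc m} = insert (a + 2 * m + 1) (insert (a + 2 * m) {a..<a + 2 * m})" by auto
  then show ?case using Suc by simp
qed simp

context feynman
begin

text \<open>Each contraction of two coordinates on \<open>L\<close> costs one \<open>hbar\<close>,
  so integration preserves the weight \<open>2e + |M|\<close>.\<close>

lemma moment_nth:
  assumes "set_mset B \<subseteq> {n..<N}" "fls_nth (moment B) j \<noteq> 0"
  shows "2 * j = int (size B)"
proof -
  obtain i where i: "fls_nth (\<Prod>x\<in>{n..<n + k}. even_moment (\<epsilon> x) (count B x)) i \<noteq> 0"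
    "fls_nth (\<Prod>r<m. odd_moment (count B (n + k + 2 * r)) (count B (n + k + 2 * r + 1))) (j - i) \<noteq> 0"
    using assms(2) unfolding gauss_moment_def by (rule fls_nth_mult_nonzero)
  have "2 * i = int (\<Sum>x\<in>{n..<n + k}. count B x)"
    by (rule prod_fls_nth[OF _ _ i(1)]) (auto dest: even_moment_nth)
  moreover have "2 * (j - i) = int (\<Sum>r<m. count B (n + k + 2 * r) + count B (n + k + 2 * r + 1))"
    by (rule prod_fls_nth[OF _ _ i(2)]) (auto dest: odd_moment_nth)
  moreover have "(\<Sum>r<m. count B (n + k + 2 * r) + count B (n + k + 2 * r + 1)) = (\<Sum>x\<in>{n+k..<N}. count B x)"
    using sum_pairs[of "count B" "n + k" m] by simp
  moreover have "(\<Sum>x\<in>{n..<n + k}. count B x) + (\<Sum>x\<in>{n+k..<N}. count B x) = (\<Sum>x\<in>{n..<N}. count B x)"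
    by (rule sum.atLeastLessThan_concat) auto
  moreover have "size B = (\<Sum>x\<in>{n..<N}. count B x)"
    unfolding size_multiset_overloaded_eq by (rule sum.mono_neutral_left) (use assms(1) in \<open>auto simp: not_in_iff\<close>)
  ultimately show ?thesis by (simp del: of_nat_sum)
qed

lemma finite_multisets_bounded: "finite {B :: nat multiset. set_mset B \<subseteq> {n..<N} \<and> size B \<le> K}"
proof (rule finite_subset)
  show "{B. set_mset B \<subseteq> {n..<N} \<and> size B \<le> K} \<subseteq> mset ` {xs. set xs \<subseteq> {n..<N} \<and> length xs \<le> K}"
  proof safe
    fix B :: "nat multiset" assume "set_mset B \<subseteq> {n..<N}" "size B \<le> K"
    moreover obtain xs where "mset xs = B" using ex_mset by blast
    ultimately show "B \<in> mset ` {xs. set xs \<subseteq> {n..<N} \<and> length xs \<le> K}"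
      by (intro image_eqI[of _ _ xs]) auto
  qed
qed (auto intro: finite_lists_length_le)

text \<open>If \<open>i\<close> is the exponent of \<open>hbar\<close> in the integrand, then
  \<open>3 * i + size A + size B >= 0\<close> and \<open>2 * (e - i) = size B\<close> give
  \<open>size B <= 6 * e + 2 * size A\<close>. With 2 in place of 3 the number \<open>size B\<close>
  would cancel; this is the reason for the second weight.\<close>

lemma integral_L_nth:
  assumes F: "weight_ge par 3 0 F" "admissible_supported par F"
  shows "fls_nth (integral_L F A) e =
    (\<Sum>B\<in>{B. set_mset B \<subseteq> {n..<N} \<and> size B \<le> nat (6 * e + 2 * int (size A))}.
        fls_nth (F (A + B) * moment B) e)"
proof -
  have nz: "0 \<le> 6 * e + 2 * int (size A) - int (size B)"
    if B: "set_mset B \<subseteq> {n..<N}" and nz: "fls_nth (F (A + B) * moment B) e \<noteq> 0" for B e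
  proof -
    obtain i where i: "fls_nth (F (A + B)) i \<noteq> 0" "fls_nth (moment B) (e - i) \<noteq> 0"
      using nz by (rule fls_nth_mult_nonzero)
    have "2 * (e - i) = int (size B)" using moment_nth[OF B i(2)] .
    moreover have "0 \<le> 3 * i + int (size (A + B))"
      using F i(1) unfolding weight_ge_def admissible_supported_def by force
    ultimately show ?thesis by simp
  qed
  show ?thesis unfolding gauss_integral_def
  \<comment> \<open>A monomial \<open>B\<close> can satisfy the bound only if
    \<open>6 * e + 2 * size A >= 0\<close>, hence \<open>e >= - size A\<close>.\<close>
  proof (rule infsum_fls_nth_superset[where L = "- int (size A)"])
    fix e
    have "{B \<in> {B. set_mset B \<subseteq> {n..<N}}. fls_nth (F (A + B) * moment B) e \<noteq> 0} \<subseteq>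
      {B. set_mset B \<subseteq> {n..<N} \<and> size B \<le> nat (6 * e + 2 * int (size A))}"
    proof safe
      fix B assume "set_mset B \<subseteq> {n..<N}" "fls_nth (F (A + B) * moment B) e \<noteq> 0"
      from nz[OF this] show "size B \<le> nat (6 * e + 2 * int (size A))" by linarith
    qed
    then show "finite {B \<in> {B. set_mset B \<subseteq> {n..<N}}. fls_nth (F (A + B) * moment B) e \<noteq> 0}"
      using finite_multisets_bounded finite_subset by blast
  next
    fix B e assume *: "B \<in> {B. set_mset B \<subseteq> {n..<N}}" "e < - int (size A)"
    show "fls_nth (F (A + B) * moment B) e = 0"
    proof (rule ccontr)
      assume "fls_nth (F (A + B) * moment B) e \<noteq> 0"
      from nz[OF _ this] * show False by auto
    qed
  next
    fix B assume B: "B \<in> {B. set_mset B \<subseteq> {n..<N}} -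
      {B. set_mset B \<subseteq> {n..<N} \<and> size B \<le> nat (6 * e + 2 * int (size A))}"
    show "fls_nth (F (A + B) * moment B) e = 0"
    proof (rule ccontr)
      assume "fls_nth (F (A + B) * moment B) e \<noteq> 0"
      from nz[OF _ this] B show False by auto
    qed
  qed (auto simp: finite_multisets_bounded)
qed

text \<open>The integral preserves weight, so it respects truncation by weight.\<close>

lemma integral_L_weight_eq:
  assumes "weight_ge par 3 0 F" "admissible_supported par F" "weight_ge par 3 0 G" "admissible_supported par G"
    and "weight_eq par K F G"
  shows "weight_eq par K (integral_L F) (integral_L G)"
  unfolding weight_eq_iff
proof (intro allI impI)
  fix A e assume A: "admissible par A" "2 * e + int (size A) \<le> K"
  show "fls_nth (integral_L F A) e = fls_nth (integral_L G A) e"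
    unfolding integral_L_nth[OF assms(1,2)] integral_L_nth[OF assms(3,4)]
  proof (rule sum.cong[OF refl])
    fix B assume "B \<in> {B. set_mset B \<subseteq> {n..<N} \<and> size B \<le> nat (6 * e + 2 * int (size A))}"
    hence B: "set_mset B \<subseteq> {n..<N}" by simp
    have "fls_nth ((F (A + B) - G (A + B)) * moment B) e = 0"
    proof (rule ccontr)
      assume "fls_nth ((F (A + B) - G (A + B)) * moment B) e \<noteq> 0"
      then obtain i where i: "fls_nth (F (A + B) - G (A + B)) i \<noteq> 0" "fls_nth (moment B) (e - i) \<noteq> 0"
        by (rule fls_nth_mult_nonzero)
      hence "2 * (e - i) = int (size B)" using moment_nth[OF B] by blast
      moreover have "admissible par (A + B)" using i(1) assms(2,4) unfolding admissible_supported_def by (metis diff_self fls_zero_nth)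
      hence "\<not> 2 * i + int (size (A + B)) \<le> K"
        using i(1) assms(5) unfolding weight_eq_iff by (metis eq_iff_diff_eq_0 fls_minus_nth)
      ultimately show False using A(2) by simp
    qed
    then show "fls_nth (F (A + B) * moment B) e = fls_nth (G (A + B) * moment B) e"
      by (simp add: left_diff_distrib)
  qed
qed

text \<open>Only the parts on \<open>L\<close> of the finitely many given words occur as
  \<open>B\<close>. So the infinite sum in the integral is finite and can be exchanged with the sum
  over \<open>I\<close>.\<close>

lemma integral_L_word_sum:
  assumes "finite I" "\<And>i. i \<in> I \<Longrightarrow> set (xs i) \<subseteq> {..<N}" "set_mset A \<subseteq> {..<n}"
  shows "integral_L (\<lambda>M. \<Sum>i\<in>I. c i * s_word par (xs i) M) A =
    (\<Sum>i\<in>I. c i * (if A = filter_mset (\<lambda>x. x < n) (mset (xs i)) \<and> admissible par (mset (xs i))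
       then fls_const (sorting_sign par (xs i)) * moment (filter_mset (\<lambda>x. \<not> x < n) (mset (xs i))) else 0))"
proof -
  let ?B = "\<lambda>i. filter_mset (\<lambda>x. \<not> x < n) (mset (xs i))"
  let ?T = "?B ` I"
  \<comment> \<open>Coordinates on \<open>H\<close> are those with index below \<open>n\<close>;
    hence a word splits in only one way into a part on \<open>H\<close> and a part on
    \<open>L\<close>.\<close>
  have key: "A + B = mset (xs i) \<longleftrightarrow> A = filter_mset (\<lambda>x. x < n) (mset (xs i)) \<and> B = ?B i"
    if B: "set_mset B \<subseteq> {n..<N}" for B i
  proof
    assume *: "A + B = mset (xs i)"
    have 1: "filter_mset (\<lambda>x. x < n) A = A" "filter_mset (\<lambda>x. x < n) B = {#}"
      using assms(3) B by (auto simp: filter_mset_eq_conv filter_mset_eq_mempty_iff)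
    have 2: "filter_mset (\<lambda>x. \<not> x < n) A = {#}" "filter_mset (\<lambda>x. \<not> x < n) B = B"
      using assms(3) B by (auto simp: filter_mset_eq_conv filter_mset_eq_mempty_iff)
    show "A = filter_mset (\<lambda>x. x < n) (mset (xs i)) \<and> B = ?B i"
      unfolding *[symmetric] filter_union_mset 1 2 by simp
  qed (simp add: multiset_partition[symmetric])
  have "integral_L (\<lambda>M. \<Sum>i\<in>I. c i * s_word par (xs i) M) A =
    infsum (\<lambda>B. (\<Sum>i\<in>I. c i * s_word par (xs i) (A + B)) * moment B) ?T"
    unfolding gauss_integral_def
  proof (rule infsum_cong_neutral)
    fix B assume "B \<in> ?T - {B. set_mset B \<subseteq> {n..<N}}"
    then show "(\<Sum>i\<in>I. c i * s_word par (xs i) (A + B)) * moment B = 0"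
      using assms(2) by fastforce
  next
    fix B assume B: "B \<in> {B. set_mset B \<subseteq> {n..<N}} - ?T"
    have "s_word par (xs i) (A + B) = 0" if "i \<in> I" for i
      using key[of B i] B that by (auto simp: s_word_eq)
    then show "(\<Sum>i\<in>I. c i * s_word par (xs i) (A + B)) * moment B = 0" by simp
  qed auto
  also have "\<dots> = (\<Sum>B\<in>?T. (\<Sum>i\<in>I. c i * s_word par (xs i) (A + B)) * moment B)"
    by (rule infsum_finite) (use assms(1) in simp)
  also have "\<dots> = (\<Sum>i\<in>I. \<Sum>B\<in>?T. c i * s_word par (xs i) (A + B) * moment B)"
    unfolding sum_distrib_right by (rule sum.swap)
  also have "\<dots> = (\<Sum>i\<in>I. c i * (if A = filter_mset (\<lambda>x. x < n) (mset (xs i)) \<and> admissible par (mset (xs i))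
       then fls_const (sorting_sign par (xs i)) * moment (?B i) else 0))"
  proof (rule sum.cong[OF refl])
    fix i assume i: "i \<in> I"
    have "(\<Sum>B\<in>?T. c i * s_word par (xs i) (A + B) * moment B) =
      (\<Sum>B\<in>?T. if B = ?B i then c i * (if A = filter_mset (\<lambda>x. x < n) (mset (xs i)) \<and> admissible par (mset (xs i))
       then fls_const (sorting_sign par (xs i)) * moment (?B i) else 0) else 0)"
    proof (rule sum.cong[OF refl])
      fix B assume "B \<in> ?T"
      hence "set_mset B \<subseteq> {n..<N}" using assms(2) by fastforce
      note K = key[OF this, of i]
      show "c i * s_word par (xs i) (A + B) * moment B =
        (if B = ?B i then c i * (if A = filter_mset (\<lambda>x. x < n) (mset (xs i)) \<and> admissible par (mset (xs i))
         then fls_const (sorting_sign par (xs i)) * moment (?B i) else 0) else 0)"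
        using K by (auto simp: s_word_eq)
    qed
    also have "\<dots> = c i * (if A = filter_mset (\<lambda>x. x < n) (mset (xs i)) \<and> admissible par (mset (xs i))
       then fls_const (sorting_sign par (xs i)) * moment (?B i) else 0)"
      using i assms(1) by (subst sum.delta) auto
    finally show "(\<Sum>B\<in>?T. c i * s_word par (xs i) (A + B) * moment B) = \<dots>" .
  qed
  finally show ?thesis .
qed

lemma integral_L_word:
  assumes "set xs \<subseteq> {..<N}" "set_mset A \<subseteq> {..<n}"
  shows "integral_L (s_word par xs) A =
    (if A = filter_mset (\<lambda>x. x < n) (mset xs) \<and> admissible par (mset xs)
       then fls_const (sorting_sign par xs) * moment (filter_mset (\<lambda>x. \<not> x < n) (mset xs)) else 0)"
  using integral_L_word_sum[of "{()}" "\<lambda>_. xs" A "\<lambda>_. 1"] assms by simp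

lemma integral_L_sum:
  assumes "finite I" "\<And>i. i \<in> I \<Longrightarrow> set (xs i) \<subseteq> {..<N}" "set_mset A \<subseteq> {..<n}"
  shows "integral_L (\<lambda>M. \<Sum>i\<in>I. c i * s_word par (xs i) M) A =
    (\<Sum>i\<in>I. c i * integral_L (s_word par (xs i)) A)"
proof -
  have "integral_L (s_word par (xs i)) A =
    (if A = filter_mset (\<lambda>x. x < n) (mset (xs i)) \<and> admissible par (mset (xs i))
       then fls_const (sorting_sign par (xs i)) * moment (filter_mset (\<lambda>x. \<not> x < n) (mset (xs i))) else 0)"
    if "i \<in> I" for i by (rule integral_L_word) (use assms that in auto)
  then show ?thesis using integral_L_word_sum[of I xs A c] assms by simp
qed

section \<open>Wick's theorem\<close>

definition sinv :: "nat \<Rightarrow> nat \<Rightarrow> real" where "sinv = sigma_inv n k m \<epsilon>"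

lemma sinv_even: "z \<in> {n..<n + k} \<Longrightarrow> sinv z y = (if y = z then \<epsilon> z else 0)"
  unfolding sinv_def sigma_inv_def by auto

lemma sinv_odd_left: "r < m \<Longrightarrow> sinv (n + k + 2 * r) y = (if y = n + k + 2 * r + 1 then 2 else 0)"
  unfolding sinv_def sigma_inv_def by (auto; presburger)

lemma sinv_odd_right: "r < m \<Longrightarrow> sinv (n + k + 2 * r + 1) y = (if y = n + k + 2 * r then -2 else 0)"
  unfolding sinv_def sigma_inv_def by (auto; presburger)

lemma L_cases:
  assumes "z \<in> {n..<N}"
  obtains "z \<in> {n..<n + k}" | r where "r < m" "z = n + k + 2 * r" | r where "r < m" "z = n + k + 2 * r + 1"
proof (cases "z < n + k")
  case False
  define r where "r = (z - (n + k)) div 2"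
  have "r < m" "z = n + k + 2 * r \<or> z = n + k + 2 * r + 1" using False assms unfolding r_def by auto
  then show ?thesis using that by blast
qed (use assms that in auto)

lemma even_moment_Suc: "even_moment e (Suc c) = (if c = 0 then 0 else fls_const (e * real c) * fls_X * even_moment e (c - 1))"
  by (cases c) auto

text \<open>Integration by parts: the extra factor \<open>z\<close> is contracted in turn with every
  occurrence of \<open>z\<close> in \<open>B\<close>.\<close>

lemma moment_even:
  assumes z: "z \<in> {n..<n + k}"
  shows "moment (add_mset z B) = of_nat (count B z) * (fls_const (\<epsilon> z) * fls_X * moment (B - {#z#}))"
proof -
  have split: "(\<Prod>x\<in>{n..<n + k}. even_moment (\<epsilon> x) (count C x)) =
    even_moment (\<epsilon> z) (count C z) * (\<Prod>x\<in>{n..<n + k} - {z}. even_moment (\<epsilon> x) (count B x))"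
    if "\<And>x. x \<noteq> z \<Longrightarrow> count C x = count B x" for C
    using z that by (subst prod.remove[of _ z]) (auto intro!: prod.cong)
  have odd: "(\<Prod>r<m. odd_moment (count C (n + k + 2 * r)) (count C (n + k + 2 * r + 1))) =
     (\<Prod>r<m. odd_moment (count B (n + k + 2 * r)) (count B (n + k + 2 * r + 1)))"
    if "\<And>x. x \<noteq> z \<Longrightarrow> count C x = count B x" for C
  proof (rule prod.cong[OF refl])
    fix r
    have "n + k + 2 * r \<noteq> z" "n + k + 2 * r + 1 \<noteq> z" using z by auto
    then show "odd_moment (count C (n + k + 2 * r)) (count C (n + k + 2 * r + 1)) =
      odd_moment (count B (n + k + 2 * r)) (count B (n + k + 2 * r + 1))" using that by simp
  qed
  show ?thesis
    unfolding gauss_moment_def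
    by (subst (1 2) split, simp, simp, subst (1 2) odd, simp, simp)
       (simp add: even_moment_Suc fls_of_nat mult_ac flip: fls_const_mult_const)
qed

text \<open>The equation of sets leaves open which coordinate is the first of the pair. Moments
  depend only on multisets; the sign of the order is carried by \<open>sorting_sign\<close>.\<close>

lemma moment_odd:
  assumes "r < m" "{a, b} = {n + k + 2 * r, n + k + 2 * r + 1}"
  shows "a \<notin># B \<Longrightarrow> b \<notin># B \<Longrightarrow> moment (add_mset a (add_mset b B)) = fls_const 2 * fls_X * moment B"
    and "a \<in># B \<Longrightarrow> b \<notin># B \<Longrightarrow> moment B = 0"
proof -
  let ?o = "\<lambda>C r. odd_moment (count C (n + k + 2 * r)) (count C (n + k + 2 * r + 1))"
  have ab: "a \<ge> n + k" "b \<ge> n + k" using assms by (auto simp: doubleton_eq_iff)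
  have split: "(\<Prod>r<m. ?o C r) = ?o C r * (\<Prod>r'\<in>{..<m} - {r}. ?o C r')" for C
    using assms(1) by (subst prod.remove[of _ r]) auto
  show "moment (add_mset a (add_mset b B)) = fls_const 2 * fls_X * moment B" if "a \<notin># B" "b \<notin># B"
  proof -
    let ?C = "add_mset a (add_mset b B)"
    have "(\<Prod>x\<in>{n..<n + k}. even_moment (\<epsilon> x) (count ?C x)) = (\<Prod>x\<in>{n..<n + k}. even_moment (\<epsilon> x) (count B x))"
      using ab by (intro prod.cong) auto
    moreover have "(\<Prod>r'\<in>{..<m} - {r}. ?o ?C r') = (\<Prod>r'\<in>{..<m} - {r}. ?o B r')"
    proof (rule prod.cong[OF refl])
      fix r' assume "r' \<in> {..<m} - {r}"
      hence "n + k + 2 * r' \<notin> {a, b}" "n + k + 2 * r' + 1 \<notin> {a, b}" unfolding assms(2) by (auto; presburger)+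
      then show "?o ?C r' = ?o B r'" by simp
    qed
    moreover have "?o ?C r = fls_const 2 * fls_X" "?o B r = 1"
      using that assms(2) by (auto simp: odd_moment_def doubleton_eq_iff not_in_iff)
    ultimately show ?thesis unfolding gauss_moment_def split by (simp add: mult_ac)
  qed
  show "moment B = 0" if "a \<in># B" "b \<notin># B"
  proof -
    have "?o B r = 0" using that assms(2) by (auto simp: odd_moment_def doubleton_eq_iff not_in_iff)
    then show ?thesis unfolding gauss_moment_def split by simp
  qed
qed

end

text \<open>Runs through the possible partners of a letter, one occurrence at a time. The
  accumulated prefix is what the partner has to be moved across, so it determines the sign.\<close>

fun contract :: "('a list \<Rightarrow> 'a \<Rightarrow> 'a list \<Rightarrow> 'b::comm_monoid_add) \<Rightarrow> 'a list \<Rightarrow> 'a list \<Rightarrow> 'b" where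
  "contract h pre [] = 0"
| "contract h pre (x # xs) = h pre x xs + contract h (pre @ [x]) xs"

lemma contract_append: "contract h pre (xs @ ys) = contract (\<lambda>u x v. h u x (v @ ys)) pre xs + contract h (pre @ xs) ys"
  by (induction xs arbitrary: pre) (auto simp: add.assoc)

lemma contract_zero: "(\<And>u x v. x \<in> set xs \<Longrightarrow> h u x v = 0) \<Longrightarrow> contract h pre xs = 0"
  by (induction xs arbitrary: pre) auto

lemma contract_map: "contract h (map l pre) (map l xs) = contract (\<lambda>u x v. h (map l u) (l x) (map l v)) pre xs"
proof (induction xs arbitrary: pre)
  case (Cons x xs)
  from Cons[of "pre @ [x]"] show ?case by simp
qed simp

lemma contract_eq_sum:
  assumes "distinct xs" "\<And>u x v. pre @ xs = u @ x # v \<Longrightarrow> x \<in> set xs \<Longrightarrow> h u x v = H x"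
  shows "contract h pre xs = sum H (set xs)"
  using assms
proof (induction xs arbitrary: pre)
  case (Cons x xs)
  have "h pre x xs = H x" using Cons.prems(2)[of pre x xs] by simp
  moreover have "contract h (pre @ [x]) xs = sum H (set xs)"
    by (rule Cons.IH) (use Cons.prems in auto)
  ultimately show ?case using Cons.prems(1) by simp
qed simp

lemma contract_eq_count:
  fixes V :: "'b::semiring_1"
  assumes "\<And>u x v. pre @ xs = u @ x # v \<Longrightarrow> h u x v = (if x = z then V else 0)"
  shows "contract h pre xs = of_nat (count (mset xs) z) * V"
  using assms
proof (induction xs arbitrary: pre)
  case (Cons x xs)
  have "h pre x xs = (if x = z then V else 0)" using Cons.prems[of pre x xs] by simp
  moreover have "contract h (pre @ [x]) xs = of_nat (count (mset xs) z) * V"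
    by (rule Cons.IH) (use Cons.prems in auto)
  ultimately show ?case by (auto simp: algebra_simps)
qed simp

section \<open>Contraction of the first letter of a word\<close>

context feynman
begin

text \<open>The value of the Gaussian integral of a word according to
  \<open>integral_L_word\<close>, made a definition because it involves no infinite sum.\<close>

definition word_integral :: "nat list \<Rightarrow> series" where
  "word_integral xs A = (if A = filter_mset (\<lambda>x. x < n) (mset xs) \<and> admissible par (mset xs)
       then fls_const (sorting_sign par xs) * moment (filter_mset (\<lambda>x. \<not> x < n) (mset xs)) else 0)"

text \<open>A coordinate on \<open>H\<close> is a constant for the integral. Its index is below all
  those on \<open>L\<close>, so sorting it creates no sign with the part on
  \<open>L\<close>.\<close>

lemma word_integral_H:
  assumes "x < n" "set xs \<subseteq> {..<N}"
  shows "word_integral (x # xs) A = (if x \<in># A \<and> admissible par A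
     then fls_const (cross_sign par {#x#} (A - {#x#})) * word_integral xs (A - {#x#}) else 0)"
proof (cases "x \<in># A \<and> A - {#x#} = filter_mset (\<lambda>x. x < n) (mset xs)")
  case True
  let ?A = "filter_mset (\<lambda>x. x < n) (mset xs)" and ?B = "filter_mset (\<lambda>x. \<not> x < n) (mset xs)"
  have A: "A = add_mset x ?A" using True by (metis insert_DiffM)
  have xs: "mset xs = ?A + ?B" by (rule multiset_partition)
  have "x \<notin># ?B" using assms(1) by auto
  hence cnt: "count (mset xs) x = count ?A x" using assms(1) by simp
  have admissible: "admissible par (add_mset x (mset xs)) \<longleftrightarrow> admissible par A \<and> admissible par (mset xs)"
  proof
    assume *: "admissible par (add_mset x (mset xs))"
    have "A \<subseteq># add_mset x (mset xs)" "mset xs \<subseteq># add_mset x (mset xs)" unfolding A by (simp_all add: subset_mset.add_increasing2)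
    then show "admissible par A \<and> admissible par (mset xs)" using admissible_mono[OF *] by blast
  next
    assume *: "admissible par A \<and> admissible par (mset xs)"
    show "admissible par (add_mset x (mset xs))"
      unfolding admissible_def
    proof (intro allI impI)
      fix y assume "par y"
      then show "count (add_mset x (mset xs)) y \<le> 1"
        using * cnt unfolding admissible_def A by (cases "y = x") auto
    qed
  qed
  have "cross_sign par {#x#} ?B = 1"
    unfolding cross_sign_def using assms(1) by (auto intro!: prod_mset.neutral simp: inversion_sign_def)
  hence "cross_sign par {#x#} (mset xs) = cross_sign par {#x#} ?A"
    by (metis cross_sign_union(2) mult_1_right xs)
  then show ?thesis using True A admissible assms(1) by (auto simp: word_integral_def simp flip: fls_const_mult_const)
next
  case False
  have "A \<noteq> filter_mset (\<lambda>x. x < n) (mset (x # xs))" using False assms(1) by auto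
  then show ?thesis using False by (auto simp: word_integral_def)
qed

lemma sorting_sign_move_front:
  assumes "par y \<Longrightarrow> y \<notin> set us"
  shows "sorting_sign par (us @ y # vs) = (if par y then (-1) ^ odd_count par (mset us) else 1) * sorting_sign par (y # us @ vs)"
proof -
  have "cross_sign par (mset us) {#y#} = (-1) ^ (odd_count par (mset us) * odd_count par {#y#}) * cross_sign par {#y#} (mset us)"
    by (rule cross_sign_swap) (use assms in auto)
  then show ?thesis
    by (auto simp: sorting_sign_append cross_sign_union cross_sign_add_mset(2)[of par "mset us" y "mset vs"])
qed

text \<open>The indices of an odd pair are consecutive, so any other letter lies on the same side of
  both, and the signs for moving the pair across it cancel. The inverse form is 2 or -2 according to
  the order of the pair.\<close>

lemma partner_signs:
  assumes "r < m" "{z, y} = {n + k + 2 * r, n + k + 2 * r + 1}" "z \<notin># X" "y \<notin># X"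
  shows "cross_sign par {#z#} X * cross_sign par {#y#} X = 1" "sinv z y = 2 * inversion_sign par z y" "z \<noteq> y" "par z" "par y"
    "\<not> z < n" "\<not> y < n" "\<And>x. sinv z x \<noteq> 0 \<Longrightarrow> x = y"
proof -
  have zy: "(z = n + k + 2 * r \<and> y = n + k + 2 * r + 1) \<or> (y = n + k + 2 * r \<and> z = n + k + 2 * r + 1)"
    using assms(2) by (auto simp: doubleton_eq_iff)
  show p: "par z" "par y" using odd_L zy assms(1) by auto
  show "z \<noteq> y" "\<not> z < n" "\<not> y < n" using zy by auto
  have "cross_sign par {#z#} X = cross_sign par {#y#} X"
  proof -
    have "inversion_sign par z x = inversion_sign par y x" if "x \<in># X" for x
    proof -
      have "x \<noteq> z" "x \<noteq> y" using that assms(3,4) by auto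
      hence "(x < z) = (x < y)" using zy by auto
      then show ?thesis using p by (simp add: inversion_sign_def)
    qed
    then show ?thesis unfolding cross_sign_def by (auto intro!: arg_cong[where f = prod_mset] image_mset_cong)
  qed
  then show "cross_sign par {#z#} X * cross_sign par {#y#} X = 1" using cross_sign_square by metis
  show "sinv z y = 2 * inversion_sign par z y"
    using zy p sinv_odd_left[OF assms(1)] sinv_odd_right[OF assms(1)] by (auto simp: inversion_sign_def)
  show "x = y" if "sinv z x \<noteq> 0" for x
    using zy that sinv_odd_left[OF assms(1), of x] sinv_odd_right[OF assms(1), of x] by (auto split: if_splits)
qed

text \<open>The sign is that of moving \<open>y\<close> across \<open>u\<close>, next to the leading
  letter \<open>z\<close>.\<close>

definition contraction :: "nat \<Rightarrow> nat multiset \<Rightarrow> nat list \<Rightarrow> nat \<Rightarrow> nat list \<Rightarrow> real fls" where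
  "contraction z A u y v =
     fls_const (sinv z y * (if par y then (-1) ^ odd_count par (mset u) else 1)) * fls_X * word_integral (u @ v) A"

lemma word_integral_even:
  assumes z: "z \<in> {n..<n + k}"
  shows "word_integral (z # ys) A = contract (contraction z A) [] ys"
proof -
  let ?Y = "mset ys"
  let ?B = "filter_mset (\<lambda>x. \<not> x < n) ?Y"
  have pz: "\<not> par z" using even_L z by blast
  \<comment> \<open>Every occurrence of \<open>z\<close> contributes this same value, and their
    number is the factor in \<open>moment_even\<close>.\<close>
  define V where "V = (if A = filter_mset (\<lambda>x. x < n) ?Y \<and> admissible par ?Y
     then fls_const (\<epsilon> z) * fls_X * (fls_const (sorting_sign par ys) * moment (?B - {#z#})) else 0)"
  have "contract (contraction z A) [] ys = of_nat (count ?Y z) * V"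
  proof (rule contract_eq_count)
    fix u x v assume ys: "[] @ ys = u @ x # v"
    show "contraction z A u x v = (if x = z then V else 0)"
    proof (cases "x = z")
      case True
      have "sorting_sign par (u @ z # v) = sorting_sign par (u @ v)"
        using sorting_sign_move_front[of z u v] pz by (simp add: cross_sign_single_left_even)
      moreover have "admissible par (add_mset z M) = admissible par M" for M
        using pz by (auto simp: admissible_def)
      ultimately show ?thesis
        using ys True z pz by (simp add: contraction_def V_def word_integral_def sinv_even mult_ac)
    qed (use z in \<open>simp add: contraction_def sinv_even\<close>)
  qed
  moreover have "word_integral (z # ys) A = of_nat (count ?Y z) * V"
  proof -
    have "admissible par (add_mset z ?Y) = admissible par ?Y"
      using pz by (auto simp: admissible_def)
    then show ?thesis
      using z by (simp add: word_integral_def V_def moment_even[OF z] cross_sign_single_left_even[of par z, OF pz] mult_ac)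
  qed
  ultimately show ?thesis by simp
qed

text \<open>Only occurrences of the partner \<open>y\<close> can be contracted with
  \<open>z\<close>. If there is none, both sides vanish; a single one gives the moment of the pair.
  With two, the word on the left is zero and the two contractions cancel. With three or more, every
  contraction leaves a repeated odd letter.\<close>

lemma word_integral_odd:
  assumes r: "r < m" and zy: "{z, y} = {n + k + 2 * r, n + k + 2 * r + 1}"
  shows "word_integral (z # ys) A = contract (contraction z A) [] ys"
proof -
  let ?h = "contraction z A"
  note S = partner_signs(2-8)[where X = "{#}", OF r zy, simplified]
  have yz: "{y, z} = {n + k + 2 * r, n + k + 2 * r + 1}" using zy by (simp add: insert_commute)
  have zero: "?h u x v = 0" if "x \<noteq> y" for u x v using S(7)[of x] that by (auto simp: contraction_def)
  have Czero: "contract ?h pre xs = 0" if "y \<notin> set xs" for pre xs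
    by (rule contract_zero) (use zero that in metis)
  have Czero': "contract (\<lambda>u x v. ?h u x (v @ ws)) pre xs = 0" if "y \<notin> set xs" for pre xs ws
    by (rule contract_zero) (use zero that in metis)
  show ?thesis
  proof (cases "y \<in> set ys")
    case False
    hence "moment (add_mset z (filter_mset (\<lambda>x. \<not> x < n) (mset ys))) = 0"
      using S(2) by (intro moment_odd(2)[OF r zy]) auto
    hence "word_integral (z # ys) A = 0" using False S by (simp add: word_integral_def)
    then show ?thesis using Czero[OF False] by simp
  next
    case True
    then obtain us xs where ys: "ys = us @ y # xs" "y \<notin> set us" using split_list_first[OF True] by blast
    have L: "contract ?h [] ys = ?h us y xs + contract ?h (us @ [y]) xs"
      using ys by (simp add: contract_append Czero')
    show ?thesis
    proof (cases "y \<in> set xs")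
      case False
      hence L: "contract ?h [] ys = ?h us y xs" using L by (simp add: Czero)
      show ?thesis
      \<comment> \<open>If the rest is inadmissible or contains another \<open>z\<close>, the word
        on the left is zero. On the right the integral of the rest vanishes, in the second case
        because that \<open>z\<close> has no partner.\<close>
      proof (cases "admissible par (mset (us @ xs)) \<and> z \<notin> set (us @ xs)")
        case False
        have "\<not> admissible par (mset (z # ys))"
        proof
          assume *: "admissible par (mset (z # ys))"
          have "mset (z # ys) = mset (us @ xs) + {#z, y#}" using ys by simp
          hence "admissible par (mset (us @ xs))" using * admissible_union by metis
          moreover have "count (mset (z # ys)) z \<le> 1" using * S(3) unfolding admissible_def by blast
          hence "z \<notin> set ys" by simp
          ultimately show False using False ys by auto
        qed
        moreover have "moment (filter_mset (\<lambda>x. \<not> x < n) (mset (us @ xs))) = 0" if "z \<in> set (us @ xs)"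
          using that \<open>y \<notin> set us\<close> \<open>y \<notin> set xs\<close> S(5) by (intro moment_odd(2)[OF r zy]) auto
        ultimately show ?thesis using False unfolding L contraction_def word_integral_def by auto
      next
        case admissible: True
        let ?X = "mset (us @ xs)" and ?B = "filter_mset (\<lambda>x. \<not> x < n) (mset (us @ xs))"
        have y: "y \<notin># ?X" and z: "z \<notin># ?X" using ys \<open>y \<notin> set xs\<close> admissible by auto
        have a: "admissible par (mset (z # ys))"
          using admissible y z S(2) unfolding admissible_def ys by (auto simp: not_in_iff)
        have m: "moment (add_mset z (add_mset y ?B)) = fls_const 2 * fls_X * moment ?B"
          by (rule moment_odd(1)[OF r zy]) (use y z in auto)
        have f: "filter_mset (\<lambda>x. \<not> x < n) (mset (z # ys)) = add_mset z (add_mset y ?B)"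
          "filter_mset (\<lambda>x. x < n) (mset (z # ys)) = filter_mset (\<lambda>x. x < n) ?X"
          using ys S(5,6) by auto
        \<comment> \<open>The signs of moving \<open>z\<close> and \<open>y\<close> across the rest
          cancel. There remain the inversion sign between the two and the sign of moving
          \<open>y\<close> across \<open>us\<close>.\<close>
        have "sorting_sign par (z # ys) = cross_sign par {#z#} (add_mset y ?X) * ((-1) ^ odd_count par (mset us) * (cross_sign par {#y#} ?X * sorting_sign par (us @ xs)))"
          using sorting_sign_move_front[of y us xs] ys S(4) by (simp add: cross_sign_union)
        also have "\<dots> = inversion_sign par z y * (-1) ^ odd_count par (mset us) * (cross_sign par {#z#} ?X * cross_sign par {#y#} ?X) * sorting_sign par (us @ xs)"
          by (simp only: cross_sign_add_mset(2)[of par "{#z#}" y ?X] cross_sign_single mult_ac)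
        also have "\<dots> = inversion_sign par z y * (-1) ^ odd_count par (mset us) * sorting_sign par (us @ xs)"
          by (simp only: partner_signs(1)[OF r zy z y] mult_1_right)
        finally have s: "sorting_sign par (z # ys) = inversion_sign par z y * (-1) ^ odd_count par (mset us) * sorting_sign par (us @ xs)" .
        show ?thesis
          unfolding L contraction_def word_integral_def f m s using a admissible S(1,4)
          by (simp add: mult_ac flip: fls_const_mult_const)
      qed
    next
      case True
      then obtain vs ws where xs: "xs = vs @ y # ws" "y \<notin> set vs" using split_list_first[OF True] by blast
      have na: "\<not> admissible par (mset (z # ys))"
        using S(4) ys xs unfolding admissible_def by (auto intro!: exI[of _ y])
      have L: "contract ?h [] ys = ?h us y (vs @ y # ws) + ?h (us @ y # vs) y ws + contract ?h (us @ y # vs @ [y]) ws"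
        using L xs by (simp add: contract_append Czero' add.assoc)
      show ?thesis
      proof (cases "y \<in> set ws")
        case False
        \<comment> \<open>The words left after removing the first or the second \<open>y\<close>
          differ by the sign of moving \<open>y\<close> across \<open>vs\<close>. The second
          contraction has this sign too, and a further minus sign from the odd letter
          \<open>y\<close> in its prefix; so the two cancel.\<close>
        have "sorting_sign par (us @ vs @ y # ws) = (-1) ^ odd_count par (mset vs) * sorting_sign par (us @ y # vs @ ws)"
          using sorting_sign_move_front[of y vs ws] xs(2) S(4) sorting_sign_append[of par us "vs @ y # ws"] sorting_sign_append[of par us "y # vs @ ws"]
          by (simp add: ac_simps)
        hence "word_integral (us @ vs @ y # ws) A = fls_const ((-1) ^ odd_count par (mset vs)) * word_integral ((us @ y # vs) @ ws) A"
          by (simp add: word_integral_def mult_ac flip: fls_const_mult_const)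
        then show ?thesis
          using na S(4) unfolding L Czero[OF False] contraction_def by (simp add: word_integral_def[of "z # ys"] power_add mult_ac flip: fls_const_mult_const)
      next
        case True
        \<comment> \<open>Of at least three copies of \<open>y\<close>, two remain after a
          contraction.\<close>
        have "\<not> admissible par (mset (u @ v))" if "mset (u @ v) = mset us + mset vs + add_mset y (mset ws)" for u v
          using True S(4) unfolding that admissible_def by (auto intro!: exI[of _ y])
        hence z1: "word_integral (u @ v) A = 0" if "mset (u @ v) = mset us + mset vs + add_mset y (mset ws)" for u v
          using that by (simp add: word_integral_def)
        have z2: "contract ?h (us @ y # vs @ [y]) ws = 0"
        proof -
          have "?h u x v = 0" if "us @ y # vs @ [y] @ ws = u @ x # v" for u x v
          proof (cases "x = y")
            case True
            have "mset (us @ y # vs @ [y] @ ws) = mset (u @ x # v)" using that by simp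
            hence "mset (u @ v) = mset us + mset vs + add_mset y (mset ws)" using True by (simp add: add.assoc)
            then show ?thesis by (simp add: contraction_def z1 del: mset_append)
          qed (use zero in blast)
          then show ?thesis
            using contract_eq_count[of "us @ y # vs @ [y]" ws ?h y 0] by simp
        qed
        show ?thesis unfolding L z2 using na by (simp add: contraction_def word_integral_def[of "z # ys"] z1)
      qed
    qed
  qed
qed

lemma word_integral_L:
  assumes "z \<in> {n..<N}"
  shows "word_integral (z # ys) A = contract (contraction z A) [] ys"
  using assms
proof (cases rule: L_cases)
  case 1
  then show ?thesis by (rule word_integral_even)
next
  case (2 r)
  then show ?thesis by (intro word_integral_odd[of r z "z + 1"]) auto
next
  case (3 r)
  then show ?thesis by (intro word_integral_odd[of r z "z - 1"]) auto
qed


end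

section \<open>Involutions of a set of positions\<close>

lemma mset_sorted_set: "finite A \<Longrightarrow> mset (sorted_list_of_set A) = mset_set A"
  using mset_set_set[of "sorted_list_of_set A"] by simp

text \<open>Being the identity outside \<open>J\<close> makes an involution of \<open>J\<close> a
  unique function, so that sums over involutions of a finite set are finite.\<close>

definition involutions :: "'a set \<Rightarrow> ('a \<Rightarrow> 'a) set" where
  "involutions J = {\<tau>. (\<forall>x. x \<notin> J \<longrightarrow> \<tau> x = x) \<and> (\<forall>x\<in>J. \<tau> x \<in> J \<and> \<tau> (\<tau> x) = x)}"

lemma finite_involutions: "finite J \<Longrightarrow> finite (involutions J)"
proof (rule finite_subset)
  show "involutions J \<subseteq> {\<tau>. \<tau> permutes J}"
  proof
    fix \<tau> assume \<tau>: "\<tau> \<in> involutions J"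
    have inv: "\<tau> (\<tau> x) = x" for x using \<tau> unfolding involutions_def by (cases "x \<in> J") auto
    have "bij_betw \<tau> J J"
      by (rule bij_betw_byWitness[where f' = \<tau>]) (use \<tau> in \<open>auto simp: involutions_def\<close>)
    then show "\<tau> \<in> {\<tau>. \<tau> permutes J}"
      using \<tau> by (auto intro!: bij_imp_permutes simp: involutions_def)
  qed
qed (rule finite_permutations)

definition edge_set :: "('a::linorder \<Rightarrow> 'a) \<Rightarrow> 'a set \<Rightarrow> 'a set" where
  "edge_set \<tau> J = {x \<in> J. x < \<tau> x}"

definition leg_set :: "('a::linorder \<Rightarrow> 'a) \<Rightarrow> 'a set \<Rightarrow> 'a set" where
  "leg_set \<tau> J = {x \<in> J. \<tau> x = x}"

definition edge_list :: "('a::linorder \<Rightarrow> 'a) \<Rightarrow> 'a set \<Rightarrow> 'a list" where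
  "edge_list \<tau> J = concat (map (\<lambda>x. [x, \<tau> x]) (sorted_list_of_set (edge_set \<tau> J)))"

lemma mset_concat_pairs: "mset (concat (map (\<lambda>x. [x, \<tau> x]) xs)) = mset xs + image_mset \<tau> (mset xs)"
  by (induction xs) auto

lemma mset_edge_list:
  assumes "finite J" "\<tau> \<in> involutions J"
  shows "mset (edge_list \<tau> J @ sorted_list_of_set (leg_set \<tau> J)) = mset_set J"
proof -
  let ?E = "edge_set \<tau> J"
  have inv: "\<tau> (\<tau> x) = x" for x using assms(2) unfolding involutions_def by (cases "x \<in> J") auto
  have fin: "finite ?E" "finite (leg_set \<tau> J)" using assms(1) by (auto simp: edge_set_def leg_set_def)
  have "inj_on \<tau> ?E" by (rule inj_on_inverseI[of _ \<tau>]) (simp add: inv)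
  hence "mset (edge_list \<tau> J) = mset_set ?E + mset_set (\<tau> ` ?E)"
    using fin by (simp add: edge_list_def mset_concat_pairs image_mset_mset_set mset_sorted_set)
  moreover have "J = (?E \<union> \<tau> ` ?E) \<union> leg_set \<tau> J"
  proof (intro equalityI subsetI)
    fix x assume "x \<in> J"
    moreover have "x \<in> \<tau> ` ?E" if "\<tau> x < x" "x \<in> J"
      using that inv assms(2) by (intro image_eqI[of _ _ "\<tau> x"]) (auto simp: edge_set_def involutions_def)
    ultimately show "x \<in> (?E \<union> \<tau> ` ?E) \<union> leg_set \<tau> J"
      by (cases "x < \<tau> x"; cases "\<tau> x = x") (auto simp: edge_set_def leg_set_def neq_iff)
  qed (use assms(2) in \<open>auto simp: edge_set_def leg_set_def involutions_def\<close>)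
  moreover have "?E \<inter> \<tau> ` ?E = {}" "(?E \<union> \<tau> ` ?E) \<inter> leg_set \<tau> J = {}"
    using inv by (auto simp: edge_set_def leg_set_def dest: less_asym)
  ultimately have "mset_set J = mset_set ?E + mset_set (\<tau> ` ?E) + mset_set (leg_set \<tau> J)"
    using fin by (metis finite_imageI finite_UnI mset_set_Union)
  then show ?thesis using fin \<open>mset (edge_list \<tau> J) = _\<close> by (simp add: mset_sorted_set)
qed

lemma odd_count_even_pairs:
  assumes "\<And>x. x \<in> set xs \<Longrightarrow> P (\<tau> x) = P x"
  shows "even (odd_count P (mset (concat (map (\<lambda>x. [x, \<tau> x]) xs))))"
  using assms by (induction xs) auto

lemma sorted_list_of_set_Min:
  assumes "finite J" "x \<in> J" "\<And>y. y \<in> J \<Longrightarrow> x \<le> y"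
  shows "sorted_list_of_set J = x # sorted_list_of_set (J - {x})"
proof -
  have "Min J = x" using assms by (intro Min_eqI) auto
  then show ?thesis using sorted_list_of_set_nonempty[of J] assms by auto
qed

context feynman
begin

definition compatible :: "(nat \<Rightarrow> nat) \<Rightarrow> (nat \<Rightarrow> nat) \<Rightarrow> nat set \<Rightarrow> bool" where
  "compatible l \<tau> J \<longleftrightarrow> (\<forall>x\<in>J. if \<tau> x = x then l x < n else \<not> l x < n)"

text \<open>Parities are read off the labels, but it is the positions that are sorted. Positions are
  distinct, so the sign has no exceptions when labels repeat.\<close>

definition wick_term :: "(nat \<Rightarrow> nat) \<Rightarrow> (nat \<Rightarrow> nat) \<Rightarrow> nat set \<Rightarrow> series" where
  "wick_term l \<tau> J A =
     fls_const (sorting_sign (\<lambda>x. par (l x)) (edge_list \<tau> J @ sorted_list_of_set (leg_set \<tau> J)) *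
       (\<Prod>x\<in>edge_set \<tau> J. sinv (l x) (l (\<tau> x)))) * fls_X ^ card (edge_set \<tau> J) *
     s_word par (map l (sorted_list_of_set (leg_set \<tau> J))) A"

lemma sinv_par: "sinv x y \<noteq> 0 \<Longrightarrow> par x = par y"
proof -
  assume "sinv x y \<noteq> 0"
  then show ?thesis using even_L odd_L unfolding sinv_def sigma_inv_def by (auto split: if_splits)
qed

lemma sinv_L: "sinv x y \<noteq> 0 \<Longrightarrow> \<not> x < n \<and> \<not> y < n"
  unfolding sinv_def sigma_inv_def by (auto split: if_splits)

text \<open>In the sorted list exactly the smaller letters stand before \<open>j\<close>. So the
  sign of moving \<open>j\<close> to the front is its \<open>cross_sign\<close> with all other
  letters.\<close>

lemma sigma_even:
  assumes "sorted_list_of_set J = u @ j # v" "finite J"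
  shows "cross_sign P {#j#} (mset u + mset v) = (if P j then (-1) ^ odd_count P (mset u) else 1)"
proof (cases "P j")
  case True
  have s: "sorted (u @ j # v)" "distinct (u @ j # v)" using assms by (metis sorted_list_of_set.sorted_sorted_key_list_of_set sorted_list_of_set.distinct_sorted_key_list_of_set)+
  have "cross_sign P {#j#} (mset v) = 1"
  proof -
    have "\<not> y < j" if "y \<in> set v" for y using s(1) that by (auto simp: sorted_append not_less)
    then show ?thesis unfolding cross_sign_def by (auto intro!: prod_mset.neutral simp: inversion_sign_def)
  qed
  moreover have "cross_sign P {#j#} (mset u) = (-1) ^ odd_count P (mset u)"
  proof -
    have "\<forall>x\<in>set u. x < j" using s by (auto simp: sorted_append order.strict_iff_order)
    then show ?thesis using True
    proof (induction u)
      case (Cons a u)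
      then show ?case by (simp add: cross_sign_add_mset(2)[of P "{#j#}" a "mset u"] cross_sign_single inversion_sign_def)
    qed simp
  qed
  ultimately show ?thesis using True by (simp add: cross_sign_union)
qed (simp add: cross_sign_single_left_even)

text \<open>Contractions are indexed by positions instead of letters, so equal labels count as
  separate partners.\<close>

lemma word_integral_L_set:
  assumes "finite J" "z \<in> {n..<N}"
  shows "word_integral (z # map l (sorted_list_of_set J)) A =
    (\<Sum>j\<in>J. fls_const (sinv z (l j) * cross_sign (\<lambda>x. par (l x)) {#j#} (mset_set (J - {j}))) * fls_X *
       word_integral (map l (sorted_list_of_set (J - {j}))) A)"
proof -
  let ?S = "sorted_list_of_set J"
  have "word_integral (z # map l ?S) A =
    contract (\<lambda>u x v. contraction z A (map l u) (l x) (map l v)) [] ?S"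
    unfolding word_integral_L[OF assms(2)] using contract_map[of "contraction z A" l "[]" ?S] by simp
  also have "\<dots> = (\<Sum>j\<in>set ?S. fls_const (sinv z (l j) * cross_sign (\<lambda>x. par (l x)) {#j#} (mset_set (J - {j}))) * fls_X *
       word_integral (map l (sorted_list_of_set (J - {j}))) A)"
  proof (rule contract_eq_sum)
    fix u j v assume *: "[] @ ?S = u @ j # v"
    have d: "distinct (u @ j # v)" using * by (metis append_Nil sorted_list_of_set.distinct_sorted_key_list_of_set)
    have r: "sorted_list_of_set (J - {j}) = u @ v"
      using sorted_list_of_set.sorted_key_list_of_set_remove[OF assms(1), of j] * d by (simp add: remove1_append)
    hence "mset_set (J - {j}) = mset u + mset v"
      using assms(1) by (metis finite_Diff mset_append mset_sorted_set)
    moreover have "odd_count par (mset (map l u)) = odd_count (\<lambda>x. par (l x)) (mset u)"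
      by (induction u) auto
    ultimately show "contraction z A (map l u) (l j) (map l v) =
       fls_const (sinv z (l j) * cross_sign (\<lambda>x. par (l x)) {#j#} (mset_set (J - {j}))) * fls_X *
       word_integral (map l (sorted_list_of_set (J - {j}))) A"
      using sigma_even[of J u j v "\<lambda>x. par (l x)"] * assms(1) by (simp add: contraction_def r)
  qed simp
  finally show ?thesis using assms(1) by simp
qed

text \<open>Induction on the number of positions, removing the least one, \<open>x\<close>. A label
  on \<open>H\<close> makes \<open>x\<close> a leg. A label on \<open>L\<close> is contracted with
  each possible partner \<open>j\<close>, and the induction hypothesis for the remaining positions
  accounts for the involutions exchanging \<open>x\<close> and \<open>j\<close>.\<close>

theorem wick:
  assumes "finite J" "\<And>x. x \<in> J \<Longrightarrow> l x < N"
  shows "word_integral (map l (sorted_list_of_set J)) A =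
    (\<Sum>\<tau>\<in>{\<tau> \<in> involutions J. compatible l \<tau> J}. wick_term l \<tau> J A)"
  using assms
proof (induction "card J" arbitrary: J A rule: less_induct)
  case less
  let ?P = "\<lambda>x. par (l x)"
  show ?case
  proof (cases "J = {}")
    case True
    have "{\<tau> \<in> involutions J. compatible l \<tau> J} = {\<lambda>x. x}"
      unfolding True by (auto simp: involutions_def compatible_def)
    moreover have "gauss_moment n k m \<epsilon> {#} = 1" by (simp add: gauss_moment_def odd_moment_def)
    ultimately show ?thesis unfolding True
      by (simp add: word_integral_def wick_term_def edge_list_def edge_set_def leg_set_def s_word_eq admissible_def)
  next
    case False
    \<comment> \<open>The least position heads the word and, in the standard orders, the list of
      edges or the list of legs. It creates no inversion with positions that follow it.\<close>
    define x where "x = Min J"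
    have x: "x \<in> J" "\<And>y. y \<in> J \<Longrightarrow> x \<le> y" using False less.prems(1) by (auto simp: x_def)
    define J' where "J' = J - {x}"
    have J': "finite J'" "x \<notin> J'" "card J' < card J" "J = insert x J'"
      unfolding J'_def by (use less.prems(1) in simp, simp, rule card_Diff1_less[OF less.prems(1) x(1)], use x(1) in auto)
    have lt: "y \<in> J' \<Longrightarrow> x < y" for y using x J' by (metis insertI2 le_neq_implies_less)
    have one: "cross_sign ?P {#x#} M = 1" if M: "set_mset M \<subseteq> J'" for M
    proof -
      have "\<not> y < x" if "y \<in># M" for y using lt[of y] M that by auto
      then show ?thesis unfolding cross_sign_def by (auto intro!: prod_mset.neutral simp: inversion_sign_def)
    qed
    have xs: "sorted_list_of_set J = x # sorted_list_of_set J'"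
      unfolding J'_def by (rule sorted_list_of_set_Min) (use x less.prems in auto)
    show ?thesis
    proof (cases "l x < n")
      case H: True
      have inv: "{\<tau> \<in> involutions J. compatible l \<tau> J} = {\<tau> \<in> involutions J'. compatible l \<tau> J'}"
      proof (intro set_eqI iffI)
        fix \<tau> assume \<tau>: "\<tau> \<in> {\<tau> \<in> involutions J. compatible l \<tau> J}"
        hence "\<tau> x = x" using H x(1) by (auto simp: compatible_def split: if_splits)
        moreover have "\<tau> y \<noteq> x" if "y \<in> J'" for y
        proof
          assume "\<tau> y = x"
          moreover have "\<tau> (\<tau> y) = y" using \<tau> that J'(4) by (auto simp: involutions_def)
          ultimately show False using \<open>\<tau> x = x\<close> that J'(2) by auto
        qed
        ultimately show "\<tau> \<in> {\<tau> \<in> involutions J'. compatible l \<tau> J'}"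
          using \<tau> J'(2) unfolding J'(4) involutions_def compatible_def by auto metis
      next
        fix \<tau> assume \<tau>: "\<tau> \<in> {\<tau> \<in> involutions J'. compatible l \<tau> J'}"
        then show "\<tau> \<in> {\<tau> \<in> involutions J. compatible l \<tau> J}"
          using H J'(2) unfolding J'(4) involutions_def compatible_def by auto
      qed
      have wt: "wick_term l \<tau> J A = (if l x \<in># A \<and> admissible par A
          then fls_const (cross_sign par {#l x#} (A - {#l x#})) * wick_term l \<tau> J' (A - {#l x#}) else 0)"
        if \<tau>: "\<tau> \<in> involutions J'" for \<tau>
      proof -
        have \<tau>x: "\<tau> x = x" using \<tau> J'(2) by (auto simp: involutions_def)
        have E: "edge_set \<tau> J = edge_set \<tau> J'" "edge_list \<tau> J = edge_list \<tau> J'"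
          unfolding edge_list_def edge_set_def J'(4) using \<tau>x by (auto intro: arg_cong[where f = "\<lambda>X. concat (map _ (sorted_list_of_set X))"] arg_cong[where f = "\<lambda>X. concat _"])
        have "leg_set \<tau> J = insert x (leg_set \<tau> J')" unfolding leg_set_def J'(4) using \<tau>x by auto
        moreover have "leg_set \<tau> J' \<subseteq> J'" by (auto simp: leg_set_def)
        ultimately have Lg: "sorted_list_of_set (leg_set \<tau> J) = x # sorted_list_of_set (leg_set \<tau> J')"
          using sorted_list_of_set_Min[of "leg_set \<tau> J" x] J' lt
          by (metis Diff_insert_absorb finite_insert finite_subset insertE insertI1 less_imp_le subsetD order_refl)
        have w: "s_word par (l x # xs) A = (if l x \<in># A \<and> admissible par A
          then fls_const (cross_sign par {#l x#} (A - {#l x#})) * s_word par xs (A - {#l x#}) else 0)" for xs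
          using admissible_mono[of par A "A - {#l x#}"]
          by (auto simp: s_word_eq diff_subset_eq_self simp flip: fls_const_mult_const) (metis insert_DiffM)+
        \<comment> \<open>The new leg stands behind the edges and has to be moved in front of them.
          Where the product over the edges is nonzero, the two ends of each edge have equal parity,
          so this costs no sign.\<close>
        have sg: "sorting_sign ?P (edge_list \<tau> J' @ x # sorted_list_of_set (leg_set \<tau> J')) =
            sorting_sign ?P (edge_list \<tau> J' @ sorted_list_of_set (leg_set \<tau> J'))"
          if nz: "(\<Prod>x\<in>edge_set \<tau> J'. sinv (l x) (l (\<tau> x))) \<noteq> 0"
        proof -
          have fE: "finite (edge_set \<tau> J')" using J'(1) by (auto simp: edge_set_def)
          have ev: "even (odd_count ?P (mset (edge_list \<tau> J')))"
            unfolding edge_list_def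
          proof (rule odd_count_even_pairs)
            fix y assume "y \<in> set (sorted_list_of_set (edge_set \<tau> J'))"
            hence "sinv (l y) (l (\<tau> y)) \<noteq> 0" using nz fE by (auto simp: prod_zero_iff)
            then show "par (l (\<tau> y)) = par (l y)" using sinv_par by metis
          qed
          have sub: "set_mset (mset (edge_list \<tau> J')) \<subseteq> J'"
            using fE \<tau> by (auto simp: edge_list_def edge_set_def involutions_def)
          have "cross_sign ?P (mset (edge_list \<tau> J')) {#x#} = cross_sign ?P {#x#} (mset (edge_list \<tau> J'))"
            by (rule cross_sign_swap_even) (use ev sub J'(2) in auto)
          moreover note one
          moreover have "set (sorted_list_of_set (leg_set \<tau> J')) \<subseteq> J'"
            using J'(1) by (auto simp: leg_set_def)
          ultimately show ?thesis
            using sub by (simp add: sorting_sign_append cross_sign_add_mset(2)[of _ _ x "mset _"])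
        qed
        show ?thesis
        proof (cases "(\<Prod>x\<in>edge_set \<tau> J'. sinv (l x) (l (\<tau> x))) = 0")
          case False
          show ?thesis unfolding wick_term_def E Lg sg[OF False] using w by (simp add: mult_ac)
        qed (simp add: wick_term_def E)
      qed
      have IH: "word_integral (map l (sorted_list_of_set J')) B =
        (\<Sum>\<tau>\<in>{\<tau> \<in> involutions J'. compatible l \<tau> J'}. wick_term l \<tau> J' B)" for B
        by (rule less.hyps[OF J'(3,1)]) (use less.prems J' in auto)
      have "word_integral (map l (sorted_list_of_set J)) A = (if l x \<in># A \<and> admissible par A
          then fls_const (cross_sign par {#l x#} (A - {#l x#})) *
            (\<Sum>\<tau>\<in>{\<tau> \<in> involutions J'. compatible l \<tau> J'}. wick_term l \<tau> J' (A - {#l x#})) else 0)"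
        unfolding xs list.map IH[symmetric] by (rule word_integral_H) (use H less.prems J' in auto)
      also have "\<dots> = (\<Sum>\<tau>\<in>{\<tau> \<in> involutions J'. compatible l \<tau> J'}. wick_term l \<tau> J A)"
        by (cases "l x \<in># A \<and> admissible par A") (auto simp: wt sum_distrib_left)
      finally show ?thesis unfolding inv .
    next
      case Lx: False
      hence lx: "l x \<in> {n..<N}" using less.prems(2)[OF x(1)] by simp
      let ?I = "\<lambda>j. {\<tau> \<in> involutions (J' - {j}). compatible l \<tau> (J' - {j})}"
      \<comment> \<open>Adds the two-cycle of \<open>x\<close> and \<open>j\<close>; it is undone by
        reading off \<open>j\<close> as the image of \<open>x\<close>.\<close>
      let ?up = "\<lambda>j \<tau>. \<tau>(x := j, j := x)"
      have up: "?up j \<tau> \<in> involutions J" "wick_term l (?up j \<tau>) J A =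
         fls_const (sinv (l x) (l j) * cross_sign ?P {#j#} (mset_set (J' - {j}))) * fls_X * wick_term l \<tau> (J' - {j}) A"
        if j: "j \<in> J'" and \<tau>: "\<tau> \<in> involutions (J' - {j})" for j \<tau>
      proof -
        have \<tau>f: "\<tau> x = x" "\<tau> j = j" using \<tau> J'(2) by (auto simp: involutions_def)
        have xj: "x < j" "x \<noteq> j" using lt j by auto
        show "?up j \<tau> \<in> involutions J"
          using \<tau> j J' xj \<tau>f unfolding involutions_def by (auto split: if_splits)
        let ?J = "J' - {j}"
        have nin: "\<tau> y \<noteq> x" "\<tau> y \<noteq> j" "y \<noteq> x" "y \<noteq> j" if "y \<in> ?J" for y
          using \<tau> that J'(2) by (auto simp: involutions_def)
        have up_eq: "?up j \<tau> y = \<tau> y" if "y \<in> ?J" for y using nin[OF that] by simp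
        have JJ: "J = insert x (insert j ?J)" using J'(4) j by auto
        have E: "edge_set (?up j \<tau>) J = insert x (edge_set \<tau> ?J)"
          unfolding edge_set_def JJ using xj up_eq by auto
        have xE: "x \<notin> edge_set \<tau> ?J" "finite (edge_set \<tau> ?J)" using J' by (auto simp: edge_set_def)
        have SE: "sorted_list_of_set (edge_set (?up j \<tau>) J) = x # sorted_list_of_set (edge_set \<tau> ?J)"
        proof -
          have "y \<in> edge_set \<tau> ?J \<Longrightarrow> x \<le> y" for y using lt[of y] by (simp add: edge_set_def)
          hence "sorted_list_of_set (insert x (edge_set \<tau> ?J)) =
              x # sorted_list_of_set (insert x (edge_set \<tau> ?J) - {x})"
            by (intro sorted_list_of_set_Min) (use xE in auto)
          then show ?thesis unfolding E using xE(1) by simp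
        qed
        have EL: "edge_list (?up j \<tau>) J = x # j # edge_list \<tau> ?J"
        proof -
          have "map (\<lambda>y. [y, ?up j \<tau> y]) (sorted_list_of_set (edge_set \<tau> ?J)) = map (\<lambda>y. [y, \<tau> y]) (sorted_list_of_set (edge_set \<tau> ?J))"
            by (rule map_cong) (use xE up_eq in \<open>auto simp: edge_set_def\<close>)
          note eq = this
          show ?thesis unfolding edge_list_def SE list.map eq using xj by simp
        qed
        have LL: "leg_set (?up j \<tau>) J = leg_set \<tau> ?J"
          unfolding leg_set_def JJ using xj up_eq J'(2) by auto
        have pr: "(\<Prod>y\<in>edge_set (?up j \<tau>) J. sinv (l y) (l (?up j \<tau> y))) =
           sinv (l x) (l j) * (\<Prod>y\<in>edge_set \<tau> ?J. sinv (l y) (l (\<tau> y)))"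
        proof -
          have "(\<Prod>y\<in>edge_set \<tau> ?J. sinv (l y) (l (?up j \<tau> y))) = (\<Prod>y\<in>edge_set \<tau> ?J. sinv (l y) (l (\<tau> y)))"
            by (rule prod.cong[OF refl]) (simp only: up_eq edge_set_def mem_Collect_eq)
          then show ?thesis unfolding E using xE xj by simp
        qed
        let ?eo = "edge_list \<tau> ?J @ sorted_list_of_set (leg_set \<tau> ?J)"
        have ms: "mset ?eo = mset_set ?J" by (rule mset_edge_list) (use \<tau> J' in auto)
        have "cross_sign ?P {#x#} (mset (j # ?eo)) = 1"
        proof -
          have "set_mset (mset (j # ?eo)) \<subseteq> J'" using ms j J'(1) by (metis finite_Diff finite_set_mset_mset_set insert_Diff mset.simps(2) order_refl set_mset_add_mset_insert)
          then show ?thesis by (rule one)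
        qed
        hence sg: "sorting_sign ?P (x # j # ?eo) = cross_sign ?P {#j#} (mset_set ?J) * sorting_sign ?P ?eo"
          using ms by (simp only: sorting_sign.simps mult_1_left)
        show "wick_term l (?up j \<tau>) J A =
         fls_const (sinv (l x) (l j) * cross_sign ?P {#j#} (mset_set ?J)) * fls_X * wick_term l \<tau> ?J A"
          unfolding wick_term_def EL LL pr append_Cons sg
          unfolding E using xE by (simp add: mult_ac flip: fls_const_mult_const)
      qed
      have comp: "compatible l (?up j \<tau>) J \<longleftrightarrow> compatible l \<tau> (J' - {j})"
        if j: "j \<in> J'" "\<not> l j < n" and \<tau>: "\<tau> \<in> involutions (J' - {j})" for j \<tau>
      proof -
        have JJ: "J = insert x (insert j (J' - {j}))" using J'(4) j by auto
        have "x \<noteq> j" using lt j by auto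
        then show ?thesis unfolding compatible_def JJ using j Lx J'(2) by auto
      qed
      have "word_integral (map l (sorted_list_of_set J)) A =
        (\<Sum>j\<in>J'. fls_const (sinv (l x) (l j) * cross_sign ?P {#j#} (mset_set (J' - {j}))) * fls_X *
           word_integral (map l (sorted_list_of_set (J' - {j}))) A)"
        unfolding xs list.map by (rule word_integral_L_set[OF J'(1) lx])
      \<comment> \<open>The inverse form vanishes on labels from \<open>H\<close>.\<close>
      also have "\<dots> = (\<Sum>j\<in>{j \<in> J'. \<not> l j < n}. fls_const (sinv (l x) (l j) * cross_sign ?P {#j#} (mset_set (J' - {j}))) * fls_X *
           word_integral (map l (sorted_list_of_set (J' - {j}))) A)"
        by (rule sum.mono_neutral_right) (use J'(1) sinv_L in auto)
      also have "\<dots> = (\<Sum>j\<in>{j \<in> J'. \<not> l j < n}. \<Sum>\<tau>\<in>?I j. wick_term l (?up j \<tau>) J A)"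
      proof (rule sum.cong[OF refl])
        fix j assume j: "j \<in> {j \<in> J'. \<not> l j < n}"
        have "word_integral (map l (sorted_list_of_set (J' - {j}))) A = (\<Sum>\<tau>\<in>?I j. wick_term l \<tau> (J' - {j}) A)"
          by (rule less.hyps) (use J' less.prems j in \<open>auto intro: le_less_trans[OF card_Diff1_le]\<close>)
        then show "fls_const (sinv (l x) (l j) * cross_sign ?P {#j#} (mset_set (J' - {j}))) * fls_X *
           word_integral (map l (sorted_list_of_set (J' - {j}))) A = (\<Sum>\<tau>\<in>?I j. wick_term l (?up j \<tau>) J A)"
          using up(2)[of j] j by (simp add: sum_distrib_left)
      qed
      also have "\<dots> = (\<Sum>(j, \<tau>)\<in>Sigma {j \<in> J'. \<not> l j < n} ?I. wick_term l (?up j \<tau>) J A)"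
        by (rule sum.Sigma) (auto intro!: finite_subset[OF _ finite_involutions] simp: J'(1))
      also have "\<dots> = (\<Sum>\<tau>\<in>{\<tau> \<in> involutions J. compatible l \<tau> J}. wick_term l \<tau> J A)"
      proof (rule sum.reindex_bij_witness[where j = "\<lambda>(j, \<tau>). ?up j \<tau>" and i = "\<lambda>\<tau>. (\<tau> x, \<tau>(x := x, \<tau> x := \<tau> x))"])
        fix z assume "z \<in> Sigma {j \<in> J'. \<not> l j < n} ?I"
        then obtain j \<tau> where z: "z = (j, \<tau>)" "j \<in> J'" "\<not> l j < n" "\<tau> \<in> involutions (J' - {j})" "compatible l \<tau> (J' - {j})"
          by auto
        have f: "\<tau> x = x" "\<tau> j = j" "x \<noteq> j" using z J'(2) by (auto simp: involutions_def)
        show "((case z of (j, \<tau>) \<Rightarrow> ?up j \<tau>) x, (case z of (j, \<tau>) \<Rightarrow> ?up j \<tau>)(x := x, (case z of (j, \<tau>) \<Rightarrow> ?up j \<tau>) x := (case z of (j, \<tau>) \<Rightarrow> ?up j \<tau>) x)) = z"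
          using f by (auto simp: z(1) fun_eq_iff)
        show "(case z of (j, \<tau>) \<Rightarrow> ?up j \<tau>) \<in> {\<tau> \<in> involutions J. compatible l \<tau> J}"
          using up(1)[of j \<tau>] comp[of j \<tau>] z by simp
      next
        fix \<tau> assume \<tau>: "\<tau> \<in> {\<tau> \<in> involutions J. compatible l \<tau> J}"
        have ne: "\<tau> x \<noteq> x" using \<tau> Lx x(1) by (auto simp: compatible_def split: if_splits)
        hence tx: "\<tau> x \<in> J'" "\<tau> (\<tau> x) = x" using \<tau> x(1) by (auto simp: involutions_def J'_def)
        let ?\<tau> = "\<tau>(x := x, \<tau> x := \<tau> x)"
        show e: "(case (\<tau> x, ?\<tau>) of (j, \<tau>) \<Rightarrow> ?up j \<tau>) = \<tau>"
          using tx ne by (auto simp: fun_eq_iff)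
        have inj: "\<tau> y = \<tau> z \<Longrightarrow> y = z" for y z
          using \<tau> unfolding involutions_def by (metis (mono_tags, lifting) mem_Collect_eq)
        have i: "?\<tau> \<in> involutions (J' - {\<tau> x})"
          using \<tau> tx ne unfolding involutions_def J'_def by (auto dest: inj)
        moreover have "\<not> l (\<tau> x) < n" using \<tau> tx ne J'(4) unfolding compatible_def by (auto split: if_splits)
        moreover have "compatible l ?\<tau> (J' - {\<tau> x})" using comp[OF tx(1) \<open>\<not> l (\<tau> x) < n\<close> i] e \<tau> by simp
        ultimately show "(\<tau> x, ?\<tau>) \<in> Sigma {j \<in> J'. \<not> l j < n} ?I" using tx by simp
      qed auto
      finally show ?thesis .
    qed
  qed
qed

end

section \<open>Amplitudes do not depend on the chosen orders\<close>

lemma mset_concat_cong: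
  assumes "mset vs = mset vs'"
  shows "mset (concat (map h vs)) = mset (concat (map h vs'))"
proof -
  have "mset (concat (map h vs)) = (\<Sum>v\<in>#mset vs. mset (h v))" for vs
    by (induction vs) auto
  then show ?thesis using assms by metis
qed

lemma prod_list_mset_cong:
  fixes F :: "'a \<Rightarrow> 'b::comm_monoid_mult"
  assumes "mset vs = mset vs'"
  shows "(\<Prod>v\<leftarrow>vs. F v) = (\<Prod>v\<leftarrow>vs'. F v)"
proof -
  have "(\<Prod>v\<leftarrow>vs. F v) = (\<Prod>v\<in>#mset vs. F v)" for vs by (induction vs) auto
  then show ?thesis using assms by metis
qed

text \<open>Signs between different blocks depend only on the multisets of the blocks, so reordering
  letters inside a block affects only its own sorting sign.\<close>

lemma blocks_reorder:
  assumes "\<And>i. i \<in> set vs \<Longrightarrow> mset (h i) = mset (h' i) \<and> sorting_sign P (h i) * F i = sorting_sign P (h' i) * F' i"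
  shows "sorting_sign P (concat (map h vs)) * (\<Prod>i\<leftarrow>vs. F i) = sorting_sign P (concat (map h' vs)) * (\<Prod>i\<leftarrow>vs. F' i)
     \<and> mset (concat (map h vs)) = mset (concat (map h' vs))"
  using assms
proof (induction vs)
  case (Cons v vs)
  have 1: "sorting_sign P (h v) * F v = sorting_sign P (h' v) * F' v" "mset (h v) = mset (h' v)" using Cons.prems by auto
  have 2: "sorting_sign P (concat (map h vs)) * (\<Prod>i\<leftarrow>vs. F i) = sorting_sign P (concat (map h' vs)) * (\<Prod>i\<leftarrow>vs. F' i)"
    "mset (concat (map h vs)) = mset (concat (map h' vs))" using Cons by auto
  have "sorting_sign P (concat (map h (v # vs))) * (\<Prod>i\<leftarrow>v # vs. F i) =
     (sorting_sign P (h v) * F v) * (sorting_sign P (concat (map h vs)) * (\<Prod>i\<leftarrow>vs. F i)) * cross_sign P (mset (h v)) (mset (concat (map h vs)))"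
    by (simp only: list.map concat.simps sorting_sign_append prod_list.Cons mult_ac)
  also have "\<dots> = (sorting_sign P (h' v) * F' v) * (sorting_sign P (concat (map h' vs)) * (\<Prod>i\<leftarrow>vs. F' i)) * cross_sign P (mset (h' v)) (mset (concat (map h' vs)))"
    by (simp only: 1 2)
  also have "\<dots> = sorting_sign P (concat (map h' (v # vs))) * (\<Prod>i\<leftarrow>v # vs. F' i)"
    by (simp only: list.map concat.simps sorting_sign_append prod_list.Cons mult_ac)
  finally show ?case using 1 2 by simp
qed simp

text \<open>Blocks with nonzero factor are even and commute without sign. If some factor is zero,
  both sides vanish.\<close>

lemma blocks_permute:
  assumes "distinct (concat (map h vs))" "mset vs = mset vs'"
    and "\<And>i. i \<in> set vs \<Longrightarrow> F i \<noteq> 0 \<Longrightarrow> even (odd_count P (mset (h i)))"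
  shows "sorting_sign P (concat (map h vs)) * (\<Prod>i\<leftarrow>vs. F i) = sorting_sign P (concat (map h vs')) * (\<Prod>i\<leftarrow>vs'. F i :: real)"
proof (cases "\<exists>i\<in>set vs. F i = 0")
  case True
  hence "(\<Prod>i\<leftarrow>vs. F i) = 0" by (auto simp: prod_list_zero_iff)
  then show ?thesis using prod_list_mset_cong[OF assms(2), of F] by simp
next
  case False
  have "sorting_sign P (concat (map h vs)) = sorting_sign P (concat (map h vs'))"
  proof (rule adjacent_swap_invariant[where A = "mset vs"])
    fix us x y ws assume *: "mset (us @ x # y # ws) = mset vs"
    have "distinct (concat (map h (us @ x # y # ws)))"
      using mset_eq_imp_distinct_iff[OF mset_concat_cong[OF *, of h]] assms(1) by blast
    hence "set (h x) \<inter> set (h y) = {}" by auto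
    moreover have "x \<in> set vs" using mset_eq_setD[OF *] by auto
    hence "even (odd_count P (mset (h x)))" using False assms(3) by auto
    ultimately have "cross_sign P (mset (h x)) (mset (h y)) = cross_sign P (mset (h y)) (mset (h x))"
      by (intro cross_sign_swap_even) auto
    then show "sorting_sign P (concat (map h (us @ x # y # ws))) = sorting_sign P (concat (map h (us @ y # x # ws)))"
      by (simp add: sorting_sign_append cross_sign_union ac_simps)
  qed (use assms(2) in auto)
  then show ?thesis using prod_list_mset_cong[OF assms(2), of F] by simp
qed

definition real_word :: "(nat \<Rightarrow> bool) \<Rightarrow> nat list \<Rightarrow> nat multiset \<Rightarrow> real" where
  "real_word P xs M = (if M = mset xs \<and> admissible P M then sorting_sign P xs else 0)"

lemma s_word_real: "s_word P xs M = fls_const (real_word P xs M)"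
  by (auto simp: s_word_eq real_word_def)

lemma real_word_swap: "real_word P (us @ x # y # vs) M = swap_sign P x y * real_word P (us @ y # x # vs) M"
  using s_word_swap[of P us x y vs M] unfolding s_word_real fls_const_mult_const
  by (metis fls_const_nth)

text \<open>The letters are distinct positions and only their labels may repeat, so order
  independence holds for repeated odd labels as well.\<close>

lemma supersymmetric_map:
  fixes l :: "nat \<Rightarrow> nat" and \<Phi> :: "nat list \<Rightarrow> real" and par :: "nat \<Rightarrow> bool"
  assumes "\<And>us x y vs. set (us @ x # y # vs) \<subseteq> l ` set xs \<Longrightarrow> \<Phi> (us @ x # y # vs) = swap_sign par x y * \<Phi> (us @ y # x # vs)"
    and "distinct xs" "mset xs = mset ys"
  shows "sorting_sign (\<lambda>x. par (l x)) xs * \<Phi> (map l xs) = sorting_sign (\<lambda>x. par (l x)) ys * \<Phi> (map l ys)"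
proof -
  have "of_real (sorting_sign (\<lambda>x. par (l x)) xs) * \<Phi> (map l xs) = of_real (sorting_sign (\<lambda>x. par (l x)) ys) * \<Phi> (map l ys)"
  proof (rule supersymmetric_invariant[where \<Phi> = "\<lambda>xs. \<Phi> (map l xs)"])
    fix us x y vs assume *: "mset (us @ x # y # vs) = mset xs"
    have "set (map l us @ l x # l y # map l vs) = l ` set (us @ x # y # vs)" by auto
    also have "\<dots> = l ` set xs" using mset_eq_setD[OF *] by simp
    finally show "\<Phi> (map l (us @ x # y # vs)) = of_real (swap_sign (\<lambda>x. par (l x)) x y) * \<Phi> (map l (us @ y # x # vs))"
      using assms(1)[of "map l us" "l x" "l y" "map l vs"] by (simp add: swap_sign_def)
  next
    fix x show "count (mset xs) x \<le> 1" using assms(2) by (metis distinct_count_atmost_1 le_refl zero_le)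
  qed (use assms in simp)
  then show ?thesis by simp
qed

section \<open>Orders on the parts of a graph\<close>

definition fibre :: "graph \<Rightarrow> nat \<Rightarrow> nat set" where
  "fibre G v = {x \<in> half_edges G. root G x = v}"

text \<open>The choices behind the formula for an amplitude: \<open>vs\<close> orders the vertices,
  \<open>h v\<close> the half-edges at \<open>v\<close>, \<open>es\<close> orders the edges and
  orients each by naming its first half, and \<open>ls\<close> orders the legs.\<close>

definition orders :: "graph \<Rightarrow> nat list \<Rightarrow> (nat \<Rightarrow> nat list) \<Rightarrow> nat list \<Rightarrow> nat list \<Rightarrow> bool" where
  "orders G vs h es ls \<longleftrightarrow> mset vs = mset_set (verts G) \<and>
     (\<forall>v\<in>verts G. mset (h v) = mset_set (fibre G v)) \<and>
     distinct es \<and> (\<forall>x\<in>set es. x \<in> half_edges G \<and> flip G x \<noteq> x \<and> flip G x \<notin> set es) \<and>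
     (\<forall>x\<in>half_edges G. flip G x \<noteq> x \<longrightarrow> x \<in> set es \<or> flip G x \<in> set es) \<and>
     mset ls = mset_set (legs G)"

lemma graph_finite: "graph G \<Longrightarrow> finite (half_edges G)" "graph G \<Longrightarrow> finite (verts G)"
  "graph G \<Longrightarrow> finite (legs G)" "graph G \<Longrightarrow> finite (fibre G v)"
  by (auto simp: graph_def legs_def fibre_def)

lemma graph_flip: "graph G \<Longrightarrow> x \<in> half_edges G \<Longrightarrow> flip G x \<in> half_edges G \<and> flip G (flip G x) = x"
  by (auto simp: graph_def)

lemma mset_concat_fibres:
  assumes "graph G" "mset vs = mset_set (verts G)" "\<And>v. v \<in> verts G \<Longrightarrow> mset (h v) = mset_set (fibre G v)"
  shows "mset (concat (map h vs)) = mset_set (half_edges G)"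
proof -
  have vs: "distinct vs" "set vs = verts G"
    using assms(2) graph_finite(2)[OF assms(1)] by (metis finite_set_mset_mset_set mset_eq_imp_distinct_iff mset_sorted_set sorted_list_of_set.distinct_sorted_key_list_of_set, metis assms(2) finite_set_mset_mset_set graph_finite(2) assms(1) set_mset_mset)
  have "distinct vs \<Longrightarrow> set vs \<subseteq> verts G \<Longrightarrow> mset (concat (map h vs)) = mset_set {x \<in> half_edges G. root G x \<in> set vs}"
  proof (induction vs)
    case (Cons v vs)
    have "{x \<in> half_edges G. root G x \<in> set (v # vs)} = fibre G v \<union> {x \<in> half_edges G. root G x \<in> set vs}"
      by (auto simp: fibre_def)
    moreover have "fibre G v \<inter> {x \<in> half_edges G. root G x \<in> set vs} = {}"
      using Cons.prems by (auto simp: fibre_def)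
    ultimately show ?case
      using Cons assms(3)[of v] graph_finite[OF assms(1)] by (simp add: mset_set_Union)
  qed simp
  moreover have "{x \<in> half_edges G. root G x \<in> set vs} = half_edges G"
    using assms(1) vs by (auto simp: graph_def)
  ultimately show ?thesis using vs by simp
qed

lemma distinct_if_mset_set: "mset xs = mset_set A \<Longrightarrow> distinct xs"
  by (metis count_mset_set' distinct_count_atmost_1 count_eq_zero_iff set_mset_mset count_mset_0_iff finite_set_mset_mset_set infinite_set_mset_mset_set empty_iff)

context feynman
begin

text \<open>The summand of the amplitude at the labelling \<open>l\<close> for chosen orders. The
  Koszul sign is split into two sorting signs, each next to the tensors that it makes independent of
  the order.\<close>

definition ordered_term :: "graph \<Rightarrow> (nat \<Rightarrow> nat) \<Rightarrow> nat list \<Rightarrow> (nat \<Rightarrow> nat list) \<Rightarrow> nat list \<Rightarrow> nat list \<Rightarrow> real" where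
  "ordered_term G l vs h es ls =
     (sorting_sign (\<lambda>x. par (l x)) (concat (map h vs)) * (\<Prod>v\<leftarrow>vs. t (vgenus G v) (map l (h v)))) *
     (sorting_sign (\<lambda>x. par (l x)) (concat (map (\<lambda>x. [x, flip G x]) es) @ ls) * (\<Prod>x\<leftarrow>es. sinv (l x) (l (flip G x))))"

lemma t_supersymmetric:
  fixes l :: "nat \<Rightarrow> nat"
  assumes "l ` set xs \<subseteq> {..<N}" "distinct xs" "mset xs = mset ys"
  shows "sorting_sign (\<lambda>x. par (l x)) xs * t g (map l xs) = sorting_sign (\<lambda>x. par (l x)) ys * t g (map l ys)"
  by (rule supersymmetric_map[where par = par and l = l and \<Phi> = "t g"]) (rule t_swap, erule order_trans, rule assms(1), rule assms(2), rule assms(3))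

lemma sinv_symmetric: "sinv y x = swap_sign par x y * sinv x y"
proof (cases "par x \<and> par y")
  case True
  have "sinv y x = - sinv x y"
    unfolding sinv_def sigma_inv_def using True even_L by (auto; presburger)
  then show ?thesis using True by (simp add: swap_sign_def)
next
  case False
  then show ?thesis
  proof (cases "x = y")
    case False
    have "sinv x y = 0" "sinv y x = 0"
      using \<open>\<not> (par x \<and> par y)\<close> odd_L False unfolding sinv_def sigma_inv_def by auto
    then show ?thesis by simp
  qed (auto simp: swap_sign_def)
qed

text \<open>Supersymmetry of the vertex tensors reorders the half-edges at each vertex; evenness of
  the tensors then permutes the vertices.\<close>

lemma ordered_term_vertices:
  assumes G: "graph G" "l ` half_edges G \<subseteq> {..<N}"
    and o: "orders G vs h es ls" "orders G vs' h' es' ls'"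
  shows "sorting_sign (\<lambda>x. par (l x)) (concat (map h vs)) * (\<Prod>v\<leftarrow>vs. t (vgenus G v) (map l (h v))) =
         sorting_sign (\<lambda>x. par (l x)) (concat (map h' vs')) * (\<Prod>v\<leftarrow>vs'. t (vgenus G v) (map l (h' v)))"
proof -
  let ?P = "\<lambda>x. par (l x)"
  have vs: "set vs = verts G" using o(1) graph_finite(2)[OF G(1)] unfolding orders_def
    by (metis finite_set_mset_mset_set set_mset_mset)
  have hm: "mset (h v) = mset_set (fibre G v)" "mset (h' v) = mset_set (fibre G v)" if "v \<in> set vs" for v
    using o that vs unfolding orders_def by auto
  have hs: "set (h v) \<subseteq> half_edges G" "distinct (h v)" if "v \<in> set vs" for v
    using hm(1)[OF that] distinct_if_mset_set[OF hm(1)[OF that]] graph_finite[OF G(1)]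
    by (metis (no_types, lifting) finite_set_mset_mset_set fibre_def mem_Collect_eq set_mset_mset subsetI, blast)
  have "sorting_sign ?P (concat (map h vs)) * (\<Prod>v\<leftarrow>vs. t (vgenus G v) (map l (h v))) =
     sorting_sign ?P (concat (map h' vs)) * (\<Prod>v\<leftarrow>vs. t (vgenus G v) (map l (h' v))) \<and>
     mset (concat (map h vs)) = mset (concat (map h' vs))"
  proof (rule blocks_reorder)
    fix v assume v: "v \<in> set vs"
    show "mset (h v) = mset (h' v) \<and> sorting_sign ?P (h v) * t (vgenus G v) (map l (h v)) = sorting_sign ?P (h' v) * t (vgenus G v) (map l (h' v))"
      using hm[OF v] hs[OF v] G(2) by (intro conjI t_supersymmetric) auto
  qed
  moreover have "sorting_sign ?P (concat (map h' vs)) * (\<Prod>v\<leftarrow>vs. t (vgenus G v) (map l (h' v))) =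
     sorting_sign ?P (concat (map h' vs')) * (\<Prod>v\<leftarrow>vs'. t (vgenus G v) (map l (h' v)))"
  proof (rule blocks_permute)
    have "mset (concat (map h' vs)) = mset_set (half_edges G)"
      by (rule mset_concat_fibres[OF G(1)]) (use o hm vs in \<open>auto simp: orders_def\<close>)
    then show "distinct (concat (map h' vs))" by (rule distinct_if_mset_set)
    show "mset vs = mset vs'" using o by (simp add: orders_def)
    fix v assume v: "v \<in> set vs" "t (vgenus G v) (map l (h' v)) \<noteq> 0"
    have "set (h' v) = set (h v)" using hm[OF v(1)] by (metis set_mset_mset)
    hence "set (map l (h' v)) \<subseteq> {..<N}" using hs(1)[OF v(1)] G(2) by auto
    from t_even[OF this v(2)] have "even (odd_count par (mset (map l (h' v))))" .
    moreover have "odd_count par (mset (map l xs)) = odd_count ?P (mset xs)" for xs by (induction xs) auto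
    ultimately show "even (odd_count ?P (mset (h' v)))" by simp
  qed
  ultimately show ?thesis by simp
qed

text \<open>The inverse form is supersymmetric, so edges can be reversed, and even, so edges can be
  permuted. Reordering legs changes the sign, but the product of their labels changes in the same
  way; therefore \<open>real_word\<close> is part of the claim.\<close>

lemma ordered_term_edges:
  assumes G: "graph G" and o: "orders G vs h es ls"
  shows "sorting_sign (\<lambda>x. par (l x)) (concat (map (\<lambda>x. [x, flip G x]) es) @ ls) * (\<Prod>x\<leftarrow>es. sinv (l x) (l (flip G x))) * real_word par (map l ls) A =
     sorting_sign (\<lambda>x. par (l x)) (edge_list (flip G) (half_edges G) @ sorted_list_of_set (legs G)) *
       (\<Prod>x\<in>edge_set (flip G) (half_edges G). sinv (l x) (l (flip G x))) * real_word par (map l (sorted_list_of_set (legs G))) A"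
proof -
  let ?P = "\<lambda>x. par (l x)" and ?E = "edge_set (flip G) (half_edges G)"
  let ?L = "sorted_list_of_set (legs G)" and ?S = "sorted_list_of_set (edge_set (flip G) (half_edges G))"
  note od = o[unfolded orders_def]
  have fl: "flip G x \<in> half_edges G" "flip G (flip G x) = x" if "x \<in> half_edges G" for x
    using graph_flip[OF G that] by auto
  have finE: "finite ?E" using graph_finite[OF G] by (auto simp: edge_set_def)
  \<comment> \<open>\<open>c\<close> replaces the chosen half of an edge by the smaller half, and
    \<open>h'\<close> lists the two halves of that edge in the order that \<open>es\<close>
    prescribes.\<close>
  define c where "c x = (if x < flip G x then x else flip G x)" for x
  define h' where "h' x = (if x \<in> set es then [x, flip G x] else [flip G x, x])" for x
  have c1: "c x \<in> ?E" "h' (c x) = [x, flip G x]" if "x \<in> set es" for x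
  proof -
    have x: "x \<in> half_edges G" "flip G x \<noteq> x" "flip G x \<notin> set es" using od that by auto
    show "c x \<in> ?E" using fl[OF x(1)] x by (auto simp: c_def edge_set_def)
    show "h' (c x) = [x, flip G x]" using fl[OF x(1)] x that by (auto simp: h'_def c_def)
  qed
  have inj: "inj_on c (set es)"
  proof (rule inj_onI)
    fix x y assume *: "x \<in> set es" "y \<in> set es" "c x = c y"
    then show "x = y" using c1(2) by (metis list.inject)
  qed
  have im: "c ` set es = ?E"
  proof (intro equalityI subsetI)
    fix x assume x: "x \<in> ?E"
    hence "x \<in> set es \<or> flip G x \<in> set es" using od by (auto simp: edge_set_def)
    moreover have "c x = x" "c (flip G x) = x" using x fl[of x] by (auto simp: c_def edge_set_def)
    ultimately show "x \<in> c ` set es" by force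
  qed (use c1 in auto)
  have ms: "mset (map c es) = mset ?S"
  proof -
    have "mset es = mset_set (set es)" using od by (simp add: mset_set_set)
    then show ?thesis using image_mset_mset_set[OF inj] im finE by (simp add: mset_sorted_set)
  qed
  have mapc: "concat (map (\<lambda>x. [x, flip G x]) es) = concat (map h' (map c es))"
    using c1(2) by (auto intro!: arg_cong[where f = concat])
  let ?F = "\<lambda>x. if x \<in> set es then sinv (l x) (l (flip G x)) else sinv (l (flip G x)) (l x)"
  have prodc: "(\<Prod>x\<leftarrow>es. sinv (l x) (l (flip G x))) = (\<Prod>x\<leftarrow>map c es. ?F x)"
  proof -
    have "?F (c x) = sinv (l x) (l (flip G x))" if "x \<in> set es" for x
    proof -
      have x: "x \<in> half_edges G" "flip G x \<noteq> x" "flip G x \<notin> set es" using od that by auto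
      then show ?thesis using fl[OF x(1)] that by (auto simp: c_def)
    qed
    then show ?thesis by (auto intro!: arg_cong[where f = prod_list])
  qed
  have dist: "distinct (edge_list (flip G) (half_edges G) @ ?L)"
  proof -
    \<comment> \<open>A graph does not restrict \<open>flip G\<close> outside its half-edges; the
      identity is put there to obtain a member of \<open>involutions\<close>.\<close>
    let ?\<tau> = "\<lambda>x. if x \<in> half_edges G then flip G x else x"
    have "?\<tau> \<in> involutions (half_edges G)" using fl by (auto simp: involutions_def)
    from mset_edge_list[OF graph_finite(1)[OF G] this]
    have "distinct (edge_list ?\<tau> (half_edges G) @ sorted_list_of_set (leg_set ?\<tau> (half_edges G)))"
      by (rule distinct_if_mset_set)
    moreover have E: "edge_set ?\<tau> (half_edges G) = ?E" by (auto simp: edge_set_def)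
    moreover have "leg_set ?\<tau> (half_edges G) = legs G" by (auto simp: leg_set_def legs_def)
    moreover have "edge_list ?\<tau> (half_edges G) = edge_list (flip G) (half_edges G)"
      unfolding edge_list_def E using finE by (intro arg_cong[where f = concat] map_cong) (auto simp: edge_set_def)
    ultimately show ?thesis by simp
  qed
  have mem: "x \<in> half_edges G" "x < flip G x" if "x \<in> set ?S" for x
    using that finE by (auto simp: edge_set_def)
  have f1: "sorting_sign ?P (concat (map h' (map c es))) * (\<Prod>x\<leftarrow>map c es. ?F x) = sorting_sign ?P (concat (map h' ?S)) * (\<Prod>x\<leftarrow>?S. ?F x)"
  proof (rule blocks_permute[OF _ ms])
    have "mset (concat (map h' (map c es))) = mset (concat (map h' ?S))" by (rule mset_concat_cong[OF ms])
    also have "\<dots> = mset (edge_list (flip G) (half_edges G))"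
    proof -
      have "mset (concat (map h' xs)) = mset (concat (map (\<lambda>x. [x, flip G x]) xs))" for xs
        by (induction xs) (auto simp: h'_def)
      then show ?thesis unfolding edge_list_def .
    qed
    finally show "distinct (concat (map h' (map c es)))" using dist mset_eq_imp_distinct_iff by auto
    fix x assume "?F x \<noteq> 0"
    hence "par (l x) = par (l (flip G x))" using sinv_par by (auto split: if_splits)
    then show "even (odd_count ?P (mset (h' x)))" by (simp add: h'_def)
  qed
  have f2: "sorting_sign ?P (concat (map h' ?S)) * (\<Prod>x\<leftarrow>?S. ?F x) =
     sorting_sign ?P (edge_list (flip G) (half_edges G)) * (\<Prod>x\<leftarrow>?S. sinv (l x) (l (flip G x))) \<and>
     mset (concat (map h' ?S)) = mset (edge_list (flip G) (half_edges G))"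
    unfolding edge_list_def
  proof (rule blocks_reorder)
    fix x assume "x \<in> set ?S"
    note x = mem[OF this]
    have "inversion_sign ?P (flip G x) x * sinv (l (flip G x)) (l x) = inversion_sign ?P x (flip G x) * sinv (l x) (l (flip G x))"
      unfolding sinv_symmetric[of "l (flip G x)" "l x"] using x(2) by (auto simp: inversion_sign_def swap_sign_def)
    then show "mset (h' x) = mset [x, flip G x] \<and> sorting_sign ?P (h' x) * ?F x = sorting_sign ?P [x, flip G x] * sinv (l x) (l (flip G x))"
      by (auto simp: h'_def cross_sign_single)
  qed
  have f3: "mset ls = mset ?L" using od graph_finite[OF G] by (simp add: mset_sorted_set)
  have f4: "sorting_sign ?P ls * real_word par (map l ls) A = sorting_sign ?P ?L * real_word par (map l ?L) A"
    by (rule supersymmetric_map[where par = par and l = l and \<Phi> = "\<lambda>xs. real_word par xs A"])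
      (rule real_word_swap, use distinct_if_mset_set od in blast, rule f3)
  have f5: "(\<Prod>x\<leftarrow>?S. sinv (l x) (l (flip G x))) = (\<Prod>x\<in>?E. sinv (l x) (l (flip G x)))"
    using prod.distinct_set_conv_list[of ?S "\<lambda>x. sinv (l x) (l (flip G x))"] finE by simp
  have f6: "mset (concat (map h' (map c es))) = mset (edge_list (flip G) (half_edges G))"
    using mset_concat_cong[OF ms, of h'] f2 by simp
  have "sorting_sign ?P (concat (map h' (map c es)) @ ls) * (\<Prod>x\<leftarrow>map c es. ?F x) * real_word par (map l ls) A =
    (sorting_sign ?P (concat (map h' (map c es))) * (\<Prod>x\<leftarrow>map c es. ?F x)) * (sorting_sign ?P ls * real_word par (map l ls) A) *
      cross_sign ?P (mset (concat (map h' (map c es)))) (mset ls)"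
    by (simp only: sorting_sign_append mult_ac)
  also have "\<dots> = (sorting_sign ?P (edge_list (flip G) (half_edges G)) * (\<Prod>x\<in>?E. sinv (l x) (l (flip G x)))) *
      (sorting_sign ?P ?L * real_word par (map l ?L) A) * cross_sign ?P (mset (edge_list (flip G) (half_edges G))) (mset ?L)"
    by (simp only: f1 conjunct1[OF f2] f3 f4 f5 f6)
  also have "\<dots> = sorting_sign ?P (edge_list (flip G) (half_edges G) @ ?L) *
       (\<Prod>x\<in>?E. sinv (l x) (l (flip G x))) * real_word par (map l ?L) A"
    by (simp only: sorting_sign_append mult_ac)
  finally show ?thesis unfolding mapc prodc .
qed

lemma ordered_term_any:
  assumes "graph G" "l ` half_edges G \<subseteq> {..<N}" "orders G vs h es ls" "orders G vs' h' es' ls'"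
  shows "ordered_term G l vs h es ls * real_word par (map l ls) A = ordered_term G l vs' h' es' ls' * real_word par (map l ls') A"
  unfolding ordered_term_def ordered_term_vertices[OF assms] mult.assoc
  using ordered_term_edges[OF assms(1,3), of l A] ordered_term_edges[OF assms(1,4), of l A] by (simp add: mult.assoc)

section \<open>The amplitude in terms of sorting signs\<close>

abbreviation amp :: "graph \<Rightarrow> series" where "amp \<equiv> amplitude n k m (\<lambda>x. x) par \<epsilon> t"

definition labellings :: "graph \<Rightarrow> (nat \<Rightarrow> nat) set" where
  "labellings G = PiE (half_edges G) (\<lambda>x. if x \<in> legs G then {..<n} else {n..<N})"

lemma labellings_N: "l \<in> labellings G \<Longrightarrow> l ` half_edges G \<subseteq> {..<N}"
  by (auto simp: labellings_def PiE_iff split: if_splits)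

abbreviation std_term :: "graph \<Rightarrow> (nat \<Rightarrow> nat) \<Rightarrow> real" where
  "std_term G l \<equiv> ordered_term G l (sorted_list_of_set (verts G)) (vertex_half_edges G)
     (sorted_list_of_set (edge_set (flip G) (half_edges G))) (sorted_list_of_set (legs G))"

lemma std_orders:
  assumes "graph G"
  shows "orders G (sorted_list_of_set (verts G)) (vertex_half_edges G)
     (sorted_list_of_set (edge_set (flip G) (half_edges G))) (sorted_list_of_set (legs G))"
proof -
  have "mset (vertex_half_edges G v) = mset_set (fibre G v)" for v
  proof -
    have "fibre G v = {x \<in> half_edges G - legs G. root G x = v} \<union> {x \<in> legs G. root G x = v}"
      by (auto simp: fibre_def legs_def)
    moreover have "{x \<in> half_edges G - legs G. root G x = v} \<inter> {x \<in> legs G. root G x = v} = {}" by auto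
    ultimately show ?thesis using graph_finite[OF assms]
      by (simp add: vertex_half_edges_def mset_sorted_set mset_set_Union)
  qed
  moreover have "finite (edge_set (flip G) (half_edges G))" using graph_finite[OF assms] by (simp add: edge_set_def)
  ultimately show ?thesis
    using graph_finite[OF assms] graph_flip[OF assms]
    by (auto simp: orders_def mset_sorted_set edge_set_def neq_iff)
qed

lemma edge_order_eq: "edge_order G = edge_list (flip G) (half_edges G) @ sorted_list_of_set (legs G)"
  by (simp add: edge_order_def edge_list_def edge_set_def)

lemma orders_distinct:
  assumes "graph G"
  shows "mset (vertex_order G) = mset_set (half_edges G)" "mset (edge_order G) = mset_set (half_edges G)"
proof -
  show "mset (vertex_order G) = mset_set (half_edges G)"
    unfolding vertex_order_def using std_orders[OF assms]
    by (intro mset_concat_fibres[OF assms]) (auto simp: orders_def)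
  let ?\<tau> = "\<lambda>x. if x \<in> half_edges G then flip G x else x"
  have "?\<tau> \<in> involutions (half_edges G)" using graph_flip[OF assms] by (auto simp: involutions_def)
  from mset_edge_list[OF graph_finite(1)[OF assms] this]
  have *: "mset (edge_list ?\<tau> (half_edges G) @ sorted_list_of_set (leg_set ?\<tau> (half_edges G))) = mset_set (half_edges G)" .
  have E: "edge_set ?\<tau> (half_edges G) = edge_set (flip G) (half_edges G)" by (auto simp: edge_set_def)
  have "leg_set ?\<tau> (half_edges G) = legs G" by (auto simp: leg_set_def legs_def)
  moreover have "edge_list ?\<tau> (half_edges G) = edge_list (flip G) (half_edges G)"
    unfolding edge_list_def E using graph_finite[OF assms] by (intro arg_cong[where f = concat] map_cong) (auto simp: edge_set_def)
  ultimately show "mset (edge_order G) = mset_set (half_edges G)" using * by (simp add: edge_order_eq)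
qed

lemma koszul_std:
  assumes "graph G"
  shows "koszul_sign P (vertex_order G) (edge_order G) = sorting_sign P (vertex_order G) * sorting_sign P (edge_order G)"
  using orders_distinct[OF assms] by (intro koszul_sign_eq) (auto intro: distinct_if_mset_set dest: mset_eq_setD simp flip: set_mset_mset)

lemma amp_eq:
  assumes "graph G"
  shows "amp G A = (\<Sum>l\<in>labellings G. fls_const (std_term G l) * s_word par (map l (sorted_list_of_set (legs G))) A)"
proof -
  have finE: "finite (edge_set (flip G) (half_edges G))" using graph_finite[OF assms] by (simp add: edge_set_def)
  have p1: "(\<Prod>v\<leftarrow>sorted_list_of_set (verts G). F v) = (\<Prod>v\<in>verts G. F v)" for F :: "nat \<Rightarrow> real"
    using prod.distinct_set_conv_list[of "sorted_list_of_set (verts G)" F] graph_finite[OF assms] by simp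
  have p2: "(\<Prod>v\<leftarrow>sorted_list_of_set (edge_set (flip G) (half_edges G)). F v) = (\<Prod>v\<in>edge_set (flip G) (half_edges G). F v)" for F :: "nat \<Rightarrow> real"
    using prod.distinct_set_conv_list[of "sorted_list_of_set (edge_set (flip G) (half_edges G))" F] finE by simp
  show ?thesis
    unfolding amplitude_def labellings_def[symmetric]
  proof (rule sum.cong[OF refl])
    fix l
    have "koszul_sign (\<lambda>x. par (l x)) (vertex_order G) (edge_order G) *
           (\<Prod>v\<in>verts G. t (vgenus G v) (map (\<lambda>x. l x) (vertex_half_edges G v))) *
           (\<Prod>x | x \<in> half_edges G \<and> x < flip G x. sigma_inv n k m \<epsilon> (l x) (l (flip G x))) = std_term G l"
      unfolding koszul_std[OF assms] ordered_term_def p1 p2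
      by (simp add: vertex_order_def edge_order_eq edge_list_def edge_set_def sinv_def mult_ac)
    then show "fls_const (koszul_sign (\<lambda>x. par (l x)) (vertex_order G) (edge_order G) *
           (\<Prod>v\<in>verts G. t (vgenus G v) (map (\<lambda>x. l x) (vertex_half_edges G v))) *
           (\<Prod>x | x \<in> half_edges G \<and> x < flip G x. sigma_inv n k m \<epsilon> (l x) (l (flip G x)))) *
        s_word par (map l (sorted_list_of_set (legs G))) A =
      fls_const (std_term G l) * s_word par (map l (sorted_list_of_set (legs G))) A" by simp
  qed
qed

end

section \<open>Isomorphism invariance and multiplicativity\<close>

lemma precedes_map: "precedes (map \<phi> xs) a b \<longleftrightarrow> (\<exists>x y. a = \<phi> x \<and> b = \<phi> y \<and> precedes xs x y)"
proof
  assume "precedes (map \<phi> xs) a b"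
  then obtain i j where "i < j" "j < length xs" "map \<phi> xs ! i = a" "map \<phi> xs ! j = b"
    unfolding precedes_def by auto
  then show "\<exists>x y. a = \<phi> x \<and> b = \<phi> y \<and> precedes xs x y"
    unfolding precedes_def by (intro exI[of _ "xs ! i"] exI[of _ "xs ! j"]) auto
next
  assume "\<exists>x y. a = \<phi> x \<and> b = \<phi> y \<and> precedes xs x y"
  then obtain i j where "i < j" "j < length xs" "\<phi> (xs ! i) = a" "\<phi> (xs ! j) = b"
    unfolding precedes_def by auto
  then show "precedes (map \<phi> xs) a b"
    unfolding precedes_def by (intro exI[of _ i] exI[of _ j]) auto
qed

text \<open>A Koszul sign compares two words and refers to no order of the letters themselves, so an
  injective renaming preserves it.\<close>

lemma koszul_map:
  assumes inj: "inj_on \<phi> (set xs \<union> set ys)" and P: "\<And>x. x \<in> set xs \<Longrightarrow> P' (\<phi> x) = P x"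
  shows "koszul_sign P' (map \<phi> xs) (map \<phi> ys) = koszul_sign P xs ys"
proof -
  let ?S = "{(x, y). P x \<and> P y \<and> precedes xs x y \<and> precedes ys y x}"
  have "{(x, y). P' x \<and> P' y \<and> precedes (map \<phi> xs) x y \<and> precedes (map \<phi> ys) y x} = map_prod \<phi> \<phi> ` ?S"
  proof (intro equalityI subsetI)
    fix z assume "z \<in> {(x, y). P' x \<and> P' y \<and> precedes (map \<phi> xs) x y \<and> precedes (map \<phi> ys) y x}"
    then obtain a b where ab: "z = (a, b)" "P' a" "P' b" "precedes (map \<phi> xs) a b" "precedes (map \<phi> ys) b a"
      by auto
    obtain x y where xy: "a = \<phi> x" "b = \<phi> y" "precedes xs x y" using ab(4) unfolding precedes_map by blast
    obtain y' x' where xy': "b = \<phi> y'" "a = \<phi> x'" "precedes ys y' x'" using ab(5) unfolding precedes_map by blast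
    have z: "z = (\<phi> x, \<phi> y)" "P' (\<phi> x)" "P' (\<phi> y)" "precedes xs x y"
      "\<phi> y = \<phi> y'" "\<phi> x = \<phi> x'" "precedes ys y' x'"
      using ab xy xy' by simp_all
    have "x \<in> set xs" "y \<in> set xs" "x' \<in> set ys" "y' \<in> set ys" using z precedes_set by metis+
    moreover from this have "x = x'" "y = y'" using z inj by (auto dest: inj_onD)
    ultimately show "z \<in> map_prod \<phi> \<phi> ` ?S" using z P by (intro image_eqI[of _ _ "(x, y)"]) auto
  next
    fix z assume "z \<in> map_prod \<phi> \<phi> ` ?S"
    then show "z \<in> {(x, y). P' x \<and> P' y \<and> precedes (map \<phi> xs) x y \<and> precedes (map \<phi> ys) y x}"
      using P precedes_set unfolding precedes_map by fastforce
  qed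
  moreover have "inj_on (map_prod \<phi> \<phi>) ?S"
  proof (rule inj_on_subset)
    show "inj_on (map_prod \<phi> \<phi>) (set xs \<times> set xs)"
      using inj by (intro map_prod_inj_on) (simp_all add: inj_on_Un)
    show "?S \<subseteq> set xs \<times> set xs" by (auto dest: precedes_set)
  qed
  ultimately show ?thesis unfolding koszul_sign_def by (simp add: card_image)
qed

lemma is_isoD:
  assumes "is_iso G G' \<phi> \<psi>"
  shows "bij_betw \<phi> (half_edges G) (half_edges G')" "bij_betw \<psi> (verts G) (verts G')"
    "x \<in> half_edges G \<Longrightarrow> root G' (\<phi> x) = \<psi> (root G x)" "x \<in> half_edges G \<Longrightarrow> flip G' (\<phi> x) = \<phi> (flip G x)"
    "v \<in> verts G \<Longrightarrow> vgenus G' (\<psi> v) = vgenus G v"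
  using assms unfolding is_iso_def by auto

lemma is_iso_legs:
  assumes "graph G" "is_iso G G' \<phi> \<psi>" "x \<in> half_edges G"
  shows "\<phi> x \<in> legs G' \<longleftrightarrow> x \<in> legs G"
  using is_isoD(1,4)[OF assms(2)] graph_flip[OF assms(1,3)] assms(3)
  by (auto simp: legs_def bij_betw_def inj_on_eq_iff)

context feynman
begin

text \<open>An isomorphism need not be monotone. It takes the standard orders of \<open>G\<close> to
  valid orders on \<open>G'\<close>, which in general are not the standard ones.\<close>

lemma iso_orders:
  assumes G: "graph G" "graph G'" and iso: "is_iso G G' \<phi> \<psi>"
  shows "orders G' (map \<psi> (sorted_list_of_set (verts G)))
     (\<lambda>v. map \<phi> (vertex_half_edges G (inv_into (verts G) \<psi> v)))
     (map \<phi> (sorted_list_of_set (edge_set (flip G) (half_edges G))))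
     (map \<phi> (sorted_list_of_set (legs G)))"
proof -
  note D = is_isoD[OF iso]
  note S = std_orders[OF G(1), unfolded orders_def]
  have im: "\<phi> ` half_edges G = half_edges G'" "\<psi> ` verts G = verts G'" "inj_on \<phi> (half_edges G)" "inj_on \<psi> (verts G)"
    using D(1,2) by (auto simp: bij_betw_def)
  have injA: "inj_on \<phi> A" if "A \<subseteq> half_edges G" for A using im(3) that by (rule inj_on_subset)
  have E: "edge_set (flip G) (half_edges G) \<subseteq> half_edges G" "finite (edge_set (flip G) (half_edges G))"
    using graph_finite[OF G(1)] by (auto simp: edge_set_def)
  have L: "legs G \<subseteq> half_edges G" by (auto simp: legs_def)
  show ?thesis
    unfolding orders_def
  proof (intro conjI ballI impI)
    show "mset (map \<psi> (sorted_list_of_set (verts G))) = mset_set (verts G')"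
      using im graph_finite[OF G(1)] by (simp add: mset_sorted_set image_mset_mset_set)
    show "distinct (map \<phi> (sorted_list_of_set (edge_set (flip G) (half_edges G))))"
      using injA[OF E(1)] E(2) by (simp add: distinct_map)
    have "\<phi> ` legs G = legs G'"
      using is_iso_legs[OF G(1) iso] im(1) L by (auto simp: legs_def image_iff) (metis imageE)
    then show "mset (map \<phi> (sorted_list_of_set (legs G))) = mset_set (legs G')"
      using injA[OF L] graph_finite[OF G(1)] by (simp add: mset_sorted_set image_mset_mset_set)
  next
    fix v' assume "v' \<in> verts G'"
    hence "v' \<in> \<psi> ` verts G" using im(2) by simp
    then obtain v where v: "v \<in> verts G" "v' = \<psi> v" by blast
    have "fibre G' v' = \<phi> ` fibre G v"
    proof (intro equalityI subsetI)
      fix y assume "y \<in> fibre G' v'"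
      hence "y \<in> \<phi> ` half_edges G" and ry: "root G' y = \<psi> v" using im(1) v by (auto simp: fibre_def)
      then obtain x where x: "x \<in> half_edges G" "y = \<phi> x" "root G' y = \<psi> v" by blast
      hence "\<psi> (root G x) = \<psi> v" using D(3) by simp
      moreover have "root G x \<in> verts G" using x(1) G(1) by (auto simp: graph_def)
      ultimately have "root G x = v" using im(4) v(1) by (auto dest: inj_onD)
      then show "y \<in> \<phi> ` fibre G v" using x by (auto simp: fibre_def)
    qed (use D(3) im(1) v in \<open>auto simp: fibre_def\<close>)
    moreover have "inj_on \<phi> (fibre G v)" by (rule injA) (auto simp: fibre_def)
    ultimately show "mset (map \<phi> (vertex_half_edges G (inv_into (verts G) \<psi> v'))) = mset_set (fibre G' v')"
      using S v im(4) by (simp add: image_mset_mset_set)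
  next
    fix y assume "y \<in> set (map \<phi> (sorted_list_of_set (edge_set (flip G) (half_edges G))))"
    then obtain x where x: "x \<in> edge_set (flip G) (half_edges G)" "y = \<phi> x" using E by auto
    have xJ: "x \<in> half_edges G" "flip G x \<in> half_edges G" "flip G x \<noteq> x" "flip G x \<notin> edge_set (flip G) (half_edges G)"
      using x graph_flip[OF G(1)] by (auto simp: edge_set_def)
    show "y \<in> half_edges G'" using x xJ im by auto
    show "flip G' y \<noteq> y" using x xJ D(4) im(3) by (auto dest: inj_onD)
    show "flip G' y \<notin> set (map \<phi> (sorted_list_of_set (edge_set (flip G) (half_edges G))))"
    proof
      assume "flip G' y \<in> set (map \<phi> (sorted_list_of_set (edge_set (flip G) (half_edges G))))"
      then obtain z where "z \<in> edge_set (flip G) (half_edges G)" "\<phi> (flip G x) = \<phi> z" using E x xJ D(4) by auto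
      then show False using xJ im(3) E(1) by (metis inj_onD subsetD)
    qed
  next
    fix y assume "y \<in> half_edges G'" "flip G' y \<noteq> y"
    then obtain x where x: "x \<in> half_edges G" "y = \<phi> x" "flip G x \<noteq> x" using im D(4) by force
    hence "x \<in> edge_set (flip G) (half_edges G) \<or> flip G x \<in> edge_set (flip G) (half_edges G)"
      using S E(2) by auto
    then show "y \<in> set (map \<phi> (sorted_list_of_set (edge_set (flip G) (half_edges G)))) \<or>
       flip G' y \<in> set (map \<phi> (sorted_list_of_set (edge_set (flip G) (half_edges G))))"
      using x D(4) E(2) by auto
  qed
qed

text \<open>Labellings of \<open>G'\<close> are pulled back along \<phi>, and order independence
  allows the amplitude of \<open>G'\<close> to be computed with the transported orders.\<close>

theorem amp_iso:
  assumes G: "graph G" "graph G'" and iso: "is_iso G G' \<phi> \<psi>"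
  shows "amp G' A = amp G A"
proof -
  note D = is_isoD[OF iso]
  let ?J = "half_edges G" and ?J' = "half_edges G'"
  let ?V = "sorted_list_of_set (verts G)" and ?E = "sorted_list_of_set (edge_set (flip G) (half_edges G))"
    and ?L = "sorted_list_of_set (legs G)" and ?L' = "sorted_list_of_set (legs G')"
  let ?h = "\<lambda>v. map \<phi> (vertex_half_edges G (inv_into (verts G) \<psi> v))"
  have im: "\<phi> ` ?J = ?J'" "inj_on \<phi> ?J" "inj_on \<psi> (verts G)" using D(1,2) by (auto simp: bij_betw_def)
  have leg: "\<phi> x \<in> legs G' \<longleftrightarrow> x \<in> legs G" if "x \<in> ?J" for x using is_iso_legs[OF G(1) iso that] .
  have E: "set ?E \<subseteq> ?J" "set ?L \<subseteq> ?J" "set ?V = verts G" using graph_finite[OF G(1)] by (auto simp: edge_set_def legs_def)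
  have vh: "set (vertex_half_edges G v) \<subseteq> ?J" for v
    using graph_finite[OF G(1)] by (auto simp: vertex_half_edges_def legs_def)
  have vo: "set (vertex_order G) = ?J" "set (edge_order G) = ?J"
    using orders_distinct[OF G(1)] graph_finite(1)[OF G(1)] by (metis finite_set_mset_mset_set set_mset_mset)+
  show ?thesis unfolding amp_eq[OF G(1)] amp_eq[OF G(2)]
  proof (rule sum.reindex_bij_witness[where j = "\<lambda>l'. restrict (\<lambda>x. l' (\<phi> x)) ?J" and i = "\<lambda>l. restrict (\<lambda>y. l (inv_into ?J \<phi> y)) ?J'"])
    fix l' assume l': "l' \<in> labellings G'"
    let ?l = "restrict (\<lambda>x. l' (\<phi> x)) ?J"
    have "l' (\<phi> x) \<in> (if x \<in> legs G then {..<n} else {n..<N})" if "x \<in> ?J" for x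
    proof -
      have "\<phi> x \<in> ?J'" using im(1) that by blast
      hence "l' (\<phi> x) \<in> (if \<phi> x \<in> legs G' then {..<n} else {n..<N})"
        using l' unfolding labellings_def PiE_iff by blast
      then show ?thesis using leg[OF that] by simp
    qed
    then show "?l \<in> labellings G" unfolding labellings_def by (intro PiE_I) auto
    show "restrict (\<lambda>y. ?l (inv_into ?J \<phi> y)) ?J' = l'"
    proof
      fix y show "restrict (\<lambda>y. ?l (inv_into ?J \<phi> y)) ?J' y = l' y"
        using l' im(1) by (auto simp: labellings_def PiE_iff extensional_def inv_into_into f_inv_into_f)
    qed
    have m: "map l' (map \<phi> xs) = map ?l xs" if "set xs \<subseteq> ?J" for xs using that by auto
    have vs: "map ?h (map \<psi> ?V) = map (\<lambda>v. map \<phi> (vertex_half_edges G v)) ?V"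
      using im(3) E(3) by auto
    have c1: "concat (map ?h (map \<psi> ?V)) = map \<phi> (vertex_order G)"
      unfolding vs vertex_order_def by (simp add: map_concat comp_def)
    have c2: "concat (map (\<lambda>x. [x, flip G' x]) (map \<phi> ?E)) @ map \<phi> ?L = map \<phi> (edge_order G)"
    proof -
      have "map (\<lambda>x. [x, flip G' x]) (map \<phi> ?E) = map (\<lambda>x. [\<phi> x, \<phi> (flip G x)]) ?E" using E(1) D(4) by auto
      moreover have "map (\<lambda>x. [x, flip G' x]) (map \<phi> ?E) = map (\<lambda>x. [\<phi> x, flip G' (\<phi> x)]) ?E" by simp
      ultimately have e: "concat (map (\<lambda>x. [x, flip G' x]) (map \<phi> ?E)) = concat (map (\<lambda>x. [\<phi> x, \<phi> (flip G x)]) ?E)" by metis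
      show ?thesis unfolding edge_order_eq edge_list_def e by (simp add: map_concat comp_def)
    qed
    have d: "distinct (vertex_order G)" "distinct (edge_order G)"
      using orders_distinct[OF G(1)] by (auto intro: distinct_if_mset_set)
    \<comment> \<open>A map that is not monotone may change each of the two sorting signs. Their
      product is a Koszul sign and stays the same.\<close>
    have "sorting_sign (\<lambda>x. par (l' x)) (map \<phi> (vertex_order G)) * sorting_sign (\<lambda>x. par (l' x)) (map \<phi> (edge_order G)) =
       koszul_sign (\<lambda>x. par (l' x)) (map \<phi> (vertex_order G)) (map \<phi> (edge_order G))"
      by (rule koszul_sign_eq[symmetric]) (use d vo im(2) in \<open>auto simp: distinct_map\<close>)
    also have "\<dots> = koszul_sign (\<lambda>x. par (?l x)) (vertex_order G) (edge_order G)"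
      by (rule koszul_map) (use vo im(2) in auto)
    also have "\<dots> = sorting_sign (\<lambda>x. par (?l x)) (vertex_order G) * sorting_sign (\<lambda>x. par (?l x)) (edge_order G)"
      by (rule koszul_sign_eq) (use d vo in auto)
    finally have sg: "sorting_sign (\<lambda>x. par (l' x)) (map \<phi> (vertex_order G)) * sorting_sign (\<lambda>x. par (l' x)) (map \<phi> (edge_order G)) =
      sorting_sign (\<lambda>x. par (?l x)) (vertex_order G) * sorting_sign (\<lambda>x. par (?l x)) (edge_order G)" .
    have p1: "(\<Prod>v\<leftarrow>map \<psi> ?V. t (vgenus G' v) (map l' (?h v))) = (\<Prod>v\<leftarrow>?V. t (vgenus G v) (map ?l (vertex_half_edges G v)))"
    proof -
      have "t (vgenus G' (\<psi> v)) (map l' (?h (\<psi> v))) = t (vgenus G v) (map ?l (vertex_half_edges G v))" if "v \<in> verts G" for v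
        using that D(5) im(3) by (simp add: m[OF vh, of v] del: map_map)
      then show ?thesis using E(3) by (auto intro!: arg_cong[where f = prod_list])
    qed
    have p2: "(\<Prod>x\<leftarrow>map \<phi> ?E. sinv (l' x) (l' (flip G' x))) = (\<Prod>x\<leftarrow>?E. sinv (?l x) (?l (flip G x)))"
    proof -
      have "sinv (l' (\<phi> x)) (l' (flip G' (\<phi> x))) = sinv (?l x) (?l (flip G x))" if "x \<in> set ?E" for x
        using that E(1) D(4) graph_flip[OF G(1)] by auto
      then show ?thesis by (auto intro!: arg_cong[where f = prod_list])
    qed
    have "std_term G' l' * real_word par (map l' ?L') A =
      ordered_term G' l' (map \<psi> ?V) ?h (map \<phi> ?E) (map \<phi> ?L) * real_word par (map l' (map \<phi> ?L)) A"
      by (rule ordered_term_any[OF G(2) labellings_N[OF l'] std_orders[OF G(2)] iso_orders[OF G iso]])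
    also have "ordered_term G' l' (map \<psi> ?V) ?h (map \<phi> ?E) (map \<phi> ?L) = std_term G ?l"
    proof -
      have "(a * p) * (b * q) = (a' * p) * (b' * q)" if "a * b = a' * b'" for a b a' b' p q :: real
        using that by (metis mult.assoc mult.commute mult.left_commute)
      from this[OF sg] show ?thesis
        unfolding ordered_term_def c1 c2 p1 p2 by (simp only: vertex_order_def edge_order_eq edge_list_def)
    qed
    finally show "fls_const (std_term G ?l) * s_word par (map ?l ?L) A = fls_const (std_term G' l') * s_word par (map l' ?L') A"
      unfolding m[OF E(2)] by (simp add: s_word_real)
  next
    fix l assume l: "l \<in> labellings G"
    let ?l' = "restrict (\<lambda>y. l (inv_into ?J \<phi> y)) ?J'"
    show "restrict (\<lambda>x. ?l' (\<phi> x)) ?J = l"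
    proof
      fix x show "restrict (\<lambda>x. ?l' (\<phi> x)) ?J x = l x"
        using l im by (auto simp: labellings_def PiE_iff extensional_def)
    qed
    show "?l' \<in> labellings G'"
      unfolding labellings_def
    proof (rule PiE_I)
      fix y assume "y \<in> ?J'"
      then obtain x where x: "x \<in> ?J" "y = \<phi> x" using im(1) by auto
      hence "?l' y = l x" using im by auto
      then show "?l' y \<in> (if y \<in> legs G' then {..<n} else {n..<N})"
        using l x leg unfolding labellings_def by (auto simp: PiE_iff)
    qed auto
  qed
qed

text \<open>With concatenated orders, the vertex side and the edge side acquire the same
  \<open>cross_sign\<close> between the half-edges of \<open>G1\<close> and those of
  \<open>G2\<close>; being a sign, it cancels.\<close>

theorem amp_union:
  assumes G: "graph G" "graph G1" "graph G2"
    and J: "half_edges G = half_edges G1 \<union> half_edges G2" "half_edges G1 \<inter> half_edges G2 = {}"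
    and V: "verts G = verts G1 \<union> verts G2" "verts G1 \<inter> verts G2 = {}"
    and r: "\<And>x. x \<in> half_edges G1 \<Longrightarrow> root G x = root G1 x \<and> flip G x = flip G1 x"
      "\<And>x. x \<in> half_edges G2 \<Longrightarrow> root G x = root G2 x \<and> flip G x = flip G2 x"
    and g: "\<And>v. v \<in> verts G1 \<Longrightarrow> vgenus G v = vgenus G1 v" "\<And>v. v \<in> verts G2 \<Longrightarrow> vgenus G v = vgenus G2 v"
  shows "amp G A = s_mult par (amp G1) (amp G2) A"
proof -
  let ?V1 = "sorted_list_of_set (verts G1)" and ?V2 = "sorted_list_of_set (verts G2)"
  let ?E1 = "sorted_list_of_set (edge_set (flip G1) (half_edges G1))" and ?E2 = "sorted_list_of_set (edge_set (flip G2) (half_edges G2))"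
  let ?L1 = "sorted_list_of_set (legs G1)" and ?L2 = "sorted_list_of_set (legs G2)" and ?L = "sorted_list_of_set (legs G)"
  let ?J1 = "half_edges G1" and ?J2 = "half_edges G2"
  note O1 = std_orders[OF G(2), unfolded orders_def] and O2 = std_orders[OF G(3), unfolded orders_def]
  have legs: "legs G = legs G1 \<union> legs G2" using J r by (auto simp: legs_def)
  have fib: "fibre G v = fibre G1 v" if "v \<in> verts G1" for v
    using that J r V G(3) by (auto simp: fibre_def graph_def)
  have fib2: "fibre G v = fibre G2 v" if "v \<in> verts G2" for v
    using that J r V G(2) by (auto simp: fibre_def graph_def)
  let ?h = "\<lambda>v. if v \<in> verts G1 then vertex_half_edges G1 v else vertex_half_edges G2 v"
  have fl1: "flip G1 x \<in> ?J1" if "x \<in> ?J1" for x using graph_flip[OF G(2) that] by simp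
  have fl2: "flip G2 x \<in> ?J2" if "x \<in> ?J2" for x using graph_flip[OF G(3) that] by simp
  have S1: "set ?E1 \<subseteq> ?J1" "set ?L1 \<subseteq> ?J1" "set ?V1 = verts G1" using graph_finite[OF G(2)] by (auto simp: edge_set_def legs_def)
  have S2: "set ?E2 \<subseteq> ?J2" "set ?L2 \<subseteq> ?J2" "set ?V2 = verts G2" using graph_finite[OF G(3)] by (auto simp: edge_set_def legs_def)
  have ord: "orders G (?V1 @ ?V2) ?h (?E1 @ ?E2) (?L1 @ ?L2)"
    unfolding orders_def
  proof (intro conjI ballI impI)
    show "mset (?V1 @ ?V2) = mset_set (verts G)"
      using V graph_finite[OF G(2)] graph_finite[OF G(3)] by (simp add: mset_sorted_set mset_set_Union)
    show "mset (?L1 @ ?L2) = mset_set (legs G)"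
      unfolding legs using J(2) graph_finite[OF G(2)] graph_finite[OF G(3)]
      by (subst mset_set_Union) (auto simp: mset_sorted_set legs_def)
    show "distinct (?E1 @ ?E2)" using S1 S2 J(2) by auto
    fix v assume "v \<in> verts G"
    then show "mset (?h v) = mset_set (fibre G v)" using O1 O2 V fib fib2 by auto
  next
    fix x assume x: "x \<in> set (?E1 @ ?E2)"
    then show "x \<in> half_edges G" using S1 S2 J by auto
    show "flip G x \<noteq> x" using x O1 O2 r S1(1) S2(1) by (auto simp del: set_sorted_list_of_set; metis subsetD)
    show "flip G x \<notin> set (?E1 @ ?E2)"
    proof (cases "x \<in> set ?E1")
      case True
      hence "flip G x = flip G1 x" "x \<in> ?J1" using r S1 by blast+
      then show ?thesis using True O1 S2(1) J(2) fl1 by (metis disjoint_iff set_append subsetD UnE)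
    next
      case False
      hence "x \<in> set ?E2" using x by simp
      hence "flip G x = flip G2 x" "x \<in> ?J2" using r S2 by blast+
      then show ?thesis using \<open>x \<in> set ?E2\<close> O2 S1(1) J(2) fl2 by (metis disjoint_iff set_append subsetD UnE)
    qed
  next
    fix x assume "x \<in> half_edges G" "flip G x \<noteq> x"
    then show "x \<in> set (?E1 @ ?E2) \<or> flip G x \<in> set (?E1 @ ?E2)"
      using O1 O2 r J(1) by (metis UnE Un_iff set_append)
  qed
  define comb where "comb l1 l2 = (\<lambda>x. if x \<in> ?J1 then l1 x else l2 x)" for l1 l2 :: "nat \<Rightarrow> nat"
  have main: "std_term G l * real_word par (map l ?L) A =
      std_term G1 l1 * std_term G2 l2 * real_word par (map l1 ?L1 @ map l2 ?L2) A"
    if l: "l = comb l1 l2" "l \<in> labellings G" for l l1 l2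
  proof -
    let ?P = "\<lambda>x. par (l x)"
    have m1: "map l xs = map l1 xs" if "set xs \<subseteq> ?J1" for xs using that by (auto simp: l comb_def)
    have m2: "map l xs = map l2 xs" if "set xs \<subseteq> ?J2" for xs using that J(2) by (auto simp: l comb_def)
    have s1: "sorting_sign ?P xs = sorting_sign (\<lambda>x. par (l1 x)) xs" if "set xs \<subseteq> ?J1" for xs
      by (rule sorting_sign_cong) (use that in \<open>auto simp: l comb_def\<close>)
    have s2: "sorting_sign ?P xs = sorting_sign (\<lambda>x. par (l2 x)) xs" if "set xs \<subseteq> ?J2" for xs
      by (rule sorting_sign_cong) (use that J(2) in \<open>auto simp: l comb_def\<close>)
    have vo: "set (vertex_order G1) = ?J1" "set (edge_order G1) = ?J1" "set (vertex_order G2) = ?J2" "set (edge_order G2) = ?J2"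
      using orders_distinct[OF G(2)] orders_distinct[OF G(3)] graph_finite(1)[OF G(2)] graph_finite(1)[OF G(3)]
      by (metis finite_set_mset_mset_set set_mset_mset)+
    have vs: "concat (map ?h (?V1 @ ?V2)) = vertex_order G1 @ vertex_order G2"
    proof -
      have "map ?h ?V1 = map (vertex_half_edges G1) ?V1" using S1 by auto
      moreover have "map ?h ?V2 = map (vertex_half_edges G2) ?V2" using S2 V(2) by auto
      ultimately show ?thesis by (simp only: vertex_order_def map_append concat_append)
    qed
    have vh: "set (vertex_half_edges G1 v) \<subseteq> ?J1" "set (vertex_half_edges G2 v) \<subseteq> ?J2" for v
      using graph_finite[OF G(2)] graph_finite[OF G(3)] by (auto simp: vertex_half_edges_def legs_def)
    have tv: "(\<Prod>v\<leftarrow>?V1 @ ?V2. t (vgenus G v) (map l (?h v))) =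
      (\<Prod>v\<leftarrow>?V1. t (vgenus G1 v) (map l1 (vertex_half_edges G1 v))) * (\<Prod>v\<leftarrow>?V2. t (vgenus G2 v) (map l2 (vertex_half_edges G2 v)))"
    proof -
      have "t (vgenus G v) (map l (?h v)) = t (vgenus G1 v) (map l1 (vertex_half_edges G1 v))" if "v \<in> set ?V1" for v
        using that g S1(3) by (simp add: m1[OF vh(1)])
      moreover have "t (vgenus G v) (map l (?h v)) = t (vgenus G2 v) (map l2 (vertex_half_edges G2 v))" if "v \<in> set ?V2" for v
      proof -
        have "v \<in> verts G2" "v \<notin> verts G1" using that S2(3) V(2) by blast+
        then show ?thesis using g(2) by (simp add: m2[OF vh(2)])
      qed
      ultimately have "map (\<lambda>v. t (vgenus G v) (map l (?h v))) ?V1 = map (\<lambda>v. t (vgenus G1 v) (map l1 (vertex_half_edges G1 v))) ?V1"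
        "map (\<lambda>v. t (vgenus G v) (map l (?h v))) ?V2 = map (\<lambda>v. t (vgenus G2 v) (map l2 (vertex_half_edges G2 v))) ?V2"
        by (metis (no_types, lifting) map_cong)+
      then show ?thesis by (simp only: map_append prod_list.append)
    qed
    have sv: "(\<Prod>x\<leftarrow>?E1 @ ?E2. sinv (l x) (l (flip G x))) =
      (\<Prod>x\<leftarrow>?E1. sinv (l1 x) (l1 (flip G1 x))) * (\<Prod>x\<leftarrow>?E2. sinv (l2 x) (l2 (flip G2 x)))"
    proof -
      have "sinv (l x) (l (flip G x)) = sinv (l1 x) (l1 (flip G1 x))" if "x \<in> set ?E1" for x
      proof -
        have "x \<in> ?J1" using that S1 by blast
        then show ?thesis using r(1) fl1 by (simp add: l comb_def)
      qed
      moreover have "sinv (l x) (l (flip G x)) = sinv (l2 x) (l2 (flip G2 x))" if "x \<in> set ?E2" for x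
      proof -
        have x: "x \<in> ?J2" using that S2 by blast
        hence "x \<notin> ?J1" "flip G2 x \<notin> ?J1" using fl2 J(2) by blast+
        then show ?thesis using r(2)[OF x] by (simp add: l comb_def)
      qed
      ultimately have "map (\<lambda>x. sinv (l x) (l (flip G x))) ?E1 = map (\<lambda>x. sinv (l1 x) (l1 (flip G1 x))) ?E1"
        "map (\<lambda>x. sinv (l x) (l (flip G x))) ?E2 = map (\<lambda>x. sinv (l2 x) (l2 (flip G2 x))) ?E2"
        by (metis (no_types, lifting) map_cong)+
      then show ?thesis by (simp only: map_append prod_list.append)
    qed
    let ?e1 = "edge_list (flip G1) ?J1" and ?e2 = "edge_list (flip G2) ?J2"
    have el: "concat (map (\<lambda>x. [x, flip G x]) (?E1 @ ?E2)) = ?e1 @ ?e2"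
    proof -
      have "map (\<lambda>x. [x, flip G x]) ?E1 = map (\<lambda>x. [x, flip G1 x]) ?E1" using S1(1) r(1) by (intro map_cong) blast+
      moreover have "map (\<lambda>x. [x, flip G x]) ?E2 = map (\<lambda>x. [x, flip G2 x]) ?E2" using S2(1) r(2) by (intro map_cong) blast+
      ultimately show ?thesis by (simp only: edge_list_def map_append concat_append)
    qed
    have ml: "map l (?L1 @ ?L2) = map l1 ?L1 @ map l2 ?L2" using m1[OF S1(2)] m2[OF S2(2)] by simp
    let ?c = "cross_sign ?P (mset_set ?J1) (mset_set ?J2)"
    have sgv: "sorting_sign ?P (vertex_order G1 @ vertex_order G2) = sorting_sign (\<lambda>x. par (l1 x)) (vertex_order G1) * sorting_sign (\<lambda>x. par (l2 x)) (vertex_order G2) * ?c"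
      unfolding sorting_sign_append orders_distinct(1)[OF G(2)] orders_distinct(1)[OF G(3)] using s1 s2 vo by simp
    \<comment> \<open>The edges of \<open>G2\<close> have to pass the legs of \<open>G1\<close>.
      This costs no sign as long as no edge factor of \<open>G2\<close> vanishes.\<close>
    have sge: "sorting_sign ?P ((?e1 @ ?e2) @ (?L1 @ ?L2)) = sorting_sign (\<lambda>x. par (l1 x)) (?e1 @ ?L1) * sorting_sign (\<lambda>x. par (l2 x)) (?e2 @ ?L2) * ?c"
      if nz: "(\<Prod>x\<leftarrow>?E2. sinv (l2 x) (l2 (flip G2 x))) \<noteq> 0"
    proof -
      have "par (l (flip G2 x)) = par (l x)" if "x \<in> set ?E2" for x
      proof -
        have "sinv (l2 x) (l2 (flip G2 x)) \<noteq> 0" using nz that by (auto simp: prod_list_zero_iff)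
        hence "par (l2 x) = par (l2 (flip G2 x))" by (rule sinv_par)
        moreover have "x \<in> ?J2" using that S2 by blast
        moreover from this have "x \<notin> ?J1" "flip G2 x \<notin> ?J1" using fl2 J(2) by blast+
        ultimately show ?thesis by (simp add: l comb_def)
      qed
      hence ev: "even (odd_count ?P (mset ?e2))" unfolding edge_list_def by (intro odd_count_even_pairs) auto
      have "set ?e2 \<subseteq> ?J2" "set ?L1 \<subseteq> ?J1" using vo S1 unfolding edge_order_eq by auto
      hence "cross_sign ?P (mset ?e2) (mset ?L1) = cross_sign ?P (mset ?L1) (mset ?e2)"
        using ev J(2) by (intro cross_sign_swap_even) auto
      hence *: "sorting_sign ?P ((?e1 @ ?e2) @ (?L1 @ ?L2)) = sorting_sign ?P (?e1 @ ?L1) * sorting_sign ?P (?e2 @ ?L2) * cross_sign ?P (mset (?e1 @ ?L1)) (mset (?e2 @ ?L2))"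
        by (simp add: sorting_sign_append cross_sign_union mult_ac)
      have q: "sorting_sign ?P (edge_order G1) = sorting_sign (\<lambda>x. par (l1 x)) (edge_order G1)"
        "sorting_sign ?P (edge_order G2) = sorting_sign (\<lambda>x. par (l2 x)) (edge_order G2)"
        by (rule s1, simp add: vo) (rule s2, simp add: vo)
      show ?thesis
        unfolding * using q orders_distinct(2)[OF G(2)] orders_distinct(2)[OF G(3)] by (simp only: edge_order_eq)
    qed
    have "std_term G l * real_word par (map l ?L) A =
      ordered_term G l (?V1 @ ?V2) ?h (?E1 @ ?E2) (?L1 @ ?L2) * real_word par (map l (?L1 @ ?L2)) A"
      by (rule ordered_term_any[OF G(1) labellings_N[OF l(2)] std_orders[OF G(1)] ord])
    also have "ordered_term G l (?V1 @ ?V2) ?h (?E1 @ ?E2) (?L1 @ ?L2) = std_term G1 l1 * std_term G2 l2"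
    proof (cases "(\<Prod>x\<leftarrow>?E2. sinv (l2 x) (l2 (flip G2 x))) = 0")
      case True
      then show ?thesis unfolding ordered_term_def sv by simp
    next
      case False
      have c: "?c * ?c = 1" by (rule cross_sign_square)
      have "ordered_term G l (?V1 @ ?V2) ?h (?E1 @ ?E2) (?L1 @ ?L2) = (?c * ?c) * (std_term G1 l1 * std_term G2 l2)"
        unfolding ordered_term_def vs tv el sv sgv sge[OF False] by (simp only: vertex_order_def edge_list_def mult_ac)
      then show ?thesis unfolding c by simp
    qed
    finally show ?thesis unfolding ml .
  qed
  have a: "amp G1 = (\<lambda>A. \<Sum>l\<in>labellings G1. fls_const (std_term G1 l) * s_word par (map l ?L1) A)"
    "amp G2 = (\<lambda>A. \<Sum>l\<in>labellings G2. fls_const (std_term G2 l) * s_word par (map l ?L2) A)"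
    using amp_eq[OF G(2)] amp_eq[OF G(3)] by blast+
  have "s_mult par (amp G1) (amp G2) A = (\<Sum>l1\<in>labellings G1. \<Sum>l2\<in>labellings G2.
     fls_const (std_term G1 l1 * std_term G2 l2 * real_word par (map l1 ?L1 @ map l2 ?L2) A))"
    unfolding a s_mult_sum_left s_mult_sum_right s_mult_word sum_distrib_left
    by (simp add: s_word_real mult.assoc)
  also have "\<dots> = (\<Sum>(l1, l2)\<in>labellings G1 \<times> labellings G2.
     fls_const (std_term G1 l1 * std_term G2 l2 * real_word par (map l1 ?L1 @ map l2 ?L2) A))"
    by (rule sum.cartesian_product)
  also have "\<dots> = (\<Sum>l\<in>labellings G. fls_const (std_term G l) * s_word par (map l ?L) A)"
  proof (rule sum.reindex_bij_witness[where j = "\<lambda>(l1, l2). comb l1 l2" and i = "\<lambda>l. (restrict l ?J1, restrict l ?J2)"])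
    fix z assume "z \<in> labellings G1 \<times> labellings G2"
    then obtain l1 l2 where z: "z = (l1, l2)" "l1 \<in> labellings G1" "l2 \<in> labellings G2" by auto
    have lg: "x \<in> legs G \<longleftrightarrow> x \<in> legs G1" if "x \<in> ?J1" for x using that J(2) unfolding legs by (auto simp: legs_def)
    have lg2: "x \<in> legs G \<longleftrightarrow> x \<in> legs G2" if "x \<in> ?J2" for x using that J(2) unfolding legs by (auto simp: legs_def)
    have lab: "comb l1 l2 \<in> labellings G"
      using z lg lg2 J unfolding labellings_def comb_def PiE_iff extensional_def by auto
    then show "(case z of (l1, l2) \<Rightarrow> comb l1 l2) \<in> labellings G" using z by simp
    show "(restrict (case z of (l1, l2) \<Rightarrow> comb l1 l2) ?J1, restrict (case z of (l1, l2) \<Rightarrow> comb l1 l2) ?J2) = z"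
      using z J(2) unfolding labellings_def comb_def PiE_iff extensional_def restrict_def
      by (auto simp: fun_eq_iff)
    show "fls_const (std_term G (case z of (l1, l2) \<Rightarrow> comb l1 l2)) * s_word par (map (case z of (l1, l2) \<Rightarrow> comb l1 l2) ?L) A =
      (case z of (l1, l2) \<Rightarrow> fls_const (std_term G1 l1 * std_term G2 l2 * real_word par (map l1 ?L1 @ map l2 ?L2) A))"
      using main[OF refl lab] by (simp add: z(1) s_word_real)
  next
    fix l assume l: "l \<in> labellings G"
    show "(case (restrict l ?J1, restrict l ?J2) of (l1, l2) \<Rightarrow> comb l1 l2) = l"
      using l J unfolding labellings_def comb_def PiE_iff extensional_def restrict_def by (auto simp: fun_eq_iff)
    have lg: "x \<in> legs G \<longleftrightarrow> x \<in> legs G1" if "x \<in> ?J1" for x using that J(2) unfolding legs by (auto simp: legs_def)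
    have lg2: "x \<in> legs G \<longleftrightarrow> x \<in> legs G2" if "x \<in> ?J2" for x using that J(2) unfolding legs by (auto simp: legs_def)
    show "(restrict l ?J1, restrict l ?J2) \<in> labellings G1 \<times> labellings G2"
    proof -
      have "l x \<in> (if x \<in> legs G1 then {..<n} else {n..<N})" if "x \<in> ?J1" for x
        using l J(1) lg[OF that] that unfolding labellings_def PiE_iff by (metis UnI1)
      moreover have "l x \<in> (if x \<in> legs G2 then {..<n} else {n..<N})" if "x \<in> ?J2" for x
        using l J(1) lg2[OF that] that unfolding labellings_def PiE_iff by (metis UnI2)
      ultimately show ?thesis unfolding labellings_def by (auto intro!: PiE_I simp del: if_split_mem1 split del: if_split)
    qed
  qed
  finally show ?thesis using amp_eq[OF G(1)] by simp
qed

end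

section \<open>Powers of the vertex function as sums over labelled graphs\<close>

text \<open>Negative exponents occur because a vertex of genus \<open>g\<close> contributes
  \<open>hbar^(g-1)\<close>.\<close>

definition hbar_power :: "int \<Rightarrow> real fls" where "hbar_power j = fls_shift (-j) 1"

lemma hbar_power_mult_nth: "fls_nth (hbar_power j * F) e = fls_nth F (e - j)" "fls_nth (F * hbar_power j) e = fls_nth F (e - j)"
  by (simp_all add: hbar_power_def fls_X_intpow_times_conv_shift)

lemma hbar_power_nth: "fls_nth (hbar_power j) e = (if e = j then 1 else 0)"
  by (simp add: hbar_power_def)

lemma hbar_power_add: "hbar_power (i + j) = hbar_power i * hbar_power j"
  by (simp add: hbar_power_def fls_X_intpow_times_fls_X_intpow)

lemma hbar_power_0 [simp]: "hbar_power 0 = 1"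
  by (simp add: hbar_power_def)

lemma hbar_power_sum: "finite I \<Longrightarrow> hbar_power (\<Sum>i\<in>I. a i) = (\<Prod>i\<in>I. hbar_power (a i))"
  by (induction I rule: finite_induct) (auto simp: hbar_power_add)

lemma hbar_power_power: "fls_X ^ j = hbar_power (int j)"
  by (simp add: hbar_power_def fls_X_power_conv_shift_1)

lemma fls_const_prod: "finite I \<Longrightarrow> (\<Prod>i\<in>I. fls_const (c i)) = fls_const (\<Prod>i\<in>I. c i :: real)"
  by (induction I rule: finite_induct) auto

text \<open>Such maps are the words of length \<open>h\<close> in which each \<open>v\<close> occurs
  \<open>c v\<close> times, so a multinomial coefficient counts them.\<close>

lemma card_functions_with_fibres:
  fixes c :: "nat \<Rightarrow> nat" and r h :: nat
  assumes "(\<Sum>v<r. c v) = h"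
  shows "card {\<rho> \<in> {..<h} \<rightarrow>\<^sub>E {..<r}. \<forall>v<r. card {x \<in> {..<h}. \<rho> x = v} = c v} * (\<Prod>v<r. fact (c v)) = (fact h :: nat)"
proof -
  define M where "M = (\<Sum>v<r. replicate_mset (c v) v)"
  have cM: "count M v = (if v < r then c v else 0)" for v
    unfolding M_def by (induction r) (auto simp: less_Suc_eq)
  have sM: "size M = h" unfolding M_def using assms by simp
  have setM: "set_mset M = {v. v < r \<and> c v > 0}"
    by (auto simp flip: count_greater_zero_iff simp: cM split: if_splits)
  let ?R = "{\<rho> \<in> {..<h} \<rightarrow>\<^sub>E {..<r}. \<forall>v<r. card {x \<in> {..<h}. \<rho> x = v} = c v}"
  have cnt: "count (mset (map \<rho> [0..<h])) v = card {x \<in> {..<h}. \<rho> x = v}" for \<rho> :: "nat \<Rightarrow> nat" and v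
  proof -
    have "count (mset (map \<rho> [0..<h])) v = length (filter (\<lambda>y. v = y) (map \<rho> [0..<h]))"
      by (simp only: count_mset count_list_eq_length_filter)
    also have "\<dots> = card {i. i < h \<and> v = map \<rho> [0..<h] ! i}"
      by (simp only: length_filter_conv_card length_map length_upt diff_zero)
    also have "{i. i < h \<and> v = map \<rho> [0..<h] ! i} = {x \<in> {..<h}. \<rho> x = v}" by auto
    finally show ?thesis .
  qed
  have "bij_betw (\<lambda>\<rho>. map \<rho> [0..<h]) ?R (permutations_of_multiset M)"
  proof (rule bij_betw_byWitness[where f' = "\<lambda>xs. restrict (\<lambda>i. xs ! i) {..<h}"])
    show "\<forall>\<rho>\<in>?R. restrict (\<lambda>i. map \<rho> [0..<h] ! i) {..<h} = \<rho>"
      by (auto simp: fun_eq_iff PiE_iff extensional_def restrict_def)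
    show "\<forall>xs\<in>permutations_of_multiset M. map (restrict (\<lambda>i. xs ! i) {..<h}) [0..<h] = xs"
      using sM by (auto intro!: nth_equalityI dest: length_finite_permutations_of_multiset)
    show "(\<lambda>\<rho>. map \<rho> [0..<h]) ` ?R \<subseteq> permutations_of_multiset M"
    proof safe
      fix \<rho> assume \<rho>: "\<rho> \<in> {..<h} \<rightarrow>\<^sub>E {..<r}" "\<forall>v<r. card {x \<in> {..<h}. \<rho> x = v} = c v"
      have "card {x \<in> {..<h}. \<rho> x = v} = 0" if "\<not> v < r" for v
      proof -
        have "{x \<in> {..<h}. \<rho> x = v} = {}" using \<rho>(1) that by (auto simp: PiE_iff)
        then show ?thesis by (simp only: card.empty)
      qed
      hence "card {x \<in> {..<h}. \<rho> x = v} = (if v < r then c v else 0)" for v using \<rho>(2) by simp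
      hence "mset (map \<rho> [0..<h]) = M" by (intro multiset_eqI) (simp only: cnt cM)
      then show "map \<rho> [0..<h] \<in> permutations_of_multiset M" by (rule permutations_of_multisetI)
    qed
    show "(\<lambda>xs. restrict (\<lambda>i. xs ! i) {..<h}) ` permutations_of_multiset M \<subseteq> ?R"
    proof (rule image_subsetI)
      fix xs assume xs: "xs \<in> permutations_of_multiset M"
      hence len: "length xs = h" and ms: "mset xs = M"
        using sM by (auto dest: length_finite_permutations_of_multiset permutations_of_multisetD)
      have "restrict (\<lambda>i. xs ! i) {..<h} \<in> {..<h} \<rightarrow>\<^sub>E {..<r}"
      proof (rule PiE_I)
        fix i assume i: "i \<in> {..<h}"
        hence "xs ! i \<in># M" using len ms[symmetric] by auto
        then show "restrict (\<lambda>i. xs ! i) {..<h} i \<in> {..<r}" using setM i by auto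
      qed auto
      moreover have "map (restrict (\<lambda>i. xs ! i) {..<h}) [0..<h] = xs" using len by (auto intro!: nth_equalityI)
      hence "card {x \<in> {..<h}. restrict (\<lambda>i. xs ! i) {..<h} x = v} = c v" if "v < r" for v
        using cnt[of "restrict (\<lambda>i. xs ! i) {..<h}" v] ms cM that by simp
      ultimately show "restrict (\<lambda>i. xs ! i) {..<h} \<in> ?R" by blast
    qed
  qed
  hence "card ?R = fact (size M) div (\<Prod>x\<in>set_mset M. fact (count M x))"
    by (simp add: bij_betw_same_card card_permutations_of_multiset)
  moreover have "(\<Prod>x\<in>set_mset M. fact (count M x)) = (\<Prod>v<r. fact (c v) :: nat)"
    by (rule prod.mono_neutral_cong_left) (auto simp: setM cM)
  moreover have "(\<Prod>x\<in>set_mset M. fact (count M x)) dvd (fact (size M) :: nat)"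
    by (rule card_permutations_of_multiset(2))
  ultimately show ?thesis by (simp add: sM)
qed

lemma sum_PiE_insert:
  assumes "r \<notin> S"
  shows "(\<Sum>p\<in>PiE (insert r S) T. f p) = (\<Sum>y\<in>T r. \<Sum>p\<in>PiE S T. f (p(r := y)))"
proof -
  have "(\<Sum>p\<in>PiE (insert r S) T. f p) = (\<Sum>(y, p)\<in>T r \<times> PiE S T. f (p(r := y)))"
    unfolding PiE_insert_eq by (subst sum.reindex[OF inj_combinator[OF assms]]) (auto intro!: sum.cong)
  then show ?thesis by (simp add: sum.cartesian_product)
qed

text \<open>Prescribing the three functions outside their domains turns equality of labelled graphs
  into equality of records; only then does a sum over records count each labelled graph
  once.\<close>

definition labelled :: "nat set \<Rightarrow> nat set \<Rightarrow> graph set" where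
  "labelled J V = {G. graph G \<and> half_edges G = J \<and> verts G = V \<and> root G \<in> extensional J \<and>
     flip G \<in> involutions J \<and> vgenus G \<in> extensional V}"

text \<open>Stability together with the bound \<open>K\<close> on the weight
  \<open>2g + n - 2\<close> of each vertex. The bound makes the set finite for finite
  \<open>J\<close> and \<open>V\<close>; as all vertex weights of a stable graph are positive,
  heavier vertices do not occur in weight at most \<open>K\<close>.\<close>

definition bounded :: "nat \<Rightarrow> nat set \<Rightarrow> nat set \<Rightarrow> graph set" where
  "bounded K J V = {G \<in> labelled J V. \<forall>v\<in>V. 3 \<le> 2 * vgenus G v + valence G v \<and> 2 * vgenus G v + valence G v \<le> K + 2}"

abbreviation make_graph :: "nat set \<Rightarrow> nat set \<Rightarrow> (nat \<Rightarrow> nat) \<Rightarrow> (nat \<Rightarrow> nat) \<Rightarrow> (nat \<Rightarrow> nat) \<Rightarrow> graph" where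
  "make_graph J V \<rho> g \<tau> \<equiv> \<lparr>half_edges = J, verts = V, root = \<rho>, flip = \<tau>, vgenus = g\<rparr>"

definition genera :: "nat \<Rightarrow> nat set \<Rightarrow> nat set \<Rightarrow> (nat \<Rightarrow> nat) \<Rightarrow> (nat \<Rightarrow> nat) set" where
  "genera K J V \<rho> = {g \<in> V \<rightarrow>\<^sub>E UNIV. \<forall>v\<in>V. 3 \<le> 2 * g v + card {x \<in> J. \<rho> x = v} \<and> 2 * g v + card {x \<in> J. \<rho> x = v} \<le> K + 2}"

lemma finite_genera: "finite V \<Longrightarrow> finite (genera K J V \<rho>)"
  by (rule finite_subset[of _ "V \<rightarrow>\<^sub>E {..K + 2}"]) (auto simp: genera_def PiE_iff extensional_def intro!: finite_PiE)

lemma sum_bounded: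
  assumes "finite J" "finite V"
  shows "(\<Sum>G\<in>bounded K J V. f G) = (\<Sum>\<rho>\<in>J \<rightarrow>\<^sub>E V. \<Sum>g\<in>genera K J V \<rho>. \<Sum>\<tau>\<in>involutions J. f (make_graph J V \<rho> g \<tau>))"
proof -
  have "(\<Sum>\<rho>\<in>J \<rightarrow>\<^sub>E V. \<Sum>g\<in>genera K J V \<rho>. \<Sum>\<tau>\<in>involutions J. f (make_graph J V \<rho> g \<tau>)) =
    (\<Sum>(\<rho>, g, \<tau>)\<in>(SIGMA \<rho>:J \<rightarrow>\<^sub>E V. genera K J V \<rho> \<times> involutions J). f (make_graph J V \<rho> g \<tau>))"
    using assms by (subst sum.Sigma[symmetric]) (auto intro!: finite_PiE finite_genera finite_involutions sum.cong simp: sum.cartesian_product)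
  also have "\<dots> = (\<Sum>G\<in>bounded K J V. f G)"
  proof (rule sum.reindex_bij_witness[where j = "\<lambda>(\<rho>, g, \<tau>). make_graph J V \<rho> g \<tau>" and i = "\<lambda>G. (root G, vgenus G, flip G)"])
    fix z assume "z \<in> (SIGMA \<rho>:J \<rightarrow>\<^sub>E V. genera K J V \<rho> \<times> involutions J)"
    then show "(case z of (\<rho>, g, \<tau>) \<Rightarrow> make_graph J V \<rho> g \<tau>) \<in> bounded K J V"
      using assms by (auto simp: bounded_def labelled_def genera_def valence_def graph_def PiE_iff involutions_def)
  next
    fix G assume G: "G \<in> bounded K J V"
    then show "(root G, vgenus G, flip G) \<in> (SIGMA \<rho>:J \<rightarrow>\<^sub>E V. genera K J V \<rho> \<times> involutions J)"
      by (auto simp: bounded_def labelled_def genera_def valence_def graph_def PiE_iff)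
    show "(case (root G, vgenus G, flip G) of (\<rho>, g, \<tau>) \<Rightarrow> make_graph J V \<rho> g \<tau>) = G"
      using G by (cases G) (auto simp: bounded_def labelled_def)
  qed auto
  finally show ?thesis by simp
qed

lemma finite_bounded: "finite J \<Longrightarrow> finite V \<Longrightarrow> finite (bounded K J V)"
proof -
  assume fin: "finite J" "finite V"
  have "finite (SIGMA \<rho>:J \<rightarrow>\<^sub>E V. genera K J V \<rho> \<times> involutions J)"
    using fin by (auto intro!: finite_PiE finite_genera finite_involutions finite_SigmaI)
  moreover have "bounded K J V \<subseteq> (\<lambda>(\<rho>, g, \<tau>). make_graph J V \<rho> g \<tau>) ` (SIGMA \<rho>:J \<rightarrow>\<^sub>E V. genera K J V \<rho> \<times> involutions J)"
  proof
    fix G assume G: "G \<in> bounded K J V"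
    have "(root G, vgenus G, flip G) \<in> (SIGMA \<rho>:J \<rightarrow>\<^sub>E V. genera K J V \<rho> \<times> involutions J)"
      using G by (auto simp: bounded_def labelled_def genera_def valence_def graph_def PiE_iff)
    moreover have "G = make_graph J V (root G) (vgenus G) (flip G)"
      using G by (cases G) (auto simp: bounded_def labelled_def)
    ultimately show "G \<in> (\<lambda>(\<rho>, g, \<tau>). make_graph J V \<rho> g \<tau>) ` (SIGMA \<rho>:J \<rightarrow>\<^sub>E V. genera K J V \<rho> \<times> involutions J)"
      by (intro image_eqI[of _ _ "(root G, vgenus G, flip G)"]) simp_all
  qed
  ultimately show "finite (bounded K J V)" by (meson finite_imageI finite_subset)
qed

lemma mset_concat_sorted_fibres:
  fixes \<rho> :: "nat \<Rightarrow> nat"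
  assumes "\<rho> ` {..<h} \<subseteq> {..<r}"
  shows "mset (concat (map (\<lambda>v. sorted_list_of_set {x \<in> {..<h}. \<rho> x = v}) [0..<r])) = mset_set {..<h}"
proof -
  have "mset (concat (map (\<lambda>v. sorted_list_of_set {x \<in> {..<h}. \<rho> x = v}) [0..<r])) = mset_set {x \<in> {..<h}. \<rho> x < r}"
  proof (induction r)
    case (Suc r)
    have "{x \<in> {..<h}. \<rho> x < Suc r} = {x \<in> {..<h}. \<rho> x < r} \<union> {x \<in> {..<h}. \<rho> x = r}" by auto
    moreover have "{x \<in> {..<h}. \<rho> x < r} \<inter> {x \<in> {..<h}. \<rho> x = r} = {}" by auto
    ultimately show ?case using Suc by (simp add: mset_set_Union mset_sorted_set)
  qed simp
  moreover have "{x \<in> {..<h}. \<rho> x < r} = {..<h}" using assms by auto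
  ultimately show ?thesis by simp
qed

section \<open>The vertex function and the powers of its truncation\<close>

context feynman
begin

definition vertex_function :: series where "vertex_function M = restriction (\<lambda>x. x) N t M / fls_X"

definition vertex_words :: "nat \<Rightarrow> (nat \<times> nat list) set" where
  "vertex_words K = {(g, xs). set xs \<subseteq> {..<N} \<and> 3 \<le> 2 * g + length xs \<and> 2 * g + length xs \<le> K + 2}"

definition vertex_coeff :: "nat \<times> nat list \<Rightarrow> real fls" where
  "vertex_coeff p = fls_const (t (fst p) (snd p)) * hbar_power (int (fst p) - 1)"

text \<open>A sum over words instead of monomials, because the letters of a word will become the
  half-edges at one vertex; this is the origin of the factorial of the length.\<close>

definition vertex_truncation :: "nat \<Rightarrow> series" where
  "vertex_truncation K M = (\<Sum>p\<in>vertex_words K. fls_const (1 / fact (length (snd p))) * vertex_coeff p * s_word par (snd p) M)"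

lemma finite_vertex_words: "finite (vertex_words K)"
  by (rule finite_subset[of _ "{..K + 2} \<times> {xs. set xs \<subseteq> {..<N} \<and> length xs \<le> K + 2}"])
     (auto simp: vertex_words_def intro: finite_lists_length_le)

lemma vertex_function_nth: "fls_nth (vertex_function M) e = (if set_mset M \<subseteq> {..<N} \<and> e \<ge> -1 then
    t (nat (e + 1)) (sorted_list_of_multiset M) / (\<Prod>x\<in>set_mset M. fact (count M x)) else 0)"
  by (auto simp: vertex_function_def restriction_def)

lemma vertex_truncation_nth: "fls_nth (vertex_truncation K M) e = (\<Sum>p\<in>vertex_words K.
    if e = int (fst p) - 1 then t (fst p) (snd p) / fact (length (snd p)) * real_word par (snd p) M else 0)"
proof -
  have "fls_nth (fls_const a * (fls_const b * hbar_power j) * fls_const c) e = (if e = j then b / a' * c else 0)"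
    if "a = 1 / a'" for a b c a' :: real and j using that by (simp add: mult.assoc hbar_power_mult_nth hbar_power_nth)
  then show ?thesis by (simp add: vertex_truncation_def fls_nth_sum s_word_real vertex_coeff_def hbar_power_nth)
qed

text \<open>All words with the letters \<open>M\<close> contribute equally to \<open>y^M\<close>.
  Their number divided by \<open>(size M)!\<close> is the inverse of the product of factorials in
  \<open>restriction\<close>.\<close>

lemma weight_eq_vertex_function: "weight_eq par (int K) vertex_function (vertex_truncation K)"
  unfolding weight_eq_iff
proof (intro allI impI)
  fix M e assume M: "admissible par M" "2 * e + int (size M) \<le> int K"
  define g where "g = nat (e + 1)"
  let ?Q = "permutations_of_multiset M"
  show "fls_nth (vertex_function M) e = fls_nth (vertex_truncation K M) e"
  proof (cases "set_mset M \<subseteq> {..<N} \<and> e \<ge> -1 \<and> 3 \<le> 2 * g + size M")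
    case True
    have e: "e = int g - 1" using True by (simp add: g_def)
    have sub: "Pair g ` ?Q \<subseteq> vertex_words K"
    proof
      fix p assume "p \<in> Pair g ` ?Q"
      then obtain xs where "p = (g, xs)" "mset xs = M" by (auto dest: permutations_of_multisetD)
      moreover from this have "length xs = size M" "set xs = set_mset M" by auto
      ultimately show "p \<in> vertex_words K" using True M(2) by (auto simp: vertex_words_def e)
    qed
    have "fls_nth (vertex_truncation K M) e = (\<Sum>p\<in>Pair g ` ?Q. t (fst p) (snd p) / fact (length (snd p)) * real_word par (snd p) M)"
      unfolding vertex_truncation_nth
    proof (rule sum.mono_neutral_cong_right[OF finite_vertex_words sub])
      show "\<forall>p\<in>vertex_words K - Pair g ` ?Q. (if e = int (fst p) - 1 then t (fst p) (snd p) / fact (length (snd p)) * real_word par (snd p) M else 0) = 0"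
        by (force simp: e real_word_def permutations_of_multiset_def)
    qed (auto simp: e)
    also have "\<dots> = (\<Sum>xs\<in>?Q. t g xs / fact (length xs) * real_word par xs M)"
      by (subst sum.reindex) (auto simp: inj_on_def)
    also have "\<dots> = (\<Sum>xs\<in>?Q. t g (sorted_list_of_multiset M) / fact (size M))"
    proof (rule sum.cong[OF refl])
      fix xs assume "xs \<in> ?Q"
      hence xs: "mset xs = M" by (rule permutations_of_multisetD)
      have "of_real (sorting_sign par xs) * t g xs = of_real (sorting_sign par (sorted_list_of_multiset M)) * t g (sorted_list_of_multiset M)"
      proof (rule supersymmetric_invariant)
        fix us x y vs assume *: "mset (us @ x # y # vs) = mset xs"
        show "t g (us @ x # y # vs) = of_real (swap_sign par x y) * t g (us @ y # x # vs)"
        proof -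
          have "set (us @ x # y # vs) \<subseteq> {..<N}" using True * xs by (metis set_mset_mset)
          from t_swap[OF this] show ?thesis by simp
        qed
      next
        fix x assume "par x" then show "count (mset xs) x \<le> 1" using M(1) xs by (auto simp: admissible_def)
      qed (simp add: xs)
      moreover have "sorting_sign par (sorted_list_of_multiset M) = 1" by (rule sorting_sign_sorted) simp
      moreover have "length xs = size M" using xs by auto
      ultimately show "t g xs / fact (length xs) * real_word par xs M = t g (sorted_list_of_multiset M) / fact (size M)"
        using xs M(1) by (simp add: real_word_def mult_ac)
    qed
    also have "\<dots> = real (card ?Q) * t g (sorted_list_of_multiset M) / fact (size M)" by simp
    also have "real (card ?Q) = fact (size M) / (\<Prod>x\<in>set_mset M. fact (count M x))"
      using card_permutations_of_multiset[of M] by (simp add: real_of_nat_div)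
    also have "fact (size M) / (\<Prod>x\<in>set_mset M. fact (count M x)) * t g (sorted_list_of_multiset M) / fact (size M) =
       fls_nth (vertex_function M) e"
      using True by (simp add: vertex_function_nth g_def)
    finally show ?thesis by simp
  next
    case False
    have "t (fst p) (snd p) / fact (length (snd p)) * real_word par (snd p) M = 0"
      if "p \<in> vertex_words K" "e = int (fst p) - 1" for p
      using that False by (auto simp: vertex_words_def real_word_def g_def)
    hence "fls_nth (vertex_truncation K M) e = 0" unfolding vertex_truncation_nth by (intro sum.neutral) auto
    moreover have "fls_nth (vertex_function M) e = 0"
    proof -
      have "length (sorted_list_of_multiset M) = size M" by (metis mset_sorted_list_of_multiset size_mset)
      hence "t g (sorted_list_of_multiset M) = 0" if "\<not> 3 \<le> 2 * g + size M"
        using that t_stable[of g "sorted_list_of_multiset M"] by fastforce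
      then show ?thesis using False by (auto simp: vertex_function_nth g_def)
    qed
    ultimately show ?thesis by simp
  qed
qed

text \<open>With \<open>e = g - 1\<close>, stability reads \<open>2 * e + size M >= 1\<close>.
  Adding \<open>e >= -1\<close> gives the bound for \<alpha> = 3.\<close>

lemma weight_ge_vertex_function: "\<alpha> \<in> {2, 3} \<Longrightarrow> weight_ge par \<alpha> (3 - \<alpha>) vertex_function"
  unfolding weight_ge_def
proof (intro allI impI)
  fix M e assume \<alpha>: "\<alpha> \<in> {2, 3}" and nz: "fls_nth (vertex_function M) e \<noteq> 0"
  hence e: "e \<ge> -1" and tn: "t (nat (e + 1)) (sorted_list_of_multiset M) \<noteq> 0" by (auto simp: vertex_function_nth split: if_splits)
  have "length (sorted_list_of_multiset M) = size M" by (metis mset_sorted_list_of_multiset size_mset)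
  hence "2 * nat (e + 1) + size M > 2" using t_stable[OF tn] by simp
  then show "3 - \<alpha> \<le> \<alpha> * e + int (size M)" using e \<alpha> by auto
qed

lemma weight_ge_vertex_truncation: "\<alpha> \<in> {2, 3} \<Longrightarrow> weight_ge par \<alpha> (3 - \<alpha>) (vertex_truncation K)"
  unfolding weight_ge_def
proof (intro allI impI)
  fix M e assume \<alpha>: "\<alpha> \<in> {2, 3}" and nz: "fls_nth (vertex_truncation K M) e \<noteq> 0"
  then obtain p where p: "p \<in> vertex_words K" "e = int (fst p) - 1" "real_word par (snd p) M \<noteq> 0"
    unfolding vertex_truncation_nth by (auto elim!: sum.not_neutral_contains_not_neutral split: if_splits)
  hence "M = mset (snd p)" by (auto simp: real_word_def split: if_splits)
  then show "3 - \<alpha> \<le> \<alpha> * e + int (size M)" using p \<alpha> by (auto simp: vertex_words_def)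
qed

text \<open>Each new factor is multiplied on the right, so the words are concatenated in the order
  of the vertices to which they belong.\<close>

lemma s_power_vertex_truncation:
  "s_power par (vertex_truncation K) r M = (\<Sum>p\<in>{..<r} \<rightarrow>\<^sub>E vertex_words K.
     (\<Prod>v<r. fls_const (1 / fact (length (snd (p v)))) * vertex_coeff (p v)) * s_word par (concat (map (\<lambda>v. snd (p v)) [0..<r])) M)"
proof (induction r arbitrary: M)
  case 0
  then show ?case by (simp add: s_word_def)
next
  case (Suc r)
  let ?c = "\<lambda>p. fls_const (1 / fact (length (snd p))) * vertex_coeff p"
  have "s_power par (vertex_truncation K) r = (\<lambda>M. \<Sum>p\<in>{..<r} \<rightarrow>\<^sub>E vertex_words K.
     (\<Prod>v<r. ?c (p v)) * s_word par (concat (map (\<lambda>v. snd (p v)) [0..<r])) M)" using Suc by blast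
  hence "s_power par (vertex_truncation K) (Suc r) M = (\<Sum>p\<in>{..<r} \<rightarrow>\<^sub>E vertex_words K. (\<Prod>v<r. ?c (p v)) *
      (\<Sum>q\<in>vertex_words K. ?c q * s_word par (concat (map (\<lambda>v. snd (p v)) [0..<r]) @ snd q) M))"
    unfolding s_power_Suc_right vertex_truncation_def[abs_def] by (simp only: s_mult_sum_left s_mult_sum_right s_mult_word)
  also have "\<dots> = (\<Sum>q\<in>vertex_words K. \<Sum>p\<in>{..<r} \<rightarrow>\<^sub>E vertex_words K. (\<Prod>v<r. ?c (p v)) *
      (?c q * s_word par (concat (map (\<lambda>v. snd (p v)) [0..<r]) @ snd q) M))"
    unfolding sum_distrib_left by (rule sum.swap)
  also have "\<dots> = (\<Sum>p\<in>insert r {..<r} \<rightarrow>\<^sub>E vertex_words K.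
     (\<Prod>v<Suc r. ?c (p v)) * s_word par (concat (map (\<lambda>v. snd (p v)) [0..<Suc r])) M)"
  proof (subst sum_PiE_insert, simp, intro sum.cong refl)
    fix q :: "nat \<times> nat list" and p :: "nat \<Rightarrow> nat \<times> nat list"
    have 1: "map (\<lambda>v. snd ((p(r := q)) v)) [0..<r] = map (\<lambda>v. snd (p v)) [0..<r]" by auto
    have 2: "(\<Prod>v<r. ?c ((p(r := q)) v)) = (\<Prod>v<r. ?c (p v))" by (rule prod.cong) auto
    have 3: "(\<Prod>v<Suc r. ?c ((p(r := q)) v)) = (\<Prod>v<r. ?c (p v)) * ?c q" unfolding prod.lessThan_Suc 2 by simp
    have 4: "concat (map (\<lambda>v. snd ((p(r := q)) v)) [0..<Suc r]) = concat (map (\<lambda>v. snd (p v)) [0..<r]) @ snd q"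
      unfolding upt_Suc_append[OF le0] map_append concat_append 1 by simp
    show "(\<Prod>v<r. ?c (p v)) * (?c q * s_word par (concat (map (\<lambda>v. snd (p v)) [0..<r]) @ snd q) M) =
      (\<Prod>v<Suc r. ?c ((p(r := q)) v)) * s_word par (concat (map (\<lambda>v. snd ((p(r := q)) v)) [0..<Suc r])) M"
      unfolding 3 4 by (simp only: mult.assoc)
  qed
  finally show ?case by (simp only: lessThan_Suc)
qed

definition hbar_exponent :: "graph \<Rightarrow> int" where
  "hbar_exponent G = int (card (edge_set (flip G) (half_edges G))) + (\<Sum>v\<in>verts G. int (vgenus G v) - 1)"

definition graph_term :: "graph \<Rightarrow> series" where "graph_term G A = hbar_power (hbar_exponent G) * amp G A"

text \<open>The words to be integrated list the half-edges vertex by vertex, whereas Wick's theorem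
  is stated for the sorted list.\<close>

lemma word_integral_permute:
  fixes l :: "nat \<Rightarrow> nat"
  assumes "mset xs = mset_set J" "finite J"
  shows "word_integral (map l xs) A = fls_const (sorting_sign (\<lambda>x. par (l x)) xs) * word_integral (map l (sorted_list_of_set J)) A"
proof -
  let ?S = "sorted_list_of_set J" and ?P = "\<lambda>x. par (l x)"
  have ms: "mset xs = mset ?S" using assms by (simp add: mset_sorted_set)
  hence mm: "mset (map l xs) = mset (map l ?S)" by simp
  have WI: "word_integral ys A = (if A = filter_mset (\<lambda>x. x < n) (mset ys)
     then fls_const (real_word par ys (mset ys)) * moment (filter_mset (\<lambda>x. \<not> x < n) (mset ys)) else 0)" for ys
    by (simp add: word_integral_def real_word_def)
  have "sorting_sign ?P xs * real_word par (map l xs) (mset (map l ?S)) = sorting_sign ?P ?S * real_word par (map l ?S) (mset (map l ?S))"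
    by (rule supersymmetric_map[where par = par and l = l and \<Phi> = "\<lambda>xs. real_word par xs (mset (map l ?S))"])
      (rule real_word_swap, rule distinct_if_mset_set[OF assms(1)], rule ms)
  moreover have "sorting_sign ?P ?S = 1" by (rule sorting_sign_sorted) simp
  ultimately have "real_word par (map l xs) (mset (map l ?S)) = sorting_sign ?P xs * real_word par (map l ?S) (mset (map l ?S))"
    by (metis mult.assoc mult_1 sorting_sign_square)
  then show ?thesis unfolding WI mm by (auto simp flip: fls_const_mult_const)
qed

text \<open>Choosing at each vertex a word as long as its valence means choosing a genus for each
  vertex and a label for each half-edge.\<close>

lemma sum_functions_with_fibres:
  fixes h r :: nat
  defines "J \<equiv> {..<h}" and "V \<equiv> {..<r}"
  assumes \<rho>: "\<rho> \<in> J \<rightarrow>\<^sub>E V"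
  defines "fl \<equiv> \<lambda>v. sorted_list_of_set {x \<in> J. \<rho> x = v}"
  shows "(\<Sum>p\<in>{p \<in> V \<rightarrow>\<^sub>E vertex_words K. \<forall>v<r. card {x \<in> J. \<rho> x = v} = length (snd (p v))}. T p) =
    (\<Sum>g\<in>genera K J V \<rho>. \<Sum>l\<in>J \<rightarrow>\<^sub>E {..<N}. T (restrict (\<lambda>v. (g v, map l (fl v))) V))"
proof -
  have fin: "finite {x \<in> J. \<rho> x = v}" for v by (simp add: J_def)
  have fl: "distinct (fl v)" "set (fl v) = {x \<in> J. \<rho> x = v}" "length (fl v) = card {x \<in> J. \<rho> x = v}" for v
    using fin by (auto simp: fl_def)
  \<comment> \<open>The label of \<open>x\<close> stands in the word of its vertex where
    \<open>x\<close> stands in the list of half-edges there.\<close>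
  define lab where "lab p x = the (map_of (zip (fl (\<rho> x)) (snd (p (\<rho> x)))) x)" for p :: "nat \<Rightarrow> nat \<times> nat list" and x
  have mlab: "map (restrict (lab p) J) (fl v) = snd (p v)" if "length (snd (p v)) = length (fl v)" for p v
  proof (rule nth_equalityI)
    fix i assume "i < length (map (restrict (lab p) J) (fl v))"
    hence i: "i < length (fl v)" by simp
    hence "fl v ! i \<in> set (fl v)" by simp
    hence "fl v ! i \<in> J" "\<rho> (fl v ! i) = v" using fl(2) by auto
    then show "map (restrict (lab p) J) (fl v) ! i = snd (p v) ! i"
      using i that map_of_zip_nth[of "fl v" "snd (p v)" i] fl(1) by (simp add: lab_def)
  qed (use that in simp)
  have "(\<Sum>g\<in>genera K J V \<rho>. \<Sum>l\<in>J \<rightarrow>\<^sub>E {..<N}. T (restrict (\<lambda>v. (g v, map l (fl v))) V)) =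
    (\<Sum>(g, l)\<in>genera K J V \<rho> \<times> (J \<rightarrow>\<^sub>E {..<N}). T (restrict (\<lambda>v. (g v, map l (fl v))) V))"
    by (rule sum.cartesian_product)
  also have "\<dots> = (\<Sum>p\<in>{p \<in> V \<rightarrow>\<^sub>E vertex_words K. \<forall>v<r. card {x \<in> J. \<rho> x = v} = length (snd (p v))}. T p)"
  proof (rule sum.reindex_bij_witness[where j = "\<lambda>(g, l). restrict (\<lambda>v. (g v, map l (fl v))) V"
      and i = "\<lambda>p. (restrict (\<lambda>v. fst (p v)) V, restrict (lab p) J)"])
    fix z assume "z \<in> genera K J V \<rho> \<times> (J \<rightarrow>\<^sub>E {..<N})"
    then obtain g l where z: "z = (g, l)" "g \<in> genera K J V \<rho>" "l \<in> J \<rightarrow>\<^sub>E {..<N}" by auto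
    let ?p = "restrict (\<lambda>v. (g v, map l (fl v))) V"
    have "lab ?p x = l x" if "x \<in> J" for x
    proof -
      have "\<rho> x \<in> V" using \<rho> that by auto
      moreover have "x \<in> set (fl (\<rho> x))" using fl(2) that by auto
      ultimately show ?thesis unfolding lab_def by (simp add: map_of_zip_map)
    qed
    hence "restrict (lab ?p) J = l" using z(3) by (auto simp: fun_eq_iff PiE_iff extensional_def restrict_def)
    moreover have "restrict (\<lambda>v. fst (?p v)) V = g"
      using z(2) by (auto simp: genera_def fun_eq_iff PiE_iff extensional_def restrict_def)
    ultimately show "(restrict (\<lambda>v. fst ((case z of (g, l) \<Rightarrow> restrict (\<lambda>v. (g v, map l (fl v))) V) v)) V,
       restrict (lab (case z of (g, l) \<Rightarrow> restrict (\<lambda>v. (g v, map l (fl v))) V)) J) = z" by (simp add: z(1))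
    have "(g v, map l (fl v)) \<in> vertex_words K" if "v \<in> V" for v
      using z that fl by (auto simp: vertex_words_def genera_def PiE_iff)
    hence "?p \<in> V \<rightarrow>\<^sub>E vertex_words K" by auto
    moreover have "\<forall>v<r. card {x \<in> J. \<rho> x = v} = length (snd (?p v))" using fl(3) by (auto simp: V_def)
    ultimately show "(case z of (g, l) \<Rightarrow> restrict (\<lambda>v. (g v, map l (fl v))) V) \<in>
      {p \<in> V \<rightarrow>\<^sub>E vertex_words K. \<forall>v<r. card {x \<in> J. \<rho> x = v} = length (snd (p v))}" by (simp add: z(1))
  next
    fix p assume p: "p \<in> {p \<in> V \<rightarrow>\<^sub>E vertex_words K. \<forall>v<r. card {x \<in> J. \<rho> x = v} = length (snd (p v))}"
    hence len: "length (snd (p v)) = length (fl v)" if "v \<in> V" for v using that fl(3) by (auto simp: V_def)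
    have pv: "p v \<in> vertex_words K" if "v \<in> V" for v using p that by auto
    have ml: "map (restrict (lab p) J) (fl v) = snd (p v)" if "v \<in> V" for v using mlab len[OF that] .
    show "(case (restrict (\<lambda>v. fst (p v)) V, restrict (lab p) J) of (g, l) \<Rightarrow> restrict (\<lambda>v. (g v, map l (fl v))) V) = p"
    proof
      fix v
      have "p v = undefined" if "v \<notin> V" using p that by (auto simp: PiE_iff extensional_def)
      then show "(case (restrict (\<lambda>v. fst (p v)) V, restrict (lab p) J) of (g, l) \<Rightarrow> restrict (\<lambda>v. (g v, map l (fl v))) V) v = p v"
        using ml[of v] by (cases "v \<in> V") (simp_all del: map_eq_conv)
    qed
    have "lab p x < N" if "x \<in> J" for x
    proof -
      have v: "\<rho> x \<in> V" using \<rho> that by auto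
      have "restrict (lab p) J x \<in> set (map (restrict (lab p) J) (fl (\<rho> x)))" using fl(2) that by auto
      hence "lab p x \<in> set (snd (p (\<rho> x)))" unfolding ml[OF v] using that by simp
      then show ?thesis using pv[OF v] by (auto simp: vertex_words_def)
    qed
    moreover have "restrict (\<lambda>v. fst (p v)) V \<in> genera K J V \<rho>"
    proof -
      have "3 \<le> 2 * fst (p v) + card {x \<in> J. \<rho> x = v} \<and> 2 * fst (p v) + card {x \<in> J. \<rho> x = v} \<le> K + 2"
        if "v \<in> V" for v
        using pv[OF that] len[OF that] fl(3)[of v] by (cases "p v") (simp add: vertex_words_def)
      then show ?thesis by (simp add: genera_def)
    qed
    ultimately show "(restrict (\<lambda>v. fst (p v)) V, restrict (lab p) J) \<in> genera K J V \<rho> \<times> (J \<rightarrow>\<^sub>E {..<N})" by auto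
  qed auto
  finally show ?thesis by simp
qed

lemma graph_make_graph:
  assumes "finite J" "finite V" "\<rho> \<in> J \<rightarrow>\<^sub>E V" "\<tau> \<in> involutions J"
  shows "graph (make_graph J V \<rho> g \<tau>)"
  using assms by (auto simp: graph_def involutions_def PiE_iff)

text \<open>For a fixed incidence map \<rho>, the words supply genera and labels and Wick's theorem
  supplies the involution. Exchanging the sums over labellings and involutions leaves the graphs
  outside and their amplitudes inside.\<close>

lemma sum_labelled_graphs:
  fixes h r :: nat
  defines "J \<equiv> {..<h}" and "V \<equiv> {..<r}"
  assumes \<rho>: "\<rho> \<in> J \<rightarrow>\<^sub>E V"
  shows "(\<Sum>p\<in>{p \<in> V \<rightarrow>\<^sub>E vertex_words K. \<forall>v<r. card {x \<in> J. \<rho> x = v} = length (snd (p v))}.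
       (\<Prod>v<r. vertex_coeff (p v)) * word_integral (concat (map (\<lambda>v. snd (p v)) [0..<r])) A) =
    (\<Sum>g\<in>genera K J V \<rho>. \<Sum>\<tau>\<in>involutions J. graph_term (make_graph J V \<rho> g \<tau>) A)"
proof -
  let ?fl = "\<lambda>v. sorted_list_of_set {x \<in> J. \<rho> x = v}"
  let ?cf = "concat (map ?fl [0..<r])"
  have fin: "finite J" "finite V" by (simp_all add: J_def V_def)
  have ms: "mset ?cf = mset_set J" unfolding J_def
    by (rule mset_concat_sorted_fibres) (use \<rho> in \<open>auto simp: J_def V_def\<close>)
  let ?T = "\<lambda>p. (\<Prod>v<r. vertex_coeff (p v)) * word_integral (concat (map (\<lambda>v. snd (p v)) [0..<r])) A"
  let ?G = "\<lambda>g \<tau>. make_graph J V \<rho> g \<tau>"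
  let ?X = "\<lambda>g l \<tau>. hbar_power (hbar_exponent (?G g \<tau>)) * (fls_const (std_term (?G g \<tau>) l) * s_word par (map l (sorted_list_of_set (legs (?G g \<tau>)))) A)"
  have lab: "{l \<in> J \<rightarrow>\<^sub>E {..<N}. compatible l \<tau> J} = labellings (?G g \<tau>)" for g \<tau>
  proof -
    have pt: "(l x < N \<and> (if \<tau> x = x then l x < n else \<not> l x < n)) = (l x \<in> (if x \<in> legs (?G g \<tau>) then {..<n} else {n..<N}))"
      if "x \<in> J" for x l using that by (auto simp: legs_def)
    show ?thesis
    proof (rule set_eqI)
      fix l
      have "l \<in> {l \<in> J \<rightarrow>\<^sub>E {..<N}. compatible l \<tau> J} \<longleftrightarrow>
        l \<in> extensional J \<and> (\<forall>x\<in>J. l x < N \<and> (if \<tau> x = x then l x < n else \<not> l x < n))"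
        unfolding PiE_iff compatible_def by blast
      also have "\<dots> \<longleftrightarrow> l \<in> labellings (?G g \<tau>)"
        unfolding labellings_def PiE_iff using pt[of _ l] by (simp, blast)
      finally show "l \<in> {l \<in> J \<rightarrow>\<^sub>E {..<N}. compatible l \<tau> J} \<longleftrightarrow> l \<in> labellings (?G g \<tau>)" .
    qed
  qed
  have T: "?T (restrict (\<lambda>v. (g v, map l (?fl v))) V) = (\<Sum>\<tau>\<in>{\<tau> \<in> involutions J. compatible l \<tau> J}. ?X g l \<tau>)"
    if l: "l \<in> J \<rightarrow>\<^sub>E {..<N}" for g l
  proof -
    let ?p = "restrict (\<lambda>v. (g v, map l (?fl v))) V"
    let ?P = "\<lambda>x. par (l x)"
    have "map (\<lambda>v. snd (?p v)) [0..<r] = map (\<lambda>v. map l (?fl v)) [0..<r]" by (auto simp: V_def)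
    hence c: "concat (map (\<lambda>v. snd (?p v)) [0..<r]) = map l ?cf"
      by (metis (no_types, lifting) map_concat map_map comp_def map_cong)
    have "(\<Prod>v<r. vertex_coeff (?p v)) = (\<Prod>v<r. fls_const (t (g v) (map l (?fl v))) * hbar_power (int (g v) - 1))"
      by (rule prod.cong) (auto simp: vertex_coeff_def V_def)
    also have "\<dots> = fls_const (\<Prod>v<r. t (g v) (map l (?fl v))) * hbar_power (\<Sum>v<r. int (g v) - 1)"
      by (simp add: prod.distrib fls_const_prod hbar_power_sum)
    finally have vc: "(\<Prod>v<r. vertex_coeff (?p v)) = fls_const (\<Prod>v<r. t (g v) (map l (?fl v))) * hbar_power (\<Sum>v<r. int (g v) - 1)" .
    have wi: "word_integral (map l ?cf) A = fls_const (sorting_sign ?P ?cf) * (\<Sum>\<tau>\<in>{\<tau> \<in> involutions J. compatible l \<tau> J}. wick_term l \<tau> J A)"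
      unfolding word_integral_permute[OF ms fin(1)]
      by (subst wick[OF fin(1)]) (use l in auto)
    have "?T ?p = (\<Sum>\<tau>\<in>{\<tau> \<in> involutions J. compatible l \<tau> J}.
       fls_const (\<Prod>v<r. t (g v) (map l (?fl v))) * hbar_power (\<Sum>v<r. int (g v) - 1) * fls_const (sorting_sign ?P ?cf) * wick_term l \<tau> J A)"
      unfolding vc c wi by (simp only: sum_distrib_left mult.assoc)
    also have "\<dots> = (\<Sum>\<tau>\<in>{\<tau> \<in> involutions J. compatible l \<tau> J}. ?X g l \<tau>)"
    proof (rule sum.cong[OF refl])
      fix \<tau> assume "\<tau> \<in> {\<tau> \<in> involutions J. compatible l \<tau> J}"
      hence \<tau>: "\<tau> \<in> involutions J" and ll: "l \<in> labellings (?G g \<tau>)" using l lab[of \<tau> g] by auto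
      have G: "graph (?G g \<tau>)" by (rule graph_make_graph[OF fin \<rho> \<tau>])
      let ?E = "edge_set \<tau> J" and ?L = "sorted_list_of_set (leg_set \<tau> J)"
      have L: "legs (?G g \<tau>) = leg_set \<tau> J" by (simp add: legs_def leg_set_def)
      have finE: "finite ?E" using fin by (simp add: edge_set_def)
      \<comment> \<open>Here the half-edges at a vertex are listed in increasing order, whereas
        \<open>vertex_half_edges\<close> puts the legs last; order independence bridges the
        difference.\<close>
      have ord: "orders (?G g \<tau>) [0..<r] ?fl (sorted_list_of_set ?E) ?L"
        using std_orders[OF G] fin unfolding orders_def L
        by (auto simp: fibre_def mset_sorted_set V_def simp flip: mset_set_set atLeast0LessThan)
      have "ordered_term (?G g \<tau>) l [0..<r] ?fl (sorted_list_of_set ?E) ?L * real_word par (map l ?L) A =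
         std_term (?G g \<tau>) l * real_word par (map l (sorted_list_of_set (legs (?G g \<tau>)))) A"
        by (rule ordered_term_any[OF G labellings_N[OF ll] ord std_orders[OF G]])
      moreover have "ordered_term (?G g \<tau>) l [0..<r] ?fl (sorted_list_of_set ?E) ?L =
         sorting_sign ?P ?cf * (\<Prod>v<r. t (g v) (map l (?fl v))) * (sorting_sign ?P (edge_list \<tau> J @ ?L) * (\<Prod>x\<in>?E. sinv (l x) (l (\<tau> x))))"
      proof -
        have "(\<Prod>v\<leftarrow>[0..<r]. t (g v) (map l (?fl v))) = (\<Prod>v<r. t (g v) (map l (?fl v)))"
          using prod.distinct_set_conv_list[of "[0..<r]" "\<lambda>v. t (g v) (map l (?fl v))"] by (simp add: atLeast0LessThan)
        moreover have "(\<Prod>x\<leftarrow>sorted_list_of_set ?E. sinv (l x) (l (\<tau> x))) = (\<Prod>x\<in>?E. sinv (l x) (l (\<tau> x)))"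
          using prod.distinct_set_conv_list[of "sorted_list_of_set ?E" "\<lambda>x. sinv (l x) (l (\<tau> x))"] finE by simp
        ultimately show ?thesis unfolding ordered_term_def by (simp add: edge_list_def)
      qed
      ultimately have "fls_const (std_term (?G g \<tau>) l) * s_word par (map l (sorted_list_of_set (legs (?G g \<tau>)))) A =
        fls_const (sorting_sign ?P ?cf * (\<Prod>v<r. t (g v) (map l (?fl v))) * (sorting_sign ?P (edge_list \<tau> J @ ?L) * (\<Prod>x\<in>?E. sinv (l x) (l (\<tau> x)))) * real_word par (map l ?L) A)"
        by (simp only: s_word_real fls_const_mult_const)
      moreover have "hbar_power (hbar_exponent (?G g \<tau>)) = fls_X ^ card ?E * hbar_power (\<Sum>v<r. int (g v) - 1)"
        by (simp add: hbar_exponent_def hbar_power_add hbar_power_power V_def)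
      ultimately show "fls_const (\<Prod>v<r. t (g v) (map l (?fl v))) * hbar_power (\<Sum>v<r. int (g v) - 1) * fls_const (sorting_sign ?P ?cf) * wick_term l \<tau> J A = ?X g l \<tau>"
        by (simp only: wick_term_def s_word_real fls_const_mult_const[symmetric] mult_ac)
    qed
    finally show ?thesis .
  qed
  have "(\<Sum>p\<in>{p \<in> V \<rightarrow>\<^sub>E vertex_words K. \<forall>v<r. card {x \<in> J. \<rho> x = v} = length (snd (p v))}. ?T p) =
    (\<Sum>g\<in>genera K J V \<rho>. \<Sum>l\<in>J \<rightarrow>\<^sub>E {..<N}. ?T (restrict (\<lambda>v. (g v, map l (?fl v))) V))"
    unfolding J_def V_def by (rule sum_functions_with_fibres) (use \<rho> in \<open>simp add: J_def V_def\<close>)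
  also have "\<dots> = (\<Sum>g\<in>genera K J V \<rho>. \<Sum>l\<in>J \<rightarrow>\<^sub>E {..<N}. \<Sum>\<tau>\<in>{\<tau> \<in> involutions J. compatible l \<tau> J}. ?X g l \<tau>)"
    by (intro sum.cong refl T)
  also have "\<dots> = (\<Sum>g\<in>genera K J V \<rho>. \<Sum>\<tau>\<in>involutions J. \<Sum>l\<in>{l \<in> J \<rightarrow>\<^sub>E {..<N}. compatible l \<tau> J}. ?X g l \<tau>)"
    by (intro sum.cong refl sum.swap_restrict) (auto intro!: finite_PiE finite_involutions fin)
  also have "\<dots> = (\<Sum>g\<in>genera K J V \<rho>. \<Sum>\<tau>\<in>involutions J. graph_term (?G g \<tau>) A)"
  proof (intro sum.cong refl)
    fix g \<tau> assume \<tau>: "\<tau> \<in> involutions J"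
    have G: "graph (?G g \<tau>)" by (rule graph_make_graph[OF fin \<rho> \<tau>])
    show "(\<Sum>l\<in>{l \<in> J \<rightarrow>\<^sub>E {..<N}. compatible l \<tau> J}. ?X g l \<tau>) = graph_term (?G g \<tau>) A"
      unfolding graph_term_def amp_eq[OF G] lab[of \<tau> g] by (simp only: sum_distrib_left)
  qed
  finally show ?thesis .
qed

text \<open>The factorials of the word lengths are traded for \<open>1 / h!\<close> by summing over
  the incidence maps that fit the words. For given words, such maps exist only if \<open>h\<close>
  is their total length, which is at most \<open>r * (K + 2)\<close>.\<close>

lemma power_graphs:
  "(\<Sum>p\<in>{..<r} \<rightarrow>\<^sub>E vertex_words K. (\<Prod>v<r. fls_const (1 / fact (length (snd (p v)))) * vertex_coeff (p v)) *
      word_integral (concat (map (\<lambda>v. snd (p v)) [0..<r])) A) =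
   (\<Sum>h\<le>r * (K + 2). fls_const (1 / fact h) * (\<Sum>G\<in>bounded K {..<h} {..<r}. graph_term G A))"
proof -
  let ?T = "\<lambda>p. (\<Prod>v<r. vertex_coeff (p v)) * word_integral (concat (map (\<lambda>v. snd (p v)) [0..<r])) A"
  let ?H = "r * (K + 2)"
  let ?S = "{..<r} \<rightarrow>\<^sub>E vertex_words K"
  define R where "R h p = {\<rho> \<in> {..<h} \<rightarrow>\<^sub>E {..<r}. \<forall>v<r. card {x \<in> {..<h}. \<rho> x = v} = length (snd (p v))}"
    for h :: nat and p :: "nat \<Rightarrow> nat \<times> nat list"
  have finS: "finite ?S" by (intro finite_PiE) (auto simp: finite_vertex_words)
  have fact_eq: "fls_const (1 / (\<Prod>v<r. fact (length (snd (p v))))) = (\<Sum>h\<le>?H. fls_const (real (card (R h p)) / fact h))"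
    if p: "p \<in> ?S" for p
  proof -
    define h0 where "h0 = (\<Sum>v<r. length (snd (p v)))"
    have "length (snd (p v)) \<le> K + 2" if "v < r" for v
      using PiE_mem[OF p, of v] that by (cases "p v") (auto simp: vertex_words_def)
    hence "h0 \<le> (\<Sum>v<r. K + 2)" unfolding h0_def by (intro sum_mono) auto
    hence h0: "h0 \<le> ?H" by simp
    have "R h p = {}" if "h \<noteq> h0" for h
    proof (rule ccontr)
      assume "R h p \<noteq> {}"
      then obtain \<rho> where \<rho>: "\<rho> \<in> {..<h} \<rightarrow>\<^sub>E {..<r}" "\<And>v. v < r \<Longrightarrow> card {x \<in> {..<h}. \<rho> x = v} = length (snd (p v))"
        unfolding R_def by auto
      have "(\<Sum>v\<in>{..<r}. \<Sum>x\<in>{x \<in> {..<h}. \<rho> x = v}. 1) = (\<Sum>x\<in>{..<h}. 1 :: nat)"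
        by (rule sum.group) (use \<rho>(1) in auto)
      hence "(\<Sum>v<r. card {x \<in> {..<h}. \<rho> x = v}) = h" by simp
      then show False using \<rho>(2) that by (simp add: h0_def)
    qed
    hence "(\<Sum>h\<le>?H. fls_const (real (card (R h p)) / fact h)) = (\<Sum>h\<in>{h0}. fls_const (real (card (R h p)) / fact h))"
      by (intro sum.mono_neutral_right) (use h0 in auto)
    also have "\<dots> = fls_const (1 / (\<Prod>v<r. fact (length (snd (p v)))))"
    proof -
      have "card (R h0 p) * (\<Prod>v<r. fact (length (snd (p v)))) = (fact h0 :: nat)"
        unfolding R_def by (rule card_functions_with_fibres) (simp add: h0_def)
      hence "real (card (R h0 p)) * (\<Prod>v<r. fact (length (snd (p v)))) = fact h0"
        by (metis (mono_tags, lifting) of_nat_fact of_nat_mult of_nat_prod prod.cong)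
      moreover have "(\<Prod>v<r. fact (length (snd (p v)))) \<noteq> (0 :: real)" by simp
      moreover have "a / f = 1 / b" if "a * b = f" "b \<noteq> 0" "f \<noteq> 0" for a b f :: real
        using that by (auto simp: field_simps)
      ultimately have "real (card (R h0 p)) / fact h0 = 1 / (\<Prod>v<r. fact (length (snd (p v))))"
        using fact_nonzero by blast
      then show ?thesis by (simp only: sum.insert sum.empty finite.emptyI empty_iff not_False_eq_True add_0_right)
    qed
    finally show ?thesis by simp
  qed
  have "(\<Sum>p\<in>?S. (\<Prod>v<r. fls_const (1 / fact (length (snd (p v)))) * vertex_coeff (p v)) *
      word_integral (concat (map (\<lambda>v. snd (p v)) [0..<r])) A) =
    (\<Sum>p\<in>?S. \<Sum>h\<le>?H. fls_const (1 / fact h) * (\<Sum>\<rho>\<in>R h p. ?T p))"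
  proof (rule sum.cong[OF refl])
    fix p assume p: "p \<in> ?S"
    have "(\<Prod>v<r. fls_const (1 / fact (length (snd (p v)))) * vertex_coeff (p v)) *
      word_integral (concat (map (\<lambda>v. snd (p v)) [0..<r])) A = fls_const (1 / (\<Prod>v<r. fact (length (snd (p v))))) * ?T p"
      by (simp add: prod.distrib fls_const_prod prod_dividef mult.assoc)
    also have "\<dots> = (\<Sum>h\<le>?H. fls_const (1 / fact h) * (\<Sum>\<rho>\<in>R h p. ?T p))"
    proof -
      have "fls_const (real (card (R h p)) / fact h) * X = fls_const (1 / fact h) * (\<Sum>\<rho>\<in>R h p. X)" for h :: nat and X
        by (simp add: fls_of_nat flip: mult.assoc)
      then show ?thesis unfolding fact_eq[OF p] sum_distrib_right by (intro sum.cong) auto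
    qed
    finally show "(\<Prod>v<r. fls_const (1 / fact (length (snd (p v)))) * vertex_coeff (p v)) *
      word_integral (concat (map (\<lambda>v. snd (p v)) [0..<r])) A = (\<Sum>h\<le>?H. fls_const (1 / fact h) * (\<Sum>\<rho>\<in>R h p. ?T p))" .
  qed
  also have "\<dots> = (\<Sum>h\<le>?H. fls_const (1 / fact h) * (\<Sum>p\<in>?S. \<Sum>\<rho>\<in>R h p. ?T p))"
    unfolding sum_distrib_left by (rule sum.swap)
  also have "\<dots> = (\<Sum>h\<le>?H. fls_const (1 / fact h) * (\<Sum>G\<in>bounded K {..<h} {..<r}. graph_term G A))"
  proof (rule sum.cong[OF refl])
    fix h
    have "(\<Sum>p\<in>?S. \<Sum>\<rho>\<in>R h p. ?T p) = (\<Sum>\<rho>\<in>{..<h} \<rightarrow>\<^sub>E {..<r}.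
       \<Sum>p\<in>{p \<in> ?S. \<forall>v<r. card {x \<in> {..<h}. \<rho> x = v} = length (snd (p v))}. ?T p)"
      unfolding R_def by (rule sum.swap_restrict[OF finS]) (auto intro: finite_PiE)
    also have "\<dots> = (\<Sum>\<rho>\<in>{..<h} \<rightarrow>\<^sub>E {..<r}. \<Sum>g\<in>genera K {..<h} {..<r} \<rho>. \<Sum>\<tau>\<in>involutions {..<h}. graph_term (make_graph {..<h} {..<r} \<rho> g \<tau>) A)"
      by (intro sum.cong refl sum_labelled_graphs)
    also have "\<dots> = (\<Sum>G\<in>bounded K {..<h} {..<r}. graph_term G A)"
      by (rule sum_bounded[symmetric]) auto
    finally show "fls_const (1 / fact h) * (\<Sum>p\<in>?S. \<Sum>\<rho>\<in>R h p. ?T p) =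
      fls_const (1 / fact h) * (\<Sum>G\<in>bounded K {..<h} {..<r}. graph_term G A)" by (simp only:)
  qed
  finally show ?thesis .
qed

lemma weight_ge_exp:
  assumes "weight_ge P 2 1 F" "weight_ge P \<alpha> 0 F"
  shows "weight_ge P \<alpha> 0 (s_exp P F)"
  unfolding weight_ge_def
proof (intro allI impI)
  fix M e assume M: "admissible P M" "fls_nth (s_exp P F M) e \<noteq> 0"
  define K where "K = nat (2 * e + int (size M))"
  have "2 * e + int (size M) \<le> int K" by (simp add: K_def)
  hence "fls_nth (\<Sum>r\<le>K. fls_const (1 / fact r) * s_power P F r M) e \<noteq> 0"
    using s_exp_weight_eq[OF assms(1), of K] M unfolding weight_eq_iff by metis
  moreover have "weight_ge P \<alpha> 0 (\<lambda>M. \<Sum>r\<le>K. fls_const (1 / fact r) * s_power P F r M)"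
    using weight_ge_power[OF assms(2)] by (intro weight_ge_sum weight_ge_const) simp
  ultimately show "0 \<le> \<alpha> * e + int (size M)" using M(1) unfolding weight_ge_def by blast
qed

definition graph_series :: "nat \<Rightarrow> series" where
  "graph_series K A = (\<Sum>r\<le>K. \<Sum>h\<le>r * (K + 2). fls_const (1 / (fact h * fact r)) * (\<Sum>G\<in>bounded K {..<h} {..<r}. graph_term G A))"

text \<open>The case \<alpha> = 2 of the weight compares the exponential with its truncation. The
  case \<alpha> = 3 makes both integrals finite in each coefficient, so that the comparison passes
  through the integral.\<close>

lemma integral_L_exp:
  assumes "admissible par A" "set_mset A \<subseteq> {..<n}" "2 * e + int (size A) \<le> int K"
  shows "fls_nth (integral_L (s_exp par vertex_function) A) e = fls_nth (graph_series K A) e"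
proof -
  let ?w = "\<lambda>r p. concat (map (\<lambda>v. snd (p v)) [0..<r]) :: nat list"
  let ?c = "\<lambda>r p. (\<Prod>v<r. fls_const (1 / fact (length (snd (p v)))) * vertex_coeff (p v))"
  let ?S = "SIGMA r:{..K}. {..<r} \<rightarrow>\<^sub>E vertex_words K"
  define T where "T = (\<lambda>M. \<Sum>r\<le>K. fls_const (1 / fact r) * s_power par (vertex_truncation K) r M)"
  have F2: "weight_ge par 2 1 vertex_function" and F3: "weight_ge par 3 0 vertex_function" using weight_ge_vertex_function[of 2] weight_ge_vertex_function[of 3] by auto
  have T2: "weight_ge par 2 1 (vertex_truncation K)" and T3: "weight_ge par 3 0 (vertex_truncation K)" using weight_ge_vertex_truncation[of 2] weight_ge_vertex_truncation[of 3] by auto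
  have E3: "weight_ge par 3 0 (s_exp par vertex_function)" by (rule weight_ge_exp[OF F2 F3])
  have T3': "weight_ge par 3 0 T" unfolding T_def using weight_ge_power[OF T3] by (intro weight_ge_sum weight_ge_const) simp
  have s: "admissible_supported par (s_exp par vertex_function)" "admissible_supported par T"
    by (auto simp: admissible_supported_def s_exp_inadmissible T_def s_power_inadmissible)
  have "weight_eq par (int K) (s_exp par vertex_function) (\<lambda>M. \<Sum>r\<le>K. fls_const (1 / fact r) * s_power par vertex_function r M)"
    by (rule s_exp_weight_eq[OF F2])
  also have "weight_eq par (int K) \<dots> T"
    unfolding T_def
  proof (intro weight_eq_scale_sum weight_eq_power weight_eq_vertex_function)
    show "weight_ge par 2 0 vertex_function" "weight_ge par 2 0 (vertex_truncation K)" by (rule weight_ge_mono[OF F2], simp) (rule weight_ge_mono[OF T2], simp)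
  qed
  finally have "weight_eq par (int K) (integral_L (s_exp par vertex_function)) (integral_L T)"
    by (rule integral_L_weight_eq[OF E3 s(1) T3' s(2)])
  hence "fls_nth (integral_L (s_exp par vertex_function) A) e = fls_nth (integral_L T A) e"
    using assms unfolding weight_eq_iff by blast
  also have "integral_L T A = graph_series K A"
  proof -
    have finS: "finite ?S" by (auto intro!: finite_SigmaI finite_PiE finite_vertex_words)
    have "T = (\<lambda>M. \<Sum>z\<in>?S. (fls_const (1 / fact (fst z)) * ?c (fst z) (snd z)) * s_word par (?w (fst z) (snd z)) M)"
    proof
      fix M
      have "T M = (\<Sum>r\<le>K. \<Sum>p\<in>{..<r} \<rightarrow>\<^sub>E vertex_words K. (fls_const (1 / fact r) * ?c r p) * s_word par (?w r p) M)"
        unfolding T_def s_power_vertex_truncation by (simp only: sum_distrib_left mult.assoc)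
      also have "\<dots> = (\<Sum>(r, p)\<in>?S. (fls_const (1 / fact r) * ?c r p) * s_word par (?w r p) M)"
        by (rule sum.Sigma) (auto intro!: finite_PiE finite_vertex_words)
      finally show "T M = (\<Sum>z\<in>?S. (fls_const (1 / fact (fst z)) * ?c (fst z) (snd z)) * s_word par (?w (fst z) (snd z)) M)"
        by (simp add: case_prod_beta)
    qed
    moreover have "set (?w (fst z) (snd z)) \<subseteq> {..<N}" if "z \<in> ?S" for z
    proof -
      obtain r p where z: "z = (r, p)" "p \<in> {..<r} \<rightarrow>\<^sub>E vertex_words K" using \<open>z \<in> ?S\<close> by auto
      have "\<forall>x\<in>set (snd (p v)). x < N" if "v < r" for v
        using PiE_mem[OF z(2), of v] that by (cases "p v") (auto simp: vertex_words_def)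
      then show ?thesis by (auto simp: z(1))
    qed
    ultimately have "integral_L T A = (\<Sum>z\<in>?S. (fls_const (1 / fact (fst z)) * ?c (fst z) (snd z)) * integral_L (s_word par (?w (fst z) (snd z))) A)"
      by (simp only:) (rule integral_L_sum[OF finS _ assms(2)])
    also have "\<dots> = (\<Sum>z\<in>?S. (fls_const (1 / fact (fst z)) * ?c (fst z) (snd z)) * word_integral (?w (fst z) (snd z)) A)"
      by (intro sum.cong refl) (simp add: word_integral_def integral_L_word[OF \<open>\<And>z. z \<in> ?S \<Longrightarrow> _\<close> assms(2)])
    also have "\<dots> = (\<Sum>(r, p)\<in>?S. (fls_const (1 / fact r) * ?c r p) * word_integral (?w r p) A)"
      by (simp add: case_prod_beta)
    also have "\<dots> = (\<Sum>r\<le>K. \<Sum>p\<in>{..<r} \<rightarrow>\<^sub>E vertex_words K. (fls_const (1 / fact r) * ?c r p) * word_integral (?w r p) A)"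
      by (rule sum.Sigma[symmetric]) (auto intro!: finite_PiE finite_vertex_words)
    also have "\<dots> = (\<Sum>r\<le>K. fls_const (1 / fact r) * (\<Sum>p\<in>{..<r} \<rightarrow>\<^sub>E vertex_words K. ?c r p * word_integral (?w r p) A))"
      by (simp only: sum_distrib_left mult.assoc)
    also have "\<dots> = graph_series K A"
      unfolding power_graphs graph_series_def sum_distrib_left
      by (simp add: mult.assoc[symmetric] mult.commute)
    finally show ?thesis .
  qed
  finally show ?thesis .
qed

end

section \<open>Relabelling graphs\<close>

lemma bij_betw_obtain:
  assumes "bij_betw f A B" "y \<in> B"
  obtains x where "x \<in> A" "y = f x"
  using assms by (metis bij_betw_imp_surj_on imageE)

definition relabel :: "(nat \<Rightarrow> nat) \<Rightarrow> (nat \<Rightarrow> nat) \<Rightarrow> graph \<Rightarrow> graph" where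
  "relabel \<phi> \<psi> G = \<lparr>half_edges = \<phi> ` half_edges G, verts = \<psi> ` verts G,
     root = restrict (\<lambda>y. \<psi> (root G (inv_into (half_edges G) \<phi> y))) (\<phi> ` half_edges G),
     flip = (\<lambda>y. if y \<in> \<phi> ` half_edges G then \<phi> (flip G (inv_into (half_edges G) \<phi> y)) else y),
     vgenus = restrict (\<lambda>v. vgenus G (inv_into (verts G) \<psi> v)) (\<psi> ` verts G)\<rparr>"

lemma relabel:
  assumes G: "graph G" and inj: "inj_on \<phi> (half_edges G)" "inj_on \<psi> (verts G)"
  shows "relabel \<phi> \<psi> G \<in> labelled (\<phi> ` half_edges G) (\<psi> ` verts G)" "is_iso G (relabel \<phi> \<psi> G) \<phi> \<psi>"
proof -
  have r: "x \<in> half_edges G \<Longrightarrow> root G x \<in> verts G" for x using G by (auto simp: graph_def)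
  note fl = graph_flip[OF G]
  have "graph (relabel \<phi> \<psi> G)"
    using G inj r fl by (auto simp: relabel_def graph_def)
  moreover have "flip (relabel \<phi> \<psi> G) \<in> involutions (\<phi> ` half_edges G)"
    using inj fl by (auto simp: relabel_def involutions_def)
  ultimately show "relabel \<phi> \<psi> G \<in> labelled (\<phi> ` half_edges G) (\<psi> ` verts G)"
    by (auto simp: labelled_def relabel_def)
  show "is_iso G (relabel \<phi> \<psi> G) \<phi> \<psi>"
    using inj r by (auto simp: is_iso_def relabel_def bij_betw_def)
qed

lemma labelled_eqI:
  assumes "G1 \<in> labelled J V" "G2 \<in> labelled J V"
    and "\<And>x. x \<in> J \<Longrightarrow> root G1 x = root G2 x" "\<And>x. x \<in> J \<Longrightarrow> flip G1 x = flip G2 x"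
    and "\<And>v. v \<in> V \<Longrightarrow> vgenus G1 v = vgenus G2 v"
  shows "G1 = G2"
proof (rule graph.equality)
  show "root G1 = root G2" using assms(1-3) by (auto simp: labelled_def intro!: extensionalityI)
  show "vgenus G1 = vgenus G2" using assms(1,2,5) by (auto simp: labelled_def intro!: extensionalityI)
  show "flip G1 = flip G2"
  proof
    fix x show "flip G1 x = flip G2 x"
      using assms(1,2,4) by (cases "x \<in> J") (auto simp: labelled_def involutions_def)
  qed
qed (use assms in \<open>auto simp: labelled_def\<close>)

text \<open>An isomorphism carries all the structure of \<open>G\<close> to its target, so a
  labelled target is determined by the two maps. Hence relabellings along inverse maps are inverse
  to each other.\<close>

lemma iso_unique:
  assumes "is_iso G G1 \<phi> \<psi>" "is_iso G G2 \<phi>' \<psi>'" "G1 \<in> labelled J V" "G2 \<in> labelled J V"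
    and "\<And>x. x \<in> half_edges G \<Longrightarrow> \<phi> x = \<phi>' x" "\<And>v. v \<in> verts G \<Longrightarrow> \<psi> v = \<psi>' v" and G: "graph G"
  shows "G1 = G2"
proof (rule labelled_eqI[OF assms(3,4)])
  note D1 = is_isoD[OF assms(1)] and D2 = is_isoD[OF assms(2)]
  have im: "\<phi> ` half_edges G = J" "\<psi> ` verts G = V" using D1(1,2) assms(3) by (auto simp: bij_betw_def labelled_def)
  fix y assume "y \<in> J"
  then obtain x where x: "x \<in> half_edges G" "y = \<phi> x" using im by auto
  have "root G x \<in> verts G" "flip G x \<in> half_edges G" using G x by (auto simp: graph_def)
  then show "root G1 y = root G2 y" "flip G1 y = flip G2 y"
    using D1(3,4)[OF x(1)] D2(3,4)[OF x(1)] x assms(5,6) by auto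
next
  note D1 = is_isoD[OF assms(1)] and D2 = is_isoD[OF assms(2)]
  fix v' assume "v' \<in> V"
  hence "v' \<in> verts G1" using assms(3) by (simp add: labelled_def)
  then obtain v where "v \<in> verts G" "v' = \<psi> v" using bij_betw_obtain[OF D1(2)] by metis
  then show "vgenus G1 v' = vgenus G2 v'" using D1(5) D2(5) assms(6) by metis
qed

lemma iso_inverse:
  assumes "is_iso G G' \<phi> \<psi>" "graph G"
  shows "is_iso G' G (inv_into (half_edges G) \<phi>) (inv_into (verts G) \<psi>)"
proof -
  note D = is_isoD[OF assms(1)]
  have inj: "inj_on \<phi> (half_edges G)" "inj_on \<psi> (verts G)" "\<phi> ` half_edges G = half_edges G'" "\<psi> ` verts G = verts G'"
    using D(1,2) by (auto simp: bij_betw_def)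
  have r: "x \<in> half_edges G \<Longrightarrow> root G x \<in> verts G" for x using assms(2) by (auto simp: graph_def)
  show ?thesis
    unfolding is_iso_def
  proof (intro conjI ballI)
    show "bij_betw (inv_into (half_edges G) \<phi>) (half_edges G') (half_edges G)" "bij_betw (inv_into (verts G) \<psi>) (verts G') (verts G)"
      using D(1,2) by (auto intro: bij_betw_inv_into)
    fix y assume "y \<in> half_edges G'"
    then obtain x where x: "x \<in> half_edges G" "y = \<phi> x" using bij_betw_obtain[OF D(1)] by metis
    then show "root G (inv_into (half_edges G) \<phi> y) = inv_into (verts G) \<psi> (root G' y)"
      "flip G (inv_into (half_edges G) \<phi> y) = inv_into (half_edges G) \<phi> (flip G' y)"
      using D(3,4)[OF x(1)] inj r[OF x(1)] graph_flip[OF assms(2) x(1)] by auto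
  next
    fix v' assume "v' \<in> verts G'"
    then obtain v where "v \<in> verts G" "v' = \<psi> v" using bij_betw_obtain[OF D(2)] by metis
    then show "vgenus G (inv_into (verts G) \<psi> v') = vgenus G' v'" using D(5) inj by auto
  qed
qed

lemma iso_compose:
  assumes "is_iso G1 G2 \<phi> \<psi>" "is_iso G2 G3 \<phi>' \<psi>'" "graph G1"
  shows "is_iso G1 G3 (\<phi>' \<circ> \<phi>) (\<psi>' \<circ> \<psi>)"
proof -
  note D = is_isoD[OF assms(1)] and D' = is_isoD[OF assms(2)]
  have "\<phi> x \<in> half_edges G2" if "x \<in> half_edges G1" for x using D(1) that by (auto simp: bij_betw_def)
  moreover have "\<psi> v \<in> verts G2" if "v \<in> verts G1" for v using D(2) that by (auto simp: bij_betw_def)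
  ultimately show ?thesis
    unfolding is_iso_def using D D' assms(3)
    by (auto intro: bij_betw_trans simp: graph_def)
qed

lemma iso_refl: "is_iso G G (\<lambda>x. x) (\<lambda>x. x)"
  by (auto simp: is_iso_def bij_betw_def)

lemma iso_valence:
  assumes "is_iso G G' \<phi> \<psi>" "graph G" "v \<in> verts G"
  shows "valence G' (\<psi> v) = valence G v"
proof -
  note D = is_isoD[OF assms(1)]
  have inj: "inj_on \<phi> (half_edges G)" "inj_on \<psi> (verts G)" "\<phi> ` half_edges G = half_edges G'"
    using D(1,2) by (auto simp: bij_betw_def)
  have "{y \<in> half_edges G'. root G' y = \<psi> v} = \<phi> ` {x \<in> half_edges G. root G x = v}"
  proof (intro equalityI subsetI)
    fix y assume y: "y \<in> {y \<in> half_edges G'. root G' y = \<psi> v}"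
    hence "y \<in> \<phi> ` half_edges G" using inj by simp
    then obtain x where x: "x \<in> half_edges G" "y = \<phi> x" by blast
    hence "\<psi> (root G x) = \<psi> v" using D(3) y by auto
    hence "root G x = v" using inj(2) x assms(2,3) by (auto dest: inj_onD simp: graph_def)
    then show "y \<in> \<phi> ` {x \<in> half_edges G. root G x = v}" using x by auto
  qed (use D(3) inj in auto)
  moreover have "inj_on \<phi> {x \<in> half_edges G. root G x = v}" using inj(1) by (rule inj_on_subset) auto
  ultimately show ?thesis unfolding valence_def by (simp add: card_image)
qed

definition adjacency :: "graph \<Rightarrow> (nat \<times> nat) set" where
  "adjacency G = {(root G x, root G (flip G x)) | x. x \<in> half_edges G}"

lemma connected_graph_adjacency:
  "connected_graph G \<longleftrightarrow> verts G \<noteq> {} \<and> (\<forall>u\<in>verts G. \<forall>v\<in>verts G. (u, v) \<in> (adjacency G)\<^sup>*)"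
  by (simp add: connected_graph_def adjacency_def)

lemma iso_connected:
  assumes "is_iso G G' \<phi> \<psi>" "graph G" "connected_graph G"
  shows "connected_graph G'"
proof -
  note D = is_isoD[OF assms(1)]
  have step: "(\<psi> u, \<psi> v) \<in> adjacency G'" if uv: "(u, v) \<in> adjacency G" for u v
  proof -
    obtain x where x: "x \<in> half_edges G" "u = root G x" "v = root G (flip G x)" using uv by (auto simp: adjacency_def)
    have "flip G x \<in> half_edges G" using graph_flip[OF assms(2) x(1)] by simp
    hence "root G' (\<phi> x) = \<psi> u" "root G' (flip G' (\<phi> x)) = \<psi> v" using D(3,4) x by auto
    moreover have "\<phi> x \<in> half_edges G'" using D(1) x(1) by (auto simp: bij_betw_def)
    ultimately show ?thesis unfolding adjacency_def by force
  qed
  have "(\<psi> u, \<psi> v) \<in> (adjacency G')\<^sup>*" if "(u, v) \<in> (adjacency G)\<^sup>*" for u v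
    using that by (induction rule: rtrancl_induct) (auto intro: step rtrancl_into_rtrancl)
  note path = this
  have im: "verts G' = \<psi> ` verts G" using D(2) by (simp add: bij_betw_def)
  show ?thesis
    using assms(3) path unfolding connected_graph_adjacency im by blast
qed

lemma labelledD:
  assumes "G \<in> labelled J V"
  shows "graph G" "half_edges G = J" "verts G = V"
  using assms by (auto simp: labelled_def)

definition connected_bounded :: "nat \<Rightarrow> nat set \<Rightarrow> nat set \<Rightarrow> graph set" where
  "connected_bounded K J V = {G \<in> bounded K J V. connected_graph G}"

lemma boundedD:
  assumes "G \<in> bounded K J V"
  shows "G \<in> labelled J V" "graph G" "half_edges G = J" "verts G = V"
    "v \<in> V \<Longrightarrow> 3 \<le> 2 * vgenus G v + valence G v" "v \<in> V \<Longrightarrow> 2 * vgenus G v + valence G v \<le> K + 2"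
  using assms labelledD[of G J V] by (auto simp: bounded_def)

lemma bounded_iso:
  assumes "is_iso G G' \<phi> \<psi>" "G \<in> bounded K J V" "G' \<in> labelled J' V'"
  shows "G' \<in> bounded K J' V'"
proof -
  note D = is_isoD[OF assms(1)] and B = boundedD[OF assms(2)]
  have "3 \<le> 2 * vgenus G' v' + valence G' v' \<and> 2 * vgenus G' v' + valence G' v' \<le> K + 2" if "v' \<in> V'" for v'
  proof -
    have "v' \<in> verts G'" using \<open>v' \<in> V'\<close> labelledD[OF assms(3)] by simp
    then obtain v where v: "v \<in> verts G" "v' = \<psi> v" using bij_betw_obtain[OF D(2)] by metis
    then show ?thesis using D(5) iso_valence[OF assms(1) B(2)] B(4-6) by simp
  qed
  then show ?thesis using assms(3) by (auto simp: bounded_def)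
qed

text \<open>A sum of isomorphism-invariant terms depends on the sets of half-edges and vertices only
  through their cardinalities. The family \<G> is a parameter since this is applied to all bounded
  graphs and to the connected ones.\<close>

lemma sum_relabel:
  assumes fin: "finite J" "finite V"
    and inv: "\<And>G G' \<phi> \<psi>. G \<in> \<G> J V \<Longrightarrow> is_iso G G' \<phi> \<psi> \<Longrightarrow> G' \<in> labelled J' V' \<Longrightarrow> G' \<in> \<G> J' V' \<and> f G' = f G"
    and inv': "\<And>G G' \<phi> \<psi>. G \<in> \<G> J' V' \<Longrightarrow> is_iso G G' \<phi> \<psi> \<Longrightarrow> G' \<in> labelled J V \<Longrightarrow> G' \<in> \<G> J V"
    and sub: "\<G> J V \<subseteq> labelled J V" "\<G> J' V' \<subseteq> labelled J' V'"
    and card: "card J = card J'" "card V = card V'" "finite J'" "finite V'"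
  shows "(\<Sum>G\<in>\<G> J V. f G) = (\<Sum>G\<in>\<G> J' V'. f G)"
proof -
  obtain \<phi> \<psi> where b: "bij_betw \<phi> J J'" "bij_betw \<psi> V V'"
    using fin card finite_same_card_bij by metis
  define \<phi>' \<psi>' where "\<phi>' = inv_into J \<phi>" and "\<psi>' = inv_into V \<psi>"
  have b': "bij_betw \<phi>' J' J" "bij_betw \<psi>' V' V" unfolding \<phi>'_def \<psi>'_def using b by (auto intro: bij_betw_inv_into)
  have r: "relabel \<phi> \<psi> G \<in> labelled J' V'" "is_iso G (relabel \<phi> \<psi> G) \<phi> \<psi>" if "G \<in> labelled J V" for G
    using relabel[of G \<phi> \<psi>] labelledD[OF that] b by (auto simp: bij_betw_def)
  have r': "relabel \<phi>' \<psi>' G \<in> labelled J V" "is_iso G (relabel \<phi>' \<psi>' G) \<phi>' \<psi>'" if "G \<in> labelled J' V'" for G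
    using relabel[of G \<phi>' \<psi>'] labelledD[OF that] b' by (auto simp: bij_betw_def)
  show ?thesis
  proof (rule sum.reindex_bij_witness[where j = "relabel \<phi> \<psi>" and i = "relabel \<phi>' \<psi>'"])
    fix G assume G: "G \<in> \<G> J V"
    hence L: "G \<in> labelled J V" using sub by auto
    show "relabel \<phi> \<psi> G \<in> \<G> J' V'" "f (relabel \<phi> \<psi> G) = f G" using inv[OF G r(2,1)[OF L]] by auto
    show "relabel \<phi>' \<psi>' (relabel \<phi> \<psi> G) = G"
    proof (rule iso_unique[OF iso_compose[OF r(2)[OF L] r'(2)[OF r(1)[OF L]]] iso_refl r'(1)[OF r(1)[OF L]] L])
      show "graph G" "graph G" using labelledD[OF L] by auto
      fix x assume "x \<in> half_edges G" then show "(\<phi>' \<circ> \<phi>) x = x"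
        using labelledD[OF L] b by (simp add: \<phi>'_def bij_betw_def)
    next
      fix x assume "x \<in> verts G" then show "(\<psi>' \<circ> \<psi>) x = x"
        using labelledD[OF L] b by (simp add: \<psi>'_def bij_betw_def)
    qed
  next
    fix G assume G: "G \<in> \<G> J' V'"
    hence L: "G \<in> labelled J' V'" using sub by auto
    show "relabel \<phi>' \<psi>' G \<in> \<G> J V" using inv'[OF G r'(2,1)[OF L]] .
    show "relabel \<phi> \<psi> (relabel \<phi>' \<psi>' G) = G"
    proof (rule iso_unique[OF iso_compose[OF r'(2)[OF L] r(2)[OF r'(1)[OF L]]] iso_refl r(1)[OF r'(1)[OF L]] L])
      show "graph G" "graph G" using labelledD[OF L] by auto
      fix x assume "x \<in> half_edges G" then show "(\<phi> \<circ> \<phi>') x = x"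
        using labelledD[OF L] b by (auto simp: \<phi>'_def bij_betw_def f_inv_into_f)
    next
      fix x assume "x \<in> verts G" then show "(\<psi> \<circ> \<psi>') x = x"
        using labelledD[OF L] b by (auto simp: \<psi>'_def bij_betw_def f_inv_into_f)
    qed
  qed
qed

section \<open>Weights of graphs\<close>

definition graph_weight :: "graph \<Rightarrow> int" where
  "graph_weight G = (\<Sum>v\<in>verts G. 2 * int (vgenus G v) + int (valence G v) - 2)"

text \<open>The functions are reset outside the subgraph so that the result again belongs to
  \<open>labelled\<close>.\<close>

definition induced :: "graph \<Rightarrow> nat set \<Rightarrow> graph" where
  "induced G T = \<lparr>half_edges = {x \<in> half_edges G. root G x \<in> T}, verts = T,
     root = restrict (root G) {x \<in> half_edges G. root G x \<in> T},
     flip = (\<lambda>x. if x \<in> {x \<in> half_edges G. root G x \<in> T} then flip G x else x),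
     vgenus = restrict (vgenus G) T\<rparr>"

definition join :: "graph \<Rightarrow> graph \<Rightarrow> graph" where
  "join G1 G2 = \<lparr>half_edges = half_edges G1 \<union> half_edges G2, verts = verts G1 \<union> verts G2,
     root = (\<lambda>x. if x \<in> half_edges G1 then root G1 x else root G2 x),
     flip = (\<lambda>x. if x \<in> half_edges G1 then flip G1 x else flip G2 x),
     vgenus = (\<lambda>v. if v \<in> verts G1 then vgenus G1 v else vgenus G2 v)\<rparr>"

lemma join_labelled:
  assumes "G1 \<in> labelled J1 V1" "G2 \<in> labelled J2 V2" "J1 \<inter> J2 = {}" "V1 \<inter> V2 = {}"
  shows "join G1 G2 \<in> labelled (J1 \<union> J2) (V1 \<union> V2)"
  using assms by (auto simp: labelled_def join_def graph_def extensional_def involutions_def)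

lemma join_valence:
  assumes "G1 \<in> labelled J1 V1" "G2 \<in> labelled J2 V2" "J1 \<inter> J2 = {}" "V1 \<inter> V2 = {}"
  shows "v \<in> V1 \<Longrightarrow> valence (join G1 G2) v = valence G1 v" "v \<in> V2 \<Longrightarrow> valence (join G1 G2) v = valence G2 v"
proof -
  have r: "x \<in> J1 \<Longrightarrow> root G1 x \<in> V1" "x \<in> J2 \<Longrightarrow> root G2 x \<in> V2" for x using assms(1,2) by (auto simp: labelled_def graph_def)
  assume "v \<in> V1"
  hence "root G2 x \<noteq> v" if "x \<in> J2" for x using r(2)[OF that] assms(4) by blast
  hence "{x \<in> half_edges (join G1 G2). root (join G1 G2) x = v} = {x \<in> half_edges G1. root G1 x = v}"
    using assms by (auto simp: labelled_def join_def graph_def)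
  then show "valence (join G1 G2) v = valence G1 v" by (simp add: valence_def)
next
  have r: "x \<in> J1 \<Longrightarrow> root G1 x \<in> V1" "x \<in> J2 \<Longrightarrow> root G2 x \<in> V2" for x using assms(1,2) by (auto simp: labelled_def graph_def)
  assume "v \<in> V2"
  hence "root G1 x \<noteq> v" if "x \<in> J1" for x using r(1)[OF that] assms(4) by blast
  hence "{x \<in> half_edges (join G1 G2). root (join G1 G2) x = v} = {x \<in> half_edges G2. root G2 x = v}"
    using assms by (auto simp: labelled_def join_def graph_def)
  then show "valence (join G1 G2) v = valence G2 v" by (simp add: valence_def)
qed

lemma join_bounded:
  assumes "G1 \<in> bounded K J1 V1" "G2 \<in> bounded K J2 V2" "J1 \<inter> J2 = {}" "V1 \<inter> V2 = {}"
  shows "join G1 G2 \<in> bounded K (J1 \<union> J2) (V1 \<union> V2)"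
proof -
  note B1 = boundedD[OF assms(1)] and B2 = boundedD[OF assms(2)]
  have "vgenus (join G1 G2) v = (if v \<in> V1 then vgenus G1 v else vgenus G2 v)" for v using B1 by (simp add: join_def)
  then show ?thesis
    using join_labelled[OF B1(1) B2(1) assms(3,4)] join_valence[OF B1(1) B2(1) assms(3,4)] B1(5,6) B2(5,6) assms(4)
    unfolding bounded_def by auto
qed

text \<open>These are the unions of connected components: no edge leaves \<open>T\<close>.\<close>

definition closed_in :: "graph \<Rightarrow> nat set \<Rightarrow> bool" where
  "closed_in G T \<longleftrightarrow> T \<subseteq> verts G \<and> (\<forall>x\<in>half_edges G. root G x \<in> T \<longrightarrow> root G (flip G x) \<in> T)"

lemma closed_in_compl: "graph G \<Longrightarrow> closed_in G T \<Longrightarrow> closed_in G (verts G - T)"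
  unfolding closed_in_def by (auto simp: graph_def)

lemma induced_bounded:
  assumes "G \<in> bounded K J V" "closed_in G T"
  shows "induced G T \<in> bounded K {x \<in> J. root G x \<in> T} T"
proof -
  note B = boundedD[OF assms(1)]
  have T: "T \<subseteq> V" "finite T" using assms(2) B graph_finite(2)[OF B(2)] by (auto simp: closed_in_def intro: finite_subset)
  have c: "x \<in> J \<Longrightarrow> root G x \<in> T \<Longrightarrow> flip G x \<in> J \<and> flip G (flip G x) = x \<and> root G (flip G x) \<in> T" for x
    using assms(2) graph_flip[OF B(2)] B(3) by (auto simp: closed_in_def)
  have "graph (induced G T)" using T c B graph_finite(1)[OF B(2)] by (auto simp: graph_def induced_def)
  moreover have "flip (induced G T) \<in> involutions {x \<in> J. root G x \<in> T}" using c B by (auto simp: involutions_def induced_def)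
  ultimately have "induced G T \<in> labelled {x \<in> J. root G x \<in> T} T" using B by (auto simp: labelled_def induced_def)
  moreover have "valence (induced G T) v = valence G v \<and> vgenus (induced G T) v = vgenus G v" if "v \<in> T" for v
  proof -
    have "{x \<in> half_edges (induced G T). root (induced G T) x = v} = {x \<in> half_edges G. root G x = v}"
      using that by (auto simp: induced_def)
    then show ?thesis using that by (simp add: valence_def induced_def)
  qed
  ultimately show ?thesis using B(5,6) T unfolding bounded_def by auto
qed

lemma join_induced:
  assumes "G \<in> labelled J V" "closed_in G T"
  shows "join (induced G T) (induced G (V - T)) = G"
proof (rule graph.equality)
  have r: "x \<in> J \<Longrightarrow> root G x \<in> V" for x using assms(1) by (auto simp: labelled_def graph_def)
  have T: "T \<subseteq> V" using assms by (auto simp: closed_in_def labelled_def)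
  show "half_edges (join (induced G T) (induced G (V - T))) = half_edges G" "verts (join (induced G T) (induced G (V - T))) = verts G"
    using r T assms(1) by (auto simp: join_def induced_def labelled_def)
  show "root (join (induced G T) (induced G (V - T))) = root G" "flip (join (induced G T) (induced G (V - T))) = flip G"
    "vgenus (join (induced G T) (induced G (V - T))) = vgenus G"
    using r T assms(1) by (auto simp: join_def induced_def labelled_def extensional_def involutions_def fun_eq_iff)
qed simp

lemma induced_join:
  assumes "G1 \<in> labelled J1 V1" "G2 \<in> labelled J2 V2" "J1 \<inter> J2 = {}" "V1 \<inter> V2 = {}"
  shows "{x \<in> J1 \<union> J2. root (join G1 G2) x \<in> V1} = J1" "induced (join G1 G2) V1 = G1" "induced (join G1 G2) V2 = G2"
proof -
  have r: "x \<in> J1 \<Longrightarrow> root G1 x \<in> V1" "x \<in> J2 \<Longrightarrow> root G2 x \<in> V2" for x using assms(1,2) by (auto simp: labelled_def graph_def)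
  have h: "half_edges (join G1 G2) = J1 \<union> J2" using assms by (auto simp: join_def labelled_def)
  show *: "{x \<in> J1 \<union> J2. root (join G1 G2) x \<in> V1} = J1" using assms r by (auto simp: join_def labelled_def)
  have **: "{x \<in> J1 \<union> J2. root (join G1 G2) x \<in> V2} = J2" using assms r by (auto simp: join_def labelled_def)
  show "induced (join G1 G2) V1 = G1"
    unfolding induced_def h * using assms
    by (intro graph.equality) (auto simp: join_def labelled_def extensional_def involutions_def fun_eq_iff restrict_def)
  show "induced (join G1 G2) V2 = G2"
    unfolding induced_def h ** using assms
    by (intro graph.equality) (auto simp: join_def labelled_def extensional_def involutions_def fun_eq_iff restrict_def)
qed

section \<open>Connected components\<close>

definition component :: "graph \<Rightarrow> nat \<Rightarrow> nat set" where
  "component G v = {u. (v, u) \<in> (adjacency G)\<^sup>*}"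

definition vertex_components :: "graph \<Rightarrow> nat set set" where
  "vertex_components G = component G ` verts G"

lemma adjacency_verts: "graph G \<Longrightarrow> (u, v) \<in> adjacency G \<Longrightarrow> u \<in> verts G \<and> v \<in> verts G"
  by (auto simp: adjacency_def graph_def)

lemma adjacency_sym: "graph G \<Longrightarrow> (u, v) \<in> adjacency G \<Longrightarrow> (v, u) \<in> adjacency G"
  unfolding adjacency_def using graph_flip[of G] by force

lemma adjacency_rtrancl_sym: "graph G \<Longrightarrow> (u, v) \<in> (adjacency G)\<^sup>* \<Longrightarrow> (v, u) \<in> (adjacency G)\<^sup>*"
  by (metis adjacency_sym sym_rtrancl symD symI)

lemma component_self: "v \<in> component G v"
  by (simp add: component_def)

lemma component_eq: "graph G \<Longrightarrow> u \<in> component G v \<Longrightarrow> component G u = component G v"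
  unfolding component_def using adjacency_rtrancl_sym by (auto intro: rtrancl_trans)

lemma component_closed:
  assumes "graph G" "v \<in> verts G"
  shows "closed_in G (component G v)"
proof -
  have "u \<in> verts G" if "(v, u) \<in> (adjacency G)\<^sup>*" for u
    using that by (induction rule: rtrancl_induct) (use assms adjacency_verts in auto)
  moreover have "root G (flip G x) \<in> component G v" if "x \<in> half_edges G" "root G x \<in> component G v" for x
    using that unfolding component_def adjacency_def by (auto intro: rtrancl_into_rtrancl)
  ultimately show ?thesis by (auto simp: closed_in_def component_def)
qed

lemma component_connected:
  assumes "graph G" "v \<in> verts G"
  shows "connected_graph (induced G (component G v))"
proof -
  let ?T = "component G v"
  note cl = component_closed[OF assms]
  have path: "(u, w) \<in> (adjacency (induced G ?T))\<^sup>* \<and> w \<in> ?T" if "(u, w) \<in> (adjacency G)\<^sup>*" "u \<in> ?T" for u w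
    using that
  proof (induction rule: rtrancl_induct)
    case (step y z)
    then obtain x where x: "x \<in> half_edges G" "y = root G x" "z = root G (flip G x)" by (auto simp: adjacency_def)
    hence z: "z \<in> ?T" using step cl by (auto simp: closed_in_def)
    have "flip G x \<in> half_edges G" using graph_flip[OF assms(1) x(1)] by simp
    hence "(y, z) \<in> adjacency (induced G ?T)"
      unfolding adjacency_def using x z step by (auto simp: induced_def intro!: exI[of _ x])
    then show ?case using step z by (auto intro: rtrancl_into_rtrancl)
  qed auto
  have "(u, w) \<in> (adjacency G)\<^sup>*" if "u \<in> ?T" "w \<in> ?T" for u w
    using that adjacency_rtrancl_sym[OF assms(1)] unfolding component_def by (auto intro: rtrancl_trans)
  hence "(u, w) \<in> (adjacency (induced G ?T))\<^sup>*" if "u \<in> ?T" "w \<in> ?T" for u w using path that by blast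
  moreover have "verts (induced G ?T) = ?T" by (simp add: induced_def)
  ultimately show ?thesis unfolding connected_graph_adjacency using component_self by blast
qed

lemma component_join:
  assumes "G1 \<in> labelled J1 V1" "G2 \<in> labelled J2 V2" "J1 \<inter> J2 = {}" "V1 \<inter> V2 = {}" "connected_graph G1"
  shows "V1 \<in> vertex_components (join G1 G2)" "closed_in (join G1 G2) V1"
proof -
  have r: "x \<in> J1 \<Longrightarrow> root G1 x \<in> V1 \<and> flip G1 x \<in> J1" "x \<in> J2 \<Longrightarrow> root G2 x \<in> V2 \<and> flip G2 x \<in> J2" for x
    using assms(1,2) by (auto simp: labelled_def graph_def)
  note L = labelledD[OF assms(1)] labelledD[OF assms(2)]
  show cl: "closed_in (join G1 G2) V1"
    unfolding closed_in_def join_def using r assms(3,4) L by auto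
  obtain v where v: "v \<in> V1" using assms(5) L by (auto simp: connected_graph_def)
  have "adjacency G1 \<subseteq> adjacency (join G1 G2)"
    unfolding adjacency_def join_def using L r by auto
  hence "V1 \<subseteq> component (join G1 G2) v"
    using assms(5) v L rtrancl_mono unfolding connected_graph_adjacency component_def by blast
  moreover have "u \<in> V1" if "(v, u) \<in> (adjacency (join G1 G2))\<^sup>*" for u
    using that by (induction rule: rtrancl_induct) (use v cl in \<open>auto simp: closed_in_def adjacency_def\<close>)
  ultimately have "component (join G1 G2) v = V1" by (auto simp: component_def)
  moreover have "v \<in> verts (join G1 G2)" using v L by (simp add: join_def)
  ultimately show "V1 \<in> vertex_components (join G1 G2)" unfolding vertex_components_def by blast
qed

lemma sum_components:
  assumes "graph G"
  shows "(\<Sum>T\<in>vertex_components G. \<Sum>v\<in>T. f v) = (\<Sum>v\<in>verts G. f v)"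
proof -
  have sub: "T \<subseteq> verts G" if "T \<in> vertex_components G" for T
    using that component_closed[OF assms] by (auto simp: vertex_components_def closed_in_def)
  have "\<Union>(vertex_components G) = verts G" using sub component_self by (auto simp: vertex_components_def)
  moreover have "sum f (\<Union>(vertex_components G)) = (\<Sum>T\<in>vertex_components G. \<Sum>v\<in>T. f v)"
  proof (subst sum.Union_disjoint)
    show "\<forall>A\<in>vertex_components G. finite A" using sub graph_finite(2)[OF assms] finite_subset by blast
    show "\<forall>A\<in>vertex_components G. \<forall>B\<in>vertex_components G. A \<noteq> B \<longrightarrow> A \<inter> B = {}"
      unfolding vertex_components_def using component_eq[OF assms] by blast
  qed (simp add: comp_def)
  ultimately show ?thesis by simp
qed

lemma graph_weight_components:
  assumes "G \<in> bounded K J V"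
  shows "graph_weight G = (\<Sum>T\<in>vertex_components G. graph_weight (induced G T))"
proof -
  note B = boundedD[OF assms]
  have "graph_weight (induced G T) = (\<Sum>v\<in>T. 2 * int (vgenus G v) + int (valence G v) - 2)" if "T \<in> vertex_components G" for T
  proof -
    have "valence (induced G T) v = valence G v" "vgenus (induced G T) v = vgenus G v" if "v \<in> T" for v
    proof -
      have "{x \<in> half_edges (induced G T). root (induced G T) x = v} = {x \<in> half_edges G. root G x = v}"
        using that by (auto simp: induced_def)
      then show "valence (induced G T) v = valence G v" "vgenus (induced G T) v = vgenus G v" using that by (simp_all add: valence_def induced_def)
    qed
    then show ?thesis by (auto simp: graph_weight_def induced_def intro!: sum.cong)
  qed
  hence "(\<Sum>T\<in>vertex_components G. graph_weight (induced G T)) = (\<Sum>T\<in>vertex_components G. \<Sum>v\<in>T. 2 * int (vgenus G v) + int (valence G v) - 2)"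
    by (intro sum.cong refl)
  then show ?thesis by (simp only: sum_components[OF B(2)] graph_weight_def)
qed

text \<open>The weight of a graph is the sum of the weights of its components. So the weighted sum
  runs over graphs with one marked component, that is, over pairs of a connected and an arbitrary
  graph on complementary sets.\<close>

theorem sum_marked_component:
  fixes \<Phi> :: "graph \<Rightarrow> 'a::comm_ring_1"
  assumes fin: "finite J" "finite V"
    and join: "\<And>J1 J2 V1 V2 G1 G2. G1 \<in> bounded K J1 V1 \<Longrightarrow> G2 \<in> bounded K J2 V2 \<Longrightarrow> J1 \<inter> J2 = {} \<Longrightarrow> V1 \<inter> V2 = {} \<Longrightarrow>
       \<Phi> (join G1 G2) = \<Psi> G1 G2"
  shows "(\<Sum>G\<in>bounded K J V. of_int (graph_weight G) * \<Phi> G) =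
    (\<Sum>S\<in>Pow J. \<Sum>T\<in>Pow V. \<Sum>G1\<in>connected_bounded K S T. \<Sum>G2\<in>bounded K (J - S) (V - T). of_int (graph_weight G1) * \<Psi> G1 G2)"
proof -
  let ?A = "SIGMA G:bounded K J V. vertex_components G"
  let ?B = "SIGMA ST:Pow J \<times> Pow V. connected_bounded K (fst ST) (snd ST) \<times> bounded K (J - fst ST) (V - snd ST)"
  have finb: "finite (bounded K S T)" if "S \<subseteq> J" "T \<subseteq> V" for S T
    using finite_bounded fin that finite_subset by metis
  have finc: "finite (vertex_components G)" if "G \<in> bounded K J V" for G
    using boundedD(4)[OF that] fin by (simp add: vertex_components_def)
  have "(\<Sum>G\<in>bounded K J V. of_int (graph_weight G) * \<Phi> G) = (\<Sum>G\<in>bounded K J V. \<Sum>T\<in>vertex_components G. of_int (graph_weight (induced G T)) * \<Phi> G)"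
    by (intro sum.cong refl) (simp add: graph_weight_components sum_distrib_right)
  also have "\<dots> = (\<Sum>(G, T)\<in>?A. of_int (graph_weight (induced G T)) * \<Phi> G)"
    by (rule sum.Sigma) (use finb finc in auto)
  also have "\<dots> = (\<Sum>(ST, G1, G2)\<in>?B. of_int (graph_weight G1) * \<Psi> G1 G2)"
  \<comment> \<open>The two graphs are recovered from their join as the induced subgraphs on
    \<open>T\<close> and \<open>V - T\<close>.\<close>
  proof (rule sum.reindex_bij_witness[where j = "\<lambda>(G, T). (({x \<in> J. root G x \<in> T}, T), induced G T, induced G (V - T))"
        and i = "\<lambda>(ST, G1, G2). (join G1 G2, snd ST)"])
    fix z assume "z \<in> ?A"
    then obtain G T where z: "z = (G, T)" "G \<in> bounded K J V" "T \<in> vertex_components G" by auto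
    note B = boundedD[OF z(2)]
    obtain v where v: "v \<in> verts G" "T = component G v" using z(3) by (auto simp: vertex_components_def)
    have cl: "closed_in G T" using component_closed[OF B(2) v(1)] v by simp
    have T: "T \<subseteq> V" using cl B by (auto simp: closed_in_def)
    have cl': "closed_in G (V - T)" using closed_in_compl[OF B(2) cl] B by simp
    have r: "x \<in> J \<Longrightarrow> root G x \<in> V" for x using B by (auto simp: graph_def)
    have s1: "induced G T \<in> connected_bounded K {x \<in> J. root G x \<in> T} T"
      using induced_bounded[OF z(2) cl] component_connected[OF B(2) v(1)] v by (simp add: connected_bounded_def)
    have "{x \<in> J. root G x \<in> V - T} = J - {x \<in> J. root G x \<in> T}" using r by auto
    hence s2: "induced G (V - T) \<in> bounded K (J - {x \<in> J. root G x \<in> T}) (V - T)"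
      using induced_bounded[OF z(2) cl'] by simp
    show "(case z of (G, T) \<Rightarrow> (({x \<in> J. root G x \<in> T}, T), induced G T, induced G (V - T))) \<in> ?B"
      using s1 s2 T by (auto simp: z(1))
    have j: "join (induced G T) (induced G (V - T)) = G" by (rule join_induced[OF B(1) cl])
    show "(case case z of (G, T) \<Rightarrow> (({x \<in> J. root G x \<in> T}, T), induced G T, induced G (V - T)) of (ST, G1, G2) \<Rightarrow> (join G1 G2, snd ST)) = z"
      using j by (simp add: z(1))
    have "\<Psi> (induced G T) (induced G (V - T)) = \<Phi> G"
      using join[OF _ s2, of "induced G T" "{x \<in> J. root G x \<in> T}" T] s1 j by (simp add: connected_bounded_def)
    then show "(case case z of (G, T) \<Rightarrow> (({x \<in> J. root G x \<in> T}, T), induced G T, induced G (V - T)) of (ST, G1, G2) \<Rightarrow> of_int (graph_weight G1) * \<Psi> G1 G2) =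
      (case z of (G, T) \<Rightarrow> of_int (graph_weight (induced G T)) * \<Phi> G)" by (simp add: z(1))
  next
    fix z assume "z \<in> ?B"
    then obtain S T G1 G2 where z: "z = ((S, T), G1, G2)" "S \<subseteq> J" "T \<subseteq> V" "G1 \<in> connected_bounded K S T" "G2 \<in> bounded K (J - S) (V - T)"
      by auto
    have b1: "G1 \<in> bounded K S T" "connected_graph G1" using z(4) by (auto simp: connected_bounded_def)
    note B1 = boundedD[OF b1(1)] and B2 = boundedD[OF z(5)]
    have d: "S \<inter> (J - S) = {}" "T \<inter> (V - T) = {}" "S \<union> (J - S) = J" "T \<union> (V - T) = V" using z by auto
    have jb: "join G1 G2 \<in> bounded K J V" using join_bounded[OF b1(1) z(5) d(1,2)] d by simp
    note sj = induced_join[OF B1(1) B2(1) d(1,2)]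
    show "(case z of (ST, G1, G2) \<Rightarrow> (join G1 G2, snd ST)) \<in> ?A"
      using jb component_join(1)[OF B1(1) B2(1) d(1,2) b1(2)] by (simp add: z(1))
    show "(case case z of (ST, G1, G2) \<Rightarrow> (join G1 G2, snd ST) of (G, T) \<Rightarrow> (({x \<in> J. root G x \<in> T}, T), induced G T, induced G (V - T))) = z"
      using sj(2,3) sj(1)[unfolded d(3)] by (simp add: z(1))
  qed
  also have "\<dots> = (\<Sum>(S, T)\<in>Pow J \<times> Pow V. \<Sum>(G1, G2)\<in>connected_bounded K S T \<times> bounded K (J - S) (V - T). of_int (graph_weight G1) * \<Psi> G1 G2)"
  proof (subst sum.Sigma[symmetric])
    show "\<forall>x\<in>Pow J \<times> Pow V. finite (connected_bounded K (fst x) (snd x) \<times> bounded K (J - fst x) (V - snd x))"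
      using finb by (auto simp: connected_bounded_def)
  qed (use fin in \<open>auto intro!: sum.cong\<close>)
  also have "\<dots> = (\<Sum>S\<in>Pow J. \<Sum>T\<in>Pow V. \<Sum>(G1, G2)\<in>connected_bounded K S T \<times> bounded K (J - S) (V - T). of_int (graph_weight G1) * \<Psi> G1 G2)"
    by (rule sum.cartesian_product[symmetric])
  finally show ?thesis by (simp add: sum.cartesian_product)
qed

section \<open>The exponential formula\<close>

lemma fls_const_sum: "fls_const (\<Sum>i\<in>I. c i :: real) = (\<Sum>i\<in>I. fls_const (c i))"
  by (induction I rule: infinite_finite_induct) (auto simp flip: fls_plus_const)

lemma s_deriv_sum': "s_deriv (\<lambda>M. \<Sum>i\<in>I. F i M) M = (\<Sum>i\<in>I. s_deriv (F i) M)"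
  using s_deriv_sum[of "\<lambda>_. 1" F I M] by simp

lemma sum_Pow_card:
  fixes F :: "nat \<Rightarrow> 'a::comm_semiring_1"
  assumes "finite J"
  shows "(\<Sum>S\<in>Pow J. F (card S)) = (\<Sum>i\<le>card J. of_nat (card J choose i) * F i)"
proof -
  have "(\<Sum>S\<in>Pow J. F (card S)) = (\<Sum>i\<in>{..card J}. \<Sum>S\<in>{S \<in> Pow J. card S = i}. F (card S))"
    by (rule sum.group[symmetric]) (use assms in \<open>auto intro: card_mono\<close>)
  also have "\<dots> = (\<Sum>i\<le>card J. of_nat (card J choose i) * F i)"
  proof (rule sum.cong[OF refl])
    fix i
    have "card {S \<in> Pow J. card S = i} = card J choose i"
      using n_subsets[OF assms, of i] by (simp add: Pow_def)
    moreover have "(\<Sum>S\<in>{S \<in> Pow J. card S = i}. F (card S)) = (\<Sum>S\<in>{S \<in> Pow J. card S = i}. F i)"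
      by (rule sum.cong) auto
    ultimately show "(\<Sum>S\<in>{S \<in> Pow J. card S = i}. F (card S)) = of_nat (card J choose i) * F i" by simp
  qed
  finally show ?thesis .
qed

text \<open>This turns a truncated Cauchy product into a sum over a square.\<close>

lemma sum_triangle:
  fixes y :: "nat \<Rightarrow> nat \<Rightarrow> 'a::comm_monoid_add"
  assumes "\<And>i i'. i + i' > H \<Longrightarrow> y i i' = 0"
  shows "(\<Sum>h\<le>H. \<Sum>i\<le>h. y i (h - i)) = (\<Sum>i\<le>H. \<Sum>i'\<le>H. y i i')"
proof -
  have "(\<Sum>h\<le>H. \<Sum>i\<le>h. y i (h - i)) = (\<Sum>(i, i')\<in>{(i, i'). i + i' \<le> H}. y i i')"
    by (rule sum.triangle_reindex_eq[symmetric])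
  also have "\<dots> = (\<Sum>(i, i')\<in>{..H} \<times> {..H}. y i i')"
    by (rule sum.mono_neutral_left) (use assms in \<open>auto simp: not_le[symmetric]\<close>)
  finally show ?thesis by (simp add: sum.cartesian_product)
qed

lemma graph_weight_iso:
  assumes "is_iso G G' \<phi> \<psi>" "graph G"
  shows "graph_weight G' = graph_weight G"
proof -
  note D = is_isoD[OF assms(1)]
  have "graph_weight G' = (\<Sum>v\<in>verts G. 2 * int (vgenus G' (\<psi> v)) + int (valence G' (\<psi> v)) - 2)"
    unfolding graph_weight_def by (rule sum.reindex_bij_betw[OF D(2), symmetric])
  also have "\<dots> = graph_weight G" unfolding graph_weight_def
    by (rule sum.cong) (use D(5) iso_valence[OF assms] in auto)
  finally show ?thesis .
qed

lemma card_legs_iso: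
  assumes "is_iso G G' \<phi> \<psi>" "graph G"
  shows "card (legs G') = card (legs G)"
proof -
  note D = is_isoD[OF assms(1)]
  have im: "\<phi> ` half_edges G = half_edges G'" "inj_on \<phi> (half_edges G)" using D(1) by (auto simp: bij_betw_def)
  have "legs G' = \<phi> ` legs G"
  proof (intro equalityI subsetI)
    fix y assume y: "y \<in> legs G'"
    hence "y \<in> \<phi> ` half_edges G" using im by (simp add: legs_def)
    then obtain x where "x \<in> half_edges G" "y = \<phi> x" by blast
    then show "y \<in> \<phi> ` legs G" using is_iso_legs[OF assms(2,1)] y by auto
  next
    fix y assume "y \<in> \<phi> ` legs G"
    then obtain x where "x \<in> legs G" "y = \<phi> x" by blast
    moreover from this have "x \<in> half_edges G" by (simp add: legs_def)
    ultimately show "y \<in> legs G'" using is_iso_legs[OF assms(2,1)] by auto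
  qed
  moreover have "inj_on \<phi> (legs G)" using im(2) by (rule inj_on_subset) (auto simp: legs_def)
  ultimately show ?thesis by (simp add: card_image)
qed

text \<open>Stability makes the weight of every vertex at least 1.\<close>

lemma graph_weight_ge:
  assumes "G \<in> bounded K J V"
  shows "int (card V) \<le> graph_weight G"
proof -
  have "(\<Sum>v\<in>V. 1) \<le> (\<Sum>v\<in>V. 2 * int (vgenus G v) + int (valence G v) - 2)"
    using boundedD(5)[OF assms] by (intro sum_mono) force
  then show ?thesis using boundedD(4)[OF assms] by (simp add: graph_weight_def)
qed

context feynman
begin

lemma card_half_edges:
  assumes "graph G"
  shows "card (half_edges G) = (\<Sum>v\<in>verts G. valence G v)"
    "card (half_edges G) = 2 * card (edge_set (flip G) (half_edges G)) + card (legs G)"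
proof -
  have "(\<Sum>v\<in>verts G. \<Sum>x\<in>{x \<in> half_edges G. root G x = v}. 1) = (\<Sum>x\<in>half_edges G. 1 :: nat)"
    by (rule sum.group) (use assms in \<open>auto simp: graph_def\<close>)
  then show "card (half_edges G) = (\<Sum>v\<in>verts G. valence G v)" by (simp add: valence_def)
  have finE: "finite (edge_set (flip G) (half_edges G))" using graph_finite[OF assms] by (simp add: edge_set_def)
  have l: "length (concat (map (\<lambda>x. [x, flip G x]) xs)) = 2 * length xs" for xs by (induction xs) auto
  have "size (mset (edge_order G)) = card (half_edges G)"
    unfolding orders_distinct(2)[OF assms] by simp
  hence "length (edge_order G) = card (half_edges G)" by (simp only: size_mset)
  then show "card (half_edges G) = 2 * card (edge_set (flip G) (half_edges G)) + card (legs G)"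
    unfolding edge_order_eq edge_list_def length_append l by simp
qed

text \<open>Counting half-edges by vertices, and by edges and legs, identifies the sum of the vertex
  weights with the weight of the term of the graph, in which each leg contributes one
  coordinate.\<close>

lemma graph_weight_eq:
  assumes "graph G"
  shows "graph_weight G = 2 * hbar_exponent G + int (card (legs G))"
proof -
  have "(\<Sum>v\<in>verts G. valence G v) = 2 * card (edge_set (flip G) (half_edges G)) + card (legs G)"
    using card_half_edges[OF assms] by simp
  from arg_cong[OF this, of int]
  have "(\<Sum>v\<in>verts G. int (valence G v)) = 2 * int (card (edge_set (flip G) (half_edges G))) + int (card (legs G))"
    by simp
  then show ?thesis
    by (simp add: graph_weight_def hbar_exponent_def sum.distrib sum_subtractf sum_distrib_left[symmetric])
qed

text \<open>Amplitudes contain no \<open>hbar\<close>, so their coefficients are real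
  numbers.\<close>

definition graph_coeff :: "graph \<Rightarrow> nat multiset \<Rightarrow> real" where
  "graph_coeff G A = (\<Sum>l\<in>labellings G. std_term G l * real_word par (map l (sorted_list_of_set (legs G))) A)"

lemma amp_graph_coeff: "graph G \<Longrightarrow> amp G A = fls_const (graph_coeff G A)"
  by (simp add: amp_eq graph_coeff_def fls_const_sum s_word_real)

lemma graph_term_nth: "graph G \<Longrightarrow> fls_nth (graph_term G A) e = (if e = hbar_exponent G then graph_coeff G A else 0)"
  by (simp add: graph_term_def amp_graph_coeff hbar_power_mult_nth hbar_power_nth)

text \<open>The parity claim: in a nonzero summand every vertex is even by evenness of
  \<open>t\<close>, and every edge is even because the inverse form pairs coordinates of equal
  parity; so the legs are even in total.\<close>

lemma graph_coeff_nonzero: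
  assumes G: "graph G" and nz: "graph_coeff G A \<noteq> 0"
  shows "size A = card (legs G)" "set_mset A \<subseteq> {..<n}" "even (odd_count par A)"
proof -
  let ?L = "sorted_list_of_set (legs G)"
  obtain l where l: "l \<in> labellings G" "std_term G l \<noteq> 0" "real_word par (map l ?L) A \<noteq> 0"
    using nz unfolding graph_coeff_def by (auto elim!: sum.not_neutral_contains_not_neutral)
  have A: "A = mset (map l ?L)" using l(3) by (auto simp: real_word_def split: if_splits)
  have finL: "finite (legs G)" using graph_finite[OF G] by simp
  show "size A = card (legs G)" by (simp add: A)
  show "set_mset A \<subseteq> {..<n}" using l(1) finL by (auto simp: A labellings_def PiE_iff legs_def)
  let ?P = "\<lambda>x. par (l x)"
  have od: "odd_count par (mset (map l xs)) = odd_count ?P (mset xs)" for xs by (induction xs) auto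
  have vh: "set (vertex_half_edges G v) \<subseteq> half_edges G" for v
    using graph_finite[OF G] by (auto simp: vertex_half_edges_def legs_def)
  have "even (odd_count ?P (mset (vertex_half_edges G v)))" if "v \<in> verts G" for v
  proof -
    have "t (vgenus G v) (map l (vertex_half_edges G v)) \<noteq> 0"
      using l(2) that graph_finite[OF G] by (auto simp: ordered_term_def prod_list_zero_iff)
    moreover have "set (map l (vertex_half_edges G v)) \<subseteq> {..<N}"
      using labellings_N[OF l(1)] vh by auto
    ultimately show ?thesis using t_even od by metis
  qed
  hence "even (odd_count ?P (mset (concat (map (vertex_half_edges G) vs))))" if "set vs \<subseteq> verts G" for vs
    using that by (induction vs) auto
  hence "even (odd_count ?P (mset (vertex_order G)))"
    unfolding vertex_order_def using graph_finite[OF G] by simp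
  hence "even (odd_count ?P (mset (edge_order G)))" unfolding orders_distinct[OF G] .
  moreover have "even (odd_count ?P (mset (edge_list (flip G) (half_edges G))))"
    unfolding edge_list_def
  proof (rule odd_count_even_pairs)
    fix x assume "x \<in> set (sorted_list_of_set (edge_set (flip G) (half_edges G)))"
    hence "sinv (l x) (l (flip G x)) \<noteq> 0" using l(2) by (auto simp: ordered_term_def prod_list_zero_iff)
    then show "par (l (flip G x)) = par (l x)" using sinv_par by metis
  qed
  ultimately have "even (odd_count ?P (mset ?L))" unfolding edge_order_eq by simp
  then show "even (odd_count par A)" unfolding A od .
qed

lemma s_deriv_graph_term: "graph G \<Longrightarrow> s_deriv (graph_term G) A = of_int (graph_weight G) * graph_term G A"
proof (rule fls_eqI)
  fix e assume G: "graph G"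
  have "real_of_int (2 * e + int (size A)) * fls_nth (graph_term G A) e = real_of_int (graph_weight G) * fls_nth (graph_term G A) e"
    using graph_coeff_nonzero(1)[OF G, of A] graph_weight_eq[OF G] by (cases "graph_coeff G A = 0") (auto simp: graph_term_nth[OF G])
  then show "fls_nth (s_deriv (graph_term G) A) e = fls_nth (of_int (graph_weight G) * graph_term G A) e"
    by (simp add: s_deriv_nth)
qed

lemma weight_ge_graph_term:
  assumes "G \<in> bounded K J V"
  shows "weight_ge par 2 (int (card V)) (graph_term G)"
  unfolding weight_ge_def
proof (intro allI impI)
  fix A e assume "fls_nth (graph_term G A) e \<noteq> 0"
  hence "e = hbar_exponent G" "graph_coeff G A \<noteq> 0" using graph_term_nth[OF boundedD(2)[OF assms]] by (auto split: if_splits)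
  then show "int (card V) \<le> 2 * e + int (size A)"
    using graph_coeff_nonzero(1)[OF boundedD(2)[OF assms]] graph_weight_eq[OF boundedD(2)[OF assms]] graph_weight_ge[OF assms] by simp
qed

lemma hbar_exponent_iso:
  assumes "is_iso G G' \<phi> \<psi>" "graph G" "graph G'"
  shows "hbar_exponent G' = hbar_exponent G"
  using graph_weight_eq[OF assms(2)] graph_weight_eq[OF assms(3)] graph_weight_iso[OF assms(1,2)] card_legs_iso[OF assms(1,2)] by simp

lemma graph_term_iso: "is_iso G G' \<phi> \<psi> \<Longrightarrow> graph G \<Longrightarrow> graph G' \<Longrightarrow> graph_term G' A = graph_term G A"
  unfolding graph_term_def using hbar_exponent_iso amp_iso by metis

lemma graph_term_join:
  assumes "G1 \<in> bounded K J1 V1" "G2 \<in> bounded K J2 V2" "J1 \<inter> J2 = {}" "V1 \<inter> V2 = {}"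
  shows "graph_term (join G1 G2) A = s_mult par (graph_term G1) (graph_term G2) A"
proof -
  note B1 = boundedD[OF assms(1)] and B2 = boundedD[OF assms(2)]
  let ?G = "join G1 G2"
  have G: "graph ?G" using join_labelled[OF B1(1) B2(1) assms(3,4)] labelledD by blast
  have sel: "half_edges ?G = J1 \<union> J2" "verts ?G = V1 \<union> V2"
    "\<And>x. x \<in> J1 \<Longrightarrow> root ?G x = root G1 x \<and> flip ?G x = flip G1 x"
    "\<And>x. x \<in> J2 \<Longrightarrow> root ?G x = root G2 x \<and> flip ?G x = flip G2 x"
    "\<And>v. v \<in> V1 \<Longrightarrow> vgenus ?G v = vgenus G1 v" "\<And>v. v \<in> V2 \<Longrightarrow> vgenus ?G v = vgenus G2 v"
    using assms(3,4) B1(3,4) B2(3,4) by (auto simp: join_def)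
  have "amp ?G A = s_mult par (amp G1) (amp G2) A"
    by (rule amp_union[OF G B1(2) B2(2)]) (use sel assms(3,4) B1(3,4) B2(3,4) in auto)
  moreover have "hbar_exponent ?G = hbar_exponent G1 + hbar_exponent G2"
  proof -
    have "edge_set (flip ?G) (J1 \<union> J2) = edge_set (flip G1) J1 \<union> edge_set (flip G2) J2"
      using sel by (auto simp: edge_set_def)
    moreover have "edge_set (flip G1) J1 \<inter> edge_set (flip G2) J2 = {}" using assms(3) by (auto simp: edge_set_def)
    moreover have "finite (edge_set (flip G1) J1)" "finite (edge_set (flip G2) J2)"
      using graph_finite(1)[OF B1(2)] graph_finite(1)[OF B2(2)] B1 B2 by (auto simp: edge_set_def)
    moreover have "(\<Sum>v\<in>V1 \<union> V2. int (vgenus ?G v) - 1) = (\<Sum>v\<in>V1. int (vgenus G1 v) - 1) + (\<Sum>v\<in>V2. int (vgenus G2 v) - 1)"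
      using graph_finite(2)[OF B1(2)] graph_finite(2)[OF B2(2)] B1 B2 assms(4) sel
      by (subst sum.union_disjoint) (auto intro!: arg_cong2[where f = "(+)"] sum.cong)
    ultimately show ?thesis using sel B1 B2 by (simp add: hbar_exponent_def card_Un_disjoint)
  qed
  moreover have "graph_term G1 = (\<lambda>A. hbar_power (hbar_exponent G1) * amp G1 A)" "graph_term G2 = (\<lambda>A. hbar_power (hbar_exponent G2) * amp G2 A)"
    by (auto simp: graph_term_def fun_eq_iff)
  ultimately show ?thesis
    by (simp add: graph_term_def[of ?G] s_mult_scale_left s_mult_scale_right hbar_power_add mult.assoc)
qed

section \<open>Sums over labelled graphs by numbers of half-edges and vertices\<close>

definition graph_total :: "nat \<Rightarrow> nat \<Rightarrow> nat \<Rightarrow> series" where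
  "graph_total K h r A = (\<Sum>G\<in>bounded K {..<h} {..<r}. graph_term G A)"

definition connected_total :: "nat \<Rightarrow> nat \<Rightarrow> nat \<Rightarrow> series" where
  "connected_total K h r A = (\<Sum>G\<in>connected_bounded K {..<h} {..<r}. graph_term G A)"

lemma graph_total_card: "finite J \<Longrightarrow> finite V \<Longrightarrow> (\<Sum>G\<in>bounded K J V. graph_term G A) = graph_total K (card J) (card V) A"
  unfolding graph_total_def
  by (rule sum_relabel[where \<G> = "bounded K"])
     (auto intro: bounded_iso graph_term_iso boundedD labelledD dest: boundedD(1,2) labelledD(1))

lemma connected_total_card: "finite J \<Longrightarrow> finite V \<Longrightarrow> (\<Sum>G\<in>connected_bounded K J V. graph_term G A) = connected_total K (card J) (card V) A"
  unfolding connected_total_def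
  by (rule sum_relabel[where \<G> = "connected_bounded K"])
     (auto simp: connected_bounded_def intro: bounded_iso graph_term_iso boundedD labelledD iso_connected dest: boundedD(1,2) labelledD(1))

text \<open>The summands of \<open>sum_marked_component\<close> depend on the two subsets only
  through their sizes; the binomial coefficients count the subsets given to the marked
  component.\<close>

lemma graph_total_deriv:
  "s_deriv (graph_total K h r) A = (\<Sum>i\<le>h. \<Sum>j\<le>r. of_nat (h choose i) * of_nat (r choose j) *
     s_mult par (s_deriv (connected_total K i j)) (graph_total K (h - i) (r - j)) A)"
proof -
  let ?J = "{..<h}" and ?V = "{..<r}"
  have fin: "finite S" "finite T" if "S \<subseteq> ?J" "T \<subseteq> ?V" for S T using that finite_subset by blast+
  have Zf: "(\<lambda>A. \<Sum>G2\<in>bounded K (?J - S) (?V - T). graph_term G2 A) = graph_total K (h - card S) (r - card T)"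
    if "S \<subseteq> ?J" "T \<subseteq> ?V" for S T
    using graph_total_card[where J = "?J - S" and V = "?V - T" and K = K] that fin[OF that] by (simp add: card_Diff_subset fun_eq_iff)
  have Cf: "(\<lambda>A. \<Sum>G1\<in>connected_bounded K S T. of_int (graph_weight G1) * graph_term G1 A) = s_deriv (connected_total K (card S) (card T))"
    if "S \<subseteq> ?J" "T \<subseteq> ?V" for S T
  proof
    fix A
    have "(\<lambda>A. \<Sum>G1\<in>connected_bounded K S T. graph_term G1 A) = connected_total K (card S) (card T)"
      using connected_total_card[OF fin[OF that], where K = K] by (simp add: fun_eq_iff)
    hence "s_deriv (connected_total K (card S) (card T)) A = (\<Sum>G1\<in>connected_bounded K S T. s_deriv (graph_term G1) A)"
      using s_deriv_sum'[of graph_term "connected_bounded K S T" A] by simp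
    also have "\<dots> = (\<Sum>G1\<in>connected_bounded K S T. of_int (graph_weight G1) * graph_term G1 A)"
    proof (intro sum.cong refl s_deriv_graph_term)
      fix G assume "G \<in> connected_bounded K S T"
      then show "graph G" using boundedD(2) unfolding connected_bounded_def by blast
    qed
    finally show "(\<Sum>G1\<in>connected_bounded K S T. of_int (graph_weight G1) * graph_term G1 A) = s_deriv (connected_total K (card S) (card T)) A" by simp
  qed
  have "s_deriv (graph_total K h r) A = (\<Sum>G\<in>bounded K ?J ?V. s_deriv (graph_term G) A)"
    using s_deriv_sum'[of graph_term "bounded K ?J ?V" A] by (simp add: graph_total_def[abs_def])
  also have "\<dots> = (\<Sum>G\<in>bounded K ?J ?V. of_int (graph_weight G) * graph_term G A)"
    by (intro sum.cong refl s_deriv_graph_term) (rule boundedD(2))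
  also have "\<dots> = (\<Sum>S\<in>Pow ?J. \<Sum>T\<in>Pow ?V. \<Sum>G1\<in>connected_bounded K S T. \<Sum>G2\<in>bounded K (?J - S) (?V - T). of_int (graph_weight G1) * s_mult par (graph_term G1) (graph_term G2) A)"
    by (rule sum_marked_component) (auto intro: graph_term_join)
  also have "\<dots> = (\<Sum>S\<in>Pow ?J. \<Sum>T\<in>Pow ?V. s_mult par (s_deriv (connected_total K (card S) (card T))) (graph_total K (h - card S) (r - card T)) A)"
  proof (intro sum.cong refl)
    fix S T assume ST: "S \<in> Pow ?J" "T \<in> Pow ?V"
    have "s_mult par (\<lambda>A. \<Sum>G1\<in>connected_bounded K S T. of_int (graph_weight G1) * graph_term G1 A) (\<lambda>A. \<Sum>G2\<in>bounded K (?J - S) (?V - T). 1 * graph_term G2 A) A =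
      (\<Sum>G1\<in>connected_bounded K S T. of_int (graph_weight G1) * (\<Sum>G2\<in>bounded K (?J - S) (?V - T). 1 * s_mult par (graph_term G1) (graph_term G2) A))"
      unfolding s_mult_sum_left s_mult_sum_right ..
    then show "(\<Sum>G1\<in>connected_bounded K S T. \<Sum>G2\<in>bounded K (?J - S) (?V - T). of_int (graph_weight G1) * s_mult par (graph_term G1) (graph_term G2) A) =
      s_mult par (s_deriv (connected_total K (card S) (card T))) (graph_total K (h - card S) (r - card T)) A"
      using Zf[of S T] Cf[of S T] ST by (simp add: sum_distrib_left)
  qed
  also have "\<dots> = (\<Sum>S\<in>Pow ?J. \<Sum>j\<le>r. of_nat (r choose j) * s_mult par (s_deriv (connected_total K (card S) j)) (graph_total K (h - card S) (r - j)) A)"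
    by (rule sum.cong[OF refl])
       (use sum_Pow_card[of ?V "\<lambda>j. s_mult par (s_deriv (connected_total K (card _) j)) (graph_total K (h - card _) (r - j)) A"] in simp)
  also have "\<dots> = (\<Sum>i\<le>h. of_nat (h choose i) * (\<Sum>j\<le>r. of_nat (r choose j) * s_mult par (s_deriv (connected_total K i j)) (graph_total K (h - i) (r - j)) A))"
    using sum_Pow_card[of ?J "\<lambda>i. \<Sum>j\<le>r. of_nat (r choose j) * s_mult par (s_deriv (connected_total K i j)) (graph_total K (h - i) (r - j)) A"] by simp
  finally show ?thesis by (simp only: sum_distrib_left mult.assoc)
qed

lemma bounded_empty: "h > r * (K + 2) \<Longrightarrow> bounded K {..<h} {..<r} = {}"
proof (rule ccontr)
  assume h: "h > r * (K + 2)" and "bounded K {..<h} {..<r} \<noteq> {}"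
  then obtain G where G: "G \<in> bounded K {..<h} {..<r}" by blast
  note B = boundedD[OF G]
  have "valence G v \<le> K + 2" if "v \<in> {..<r}" for v using B(6)[OF that] by simp
  hence "(\<Sum>v\<in>{..<r}. valence G v) \<le> (\<Sum>v\<in>{..<r}. K + 2)" by (rule sum_mono)
  then show False using card_half_edges(1)[OF B(2)] B(3,4) h by simp
qed

lemma graph_total_zero: "h > r * (K + 2) \<Longrightarrow> graph_total K h r A = 0" "h > r * (K + 2) \<Longrightarrow> connected_total K h r A = 0"
  using bounded_empty by (simp_all add: graph_total_def connected_total_def connected_bounded_def)

lemma weight_ge_graph_total: "weight_ge par 2 (int r) (graph_total K h r)" "weight_ge par 2 (int r) (connected_total K h r)"
proof -
  show "weight_ge par 2 (int r) (graph_total K h r)" unfolding graph_total_def[abs_def]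
    by (rule weight_ge_sum) (use weight_ge_graph_term in force)
  show "weight_ge par 2 (int r) (connected_total K h r)" unfolding connected_total_def[abs_def] connected_bounded_def
    by (rule weight_ge_sum) (use weight_ge_graph_term in force)
qed

text \<open>The range of \<open>h\<close> is the same for all \<open>r\<close>, so that products of
  such series are sums over rectangles. The terms thereby added are zero by
  \<open>graph_total_zero\<close>.\<close>

definition connected_series :: "nat \<Rightarrow> series" where
  "connected_series K A = (\<Sum>r\<le>K. \<Sum>h\<le>K * (K + 2). fls_const (1 / (fact h * fact r)) * connected_total K h r A)"

lemma graph_series_eq: "graph_series K A = (\<Sum>r\<le>K. \<Sum>h\<le>K * (K + 2). fls_const (1 / (fact h * fact r)) * graph_total K h r A)"
  unfolding graph_series_def graph_total_def[symmetric]
proof (rule sum.cong[OF refl], rule sum.mono_neutral_left)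
  fix r assume "r \<in> {..K}"
  hence "r * (K + 2) \<le> K * (K + 2)" by (intro mult_le_mono1) simp
  then show "{..r * (K + 2)} \<subseteq> {..K * (K + 2)}" by (simp only: atMost_subset_iff)
  show "\<forall>h\<in>{..K * (K + 2)} - {..r * (K + 2)}. fls_const (1 / (fact h * fact r)) * graph_total K h r A = 0"
    using graph_total_zero(1)[of r K] by auto
qed auto

text \<open>The factorials turn the binomial convolution into a Cauchy product. The product also
  contains pairs with more than \<open>K\<close> vertices in total; these have weight above
  \<open>K\<close>, whence a congruence instead of an equality.\<close>

lemma graph_series_deriv: "weight_eq par (int K) (s_deriv (graph_series K)) (s_mult par (s_deriv (connected_series K)) (graph_series K))"
  unfolding weight_eq_iff
proof (intro allI impI)
  fix A e assume A: "admissible par A" "2 * e + int (size A) \<le> int K"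
  let ?H = "K * (K + 2)"
  define X where "X i j i' j' = fls_const (1 / (fact i * fact j * (fact i' * fact j'))) * s_mult par (s_deriv (connected_total K i j)) (graph_total K i' j') A"
    for i j i' j' :: nat
  define x where "x i j i' j' = fls_nth (X i j i' j') e" for i j i' j'
  \<comment> \<open>Every vertex has weight at least 1, so more than \<open>K\<close> vertices are
    too heavy.\<close>
  have x0: "x i j i' j' = 0" if "j + j' > K" for i j i' j'
  proof -
    have "weight_ge par 2 (int j + int j') (s_mult par (s_deriv (connected_total K i j)) (graph_total K i' j'))"
      by (intro weight_ge_mult weight_ge_deriv weight_ge_graph_total)
    hence "fls_nth (s_mult par (s_deriv (connected_total K i j)) (graph_total K i' j') A) e = 0"
      using A that unfolding weight_ge_def by force
    then show ?thesis by (simp add: x_def X_def)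
  qed
  \<comment> \<open>At most \<open>K\<close> vertices carry at most \<open>K * (K + 2)\<close>
    half-edges, so one of the two factors has too many half-edges for its vertices.\<close>
  have x1: "x i j i' j' = 0" if "i + i' > ?H" for i j i' j'
  proof (cases "j + j' > K")
    case False
    hence "(j + j') * (K + 2) \<le> ?H" by (intro mult_le_mono1) simp
    hence "i > j * (K + 2) \<or> i' > j' * (K + 2)" using that by (auto simp: add_mult_distrib)
    then have "s_mult par (s_deriv (connected_total K i j)) (graph_total K i' j') A = 0"
    proof
      assume "i > j * (K + 2)"
      hence "connected_total K i j B = 0" for B by (rule graph_total_zero)
      hence "s_deriv (connected_total K i j) B = 0" for B by (simp add: s_deriv_def)
      then show ?thesis by (simp add: s_mult_eq)
    next
      assume "i' > j' * (K + 2)"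
      then show ?thesis by (simp add: s_mult_eq graph_total_zero)
    qed
    then show ?thesis by (simp add: x_def X_def)
  qed (rule x0)
  have coeff: "fls_const (1 / (fact h * fact r)) * (of_nat (h choose i) * of_nat (r choose j) * Y) =
     fls_const (1 / (fact i * fact j * (fact (h - i) * fact (r - j)))) * Y" if "i \<le> h" "j \<le> r" for h i r j :: nat and Y :: "real fls"
  proof -
    have "1 / (fact h * fact r) * (real (h choose i) * real (r choose j)) = 1 / (fact i * fact j * (fact (h - i) * fact (r - j)))"
      by (simp add: binomial_fact[OF that(1)] binomial_fact[OF that(2)] field_simps)
    then have *: "fls_const (1 / (fact h * fact r)) * fls_const (real (h choose i) * real (r choose j)) =
      fls_const (1 / (fact i * fact j * (fact (h - i) * fact (r - j))))" by (simp only: fls_const_mult_const)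
    have e: "of_nat (h choose i) * of_nat (r choose j) = fls_const (real (h choose i) * real (r choose j))"
      by (simp add: fls_of_nat)
    show ?thesis unfolding *[symmetric] e by (simp only: mult.assoc)
  qed
  have "s_deriv (graph_series K) A = (\<Sum>r\<le>K. \<Sum>h\<le>?H. fls_const (1 / (fact h * fact r)) * s_deriv (graph_total K h r) A)"
  proof -
    have "s_deriv (graph_series K) A = s_deriv (\<lambda>A. \<Sum>r\<le>K. \<Sum>h\<le>?H. fls_const (1 / (fact h * fact r)) * graph_total K h r A) A"
      by (simp add: s_deriv_def graph_series_eq)
    also have "\<dots> = (\<Sum>r\<le>K. s_deriv (\<lambda>A. \<Sum>h\<le>?H. fls_const (1 / (fact h * fact r)) * graph_total K h r A) A)"
      by (rule s_deriv_sum')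
    finally show ?thesis by (simp only: s_deriv_sum)
  qed
  also have "\<dots> = (\<Sum>r\<le>K. \<Sum>h\<le>?H. \<Sum>i\<le>h. \<Sum>j\<le>r. X i j (h - i) (r - j))"
    unfolding graph_total_deriv sum_distrib_left X_def by (intro sum.cong refl coeff) auto
  finally have "fls_nth (s_deriv (graph_series K) A) e = (\<Sum>r\<le>K. \<Sum>h\<le>?H. \<Sum>i\<le>h. \<Sum>j\<le>r. x i j (h - i) (r - j))"
    by (simp add: x_def fls_nth_sum)
  also have "\<dots> = (\<Sum>r\<le>K. \<Sum>i\<le>?H. \<Sum>i'\<le>?H. \<Sum>j\<le>r. x i j i' (r - j))"
    by (intro sum.cong refl sum_triangle) (simp add: x1)
  also have "\<dots> = (\<Sum>i\<le>?H. \<Sum>i'\<le>?H. \<Sum>r\<le>K. \<Sum>j\<le>r. x i j i' (r - j))"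
    by (subst sum.swap) (intro sum.cong refl sum.swap)
  also have "\<dots> = (\<Sum>i\<le>?H. \<Sum>i'\<le>?H. \<Sum>j\<le>K. \<Sum>j'\<le>K. x i j i' j')"
    by (intro sum.cong refl sum_triangle) (simp add: x0)
  finally have L: "fls_nth (s_deriv (graph_series K) A) e = (\<Sum>i\<le>?H. \<Sum>i'\<le>?H. \<Sum>j\<le>K. \<Sum>j'\<le>K. x i j i' j')" .
  have dc: "s_deriv (connected_series K) = (\<lambda>A. \<Sum>z\<in>{..K} \<times> {..?H}. fls_const (1 / (fact (snd z) * fact (fst z))) * s_deriv (connected_total K (snd z) (fst z)) A)"
  proof
    fix A
    have "connected_series K = (\<lambda>A. \<Sum>z\<in>{..K} \<times> {..?H}. fls_const (1 / (fact (snd z) * fact (fst z))) * connected_total K (snd z) (fst z) A)"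
      by (simp add: connected_series_def fun_eq_iff sum.cartesian_product case_prod_beta)
    then show "s_deriv (connected_series K) A = (\<Sum>z\<in>{..K} \<times> {..?H}. fls_const (1 / (fact (snd z) * fact (fst z))) * s_deriv (connected_total K (snd z) (fst z)) A)"
      by (simp only: s_deriv_sum)
  qed
  have dz: "graph_series K = (\<lambda>A. \<Sum>z\<in>{..K} \<times> {..?H}. fls_const (1 / (fact (snd z) * fact (fst z))) * graph_total K (snd z) (fst z) A)"
    by (simp add: graph_series_eq fun_eq_iff sum.cartesian_product case_prod_beta)
  have "s_mult par (s_deriv (connected_series K)) (graph_series K) A = (\<Sum>z\<in>{..K} \<times> {..?H}. \<Sum>z'\<in>{..K} \<times> {..?H}. X (snd z) (fst z) (snd z') (fst z'))"
    unfolding dc dz s_mult_sum_left s_mult_sum_right sum_distrib_left X_def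
    by (intro sum.cong refl) (simp flip: mult.assoc)
  hence "fls_nth (s_mult par (s_deriv (connected_series K)) (graph_series K) A) e = (\<Sum>z\<in>{..K} \<times> {..?H}. \<Sum>z'\<in>{..K} \<times> {..?H}. x (snd z) (fst z) (snd z') (fst z'))"
    by (simp add: x_def fls_nth_sum)
  also have "\<dots> = (\<Sum>j\<le>K. \<Sum>i\<le>?H. \<Sum>j'\<le>K. \<Sum>i'\<le>?H. x i j i' j')"
  proof -
    have sp: "(\<Sum>z\<in>{..K} \<times> {..?H}. F (fst z) (snd z)) = (\<Sum>j\<le>K. \<Sum>i\<le>?H. F j i)" for F :: "nat \<Rightarrow> nat \<Rightarrow> real"
      by (simp add: sum.cartesian_product case_prod_beta)
    show ?thesis
      unfolding sp[where F = "\<lambda>j' i'. x _ _ i' j'"] by (rule sp[where F = "\<lambda>j i. \<Sum>j'\<le>K. \<Sum>i'\<le>?H. x i j i' j'"])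
  qed
  also have "\<dots> = (\<Sum>i\<le>?H. \<Sum>j\<le>K. \<Sum>i'\<le>?H. \<Sum>j'\<le>K. x i j i' j')"
    by (subst sum.swap) (intro sum.cong refl sum.swap)
  also have "\<dots> = (\<Sum>i\<le>?H. \<Sum>i'\<le>?H. \<Sum>j\<le>K. \<Sum>j'\<le>K. x i j i' j')"
    by (intro sum.cong refl sum.swap)
  finally show "fls_nth (s_deriv (graph_series K) A) e = fls_nth (s_mult par (s_deriv (connected_series K)) (graph_series K) A) e"
    using L by simp
qed

end

context feynman
begin

lemma graph_term_zero: "graph G \<Longrightarrow> graph_coeff G A = 0 \<Longrightarrow> graph_term G A = 0"
  by (simp add: graph_term_def amp_graph_coeff)

lemma graph_coeff_inadmissible: "\<not> admissible par A \<Longrightarrow> graph_coeff G A = 0"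
  by (simp add: graph_coeff_def real_word_def)

lemma graph_series_nonzero:
  assumes "graph_series K A \<noteq> 0"
  obtains G where "graph G" "graph_coeff G A \<noteq> 0"
proof -
  obtain r where "(\<Sum>h\<le>K * (K + 2). fls_const (1 / (fact h * fact r)) * graph_total K h r A) \<noteq> 0"
    using assms unfolding graph_series_eq by (meson sum.neutral)
  then obtain h where "fls_const (1 / (fact h * fact r)) * graph_total K h r A \<noteq> 0"
    by (meson sum.neutral)
  hence "graph_total K h r A \<noteq> 0" by auto
  then obtain G where "G \<in> bounded K {..<h} {..<r}" "graph_term G A \<noteq> 0"
    unfolding graph_total_def by (meson sum.neutral)
  then show ?thesis using that[of G] boundedD(2) graph_term_zero by blast
qed

text \<open>The truncation at 0 admits no vertices, so only the empty graph remains. This yields the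
  constant term of the integral.\<close>

lemma graph_series_0: "graph_series 0 A = s_one A"
proof -
  let ?G = "make_graph {} {} (\<lambda>_. undefined) (\<lambda>_. undefined) (\<lambda>x. x)"
  have G: "graph ?G" by (simp add: graph_def)
  have "graph_series 0 A = (\<Sum>G\<in>bounded 0 {} {}. graph_term G A)" by (simp add: graph_series_def)
  also have "\<dots> = graph_term ?G A"
  proof -
    have "involutions {} = {\<lambda>x::nat. x}" by (auto simp: involutions_def)
    moreover have "genera 0 {} {} \<rho> = {\<lambda>_. undefined}" for \<rho> by (auto simp: genera_def)
    ultimately show ?thesis by (simp add: sum_bounded)
  qed
  also have "\<dots> = s_one A"
    by (simp add: graph_term_def hbar_exponent_def amp_eq[OF G] labellings_def edge_set_def legs_def ordered_term_def s_word_def)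
  finally show ?thesis .
qed

lemma weight_eq_deriv: "weight_eq P K F G \<Longrightarrow> weight_eq P K (s_deriv F) (s_deriv G)"
  unfolding weight_eq_iff s_deriv_nth by simp

theorem log_integral:
  assumes A: "set_mset A \<subseteq> {..<n}" and le: "2 * e + int (size A) \<le> int K"
  shows "fls_nth (s_log par (integral_L (s_exp par vertex_function)) A) e = fls_nth (connected_series K A) e"
proof (cases "admissible par A")
  case False
  have "s_log par (integral_L (s_exp par vertex_function)) A = 0"
    unfolding s_log_def by (simp add: s_power_inadmissible[OF False])
  moreover have "connected_total K h r A = 0" for h r
    unfolding connected_total_def connected_bounded_def using graph_term_zero graph_coeff_inadmissible[OF False] boundedD(2) by (auto intro!: sum.neutral)
  ultimately show ?thesis by (simp add: connected_series_def)
next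
  case True
  \<comment> \<open>\<open>gauss_integral\<close> has its meaning only at monomials on
    \<open>H\<close>. Cut off elsewhere, it agrees with the graph series, which involves no other
    coordinates.\<close>
  define Z where "Z B = (if set_mset B \<subseteq> {..<n} then integral_L (s_exp par vertex_function) B else 0)" for B
  have Zw: "weight_eq par (int K) Z (graph_series K)" for K
    unfolding weight_eq_iff
  proof (intro allI impI)
    fix B e assume B: "admissible par B" "2 * e + int (size B) \<le> int K"
    show "fls_nth (Z B) e = fls_nth (graph_series K B) e"
    proof (cases "set_mset B \<subseteq> {..<n}")
      case False
      hence "graph_series K B = 0" using graph_coeff_nonzero(2) graph_series_nonzero by metis
      then show ?thesis using False by (simp add: Z_def)
    qed (use integral_L_exp B in \<open>simp add: Z_def\<close>)
  qed
  have "even_series par Z"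
    unfolding even_series_def
  proof (intro allI impI)
    fix B assume B: "admissible par B" "Z B \<noteq> 0"
    then obtain e where e: "fls_nth (Z B) e \<noteq> 0" by (metis fls_eqI fls_zero_nth)
    \<comment> \<open>A truncation chosen to reach the weight of the given coefficient is enough to
      determine its parity.\<close>
    define K' where "K' = nat (2 * e + int (size B))"
    have "2 * e + int (size B) \<le> int K'" by (simp add: K'_def)
    hence "fls_nth (graph_series K' B) e \<noteq> 0" using Zw[of K'] B(1) e unfolding weight_eq_iff by metis
    hence "graph_series K' B \<noteq> 0" by auto
    then show "even (odd_count par B)" using graph_coeff_nonzero(3) graph_series_nonzero by metis
  qed
  \<comment> \<open>Congruence with the truncation at 0 says that \<open>Z - 1\<close> has only
    terms of positive weight.\<close>
  moreover have "weight_ge par 2 1 (\<lambda>B. Z B - s_one B)"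
    using Zw[of 0] unfolding weight_eq_def graph_series_0[abs_def] by simp
  moreover have C1: "weight_ge par 2 1 (connected_series K)"
    unfolding connected_series_def[abs_def]
  proof (intro weight_ge_sum weight_ge_const)
    fix r h
    show "weight_ge par 2 1 (connected_total K h r)"
    proof (cases r)
      case 0
      \<comment> \<open>Connected graphs are non-empty, so the connected series has no terms without
        vertices.\<close>
      have "connected_bounded K {..<h} {..<r} = {}"
        using 0 boundedD(4) by (fastforce simp: connected_bounded_def connected_graph_def)
      then show ?thesis by (simp add: connected_total_def[abs_def] weight_ge_def)
    qed (use weight_ge_mono[OF weight_ge_graph_total(2)] in auto)
  qed
  moreover have "weight_eq par (int K) (s_deriv Z) (s_mult par (s_deriv (connected_series K)) Z)"
  proof -
    have "weight_eq par (int K) (s_deriv Z) (s_deriv (graph_series K))" by (rule weight_eq_deriv[OF Zw])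
    also have "weight_eq par (int K) \<dots> (s_mult par (s_deriv (connected_series K)) (graph_series K))" by (rule graph_series_deriv)
    also have "weight_eq par (int K) \<dots> (s_mult par (s_deriv (connected_series K)) Z)"
    proof (rule weight_eq_mult[OF weight_eq_refl[OF refl] weight_eq_sym[OF Zw]])
      show "weight_ge par 2 0 (s_deriv (connected_series K))" by (rule weight_ge_deriv[OF weight_ge_mono[OF C1]]) simp
      show "weight_ge par 2 0 (graph_series K)" unfolding graph_series_eq[abs_def]
        by (intro weight_ge_sum weight_ge_const weight_ge_mono[OF weight_ge_graph_total(1)]) simp
    qed
    finally show ?thesis .
  qed
  ultimately have "weight_eq par (int K) (s_log par Z) (connected_series K)" by (rule s_log_unique)
  moreover have "s_log par (integral_L (s_exp par vertex_function)) A = s_log par Z A"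
  proof -
    have "s_power par (\<lambda>A. integral_L (s_exp par vertex_function) A - s_one A) r A = s_power par (\<lambda>A. Z A - s_one A) r A" for r
    proof (rule s_power_cong)
      fix B assume "B \<subseteq># A"
      hence "set_mset B \<subseteq> {..<n}" using A set_mset_mono by blast
      then show "integral_L (s_exp par vertex_function) B - s_one B = Z B - s_one B" by (simp add: Z_def)
    qed
    then show ?thesis by (simp add: s_log_def)
  qed
  ultimately show ?thesis using True le unfolding weight_eq_iff by metis
qed

end

section \<open>The first homology of a graph\<close>

text \<open>Rank-nullity inside a space that need not be finite-dimensional: a basis of the kernel
  is extended to one of \<open>S\<close>, and \<open>f\<close> is injective on the span of the added
  vectors.\<close>

lemma dim_kernel_image:
  fixes f :: "'a::real_vector \<Rightarrow> 'b::real_vector"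
  assumes f: "linear f" and S: "subspace S" and fin: "finite B0" "S \<subseteq> span B0"
  shows "dim S = dim {x \<in> S. f x = 0} + dim (f ` S)"
proof -
  let ?K = "{x \<in> S. f x = 0}"
  have K: "subspace ?K"
    using S f by (auto simp: subspace_def linear_add linear_scale linear_0)
  obtain BK where BK: "BK \<subseteq> ?K" "independent BK" "?K \<subseteq> span BK" "card BK = dim ?K"
    using basis_exists by blast
  obtain B where B: "BK \<subseteq> B" "B \<subseteq> S" "independent B" "S \<subseteq> span B"
    using maximal_independent_subset_extend[of BK S] BK by auto
  have finB: "finite B" using independent_span_bound[OF fin(1) B(3)] B(2) fin(2) by auto
  let ?C = "B - BK"
  have spC: "span ?C \<subseteq> S" using B(2) S by (intro span_minimal) auto
  have inj: "inj_on f (span ?C)"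
  proof (subst linear_injective_on_subspace_0[OF f subspace_span], intro ballI impI)
    fix x assume x: "x \<in> span ?C" "f x = 0"
    hence "x \<in> span BK" using spC BK(3) by auto
    \<comment> \<open>A vector in the spans of two disjoint parts of \<open>B\<close> has a
      representation over each part. Both agree with its representation over \<open>B\<close>, so
      all coefficients vanish.\<close>
    hence 1: "representation B x = representation BK x" using representation_extend[OF B(3) _ B(1)] by blast
    have 2: "representation B x = representation ?C x" using representation_extend[OF B(3) x(1)] by blast
    have "representation B x b = 0" for b
      using representation_ne_zero[of BK x b] representation_ne_zero[of ?C x b] 1 2 by (metis DiffD2)
    moreover have "x \<in> span B" using x(1) span_mono[of ?C B] by auto
    ultimately show "x = 0" using sum_nonzero_representation_eq[OF B(3), of x] by simp
  qed
  have indC: "independent ?C" using B(3) independent_mono by blast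
  have ind: "independent (f ` ?C)" by (rule linear_independent_injective_image[OF f indC inj])
  have "f ` S \<subseteq> span (f ` ?C)"
  proof
    fix y assume "y \<in> f ` S"
    then obtain x where x: "x \<in> S" "y = f x" by auto
    have "f ` span B = span (f ` B)" by (rule linear_span_image[OF f, symmetric])
    hence "y \<in> span (f ` B)" using x B(4) by auto
    moreover have "f ` B \<subseteq> insert 0 (f ` ?C)" using BK(1) by auto
    hence "span (f ` B) \<subseteq> span (insert 0 (f ` ?C))" by (rule span_mono)
    ultimately show "y \<in> span (f ` ?C)" by (auto simp: span_insert_0)
  qed
  moreover have "f ` ?C \<subseteq> f ` S" using B(2) by auto
  ultimately have "dim (f ` S) = card (f ` ?C)" using ind basis_card_eq_dim by metis
  moreover have "card (f ` ?C) = card ?C" using inj span_superset[of ?C] by (intro card_image inj_on_subset[OF inj])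
  moreover have "dim S = card B" using B basis_card_eq_dim by metis
  moreover have "card B = card BK + card ?C" using finB B(1) by (simp add: card_Diff_subset card_mono finite_subset)
  ultimately show ?thesis using BK(4) by simp
qed

lemma lookup_scaleR_real: "Poly_Mapping.lookup (r *\<^sub>R x) i = r * Poly_Mapping.lookup x i"
  for x :: "'a \<Rightarrow>\<^sub>0 real"
proof -
  have "{i. r *\<^sub>R Poly_Mapping.lookup x i \<noteq> 0} \<subseteq> Poly_Mapping.keys x" by (auto simp: in_keys_iff)
  hence "finite {i. r *\<^sub>R Poly_Mapping.lookup x i \<noteq> 0}" using finite_keys finite_subset by blast
  then show ?thesis unfolding scaleR_poly_mapping_def by simp
qed

text \<open>The coordinates at the points \<open>a j\<close> are dual to the vectors
  \<open>D i\<close>, so every relation among these vectors is trivial.\<close>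

lemma dim_span_triangular:
  fixes D :: "'i \<Rightarrow> 'a \<Rightarrow>\<^sub>0 real"
  assumes "finite I" and D: "\<And>i j. i \<in> I \<Longrightarrow> j \<in> I \<Longrightarrow> Poly_Mapping.lookup (D i) (a j) = (if i = j then 1 else 0)"
  shows "dim (span (D ` I)) = card I"
proof -
  have inj: "inj_on D I"
  proof (rule inj_onI)
    fix i j assume "i \<in> I" "j \<in> I" "D i = D j"
    then show "i = j" using D[of i j] D[of j j] by (auto split: if_splits)
  qed
  have "independent (D ` I)"
  proof (subst dependent_finite, simp add: assms(1), safe)
    fix u i assume i: "i \<in> I" "u (D i) \<noteq> 0" and s: "(\<Sum>v\<in>D ` I. u v *\<^sub>R v) = 0"
    have "(\<Sum>v\<in>D ` I. u v *\<^sub>R v) = (\<Sum>j\<in>I. u (D j) *\<^sub>R D j)" using inj by (simp add: sum.reindex)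
    hence "0 = Poly_Mapping.lookup (\<Sum>j\<in>I. u (D j) *\<^sub>R D j) (a i)" using s by simp
    also have "\<dots> = (\<Sum>j\<in>I. if j = i then u (D i) else 0)"
      unfolding lookup_sum lookup_scaleR_real using D i(1) by (intro sum.cong) auto
    also have "\<dots> = u (D i)" using assms(1) i(1) by simp
    finally show False using i(2) by simp
  qed
  then have "dim (span (D ` I)) = card (D ` I)" by (rule dim_span_eq_card_independent)
  then show ?thesis using inj by (simp only: card_image)
qed

text \<open>Cycles are the kernel of the boundary map on antisymmetric functions of half-edges. This
  space has one dimension per edge, and for a connected graph its image consists of all functions on
  the vertices with sum zero.\<close>

theorem dim_cycles:
  assumes G: "graph G" and conn: "connected_graph G"
  shows "dim (cycles G) + card (verts G) = card (edge_set (flip G) (half_edges G)) + 1"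
proof -
  let ?J = "half_edges G" and ?V = "verts G" and ?E = "edge_set (flip G) (half_edges G)"
  note fin = graph_finite[OF G] and fl = graph_flip[OF G]
  let ?lk = Poly_Mapping.lookup
  \<comment> \<open>The space of 1-chains; antisymmetry forces the value 0 on legs.\<close>
  define \<Omega> where "\<Omega> = {c :: nat \<Rightarrow>\<^sub>0 real. Poly_Mapping.keys c \<subseteq> ?J \<and> (\<forall>x\<in>?J. ?lk c (flip G x) = - ?lk c x)}"
  define e where "e x = Poly_Mapping.single x 1 - Poly_Mapping.single (flip G x) (1 :: real)" for x
  define bd where "bd c = (\<Sum>v\<in>?V. Poly_Mapping.single v (\<Sum>x | x \<in> ?J \<and> root G x = v. ?lk c x))" for c :: "nat \<Rightarrow>\<^sub>0 real"
  have lk_e: "?lk (e x) y = (if y = x then 1 else 0) - (if y = flip G x then 1 else 0)" for x y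
    by (auto simp: e_def lookup_minus lookup_single when_def)
  have lk_d: "?lk (bd c) v = (if v \<in> ?V then (\<Sum>x | x \<in> ?J \<and> root G x = v. ?lk c x) else 0)" for c v
    unfolding bd_def lookup_sum lookup_single when_def using fin(2) by (simp add: sum.delta)
  have finE: "finite ?E" using fin by (simp add: edge_set_def)
  have lin: "linear bd"
    by (rule linearI; rule poly_mapping_eqI) (simp_all add: lk_d lookup_add lookup_scaleR_real sum.distrib sum_distrib_left)
  have sub\<Omega>: "subspace \<Omega>"
  proof -
    have "\<Omega> = {c. (\<forall>x. x \<notin> ?J \<longrightarrow> ?lk c x = 0) \<and> (\<forall>x\<in>?J. ?lk c (flip G x) = - ?lk c x)}"
      unfolding \<Omega>_def subset_iff in_keys_iff by blast
    then show ?thesis by (simp add: subspace_def lookup_add lookup_scaleR_real)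
  qed
  have e\<Omega>: "e x \<in> \<Omega>" if x: "x \<in> ?J" for x
  proof -
    have "?lk (e x) (flip G y) = - ?lk (e x) y" if "y \<in> ?J" for y
    proof -
      have "flip G y = x \<longleftrightarrow> y = flip G x" "flip G y = flip G x \<longleftrightarrow> y = x" using fl[OF x] fl[OF that] by metis+
      then show ?thesis unfolding lk_e by simp
    qed
    moreover have "Poly_Mapping.keys (e x) \<subseteq> ?J" using x fl[OF x] by (auto simp: in_keys_iff lk_e split: if_splits)
    ultimately show ?thesis by (simp add: \<Omega>_def)
  qed
  have \<Omega>_span: "\<Omega> = span (e ` ?E)"
  proof (intro equalityI subsetI)
    fix c assume c: "c \<in> \<Omega>"
    have "c = (\<Sum>x\<in>?E. ?lk c x *\<^sub>R e x)"
    proof (rule poly_mapping_eqI)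
      fix y
      have "?lk (\<Sum>x\<in>?E. ?lk c x *\<^sub>R e x) y = (\<Sum>x\<in>?E. if x = y then ?lk c y else 0) - (\<Sum>x\<in>?E. if flip G x = y then ?lk c x else 0)"
        unfolding lookup_sum lookup_scaleR_real lk_e sum_subtractf[symmetric] by (intro sum.cong) auto
      also have "(\<Sum>x\<in>?E. if x = y then ?lk c y else 0) = (if y \<in> ?E then ?lk c y else 0)" using finE by simp
      also have "(\<Sum>x\<in>?E. if flip G x = y then ?lk c x else 0) = (if y \<in> ?J \<and> flip G y < y then ?lk c (flip G y) else 0)"
      proof (cases "y \<in> ?J \<and> flip G y < y")
        case True
        have "(\<Sum>x\<in>?E. if flip G x = y then ?lk c x else 0) = (\<Sum>x\<in>?E. if x = flip G y then ?lk c x else 0)"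
        proof (rule sum.cong[OF refl])
          fix x assume "x \<in> ?E"
          hence "flip G (flip G x) = x" "flip G (flip G y) = y" using fl True by (auto simp: edge_set_def)
          hence "(flip G x = y) = (x = flip G y)" by metis
          then show "(if flip G x = y then ?lk c x else 0) = (if x = flip G y then ?lk c x else 0)" by simp
        qed
        moreover have "flip G y \<in> ?E" using True fl[of y] by (simp add: edge_set_def)
        ultimately show ?thesis using finE True by simp
      next
        case False
        have "flip G x \<noteq> y" if "x \<in> ?E" for x using that False fl[of x] by (auto simp: edge_set_def)
        then show ?thesis using False by (auto intro!: sum.neutral)
      qed
      also have "(if y \<in> ?E then ?lk c y else 0) - (if y \<in> ?J \<and> flip G y < y then ?lk c (flip G y) else 0) = ?lk c y"
      proof (cases "y \<in> ?J")
        case True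
        hence "?lk c (flip G y) = - ?lk c y" using c by (simp add: \<Omega>_def)
        then show ?thesis using True by (auto simp: edge_set_def neq_iff not_less le_less)
      next
        case False
        hence "?lk c y = 0" using c by (auto simp: \<Omega>_def in_keys_iff)
        then show ?thesis using False by (simp add: edge_set_def)
      qed
      finally show "?lk c y = ?lk (\<Sum>x\<in>?E. ?lk c x *\<^sub>R e x) y" by simp
    qed
    also have "\<dots> \<in> span (e ` ?E)" by (intro span_sum span_scale span_base) auto
    finally show "c \<in> span (e ` ?E)" .
  next
    have "e ` ?E \<subseteq> \<Omega>" using e\<Omega> by (auto simp: edge_set_def)
    hence "span (e ` ?E) \<subseteq> \<Omega>" using sub\<Omega> by (rule span_minimal)
    then show "c \<in> \<Omega>" if "c \<in> span (e ` ?E)" for c using that by blast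
  qed
  have dim\<Omega>: "dim \<Omega> = card ?E"
    unfolding \<Omega>_span
  proof (rule dim_span_triangular[OF finE, where a = "\<lambda>x. x"])
    fix i j assume "i \<in> ?E" "j \<in> ?E"
    moreover have "j \<noteq> flip G i" using \<open>i \<in> ?E\<close> \<open>j \<in> ?E\<close> fl[of i] by (auto simp: edge_set_def)
    ultimately show "?lk (e i) j = (if i = j then 1 else 0)" by (simp add: lk_e)
  qed
  have cyc: "cycles G = {c \<in> \<Omega>. bd c = 0}"
  proof -
    have "bd c = 0 \<longleftrightarrow> (\<forall>v\<in>?V. (\<Sum>x | x \<in> ?J \<and> root G x = v. ?lk c x) = 0)" for c
      using lk_d[of c] by (metis lookup_zero poly_mapping_eqI)
    then show ?thesis unfolding cycles_def \<Omega>_def by auto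
  qed
  obtain v0 where v0: "v0 \<in> ?V" using conn by (auto simp: connected_graph_def)
  \<comment> \<open>The differences to a base vertex form a basis of the functions on the vertices
    with sum zero.\<close>
  define d where "d v = Poly_Mapping.single v 1 - Poly_Mapping.single v0 (1 :: real)" for v
  have lk_dd: "?lk (d v) y = (if y = v then 1 else 0) - (if y = v0 then 1 else 0)" for v y
    by (auto simp: d_def lookup_minus lookup_single when_def)
  have boundary_e: "bd (e x) = Poly_Mapping.single (root G x) 1 - Poly_Mapping.single (root G (flip G x)) 1" if x: "x \<in> ?J" for x
  proof (rule poly_mapping_eqI)
    fix v
    have r: "root G x \<in> ?V" "root G (flip G x) \<in> ?V" using G x fl[OF x] by (auto simp: graph_def)
    have "(\<Sum>y | y \<in> ?J \<and> root G y = v. ?lk (e x) y) =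
      (\<Sum>y | y \<in> ?J \<and> root G y = v. if y = x then 1 else 0) - (\<Sum>y | y \<in> ?J \<and> root G y = v. if y = flip G x then 1 else 0)"
      unfolding lk_e by (rule sum_subtractf)
    also have "\<dots> = (if root G x = v then 1 else 0) - (if root G (flip G x) = v then 1 else 0)"
      using fin x fl[OF x] by simp
    finally show "?lk (bd (e x)) v = ?lk (Poly_Mapping.single (root G x) 1 - Poly_Mapping.single (root G (flip G x)) 1) v"
      using r by (auto simp: lk_d lookup_minus lookup_single when_def)
  qed
  have sub_im: "subspace (bd ` \<Omega>)" using linear_subspace_image[OF lin sub\<Omega>] .
  \<comment> \<open>The difference of the ends of a path is a boundary; connectedness will supply
    paths from the base vertex.\<close>
  have path: "Poly_Mapping.single v 1 - Poly_Mapping.single u 1 \<in> bd ` \<Omega>" if "(u, v) \<in> (adjacency G)\<^sup>*" for u v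
    using that
  proof (induction rule: rtrancl_induct)
    case base
    then show ?case using subspace_0[OF sub_im] by simp
  next
    case (step v w)
    then obtain x where x: "x \<in> ?J" "v = root G x" "w = root G (flip G x)" by (auto simp: adjacency_def)
    have "bd (e x) \<in> bd ` \<Omega>" using e\<Omega>[OF x(1)] by blast
    from subspace_diff[OF sub_im step(3) this] show ?case
      unfolding boundary_e[OF x(1)] x(2,3)[symmetric] by simp
  qed
  have im: "bd ` \<Omega> = span (d ` (?V - {v0}))"
  proof (intro equalityI subsetI)
    fix u assume "u \<in> bd ` \<Omega>"
    then obtain c where c: "c \<in> \<Omega>" "u = bd c" by auto
    have "(\<Sum>v\<in>?V. ?lk u v) = (\<Sum>v\<in>?V. \<Sum>x\<in>{x \<in> ?J. root G x = v}. ?lk c x)"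
      using c(2) by (simp add: lk_d)
    also have "\<dots> = (\<Sum>x\<in>?J. ?lk c x)"
      by (rule sum.group) (use G fin in \<open>auto simp: graph_def\<close>)
    also have "\<dots> = 0"
    proof -
      \<comment> \<open>Reindexing by \<open>flip G\<close> shows that the total equals its own
        negative.\<close>
      have "(\<Sum>x\<in>?J. ?lk c x) = (\<Sum>x\<in>?J. ?lk c (flip G x))"
        by (rule sum.reindex_bij_witness[of _ "flip G" "flip G"]) (use fl in auto)
      also have "\<dots> = - (\<Sum>x\<in>?J. ?lk c x)" using c(1) by (simp add: \<Omega>_def sum_negf)
      finally show ?thesis by simp
    qed
    finally have s0: "(\<Sum>v\<in>?V. ?lk u v) = 0" .
    have out: "?lk u v = 0" if "v \<notin> ?V" for v using c(2) that by (simp add: lk_d)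
    have "u = (\<Sum>v\<in>?V - {v0}. ?lk u v *\<^sub>R d v)"
    proof (rule poly_mapping_eqI)
      fix y
      have "?lk (\<Sum>v\<in>?V - {v0}. ?lk u v *\<^sub>R d v) y = (\<Sum>v\<in>?V - {v0}. if v = y then ?lk u y else 0) - (if y = v0 then (\<Sum>v\<in>?V - {v0}. ?lk u v) else 0)"
        unfolding lookup_sum lookup_scaleR_real lk_dd
        by (cases "y = v0") (auto simp: sum_subtractf[symmetric] sum_negf[symmetric] intro!: sum.cong split: if_splits)
      also have "(\<Sum>v\<in>?V - {v0}. if v = y then ?lk u y else 0) = (if y \<in> ?V - {v0} then ?lk u y else 0)"
        using fin(2) by simp
      also have "(\<Sum>v\<in>?V - {v0}. ?lk u v) = - ?lk u v0"
        using s0 sum.remove[OF fin(2) v0, of "?lk u"] by simp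
      finally show "?lk u y = ?lk (\<Sum>v\<in>?V - {v0}. ?lk u v *\<^sub>R d v) y"
        using out[of y] by (auto split: if_splits)
    qed
    also have "\<dots> \<in> span (d ` (?V - {v0}))" by (intro span_sum span_scale span_base) auto
    finally show "u \<in> span (d ` (?V - {v0}))" .
  next
    have "d v \<in> bd ` \<Omega>" if "v \<in> ?V" for v
      using path[of v0 v] conn v0 that unfolding connected_graph_adjacency d_def by blast
    hence "span (d ` (?V - {v0})) \<subseteq> bd ` \<Omega>" using sub_im by (intro span_minimal) auto
    then show "u \<in> bd ` \<Omega>" if "u \<in> span (d ` (?V - {v0}))" for u using that by blast
  qed
  have "dim (bd ` \<Omega>) = card (?V - {v0})"
    unfolding im
  proof (rule dim_span_triangular[where a = "\<lambda>v. v"])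
    fix i j assume "i \<in> ?V - {v0}" "j \<in> ?V - {v0}"
    then show "?lk (d i) j = (if i = j then 1 else 0)" by (simp add: lk_dd)
  qed (use fin in simp)
  moreover have "dim \<Omega> = dim (cycles G) + dim (bd ` \<Omega>)"
    unfolding cyc by (rule dim_kernel_image[OF lin sub\<Omega>, of "e ` ?E"]) (use finE \<Omega>_span in auto)
  moreover have "card ?V > 0" using v0 fin(2) by (auto simp: card_gt_0_iff)
  ultimately show ?thesis using dim\<Omega> v0 fin(2) by simp
qed

context feynman
begin

lemma graph_genus_eq:
  assumes "graph G" "connected_graph G"
  shows "int (graph_genus G) = hbar_exponent G + 1"
proof -
  have "int (dim (cycles G)) + int (card (verts G)) = int (card (edge_set (flip G) (half_edges G))) + 1"
    using arg_cong[OF dim_cycles[OF assms], of int] by simp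
  then show ?thesis by (simp add: graph_genus_def hbar_exponent_def sum_subtractf)
qed

end

section \<open>Isomorphism classes and automorphisms\<close>

lemma is_iso_cong:
  assumes "graph G" "is_iso G G' \<phi> \<psi>"
    and "\<And>x. x \<in> half_edges G \<Longrightarrow> \<phi>' x = \<phi> x" "\<And>v. v \<in> verts G \<Longrightarrow> \<psi>' v = \<psi> v"
  shows "is_iso G G' \<phi>' \<psi>'"
proof -
  note D = is_isoD[OF assms(2)]
  have "bij_betw \<phi>' (half_edges G) (half_edges G')" using D(1) bij_betw_cong[of "half_edges G" \<phi>' \<phi>] assms(3) by simp
  moreover have "bij_betw \<psi>' (verts G) (verts G')" using D(2) bij_betw_cong[of "verts G" \<psi>' \<psi>] assms(4) by simp
  moreover have "root G x \<in> verts G \<and> flip G x \<in> half_edges G" if "x \<in> half_edges G" for x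
    using assms(1) that by (simp add: graph_def)
  ultimately show ?thesis unfolding is_iso_def using D(3-5) assms(3,4) by simp
qed

section \<open>Automorphism groups\<close>

lemma finite_Aut: "graph G \<Longrightarrow> finite (Aut G)"
proof -
  assume "graph G"
  hence "finite ({\<phi>. \<phi> permutes half_edges G} \<times> {\<psi>. \<psi> permutes verts G})"
    by (simp add: graph_finite finite_permutations)
  then show ?thesis by (rule rev_finite_subset) (auto simp: Aut_def)
qed

lemma card_Aut_pos: "graph G \<Longrightarrow> card (Aut G) > 0"
proof -
  assume "graph G"
  moreover have "(id, id) \<in> Aut G" by (simp add: Aut_def permutes_id is_iso_def bij_betw_id)
  ultimately show ?thesis using finite_Aut card_gt_0_iff by blast
qed

text \<open>Conjugation by the isomorphism embeds one group into the other. The conjugates are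
  extended by the identity because members of \<open>Aut\<close> fix everything outside the
  graph.\<close>

lemma card_Aut_le:
  assumes iso: "is_iso G G' \<phi> \<psi>" and G: "graph G" "graph G'"
  shows "card (Aut G) \<le> card (Aut G')"
proof -
  note D = is_isoD[OF iso]
  let ?J = "half_edges G" and ?V = "verts G" and ?J' = "half_edges G'" and ?V' = "verts G'"
  define \<phi>' \<psi>' where "\<phi>' = inv_into ?J \<phi>" and "\<psi>' = inv_into ?V \<psi>"
  have iso': "is_iso G' G \<phi>' \<psi>'" unfolding \<phi>'_def \<psi>'_def by (rule iso_inverse[OF iso G(1)])
  define C where "C z = ((\<lambda>y. if y \<in> ?J' then \<phi> (fst z (\<phi>' y)) else y), (\<lambda>y. if y \<in> ?V' then \<psi> (snd z (\<psi>' y)) else y))"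
    for z :: "(nat \<Rightarrow> nat) \<times> (nat \<Rightarrow> nat)"
  have "C z \<in> Aut G'" if "z \<in> Aut G" for z
  proof -
    obtain a b where z: "z = (a, b)" by (cases z)
    have ab: "is_iso G G a b" using that z by (simp add: Aut_def)
    have "is_iso G' G' (\<phi> \<circ> (a \<circ> \<phi>')) (\<psi> \<circ> (b \<circ> \<psi>'))"
      by (rule iso_compose[OF iso_compose[OF iso' ab G(2)] iso G(2)])
    hence i: "is_iso G' G' (fst (C z)) (snd (C z))" by (rule is_iso_cong[OF G(2)]) (auto simp: C_def z)
    have "fst (C z) permutes ?J'" "snd (C z) permutes ?V'"
      using is_isoD(1,2)[OF i] by (auto intro!: bij_imp_permutes simp: C_def)
    then show ?thesis using i by (simp add: Aut_def case_prod_beta)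
  qed
  moreover have "inj_on C (Aut G)"
  proof (rule inj_onI)
    fix z z' assume *: "z \<in> Aut G" "z' \<in> Aut G" "C z = C z'"
    obtain a b a' b' where z: "z = (a, b)" "z' = (a', b')" by (cases z, cases z')
    have p: "a permutes ?J" "b permutes ?V" "a' permutes ?J" "b' permutes ?V" using *(1,2) z by (auto simp: Aut_def)
    have inj: "inj_on \<phi> ?J" "inj_on \<psi> ?V" and im: "\<And>x. x \<in> ?J \<Longrightarrow> \<phi> x \<in> ?J'" "\<And>v. v \<in> ?V \<Longrightarrow> \<psi> v \<in> ?V'"
      using D(1,2) by (auto simp: bij_betw_def)
    have "a x = a' x" for x
    proof (cases "x \<in> ?J")
      case True
      have "fst (C z) (\<phi> x) = fst (C z') (\<phi> x)" using * by simp
      hence "\<phi> (a x) = \<phi> (a' x)" using True im inj by (simp add: C_def z \<phi>'_def)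
      then show ?thesis using inj(1) True p by (simp add: inj_on_eq_iff permutes_in_image)
    qed (use p in \<open>simp add: permutes_not_in\<close>)
    moreover have "b v = b' v" for v
    proof (cases "v \<in> ?V")
      case True
      have "snd (C z) (\<psi> v) = snd (C z') (\<psi> v)" using * by simp
      hence "\<psi> (b v) = \<psi> (b' v)" using True im inj by (simp add: C_def z \<psi>'_def)
      then show ?thesis using inj(2) True p by (simp add: inj_on_eq_iff permutes_in_image)
    qed (use p in \<open>simp add: permutes_not_in\<close>)
    ultimately show "z = z'" by (auto simp: z)
  qed
  ultimately show ?thesis using finite_Aut[OF G(2)] by (intro card_inj_on_le[of C]) auto
qed

lemma card_Aut_iso:
  assumes "is_iso G G' \<phi> \<psi>" "graph G" "graph G'"
  shows "card (Aut G') = card (Aut G)"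
  using card_Aut_le[OF assms] card_Aut_le[OF iso_inverse[OF assms(1,2)] assms(3,2)] by simp

text \<open>The orbit-stabilizer theorem for the action of pairs of permutations by relabelling.\<close>

lemma card_isomorphic_labelled:
  assumes G: "G \<in> labelled J V" and fin: "finite J" "finite V"
  shows "card {G' \<in> labelled J V. \<exists>\<phi> \<psi>. is_iso G G' \<phi> \<psi>} * card (Aut G) = fact (card J) * fact (card V)"
proof -
  note L = labelledD[OF G]
  define P where "P = {\<phi>. \<phi> permutes J} \<times> {\<psi>. \<psi> permutes V}"
  define T where "T z = relabel (fst z) (snd z) G" for z
  let ?O = "{G' \<in> labelled J V. \<exists>\<phi> \<psi>. is_iso G G' \<phi> \<psi>}"
  have finP: "finite P" using fin by (simp add: P_def finite_permutations)
  have T: "T z \<in> labelled J V" "is_iso G (T z) (fst z) (snd z)" if "z \<in> P" for z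
  proof -
    have p: "fst z permutes J" "snd z permutes V" using that by (auto simp: P_def)
    have "inj_on (fst z) (half_edges G)" "inj_on (snd z) (verts G)"
      using permutes_inj_on[OF p(1)] permutes_inj_on[OF p(2)] by simp_all
    from relabel[OF L(1) this] show "T z \<in> labelled J V" "is_iso G (T z) (fst z) (snd z)"
      using permutes_image[OF p(1)] permutes_image[OF p(2)] L by (simp_all add: T_def)
  qed
  have TO: "T ` P \<subseteq> ?O" using T by blast
  have fib: "card {z \<in> P. T z = G'} = card (Aut G)" if G': "G' \<in> ?O" for G'
  proof -
    have L': "G' \<in> labelled J V" using G' by simp
    obtain \<phi> \<psi> where iso: "is_iso G G' \<phi> \<psi>" using G' by auto
    \<comment> \<open>Extended by the identity, the isomorphism becomes a pair of permutations;
      composing with it maps \<open>Aut G\<close> onto the fibre over \<open>G'\<close>.\<close>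
    define \<phi>0 \<psi>0 where "\<phi>0 x = (if x \<in> J then \<phi> x else x)" and "\<psi>0 x = (if x \<in> V then \<psi> x else x)" for x
    have iso0: "is_iso G G' \<phi>0 \<psi>0" by (rule is_iso_cong[OF L(1) iso]) (auto simp: \<phi>0_def \<psi>0_def L)
    have p: "\<phi>0 permutes J" "\<psi>0 permutes V"
      using is_isoD(1,2)[OF iso0] L labelledD[OF L'] by (auto intro!: bij_imp_permutes simp: \<phi>0_def \<psi>0_def)
    have iso1: "is_iso G' G (inv \<phi>0) (inv \<psi>0)"
    proof (rule is_iso_cong[OF labelledD(1)[OF L'] iso_inverse[OF iso0 L(1)]])
      fix x assume "x \<in> half_edges G'"
      then obtain y where "y \<in> half_edges G" "x = \<phi>0 y" using bij_betw_obtain[OF is_isoD(1)[OF iso0]] by metis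
      then show "inv \<phi>0 x = inv_into (half_edges G) \<phi>0 x"
        using permutes_inj_on[OF p(1)] permutes_inj[OF p(1)] by simp
    next
      fix x assume "x \<in> verts G'"
      then obtain y where "y \<in> verts G" "x = \<psi>0 y" using bij_betw_obtain[OF is_isoD(2)[OF iso0]] by metis
      then show "inv \<psi>0 x = inv_into (verts G) \<psi>0 x"
        using permutes_inj_on[OF p(2)] permutes_inj[OF p(2)] by simp
    qed
    have fibre: "{z \<in> P. T z = G'} = {z \<in> P. is_iso G G' (fst z) (snd z)}"
      using T iso_unique[OF _ _ _ L' _ _ L(1)] by blast
    have "bij_betw (\<lambda>z. (\<phi>0 \<circ> fst z, \<psi>0 \<circ> snd z)) (Aut G) {z \<in> P. is_iso G G' (fst z) (snd z)}"
    proof (rule bij_betw_byWitness[where f' = "\<lambda>z. (inv \<phi>0 \<circ> fst z, inv \<psi>0 \<circ> snd z)"])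
      show "\<forall>z\<in>Aut G. (inv \<phi>0 \<circ> fst (\<phi>0 \<circ> fst z, \<psi>0 \<circ> snd z), inv \<psi>0 \<circ> snd (\<phi>0 \<circ> fst z, \<psi>0 \<circ> snd z)) = z"
        using permutes_inverses[OF p(1)] permutes_inverses[OF p(2)] by (auto simp: fun_eq_iff prod_eq_iff)
      show "\<forall>z\<in>{z \<in> P. is_iso G G' (fst z) (snd z)}. (\<phi>0 \<circ> fst (inv \<phi>0 \<circ> fst z, inv \<psi>0 \<circ> snd z), \<psi>0 \<circ> snd (inv \<phi>0 \<circ> fst z, inv \<psi>0 \<circ> snd z)) = z"
        using permutes_inverses[OF p(1)] permutes_inverses[OF p(2)] by (auto simp: fun_eq_iff prod_eq_iff)
      show "(\<lambda>z. (\<phi>0 \<circ> fst z, \<psi>0 \<circ> snd z)) ` Aut G \<subseteq> {z \<in> P. is_iso G G' (fst z) (snd z)}"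
        using iso_compose[OF _ iso0 L(1)] p by (auto simp: Aut_def P_def L intro: permutes_compose)
      show "(\<lambda>z. (inv \<phi>0 \<circ> fst z, inv \<psi>0 \<circ> snd z)) ` {z \<in> P. is_iso G G' (fst z) (snd z)} \<subseteq> Aut G"
        using iso_compose[OF _ iso1 L(1)] permutes_inv[OF p(1)] permutes_inv[OF p(2)]
        by (auto simp: Aut_def P_def L intro: permutes_compose)
    qed
    then show ?thesis unfolding fibre by (simp add: bij_betw_same_card)
  qed
  have "?O \<subseteq> T ` P"
  proof
    fix G' assume "G' \<in> ?O"
    hence "card {z \<in> P. T z = G'} > 0" using fib card_Aut_pos[OF L(1)] by simp
    then show "G' \<in> T ` P" unfolding card_gt_0_iff by blast
  qed
  hence finO: "finite ?O" using finP finite_subset by blast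
  have "card P = (\<Sum>G'\<in>?O. \<Sum>z\<in>{z \<in> P. T z = G'}. 1)"
    by (subst sum.group[OF finP finO TO]) simp
  also have "\<dots> = card ?O * card (Aut G)" using fib by simp
  also have "card P = fact (card J) * fact (card V)"
    using fin by (simp add: P_def card_cartesian_product card_permutations)
  finally show ?thesis by simp
qed

section \<open>Isomorphism classes of connected stable graphs\<close>

lemma stable_connectedD: "G \<in> stable_connected \<Longrightarrow> graph G" "G \<in> stable_connected \<Longrightarrow> connected_graph G"
  by (auto simp: stable_connected_def stable_def)

lemma equiv_iso_rel: "equiv stable_connected iso_rel"
proof (rule equivI)
  show "refl_on stable_connected iso_rel" using iso_refl by (fastforce simp: refl_on_def iso_rel_def)
  show "sym iso_rel" unfolding sym_def iso_rel_def using iso_inverse stable_connectedD(1) by fast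
  show "trans iso_rel" unfolding trans_def iso_rel_def using iso_compose stable_connectedD(1) by fast
qed (auto simp: iso_rel_def)

lemma iso_stable_connected:
  assumes "is_iso G G' \<phi> \<psi>" "G \<in> stable_connected" "graph G'"
  shows "G' \<in> stable_connected"
proof -
  note D = is_isoD[OF assms(1)] and G = stable_connectedD[OF assms(2)]
  have "3 \<le> 2 * vgenus G' v' + valence G' v'" if "v' \<in> verts G'" for v'
  proof -
    obtain v where v: "v \<in> verts G" "v' = \<psi> v" using bij_betw_obtain[OF D(2) \<open>v' \<in> verts G'\<close>] by metis
    have "3 \<le> 2 * vgenus G v + valence G v" using assms(2) v(1) by (auto simp: stable_connected_def stable_def)
    then show ?thesis using D(5) iso_valence[OF assms(1) G(1) v(1)] v by simp
  qed
  then show ?thesis using iso_connected[OF assms(1) G] assms(3) by (simp add: stable_connected_def stable_def)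
qed

lemma connected_bounded_stable: "connected_bounded K J V \<subseteq> stable_connected"
proof
  fix G assume "G \<in> connected_bounded K J V"
  hence G: "G \<in> bounded K J V" "connected_graph G" by (auto simp: connected_bounded_def)
  then show "G \<in> stable_connected" using boundedD[OF G(1)] by (auto simp: stable_connected_def stable_def)
qed

text \<open>All vertex weights of a stable graph are positive, so each of them is bounded by their
  sum.\<close>

lemma cboundedI:
  assumes "G \<in> labelled J V" "G \<in> stable_connected" "graph_weight G \<le> int K"
  shows "G \<in> connected_bounded K J V"
proof -
  note L = labelledD[OF assms(1)] and G = stable_connectedD[OF assms(2)]
  have st: "3 \<le> 2 * vgenus G v + valence G v" if "v \<in> V" for v
    using assms(2) that L(3) by (auto simp: stable_connected_def stable_def)
  have "2 * vgenus G v + valence G v \<le> K + 2" if v: "v \<in> V" for v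
  proof -
    have "2 * int (vgenus G v) + int (valence G v) - 2 \<le> graph_weight G"
      unfolding graph_weight_def L(3)
    proof (rule member_le_sum[OF v])
      fix u assume "u \<in> V - {v}"
      then show "0 \<le> 2 * int (vgenus G u) + int (valence G u) - 2" using st[of u] by simp
    qed (use graph_finite(2)[OF L(1)] L(3) in simp)
    then show ?thesis using assms(3) by simp
  qed
  then show ?thesis using assms(1) st G(2) by (simp add: connected_bounded_def bounded_def)
qed

lemma iso_cards:
  assumes "is_iso G G' \<phi> \<psi>"
  shows "card (half_edges G') = card (half_edges G)" "card (verts G') = card (verts G)"
  using is_isoD(1,2)[OF assms] by (simp_all add: bij_betw_same_card)

context feynman
begin

text \<open>The summand of the theorem; by \<open>class_term_nth\<close> it does not depend on the
  representative.\<close>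

definition class_term :: "nat multiset \<Rightarrow> graph set \<Rightarrow> real fls" where
  "class_term A C = (let G = SOME G. G \<in> C in fls_X ^ graph_genus G * amp G A / of_nat (card (Aut G)))"

lemma class_term_nth:
  assumes C: "C \<in> stable_connected // iso_rel" and G: "G \<in> C"
  shows "fls_nth (class_term A C) e = fls_nth (graph_term G A) (e - 1) / real (card (Aut G))"
proof -
  define G' where "G' = (SOME G. G \<in> C)"
  have "G' \<in> C" unfolding G'_def using G by (rule someI)
  hence "(G, G') \<in> iso_rel" using in_quotient_imp_in_rel[OF equiv_iso_rel C] G by blast
  then obtain \<phi> \<psi> where iso: "is_iso G G' \<phi> \<psi>" and S: "G \<in> stable_connected" "G' \<in> stable_connected"
    by (auto simp: iso_rel_def)
  note g = stable_connectedD(1)[OF S(1)] stable_connectedD(1)[OF S(2)]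
  have "fls_X ^ graph_genus G' * amp G' A = hbar_power 1 * graph_term G' A"
    using graph_genus_eq[OF stable_connectedD[OF S(2)]] by (simp add: hbar_power_power graph_term_def hbar_power_add mult_ac)
  hence "class_term A C = hbar_power 1 * graph_term G' A * fls_const (inverse (real (card (Aut G'))))"
    by (simp add: class_term_def Let_def flip: G'_def)
       (simp add: divide_inverse fls_of_nat fls_inverse_const)
  then show ?thesis
    by (simp add: hbar_power_mult_nth mult.assoc graph_term_iso[OF iso g] card_Aut_iso[OF iso g] divide_inverse)
qed

text \<open>Up to a given power of \<open>hbar\<close>, only classes that meet the finite set
  \<open>B\<close> of labelled graphs contribute. For each of them, \<open>B\<close> contains all
  its labelled members on the standard sets, so the sum over \<open>B\<close> can be grouped by
  classes.\<close>

theorem graph_sum: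
  assumes A: "set_mset A \<subseteq> {..<n}"
  shows "(class_term A has_sum fls_X * s_log par (integral_L (s_exp par vertex_function)) A) (stable_connected // iso_rel)"
proof (rule has_sum_flsI)
  fix K0 :: nat
  \<comment> \<open>A coefficient of order \<open>e <= K0\<close> comes from order
    \<open>e - 1\<close> of the logarithm, whose weight \<open>2 * (e - 1) + size A\<close> does not
    exceed \<open>K\<close>.\<close>
  define K where "K = 2 * K0 + size A"
  define H where "H = K * (K + 2)"
  let ?S = "stable_connected // iso_rel"
  let ?cb = "\<lambda>p. connected_bounded K {..<snd p} {..<fst p}"
  let ?I = "{..K} \<times> {..H}"
  define B where "B = (\<Union>p\<in>?I. ?cb p)"
  define cls where "cls G = iso_rel `` {G}" for G
  have fin: "finite (?cb p)" for p
    unfolding connected_bounded_def using finite_bounded[of "{..<snd p}" "{..<fst p}" K] by simp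
  have finB: "finite B" unfolding B_def using fin by blast
  have BS: "B \<subseteq> stable_connected" unfolding B_def using connected_bounded_stable by blast
  have cls_eq: "cls G = cls G' \<longleftrightarrow> (G, G') \<in> iso_rel" if "G \<in> stable_connected" "G' \<in> stable_connected" for G G'
    unfolding cls_def using eq_equiv_class_iff[OF equiv_iso_rel that] .
  have clsS: "cls G \<in> ?S" "G \<in> cls G" if "G \<in> stable_connected" for G
    using that equiv_class_self[OF equiv_iso_rel that] by (auto simp: cls_def quotientI)
  have outside: "fls_nth (class_term A C) e = 0" if C: "C \<in> ?S - cls ` B" and e: "e \<le> int K0" for C e
  proof (rule ccontr)
    assume nz: "fls_nth (class_term A C) e \<noteq> 0"
    obtain G where G: "G \<in> C" using C in_quotient_imp_non_empty[OF equiv_iso_rel, of C] by blast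
    have S: "G \<in> stable_connected" using C G in_quotient_imp_subset[OF equiv_iso_rel, of C] by blast
    note g = stable_connectedD[OF S]
    have "fls_nth (graph_term G A) (e - 1) \<noteq> 0" using nz class_term_nth[of C G A e] C G by auto
    hence x: "hbar_exponent G = e - 1" "graph_coeff G A \<noteq> 0" by (auto simp: graph_term_nth[OF g(1)] split: if_splits)
    \<comment> \<open>A nonzero coefficient determines the weight of the graph, and the weight
      bounds the numbers of vertices and half-edges. After renumbering, the graph lies in
      \<open>B\<close>.\<close>
    have wt: "graph_weight G \<le> int K" using graph_weight_eq[OF g(1)] graph_coeff_nonzero(1)[OF g(1) x(2)] x(1) e by (simp add: K_def)
    define h r where "h = card (half_edges G)" and "r = card (verts G)"
    have "\<exists>\<phi>. bij_betw \<phi> (half_edges G) {..<h}" "\<exists>\<psi>. bij_betw \<psi> (verts G) {..<r}"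
      by (rule finite_same_card_bij; simp add: graph_finite g h_def r_def)+
    then obtain \<phi> \<psi> where b: "bij_betw \<phi> (half_edges G) {..<h}" "bij_betw \<psi> (verts G) {..<r}" by blast
    define G' where "G' = relabel \<phi> \<psi> G"
    have G': "G' \<in> labelled {..<h} {..<r}" and iso: "is_iso G G' \<phi> \<psi>"
      using relabel[OF g(1), of \<phi> \<psi>] b by (auto simp: G'_def bij_betw_def)
    have S': "G' \<in> stable_connected" by (rule iso_stable_connected[OF iso S labelledD(1)[OF G']])
    have cb: "G' \<in> connected_bounded K {..<h} {..<r}"
      by (rule cboundedI[OF G' S']) (use wt graph_weight_iso[OF iso g(1)] in simp)
    hence bd: "G' \<in> bounded K {..<h} {..<r}" by (simp add: connected_bounded_def)
    have r: "r \<le> K" using graph_weight_ge[OF bd] wt graph_weight_iso[OF iso g(1)] by simp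
    have "h \<le> r * (K + 2)" using bounded_empty[of r K h] bd by (metis empty_iff not_le)
    also have "\<dots> \<le> H" unfolding H_def using r by (rule mult_le_mono1)
    finally have "(r, h) \<in> ?I" using r by simp
    hence "G' \<in> B" using cb unfolding B_def by force
    moreover have "(G, G') \<in> iso_rel" using iso S S' by (auto simp: iso_rel_def)
    hence "cls G' = cls G" using cls_eq[OF S S'] by simp
    moreover have "cls G = C"
      using quotient_eq_iff[OF equiv_iso_rel clsS(1)[OF S] _ clsS(2)[OF S] G] C equiv_class_self[OF equiv_iso_rel S] by simp
    ultimately show False using C by blast
  qed
  have inside: "(\<Sum>C\<in>cls ` B. fls_nth (class_term A C) e) = fls_nth (fls_X * s_log par (integral_L (s_exp par vertex_function)) A) e"
    if e: "e \<le> int K0" for e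
  proof -
    let ?w = "\<lambda>G. fls_nth (graph_term G A) (e - 1) / (fact (card (half_edges G)) * fact (card (verts G)))"
    have cards: "card (half_edges G) = snd p" "card (verts G) = fst p" if "G \<in> ?cb p" for G p
      using that boundedD(3,4)[of G K "{..<snd p}" "{..<fst p}"] by (auto simp: connected_bounded_def)
    have "fls_nth (fls_X * s_log par (integral_L (s_exp par vertex_function)) A) e = fls_nth (connected_series K A) (e - 1)"
    proof -
      have "2 * (e - 1) + int (size A) \<le> int K" using e by (simp add: K_def)
      from log_integral[OF A this] show ?thesis by (simp add: fls_X_times_conv_shift)
    qed
    also have "\<dots> = (\<Sum>r\<le>K. \<Sum>h\<le>H. \<Sum>G\<in>?cb (r, h). ?w G)"
      unfolding connected_series_def connected_total_def H_def fls_nth_sum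
    proof (intro sum.cong refl)
      fix r h
      have "fls_nth (fls_const (1 / (fact h * fact r)) * (\<Sum>G\<in>?cb (r, h). graph_term G A)) (e - 1) =
          (\<Sum>G\<in>?cb (r, h). 1 / (fact h * fact r) * fls_nth (graph_term G A) (e - 1))"
        by (simp add: fls_nth_sum sum_distrib_left)
      also have "\<dots> = (\<Sum>G\<in>?cb (r, h). ?w G)"
        by (intro sum.cong refl) (use cards[of _ "(r, h)"] in simp)
      finally show "fls_nth (fls_const (1 / (fact h * fact r)) * (\<Sum>G\<in>connected_bounded K {..<h} {..<r}. graph_term G A)) (e - 1) =
          (\<Sum>G\<in>?cb (r, h). ?w G)" by simp
    qed
    also have "\<dots> = (\<Sum>p\<in>?I. \<Sum>G\<in>?cb p. ?w G)"
      by (simp add: sum.cartesian_product case_prod_beta)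
    also have "\<dots> = (\<Sum>G\<in>B. ?w G)"
    proof -
      \<comment> \<open>The numbers of half-edges and vertices of a graph determine the index
        pair.\<close>
      have "?cb p \<inter> ?cb q = {}" if "p \<noteq> q" for p q
      proof (rule ccontr)
        assume "?cb p \<inter> ?cb q \<noteq> {}"
        then obtain G where "G \<in> ?cb p" "G \<in> ?cb q" by blast
        then show False using cards[of G p] cards[of G q] that by (metis prod_eqI)
      qed
      then show ?thesis unfolding B_def using fin by (subst sum.UNION_disjoint) auto
    qed
    also have "\<dots> = (\<Sum>C\<in>cls ` B. \<Sum>G\<in>{G \<in> B. cls G = C}. ?w G)"
      by (rule sum.group[symmetric]) (use finB in auto)
    also have "\<dots> = (\<Sum>C\<in>cls ` B. fls_nth (class_term A C) e)"
    proof (rule sum.cong[OF refl])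
      fix C assume "C \<in> cls ` B"
      then obtain G p where G: "C = cls G" "G \<in> ?cb p" "p \<in> ?I" unfolding B_def by blast
      let ?J = "{..<snd p}" and ?V = "{..<fst p}"
      have S: "G \<in> stable_connected" using connected_bounded_stable G(2) by blast
      have bd: "G \<in> bounded K ?J ?V" using G(2) by (simp add: connected_bounded_def)
      note g = boundedD[OF bd]
      \<comment> \<open>The bounds and connectedness are invariant under isomorphism, so the part of
        \<open>B\<close> in one class is a full orbit, counted by
        \<open>card_isomorphic_labelled\<close>.\<close>
      have "{G' \<in> B. cls G' = C} = {G' \<in> labelled ?J ?V. \<exists>\<phi> \<psi>. is_iso G G' \<phi> \<psi>}" (is "_ = ?O")
      proof (intro equalityI subsetI)
        fix G' assume G': "G' \<in> {G' \<in> B. cls G' = C}"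
        hence S': "G' \<in> stable_connected" using BS by blast
        obtain \<phi> \<psi> where iso: "is_iso G G' \<phi> \<psi>" using G' cls_eq[OF S S'] G(1) by (auto simp: iso_rel_def)
        obtain q where q: "G' \<in> ?cb q" using G' by (auto simp: B_def)
        have "q = p" using iso_cards[OF iso] cards[OF q] cards[OF G(2)] by (simp add: prod_eq_iff)
        hence "G' \<in> labelled ?J ?V" using q boundedD(1) by (auto simp: connected_bounded_def)
        then show "G' \<in> ?O" using iso by blast
      next
        fix G' assume "G' \<in> ?O"
        then obtain \<phi> \<psi> where L': "G' \<in> labelled ?J ?V" and iso: "is_iso G G' \<phi> \<psi>" by blast
        have S': "G' \<in> stable_connected" by (rule iso_stable_connected[OF iso S labelledD(1)[OF L']])
        have "G' \<in> ?cb p" using bounded_iso[OF iso bd L'] stable_connectedD(2)[OF S'] by (simp add: connected_bounded_def)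
        hence "G' \<in> B" using G(3) unfolding B_def by blast
        moreover have "(G, G') \<in> iso_rel" using iso S S' by (auto simp: iso_rel_def)
        ultimately show "G' \<in> {G' \<in> B. cls G' = C}" using cls_eq[OF S S'] G(1) by simp
      qed
      moreover have "?w G' = fls_nth (graph_term G A) (e - 1) / (fact (snd p) * fact (fst p))" if "G' \<in> ?O" for G'
        using that graph_term_iso[of G G' _ _ A] g(2) labelledD[of G' ?J ?V] by auto
      ultimately have "(\<Sum>G'\<in>{G' \<in> B. cls G' = C}. ?w G') =
          real (card ?O) * (fls_nth (graph_term G A) (e - 1) / (fact (snd p) * fact (fst p)))" by simp
      also have "\<dots> = fls_nth (graph_term G A) (e - 1) / real (card (Aut G))"
      proof -
        have "real (card ?O) * real (card (Aut G)) = fact (snd p) * fact (fst p)"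
          using arg_cong[OF card_isomorphic_labelled[OF g(1)], of real] by simp
        then show ?thesis using card_Aut_pos[OF g(2)] by (simp add: field_simps)
      qed
      also have "\<dots> = fls_nth (class_term A C) e" using class_term_nth[of C G A e] clsS[OF S] G(1) by simp
      finally show "(\<Sum>G'\<in>{G' \<in> B. cls G' = C}. ?w G') = fls_nth (class_term A C) e" .
    qed
    finally show ?thesis by simp
  qed
  have "cls ` B \<subseteq> ?S" using clsS BS by blast
  then show "\<exists>T. finite T \<and> T \<subseteq> ?S \<and> (\<forall>C\<in>?S - T. \<forall>e\<le>int K0. fls_nth (class_term A C) e = 0) \<and>
      (\<forall>e\<le>int K0. (\<Sum>C\<in>T. fls_nth (class_term A C) e) = fls_nth (fls_X * s_log par (integral_L (s_exp par vertex_function)) A) e)"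
    using finB outside inside by (intro exI[of _ "cls ` B"]) blast
qed

end

theorem theoremA8:
  fixes W :: "bool \<Rightarrow> 'w::real_vector set" and d :: "'w \<Rightarrow> 'w" and \<omega> :: "'w \<Rightarrow> 'w \<Rightarrow> real"
    and i :: "'w set \<Rightarrow> 'w" and p :: "'w \<Rightarrow> 'w set" and s :: "'w \<Rightarrow> 'w"
    and f :: "nat \<Rightarrow> 'w list \<Rightarrow> real"
    and n k m :: nat and b :: "nat \<Rightarrow> 'w" and par :: "nat \<Rightarrow> bool" and \<epsilon> :: "nat \<Rightarrow> real"
    and A :: "nat multiset"
  assumes "odd_symplectic W d \<omega>"
    and "cyclic_sdr (\<lambda>q. W (\<not> q)) d (reversed_form W \<omega>) i p s"
    and "f \<in> weight_gt_2 W" and "even_function W f"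
    and "gaussian_coordinates W d \<omega> (i ` homology d) (range s) n k m b par \<epsilon>"
    and "set_mset A \<subseteq> {..<n}"
  shows "((\<lambda>C. let G = (SOME G. G \<in> C) in
             fls_X ^ graph_genus G * amplitude n k m b par \<epsilon> f G A / of_nat (card (Aut G)))
          has_sum
            fls_X * s_log par (gauss_integral n k m \<epsilon>
              (s_exp par (\<lambda>M. restriction b (n + k + 2 * m) f M / fls_X))) A)
          (stable_connected // iso_rel)"
proof -
  interpret co: gaussian_coordinates W d \<omega> "i ` homology d" "range s" n k m b par \<epsilon> by fact
  \<comment> \<open>On words of basis vectors, the supersymmetry, the evenness and the weight
    condition of \<open>f\<close> become the three axioms on the tensor in
    \<open>feynman\<close>.\<close>
  define t where "t g xs = f g (map b xs)" for g xs
  interpret feynman n k m par \<epsilon> t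
  proof
    fix us x y vs g assume "set (us @ x # y # vs) \<subseteq> {..<n + k + 2 * m}"
    hence "b x \<in> W (par x)" "b y \<in> W (par y)" using co.homogeneous by auto
    moreover have "f g (us' @ v # w # vs') = psign (q \<and> r) * f g (us' @ w # v # vs')" if "v \<in> W q" "w \<in> W r" for us' vs' v w q r
      using assms(3) that unfolding weight_gt_2_def formal_functions_def by blast
    ultimately have "f g (map b us @ b x # b y # map b vs) = psign (par x \<and> par y) * f g (map b us @ b y # b x # map b vs)" by blast
    then show "t g (us @ x # y # vs) = swap_sign par x y * t g (us @ y # x # vs)"
      by (simp add: t_def swap_sign_def psign_def)
  next
    fix g xs assume xs: "set xs \<subseteq> {..<n + k + 2 * m}" and nz: "t g xs \<noteq> 0"
    have "list_all2 (\<lambda>w q. w \<in> W q) (map b xs) (map par xs)"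
      using xs co.homogeneous by (auto simp: list_all2_conv_all_nth subset_iff)
    hence "even (count_list (map par xs) True)"
      using assms(4) nz unfolding even_function_def t_def by blast
    moreover have "count_list (map par xs) True = odd_count par (mset xs)"
      by (induction xs) (auto simp: odd_count_def)
    ultimately show "even (odd_count par (mset xs))" by simp
  next
    fix g xs assume "t g xs \<noteq> 0"
    moreover have "f g ws \<noteq> 0 \<Longrightarrow> 2 * g + length ws > 2" for ws using assms(3) by (simp add: weight_gt_2_def)
    ultimately show "2 * g + length xs > 2" unfolding t_def by fastforce
  qed (use co.even_L co.odd_L in auto)
  have amp: "amp G A = amplitude n k m b par \<epsilon> f G A" for G
    by (simp add: amplitude_def t_def comp_def)
  have "vertex_function = (\<lambda>M. restriction b (n + k + 2 * m) f M / fls_X)"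
    by (simp add: vertex_function_def restriction_def t_def fun_eq_iff)
  with graph_sum[OF assms(6)] show ?thesis
    unfolding class_term_def[abs_def] amp by simp
qed

end
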